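(* Let $p>3$ be a prime. Then the number of isomorphism classes of Cayley digraphs on $\mathrm{D}_{6p}$ equals \[\begin{split}\mathsf{o}\big(2^{\mathrm{D}_{6p}\setminus\{1\}},\mathrm{Aut}(\mathrm{D}_{6p})\big)=&\ \frac{2^{4p-2}}{3p(p-1)}\left(2^{2p}+5\right)+\frac{2^{2p}}{p}\left(2^p+1\right)\\ &+\frac{8}{3(p-1)}\sum_{|r|_3=1,\ 3\nmid|r|_p}\left(2^{\frac{4(p-1)}{|r|_p}}+2^{1+\frac{6(p-1)}{|r|_p}}\right)+\frac{8}{p-1}\sum_{|r|_3=1,\ 3\mid |r|_p}2^{\frac{6(p-1)}{|r|_p}}\\ &+\frac{4}{p-1}\left(\sum_{|r|_3=2,\ 2\nmid|r|_p,\ |r|_p>1}2^{\frac{4(p-1)}{|r|_p}}+\sum_{|r|_3=2,\ 2\mid|r|_p}2^{\frac{6(p-1)}{|r|_p}}\right),\end{split}\] where in every sum $r$ runs over the integers with $1<r<3p$ and $\gcd(r,3p)=1$ satisfying the stated conditions.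
   Context: $\mathrm{D}_{6p}$ is the dihedral group of order $6p$. For a finite group $R$ and $S\subseteq R\setminus\{1\}$, the Cayley digraph $\mathrm{Cay}(R,S)$ has vertex set $R$ and arcs $x\to sx$ ($x\in R$, $s\in S$). The number of isomorphism classes of Cayley digraphs on $R$ means the number of isomorphism classes among $\{\mathrm{Cay}(R,S): S\subseteq R\setminus\{1\}\}$; $\mathsf{o}(2^{R\setminus\{1\}},\mathrm{Aut}(R))$ denotes the number of orbits of $\mathrm{Aut}(R)$ on the subsets of $R\setminus\{1\}$. $|r|_m$ denotes the multiplicative order of $r$ modulo $m$. *)

theory Defs
  imports Complex_Main "HOL-Algebra.Bij" "HOL-Number_Theory.Pocklington"
begin

text \<open>Dihedral group of order 2n: the pair (i, a) stands for r^i s^a, with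
  r of order n, s an involution and s r s = r^-1; hence
  r^i s^a r^j s^b = r^(i + (-1)^a j) s^(a xor b).\<close>
definition dihedral :: "nat \<Rightarrow> (nat \<times> bool) monoid" where
  "dihedral n = \<lparr> carrier = {0..<n} \<times> UNIV,
     monoid.mult = (\<lambda>(i, a) (j, b). ((i + (if a then n - j else j)) mod n, a \<noteq> b)),
     monoid.one = (0, False) \<rparr>"

definition cay_arcs :: "('a, 'b) monoid_scheme \<Rightarrow> 'a set \<Rightarrow> ('a \<times> 'a) set" where
  "cay_arcs R S = {(x, s \<otimes>\<^bsub>R\<^esub> x) | x s. x \<in> carrier R \<and> s \<in> S}"

definition cay_iso :: "('a, 'b) monoid_scheme \<Rightarrow> 'a set \<Rightarrow> 'a set \<Rightarrow> bool" where
  "cay_iso R S T \<longleftrightarrow> (\<exists>f. bij_betw f (carrier R) (carrier R) \<and>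
     (\<forall>x\<in>carrier R. \<forall>y\<in>carrier R. (x, y) \<in> cay_arcs R S \<longleftrightarrow> (f x, f y) \<in> cay_arcs R T))"

definition conn_sets :: "('a, 'b) monoid_scheme \<Rightarrow> 'a set set" where
  "conn_sets R = Pow (carrier R - {\<one>\<^bsub>R\<^esub>})"

definition num_cay_digraphs :: "('a, 'b) monoid_scheme \<Rightarrow> nat" where
  "num_cay_digraphs R = card (conn_sets R // {(S, T). S \<in> conn_sets R \<and> T \<in> conn_sets R \<and> cay_iso R S T})"

definition num_aut_orbits :: "('a, 'b) monoid_scheme \<Rightarrow> nat" where
  "num_aut_orbits R = card (conn_sets R // {(S, T). S \<in> conn_sets R \<and> T \<in> conn_sets R \<and> (\<exists>\<sigma>\<in>auto R. \<sigma> ` S = T)})"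

end

theory Submission
  imports Defs "HOL-Combinatorics.Permutations" "HOL-Algebra.Sylow"
begin

text \<open>
  Any isomorphism between two Cayley digraphs of the dihedral group can be changed, by composing it with
  automorphisms, into one induced by a group automorphism; the count is then Burnside's lemma. Let \<open>X\<close> be a right
  translation of order \<open>p\<close>, whose orbits are six blocks of size \<open>p\<close>. By Sylow's theorem for \<open>p\<close> the isomorphism may
  be assumed to carry \<open>X\<close> into a \<open>p\<close>-group containing \<open>X\<close>; if that group fixes the blocks, the isomorphism can be
  made affine on each block. Sylow's theorem for 3 then makes it preserve the rotations and the reflections.
  Its multipliers on blocks agree whenever the blocks are joined non-uniformly; on the remaining blocks
  translations can be used to copy one multiplier everywhere. Sylow's theorem for 3 in the centralizer of \<open>X\<close> finally
  makes it commute with the translations of order 3 up to inversion, and such an affine map is an automorphism.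
  For \<open>p = 5\<close> a Sylow subgroup may have an orbit of length 25. Then either the digraph is uniform between blocks, or
  the centralizer of \<open>X\<close> is 2-transitive on the blocks and a cocycle argument shows that adjacency depends only on
  the difference of a height modulo 5 and on equality of blocks, so that an isomorphism preserving blocks can be
  written down.

  Automorphisms act on the non-identity elements with rotations multiplied by a unit \<open>r\<close> and reflections mapped
  affinely. On suitable invariant parts all cycles have equal length, so the numbers of fixed subsets are powers
  of two depending only on the orders of \<open>r\<close> modulo 3 and \<open>p\<close> and on whether the reflections have a fixed point.
\<close>

section \<open>Finite permutation groups\<close>

text \<open>The isomorphism is straightened against \<open>X\<close>, then against \<open>U\<close>
  on the level of blocks, then against \<open>U\<close> exactly. Each time Sylow's theorem is
  applied inside a group of automorphisms cut down to what is already secured, so that composing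
  with the conjugator loses nothing. Two mismatches remain that conjugation cannot remove: the
  multipliers of different blocks, and the signs with which \<open>U\<close> is conjugated on
  rotations and on reflections. A mismatch is itself useful: it makes the arcs between the two
  pieces invariant under independent shifts of the pieces, so one piece of the isomorphism can be
  replaced without disturbing those arcs. \<open>nonunif_mult\<close> and \<open>cross_shift\<close>
  are the two instances. Isomorphism, equivalence under group automorphisms and equivalence under
  the explicit maps \<open>gm\<close> are identified by a circle: an isomorphism yields a
  \<open>gm\<close>, a \<open>gm\<close> is an automorphism, an automorphism is an isomorphism. In
  the count, the 5 of the first summand is 2 + 3: 2 comes from r = 1, and 3 from the unit that is -1
  modulo 3 and 1 modulo p, the only other unit of order 1 modulo p.\<close>

lemma card_fixpoints_cong_prime:
  fixes f :: "'a \<Rightarrow> 'a" and q :: nat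
  assumes "finite X" "prime q" "\<And>x. x \<in> X \<Longrightarrow> f x \<in> X" "\<And>x. x \<in> X \<Longrightarrow> (f ^^ q) x = x"
  shows "[card X = card {x\<in>X. f x = x}] (mod q)"
  using assms(1,3,4)
proof (induction "card X" arbitrary: X rule: less_induct)
  case less
  have q0: "q > 0" using assms(2) prime_gt_0_nat by blast
  show ?case
  proof (cases "\<forall>x\<in>X. f x = x")
    case True
    then have "{x\<in>X. f x = x} = X" by auto
    then show ?thesis by simp
  next
    case False
    then obtain a where a: "a \<in> X" "f a \<noteq> a" by blast
    \<comment> \<open>The orbit of a point that is not fixed has exactly \<open>q\<close> points,
      none of them fixed, so removing it changes neither count modulo \<open>q\<close>.\<close>
    define Ob where "Ob = (\<lambda>i. (f ^^ i) a) ` {..<q}"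
    have per: "(f ^^ q) a = a" using less a by blast
    have inX: "(f ^^ i) a \<in> X" for i by (induction i) (use a(1) less.prems(2) in auto)
    have perm: "(f ^^ (i + k * q)) a = (f ^^ i) a" for i k
    proof (induction k)
      case (Suc k)
      have "(f ^^ (i + Suc k * q)) a = (f ^^ (i + k * q)) ((f ^^ q) a)"
        by (metis add.assoc add.commute comp_apply funpow_add mult_Suc)
      then show ?case using Suc per by simp
    qed simp
    have fm: "(f ^^ i) a = (f ^^ (i mod q)) a" for i
      using perm[of "i mod q" "i div q"] by simp
    \<comment> \<open>\<open>d\<close> is invertible modulo \<open>q\<close>, so a fixed point of
      the \<open>d\<close>-th power is a fixed point of \<open>f\<close>.\<close>
    have nofix: "(f ^^ d) a \<noteq> a" if "0 < d" "d < q" for d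
    proof
      assume h: "(f ^^ d) a = a"
      have cop: "coprime d q" using assms(2) that
        by (meson coprime_commute dvd_imp_le not_less prime_imp_coprime)
      have "(f ^^ (d * k)) a = a" for k
      proof (induction k)
        case (Suc k)
        have "(f ^^ (d * Suc k)) a = (f ^^ d) ((f ^^ (d * k)) a)" by (simp add: funpow_add)
        then show ?case using Suc h by simp
      qed simp
      moreover obtain k where "[d * k = Suc 0] (mod q)" using cong_solve_coprime_nat[OF cop] by blast
      ultimately have "(f ^^ (Suc 0 mod q)) a = a" using fm[of "d * k"] by (metis cong_def)
      moreover have "Suc 0 mod q = 1" using prime_gt_1_nat[OF assms(2)] by simp
      ultimately show False using a by simp
    qed
    have injb: "inj_on (\<lambda>i. (f ^^ i) a) {..<q}"
    proof (rule linorder_inj_onI)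
      fix i j :: nat assume ij: "i < j" "i \<in> {..<q}" "j \<in> {..<q}"
      show "(f ^^ i) a \<noteq> (f ^^ j) a"
      proof
        assume h: "(f ^^ i) a = (f ^^ j) a"
        have "(f ^^ (q - j + i)) a = (f ^^ (q - j + j)) a"
          using h by (simp only: funpow_add comp_apply)
        moreover have "q - j + j = q" using ij by simp
        ultimately have "(f ^^ (q - j + i)) a = a" using per by simp
        moreover have "0 < q - j + i" "q - j + i < q" using ij by auto
        ultimately show False using nofix[of "q - j + i"] by simp
      qed
    qed auto
    have cO: "card Ob = q" unfolding Ob_def using card_image[OF injb] by simp
    have OX: "Ob \<subseteq> X" using inX by (auto simp: Ob_def)
    have fO: "f x \<in> Ob" if xO: "x \<in> Ob" for x
    proof -
      obtain i where "x = (f ^^ i) a" using xO by (auto simp: Ob_def)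
      then have "f x = (f ^^ Suc i) a" by simp
      then have "f x = (f ^^ (Suc i mod q)) a" using fm[of "Suc i"] by (rule trans)
      then show ?thesis unfolding Ob_def by (rule image_eqI) (use q0 in simp)
    qed
    have Oall: "(f ^^ i) a \<in> Ob" for i 
      unfolding Ob_def by (rule image_eqI, rule fm) (use q0 in simp)
    have pre: "x \<in> Ob" if xX: "x \<in> X" "f x \<in> Ob" for x
    proof -
      obtain i where i: "f x = (f ^^ i) a" using xX by (auto simp: Ob_def)
      have "x = (f ^^ q) x" using less.prems(3)[OF xX(1)] by (rule sym)
      also have "\<dots> = (f ^^ (q - 1)) (f x)" 
      proof -
        have "(f ^^ Suc (q - 1)) x = (f ^^ (q - 1)) (f x)" by (simp add: funpow_Suc_right del: funpow.simps(2))
        then show ?thesis using q0 by simp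
      qed
      also have "\<dots> = (f ^^ (q - 1 + i)) a" using i by (simp add: funpow_add)
      finally show ?thesis using Oall by metis
    qed
    have nf: "f x \<noteq> x" if xO: "x \<in> Ob" for x
    proof
      assume fx: "f x = x"
      obtain i where i: "x = (f ^^ i) a" "i < q" using xO by (auto simp: Ob_def)
      have "(f ^^ k) x = x" for k by (induction k) (use fx in auto)
      then have "x = (f ^^ (q - i)) x" by simp
      also have "\<dots> = (f ^^ (q - i + i)) a" using i by (simp only: funpow_add comp_apply)
      also have "\<dots> = a" using i per by simp
      finally show False using fx a by simp
    qed
    have "card (X - Ob) < card X"

    proof (rule psubset_card_mono[OF less.prems(1)])
      show "X - Ob \<subset> X" using a(1) Oall[of 0] by auto
    qed
    then have IH: "[card (X - Ob) = card {x\<in>X - Ob. f x = x}] (mod q)"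
    proof (rule less.hyps)
      show "finite (X - Ob)" using less.prems(1) by simp
      show "f x \<in> X - Ob" if "x \<in> X - Ob" for x using that less.prems(2) pre by blast
      show "(f ^^ q) x = x" if "x \<in> X - Ob" for x using that less.prems(3) by blast
    qed
    have "{x\<in>X - Ob. f x = x} = {x\<in>X. f x = x}" using nf by auto
    moreover have "card X = card (X - Ob) + q"
      using OX cO less.prems(1) by (metis card_Diff_subset card_mono finite_subset le_add_diff_inverse2)
    ultimately show ?thesis using IH by (simp add: cong_def)
  qed
qed

lemma funpow_prime_fix:
  assumes "\<And>x. x \<in> X \<Longrightarrow> f x \<in> X" "x \<in> X"
  shows "(f ^^ k) x \<in> X"
  by (induction k) (use assms in auto)

text \<open>On \<open>X\<close> the map \<open>f ^^ (q ^ k)\<close> has \<open>q\<close>-th power 1,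
  so the prime case applies to it; the induction goes on with its fixed points, among which are
  those of \<open>f\<close>.\<close>

lemma card_fixpoints_cong:
  fixes f :: "'a \<Rightarrow> 'a" and q :: nat
  assumes "finite X" "prime q" "\<And>x. x \<in> X \<Longrightarrow> f x \<in> X" "\<And>x. x \<in> X \<Longrightarrow> (f ^^ (q ^ k)) x = x"
  shows "[card X = card {x\<in>X. f x = x}] (mod q)"
  using assms(1,3,4)
proof (induction k arbitrary: X)
  case 0
  then have "{x\<in>X. f x = x} = X" by auto
  then show ?case by simp
next
  case (Suc k)
  define Y where "Y = {x\<in>X. (f ^^ (q ^ k)) x = x}"
  have "[card X = card {x\<in>X. (f ^^ (q ^ k)) x = x}] (mod q)"
  proof (rule card_fixpoints_cong_prime)
    show "(f ^^ (q ^ k)) x \<in> X" if "x \<in> X" for x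
      using funpow_prime_fix[of X f x] Suc.prems(2) that by blast
    show "((f ^^ (q ^ k)) ^^ q) x = x" if "x \<in> X" for x
      using Suc.prems(3)[OF that] by (simp add: funpow_mult mult.commute)
  qed (use Suc assms in auto)
  also have "{x\<in>X. (f ^^ (q ^ k)) x = x} = Y" by (simp add: Y_def)
  also have "[card Y = card {x\<in>Y. f x = x}] (mod q)"
  proof (rule Suc.IH)
    show "f x \<in> Y" if "x \<in> Y" for x
      using that Suc.prems(2) funpow_swap1[of f "q ^ k" x] by (auto simp: Y_def)
  qed (use Suc in \<open>auto simp: Y_def\<close>)
  also have "{x\<in>Y. f x = x} = {x\<in>X. f x = x}"
  proof -
    have "(f ^^ j) x = x" if "f x = x" for x j by (induction j) (use that in auto)
    then show ?thesis by (auto simp: Y_def)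
  qed
  finally show ?case .
qed

abbreviation pinv :: "('a \<Rightarrow> 'a) \<Rightarrow> 'a \<Rightarrow> 'a" where
  "pinv f \<equiv> inv_into UNIV f"

text \<open>Closure under inverses follows from finiteness (\<open>perm_group_inv\<close>), so
  membership proofs for concrete groups reduce to composition.\<close>

definition perm_group :: "'a set \<Rightarrow> ('a \<Rightarrow> 'a) set \<Rightarrow> bool" where
  "perm_group V G \<longleftrightarrow> finite V \<and> (\<forall>g\<in>G. g permutes V) \<and> id \<in> G \<and> (\<forall>g\<in>G. \<forall>h\<in>G. g \<circ> h \<in> G)"

lemma perm_groupD:
  assumes "perm_group V G"
  shows "finite V" "\<And>g. g \<in> G \<Longrightarrow> g permutes V" "id \<in> G" "\<And>g h. g \<in> G \<Longrightarrow> h \<in> G \<Longrightarrow> g \<circ> h \<in> G" "finite G"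
proof -
  show "finite V" "\<And>g. g \<in> G \<Longrightarrow> g permutes V" "id \<in> G" "\<And>g h. g \<in> G \<Longrightarrow> h \<in> G \<Longrightarrow> g \<circ> h \<in> G"
    using assms by (auto simp: perm_group_def)
  then show "finite G" using finite_permutations[of V] by (metis finite_subset mem_Collect_eq subsetI)
qed

lemma perm_group_funpow: "perm_group V G \<Longrightarrow> g \<in> G \<Longrightarrow> g ^^ k \<in> G"
  by (induction k) (auto simp: perm_groupD)

lemma perm_group_inv:
  assumes "perm_group V G" "g \<in> G"
  shows "pinv g \<in> G"
proof -
  have gp: "g permutes V" using perm_groupD assms by blast
  have gi: "pinv g \<circ> g = id" "g \<circ> pinv g = id" using permutes_inv_o[OF gp] by auto
  have "inj_on (\<lambda>h. g \<circ> h) G"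
  proof (rule inj_onI)
    fix h k assume "g \<circ> h = g \<circ> k"
    then have "pinv g \<circ> g \<circ> h = pinv g \<circ> g \<circ> k" by (simp only: comp_assoc)
    then show "h = k" by (simp add: gi)
  qed
  moreover have "(\<lambda>h. g \<circ> h) ` G \<subseteq> G" using perm_groupD(4)[OF assms(1)] assms(2) by blast
  ultimately have "(\<lambda>h. g \<circ> h) ` G = G"
    using perm_groupD(5)[OF assms(1)] by (simp add: endo_inj_surj)
  moreover have "id \<in> G" using perm_groupD(3)[OF assms(1)] .
  ultimately obtain h where h: "h \<in> G" "g \<circ> h = id" by (metis imageE)
  have "pinv g \<circ> g \<circ> h = pinv g \<circ> (g \<circ> h)" by (simp only: comp_assoc)
  then have "pinv g = h" by (simp add: gi h)
  then show ?thesis using h by simp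
qed

lemma perm_group_inv_simps:
  assumes "perm_group V G" "g \<in> G"
  shows "pinv g \<circ> g = id" "g \<circ> pinv g = id" "pinv g (g v) = v" "g (pinv g v) = v"
  using perm_groupD(2)[OF assms] permutes_inv_o permutes_inverses by auto

lemma perm_group_cancel:
  assumes "perm_group V G" "g \<in> G" "g \<circ> h = g \<circ> k"
  shows "h = k"
proof -
  have "pinv g \<circ> g \<circ> h = pinv g \<circ> g \<circ> k" using assms(3) by (simp only: comp_assoc)
  then show ?thesis by (simp add: perm_group_inv_simps[OF assms(1,2)])
qed

definition perm_monoid :: "('a \<Rightarrow> 'a) set \<Rightarrow> ('a \<Rightarrow> 'a) monoid" where
  "perm_monoid G = \<lparr> carrier = G, monoid.mult = (\<circ>), monoid.one = id \<rparr>"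

lemma perm_monoid_simps [simp]:
  "carrier (perm_monoid G) = G" "a \<otimes>\<^bsub>perm_monoid G\<^esub> b = a \<circ> b" "\<one>\<^bsub>perm_monoid G\<^esub> = id"
  by (auto simp: perm_monoid_def)

lemma group_perm_monoid:
  assumes "perm_group V G"
  shows "group (perm_monoid G)"
proof (rule groupI; simp)
  show "id \<in> G" using perm_groupD[OF assms] by auto
  show "\<exists>y\<in>G. y \<circ> x = id" if "x \<in> G" for x
    using perm_group_inv[OF assms that] perm_group_inv_simps[OF assms that] by blast
qed (use perm_groupD[OF assms] in \<open>auto simp: o_assoc\<close>)

lemma perm_group_pow_card:
  assumes "perm_group V G" "g \<in> G"
  shows "g ^^ card G = id"
proof -
  interpret group "perm_monoid G" using group_perm_monoid assms by blast
  have pw: "g [^]\<^bsub>perm_monoid G\<^esub> k = g ^^ k" for k :: nat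
    by (induction k) (simp_all add: funpow_Suc_right del: funpow.simps(2))
  show ?thesis using pow_order_eq_1[of g] assms by (simp add: pw order_def)
qed

lemma card_eq_mult_fibres:
  assumes "finite A" "\<And>y. y \<in> f ` A \<Longrightarrow> card {x\<in>A. f x = y} = k"
  shows "card A = card (f ` A) * k"
proof -
  have "card A = (\<Sum>y\<in>f ` A. card {x\<in>A. f x = y})"
    using sum.image_gen[OF assms(1), of "\<lambda>_. 1::nat" f] by simp
  then show ?thesis using assms(2) by simp
qed

text \<open>The fibres of the orbit map are cosets of the stabilizer. The action law is asked at the
  single point \<open>x\<close>, which admits actions such as the one in
  \<open>three_group_sgn\<close>, where blocks are moved through chosen representatives.\<close>

lemma orbit_stabilizer:
  assumes G: "perm_group V G"
    and act: "\<And>g h. g \<in> G \<Longrightarrow> h \<in> G \<Longrightarrow> act (g \<circ> h) x = act g (act h x)"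
    and cancel: "\<And>g y z. g \<in> G \<Longrightarrow> y \<in> (\<lambda>g. act g x) ` G \<Longrightarrow> z \<in> (\<lambda>g. act g x) ` G \<Longrightarrow> act g y = act g z \<Longrightarrow> y = z"
  shows "card G = card ((\<lambda>g. act g x) ` G) * card {g\<in>G. act g x = act id x}"
proof (rule card_eq_mult_fibres)
  show "finite G" using perm_groupD[OF G] by blast
  fix y assume "y \<in> (\<lambda>g. act g x) ` G"
  then obtain g where g: "g \<in> G" "y = act g x" by blast
  have "(\<lambda>h. g \<circ> h) ` {h\<in>G. act h x = act id x} = {h\<in>G. act h x = y}"
  proof (intro equalityI subsetI)
    fix k assume "k \<in> (\<lambda>h. g \<circ> h) ` {h\<in>G. act h x = act id x}"
    then obtain h where h: "h \<in> G" "act h x = act id x" "k = g \<circ> h" by blast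
    then have "act k x = act g (act id x)" using act[OF g(1) h(1)] by metis
    also have "\<dots> = act (g \<circ> id) x" by (rule act[OF g(1) perm_groupD(3)[OF G], symmetric])
    finally show "k \<in> {h\<in>G. act h x = y}" using g perm_groupD(4)[OF G g(1) h(1)] h(3) by simp
  next
    fix k assume k: "k \<in> {h\<in>G. act h x = y}"
    define h where "h = pinv g \<circ> k"
    have hG: "h \<in> G" unfolding h_def
      by (rule perm_groupD(4)[OF G perm_group_inv[OF G g(1)]]) (use k in simp)
    have gh: "g \<circ> h = k" by (simp add: h_def o_assoc perm_group_inv_simps[OF G g(1)])
    have "act g (act h x) = act k x" using act[OF g(1) hG] gh by metis
    also have "\<dots> = act (g \<circ> id) x" using k g by simp
    also have "\<dots> = act g (act id x)" by (rule act[OF g(1) perm_groupD(3)[OF G]])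
    finally have "act h x = act id x"
      by (rule cancel[OF g(1) imageI[OF hG] imageI[OF perm_groupD(3)[OF G]]])
    then show "k \<in> (\<lambda>h. g \<circ> h) ` {h\<in>G. act h x = act id x}" using hG gh by blast
  qed
  moreover have "inj_on (\<lambda>h. g \<circ> h) {h\<in>G. act h x = act id x}"
    by (rule inj_onI, rule perm_group_cancel[OF G g(1)])
  ultimately show "card {h\<in>G. act h x = y} = card {g\<in>G. act g x = act id x}"
    using card_image[of "\<lambda>h. g \<circ> h" "{h\<in>G. act h x = act id x}"] by simp
qed

lemma orbit_stabilizer_cancel:
  assumes G: "perm_group V G"
    and act: "\<And>g h. g \<in> G \<Longrightarrow> h \<in> G \<Longrightarrow> act (g \<circ> h) x = act g (act h x)"
    and "g \<in> G" "y \<in> (\<lambda>g. act g x) ` G" "z \<in> (\<lambda>g. act g x) ` G" "act g y = act g z"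
  shows "y = z"
proof -
  have *: "act (pinv g) (act g (act h x)) = act h x" if "h \<in> G" for h
  proof -
    have "act (pinv g) (act g (act h x)) = act (pinv g) (act (g \<circ> h) x)" using act[OF assms(3) that] by metis
    also have "\<dots> = act (pinv g \<circ> (g \<circ> h)) x"
      by (rule act[symmetric]) (use perm_group_inv[OF G assms(3)] perm_groupD(4)[OF G assms(3) that] in auto)
    also have "pinv g \<circ> (g \<circ> h) = h" by (simp add: o_assoc perm_group_inv_simps[OF G assms(3)])
    finally show ?thesis .
  qed
  obtain h k where "h \<in> G" "y = act h x" "k \<in> G" "z = act k x" using assms(4,5) by blast
  then show ?thesis using *[of h] *[of k] assms(6) by metis
qed

lemma card_orbit_stabilizer:
  assumes G: "perm_group V G"
    and act: "\<And>g h. g \<in> G \<Longrightarrow> h \<in> G \<Longrightarrow> act (g \<circ> h) x = act g (act h x)"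
  shows "card G = card ((\<lambda>g. act g x) ` G) * card {g\<in>G. act g x = act id x}"
  using orbit_stabilizer[OF G act] orbit_stabilizer_cancel[OF G act] by blast

text \<open>Conjugacy of Sylow subgroups in the form used throughout. An element with
  \<open>q\<close>-th power 1 permutes the cosets of a Sylow subgroup, whose number is prime to
  \<open>q\<close>; so it fixes a coset, which means that it is conjugate into the subgroup.\<close>

lemma sylow_conj:
  assumes G: "perm_group V G" and q: "prime q"
    and g1: "q1 \<in> G" "q1 ^^ q = id" and g2: "q2 \<in> G" "q2 ^^ q = id"
  obtains P g k where "perm_group V P" "P \<subseteq> G" "card P = q ^ k" "g \<in> G" "q1 \<in> P" "pinv g \<circ> q2 \<circ> g \<in> P"
proof -
  note Gd = perm_groupD[OF G]
  have cG: "card G \<noteq> 0" using Gd by auto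
  then obtain a m where am: "card G = q ^ a * m" "\<not> q dvd m"
    using multiplicity_decompose'[of "card G" q] not_prime_unit[of q] q by metis
  obtain S where S: "subgroup S (perm_monoid G)" "card S = q ^ a"
    using sylow_thm[OF q group_perm_monoid[OF G], of a m] Gd am by (auto simp: order_def)
  have SG: "S \<subseteq> G" "id \<in> S" "\<And>g h. g \<in> S \<Longrightarrow> h \<in> S \<Longrightarrow> g \<circ> h \<in> S"
    using S(1) by (auto simp: subgroup_def)
  have PS: "perm_group V S" using SG Gd by (auto simp: perm_group_def)
  define X where "X = (\<lambda>g. (\<circ>) g ` S) ` G"
  have coset_self: "g \<in> (\<circ>) g ` S" for g using SG(2) by (metis comp_id imageI)
  have coset_eq: "(\<circ>) (g \<circ> h) ` S = (\<circ>) g ` S" if "h \<in> S" for g h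
  proof (intro equalityI subsetI)
    fix k assume "k \<in> (\<circ>) (g \<circ> h) ` S"
    then show "k \<in> (\<circ>) g ` S" using that SG(3) by (auto simp: comp_assoc)
  next
    fix k assume "k \<in> (\<circ>) g ` S"
    then obtain s where s: "s \<in> S" "k = g \<circ> s" by blast
    have "k = (g \<circ> h) \<circ> (pinv h \<circ> s)" using s
      by (simp add: fun_eq_iff perm_group_inv_simps[OF PS that])
    then show "k \<in> (\<circ>) (g \<circ> h) ` S" using SG(3) perm_group_inv[OF PS that] s by blast
  qed
  have "card G = card X * card S"
    unfolding X_def
  proof (rule card_eq_mult_fibres)
    fix C assume "C \<in> (\<lambda>g. (\<circ>) g ` S) ` G"
    then obtain g where g: "g \<in> G" "C = (\<circ>) g ` S" by blast
    have "{h\<in>G. (\<circ>) h ` S = C} = C"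
    proof (intro equalityI subsetI)
      fix h assume "h \<in> {h\<in>G. (\<circ>) h ` S = C}" then show "h \<in> C" using coset_self by blast
    next
      fix h assume "h \<in> C"
      then obtain s where s: "s \<in> S" "h = g \<circ> s" using g by blast
      then have "h \<in> G" using g Gd(4) SG(1) by blast
      moreover have "(\<circ>) h ` S = C" using coset_eq[OF s(1), of g] s g by metis
      ultimately show "h \<in> {h\<in>G. (\<circ>) h ` S = C}" by blast
    qed
    moreover have "inj_on ((\<circ>) g) S"
      by (rule inj_onI, rule perm_group_cancel[OF G g(1)])
    ultimately show "card {h\<in>G. (\<circ>) h ` S = C} = card S" using g card_image[of "(\<circ>) g" S] by simp
  qed (use Gd in auto)
  then have cX: "card X = m" using am S(2) q by (simp add: prime_gt_0_nat)
  have key: "\<exists>g\<in>G. pinv g \<circ> q' \<circ> g \<in> S" if q': "q' \<in> G" "q' ^^ q = id" for q'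
  proof -
    define F where "F = (\<lambda>C::('a \<Rightarrow> 'a) set. (\<circ>) q' ` C)"
    have FX: "F C \<in> X" if CX: "C \<in> X" for C
    proof -
      obtain g where "g \<in> G" "C = (\<circ>) g ` S" using CX by (auto simp: X_def)
      then have "F C = (\<circ>) (q' \<circ> g) ` S" by (auto simp: F_def image_image comp_assoc)
      then show ?thesis using \<open>g \<in> G\<close> q' Gd by (auto simp: X_def)
    qed
    have Fk: "(F ^^ k) C = (\<circ>) (q' ^^ k) ` C" for k C
      by (induction k) (simp_all add: F_def image_image image_comp comp_def)
    have "[card X = card {C\<in>X. F C = C}] (mod q)"
      by (rule card_fixpoints_cong_prime) (use Gd q FX Fk q' in \<open>auto simp: X_def\<close>)
    then have "card {C\<in>X. F C = C} \<noteq> 0" using cX am(2) by (metis cong_0_iff)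
    then obtain C where "C \<in> X" "F C = C" by (metis (mono_tags, lifting) card.empty empty_Collect_eq)
    then obtain g where g: "g \<in> G" "(\<circ>) q' ` ((\<circ>) g ` S) = (\<circ>) g ` S" by (auto simp: X_def F_def)
    then have "q' \<circ> g \<in> (\<circ>) g ` S" using imageI[OF coset_self[of g], of "(\<circ>) q'"] by simp
    then obtain s where "s \<in> S" "q' \<circ> g = g \<circ> s" by blast
    then have "pinv g \<circ> q' \<circ> g = s"
      by (simp only: comp_assoc) (simp add: fun_eq_iff perm_group_inv_simps[OF G g(1)])
    then show ?thesis using g \<open>s \<in> S\<close> by blast
  qed
  obtain h1 where h1: "h1 \<in> G" "pinv h1 \<circ> q1 \<circ> h1 \<in> S" using key g1 by blast
  obtain h2 where h2: "h2 \<in> G" "pinv h2 \<circ> q2 \<circ> h2 \<in> S" using key g2 by blast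
  note i1 = perm_group_inv[OF G h1(1)] perm_group_inv_simps[OF G h1(1)]
  note i2 = perm_group_inv[OF G h2(1)] perm_group_inv_simps[OF G h2(1)]
  \<comment> \<open>The subgroup is conjugated so that \<open>q1\<close> itself lies in it; the
    whole conjugation then falls on \<open>q2\<close>.\<close>
  define P where "P = (\<lambda>s. h1 \<circ> s \<circ> pinv h1) ` S"
  define g where "g = h2 \<circ> pinv h1"
  show ?thesis
  proof (rule that)
    show PG: "P \<subseteq> G" using SG h1 i1 Gd by (auto simp: P_def)
    have "id \<in> P" unfolding P_def by (rule image_eqI[OF _ SG(2)]) (simp add: fun_eq_iff i1)
    moreover have "g \<circ> h \<in> P" if gh: "g \<in> P" "h \<in> P" for g h
    proof -
      obtain s t where st: "s \<in> S" "t \<in> S" "g = h1 \<circ> s \<circ> pinv h1" "h = h1 \<circ> t \<circ> pinv h1"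
        using gh by (auto simp: P_def)
      have "g \<circ> h = h1 \<circ> (s \<circ> t) \<circ> pinv h1" using st(3,4) by (simp add: fun_eq_iff i1)
      then show ?thesis unfolding P_def using imageI[OF SG(3)[OF st(1,2)], of "\<lambda>s. h1 \<circ> s \<circ> pinv h1"] by simp
    qed
    ultimately show "perm_group V P" using PG Gd unfolding perm_group_def by blast
    have "inj_on (\<lambda>s. h1 \<circ> s \<circ> pinv h1) S"
    proof (rule inj_onI)
      fix s t assume "h1 \<circ> s \<circ> pinv h1 = h1 \<circ> t \<circ> pinv h1"
      then have "pinv h1 \<circ> (h1 \<circ> s \<circ> pinv h1) \<circ> h1 = pinv h1 \<circ> (h1 \<circ> t \<circ> pinv h1) \<circ> h1" by simp
      then show "s = t" by (simp add: fun_eq_iff i1)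
    qed
    then show "card P = q ^ a" using S(2) by (simp add: P_def card_image)
    show gG: "g \<in> G" using h2 i1 Gd by (auto simp: g_def)
    have "q1 = h1 \<circ> (pinv h1 \<circ> q1 \<circ> h1) \<circ> pinv h1" by (simp add: fun_eq_iff i1)
    then show "q1 \<in> P" using h1 by (auto simp: P_def)
    have "pinv g = h1 \<circ> pinv h2"
    proof -
      have "g \<circ> (h1 \<circ> pinv h2) = id" by (simp add: fun_eq_iff i1 i2 g_def)
      then have "g \<circ> pinv g = g \<circ> (h1 \<circ> pinv h2)" using perm_group_inv_simps(2)[OF G gG] by simp
      then show ?thesis by (rule perm_group_cancel[OF G gG])
    qed
    then have "pinv g \<circ> q2 \<circ> g = h1 \<circ> (pinv h2 \<circ> q2 \<circ> h2) \<circ> pinv h1"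
      by (simp add: fun_eq_iff g_def)
    then show "pinv g \<circ> q2 \<circ> g \<in> P" using h2 by (auto simp: P_def)
  qed
qed

lemma burnside_count:
  assumes G: "perm_group V G" and X: "finite X"
    and clos: "\<And>g A. g \<in> G \<Longrightarrow> A \<in> X \<Longrightarrow> act g A \<in> X"
    and act: "\<And>g h A. g \<in> G \<Longrightarrow> h \<in> G \<Longrightarrow> A \<in> X \<Longrightarrow> act (g \<circ> h) A = act g (act h A)"
    and act_id: "\<And>A. A \<in> X \<Longrightarrow> act id A = A"
  shows "card (X // {(A, B). A \<in> X \<and> B \<in> X \<and> (\<exists>g\<in>G. act g A = B)}) * card G = (\<Sum>g\<in>G. card {A\<in>X. act g A = A})"
proof -
  define r where "r = {(A, B). A \<in> X \<and> B \<in> X \<and> (\<exists>g\<in>G. act g A = B)}"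
  note Gd = perm_groupD[OF G]
  have eqv: "equiv X r"
  proof (rule equivI)
    show "r \<subseteq> X \<times> X" by (auto simp: r_def)
    show "refl_on X r" using Gd(3) act_id by (force simp: refl_on_def r_def)
    show "sym r"
    proof (rule symI)
      fix A B assume "(A, B) \<in> r"
      then obtain g where g: "A \<in> X" "B \<in> X" "g \<in> G" "act g A = B" by (auto simp: r_def)
      have "act (pinv g) B = act (pinv g \<circ> g) A" using act g perm_group_inv[OF G g(3)] by simp
      then have "act (pinv g) B = A" using g act_id perm_group_inv_simps[OF G g(3)] by simp
      then show "(B, A) \<in> r" using g perm_group_inv[OF G g(3)] by (auto simp: r_def)
    qed
    show "trans r"
    proof (rule transI)
      fix A B C assume "(A, B) \<in> r" "(B, C) \<in> r"
      then obtain g h where "A \<in> X" "B \<in> X" "C \<in> X" "g \<in> G" "h \<in> G" "act g A = B" "act h B = C" by (auto simp: r_def)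
      then show "(A, C) \<in> r" using act Gd by (auto simp: r_def intro!: bexI[of _ "h \<circ> g"])
    qed
  qed
  have cls: "r `` {A} = (\<lambda>g. act g A) ` G" if "A \<in> X" for A using that clos by (auto simp: r_def)
  have os: "card G = card (r `` {A}) * card {g\<in>G. act g A = A}" if "A \<in> X" for A
    using card_orbit_stabilizer[OF G, of act A] act that act_id cls by simp
  have fin: "finite C" "C \<subseteq> X" if "C \<in> X // r" for C
  proof -
    show "C \<subseteq> X" using that eqv by (meson in_quotient_imp_subset)
    then show "finite C" using X finite_subset by blast
  qed
  have "(\<Sum>g\<in>G. card {A\<in>X. act g A = A}) = (\<Sum>A\<in>X. card {g\<in>G. act g A = A})"
    using sum.swap[of "\<lambda>g A. if act g A = A then 1 else (0::nat)" X G] Gd X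
    by (simp add: sum.If_cases Int_def)
  also have "\<dots> = (\<Sum>C\<in>X // r. \<Sum>A\<in>C. card {g\<in>G. act g A = A})"
  proof -
    have "X = \<Union> (X // r)" using Union_quotient[OF eqv] by simp
    moreover have "\<forall>C\<in>X // r. \<forall>D\<in>X // r. C \<noteq> D \<longrightarrow> C \<inter> D = {}" using quotient_disj[OF eqv] by blast
    ultimately show ?thesis using sum.Union_disjoint[of "X // r" "\<lambda>A. card {g\<in>G. act g A = A}"] fin by simp
  qed
  also have "\<dots> = (\<Sum>C\<in>X // r. card G)"
  proof (rule sum.cong)
    fix C assume C: "C \<in> X // r"
    have CA: "C = r `` {A}" if "A \<in> C" for A
      using C that eqv by (metis Image_singleton_iff equiv_class_eq quotientE)
    have CX: "C \<noteq> {}" using C eqv in_quotient_imp_non_empty by blast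
    then have c0: "card C > 0" using fin[OF C] by (simp add: card_gt_0_iff)
    have "card {g\<in>G. act g A = A} = card G div card C" if "A \<in> C" for A
    proof -
      have "card G = card C * card {g\<in>G. act g A = A}" using os[of A] CA[OF that] fin(2)[OF C] that by auto
      then show ?thesis using c0 by simp
    qed
    then have "(\<Sum>A\<in>C. card {g\<in>G. act g A = A}) = card C * (card G div card C)" by simp
    also have "\<dots> = card G"
    proof -
      obtain A where A: "A \<in> C" using CX by blast
      have "card G = card C * card {g\<in>G. act g A = A}" using os[of A] CA[OF A] fin(2)[OF C] A by auto
      then show ?thesis using c0 by simp
    qed
    finally show "(\<Sum>A\<in>C. card {g\<in>G. act g A = A}) = card G" .
  qed simp
  finally show ?thesis by (simp add: r_def)
qed

section \<open>Coordinates on the dihedral group\<close>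

declare split_paired_All [simp del] split_paired_Ex [simp del]

type_synonym vtx = "bool \<times> int \<times> int"

lemma int_ge_cases3:
  fixes i :: int
  shows "i mod 3 = 0 \<or> i mod 3 = 1 \<or> i mod 3 = 2"
  by presburger

locale dih6 =
  fixes p :: nat
  assumes prime_p: "prime p" and p_gt_3: "p > 3"
begin

lemma p_pos [simp]: "int p > 0" "p > 0" and p_gt1: "int p > 1"
  using p_gt_3 by auto

text \<open>The vertex \<open>(e, i, a)\<close> is the rotation numbered \<open>p i + 3 a\<close> if \<open>e\<close> is false, and the reflection numbered
  \<open>- (p i + 3 a)\<close> otherwise (see \<open>num\<close>); the sign makes \<open>X\<close>, \<open>U\<close> and \<open>S\<close> right translations, of orders
  \<open>p\<close>, 3 and 2. The orbits of \<open>X\<close> are the six blocks.\<close>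

definition V :: "vtx set" where
  "V = UNIV \<times> {0..<3} \<times> {0..<int p}"

text \<open>Reduces arbitrary integer arguments, so that formulas for maps can be computed with the
  generator \<open>pt\<close> without range conditions.\<close>

definition pt :: "bool \<Rightarrow> int \<Rightarrow> int \<Rightarrow> vtx" where
  "pt e i a = (e, i mod 3, a mod int p)"

definition X :: "int \<Rightarrow> vtx \<Rightarrow> vtx" where
  "X c v = (if v \<in> V then pt (fst v) (fst (snd v)) (snd (snd v) + c) else v)"

definition U :: "int \<Rightarrow> vtx \<Rightarrow> vtx" where
  "U c v = (if v \<in> V then pt (fst v) (fst (snd v) + c) (snd (snd v)) else v)"

definition S :: "vtx \<Rightarrow> vtx" where
  "S v = (if v \<in> V then pt (\<not> fst v) (- fst (snd v)) (- snd (snd v)) else v)"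

definition blk :: "vtx \<Rightarrow> bool \<times> int" where
  "blk v = (fst v, fst (snd v))"

definition sgn :: "vtx \<Rightarrow> bool" where
  "sgn v = fst v"

lemma finite_V: "finite V" by (auto simp: V_def)

lemma card_V: "card V = 6 * p" by (auto simp: V_def card_cartesian_product)

lemma pt_V [simp]: "pt e i a \<in> V" by (auto simp: V_def pt_def)

lemma pt_iff: "pt e i a = pt e' i' a' \<longleftrightarrow> e = e' \<and> i mod 3 = i' mod 3 \<and> a mod int p = a' mod int p"
  by (auto simp: pt_def)

lemma ptE: assumes "v \<in> V" obtains e i a where "v = pt e i a"
proof -
  obtain e i a where "v = (e, i, a)" by (cases v) auto
  then have "v = pt e i a" using assms by (auto simp: V_def pt_def)
  then show ?thesis using that by blast
qed

lemma X_pt [simp]: "X c (pt e i a) = pt e i (a + c)"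
  by (simp add: X_def) (simp add: pt_def mod_simps)
lemma U_pt [simp]: "U c (pt e i a) = pt e (i + c) a"
  by (simp add: U_def) (simp add: pt_def mod_simps)
lemma S_pt [simp]: "S (pt e i a) = pt (\<not> e) (- i) (- a)"
  by (simp add: S_def) (simp add: pt_def mod_simps)
lemma blk_pt: "blk (pt e i a) = (e, i mod 3)" by (simp add: blk_def pt_def)
lemma sgn_pt [simp]: "sgn (pt e i a) = e" by (simp add: sgn_def pt_def)

lemma X_out: "v \<notin> V \<Longrightarrow> X c v = v" and U_out: "v \<notin> V \<Longrightarrow> U c v = v" and S_out: "v \<notin> V \<Longrightarrow> S v = v"
  by (auto simp: X_def U_def S_def)

lemma in_V [simp]: "v \<in> V \<Longrightarrow> X c v \<in> V" "v \<in> V \<Longrightarrow> U c v \<in> V" "v \<in> V \<Longrightarrow> S v \<in> V"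
  by (auto elim!: ptE)

lemma tr_simps [simp]:
  "X c (X d v) = X (c + d) v" "U c (U d v) = U (c + d) v" "S (S v) = v" "X 0 v = v" "U 0 v = v"
  by (cases "v \<in> V"; auto elim!: ptE simp: X_out U_out S_out algebra_simps)+

lemma tr_commute:
  "X c (U d v) = U d (X c v)" "S (X c v) = X (- c) (S v)" "S (U c v) = U (- c) (S v)"
  by (cases "v \<in> V"; auto elim!: ptE simp: X_out U_out S_out algebra_simps)+

lemma X_eq_iff: assumes "v \<in> V" shows "X c v = X d v \<longleftrightarrow> c mod int p = d mod int p"
  using assms
proof (elim ptE)
  fix e i a assume v: "v = pt e i a"
  have "(a + c) mod int p = (a + d) mod int p \<longleftrightarrow> c mod int p = d mod int p"
    using cong_add_lcancel[of a c d "int p"] by (simp add: cong_def)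
  then show ?thesis using v by (simp add: pt_iff)
qed

lemma U_eq_iff: assumes "v \<in> V" shows "U c v = U d v \<longleftrightarrow> c mod 3 = d mod 3"
  using assms
proof (elim ptE)
  fix e i a assume v: "v = pt e i a"
  have "(i + c) mod 3 = (i + d) mod 3 \<longleftrightarrow> c mod 3 = d mod 3"
    using cong_add_lcancel[of i c d "3::int"] by (simp add: cong_def)
  then show ?thesis using v by (simp add: pt_iff)
qed

lemma X_cong: "c mod int p = d mod int p \<Longrightarrow> X c = X d"
  using X_eq_iff X_out by fastforce

lemma U_cong: "c mod 3 = d mod 3 \<Longrightarrow> U c = U d"
  using U_eq_iff U_out by fastforce

lemma blk_simps [simp]: "blk (X c v) = blk v" "sgn (X c v) = sgn v" "sgn (U c v) = sgn v"
  by (cases "v \<in> V"; auto elim!: ptE simp: X_out U_out blk_pt)+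

lemma sgn_S [simp]: "v \<in> V \<Longrightarrow> sgn (S v) = (\<not> sgn v)"
  by (auto elim!: ptE)

lemma blk_sgn: "blk v = blk w \<Longrightarrow> sgn v = sgn w" by (simp add: blk_def sgn_def)

lemma blk_eqE:
  assumes "blk v = blk w" "v \<in> V" "w \<in> V"
  obtains c where "w = X c v"
proof -
  obtain e i a e' i' a' where "v = pt e i a" "w = pt e' i' a'" using assms ptE by metis
  then have "w = X (a' - a) v" using assms(1) by (simp add: blk_pt pt_iff)
  then show ?thesis using that by blast
qed

lemma sgn_eqE:
  assumes "sgn v = sgn w" "v \<in> V" "w \<in> V"
  obtains c k where "w = U k (X c v)"
proof -
  obtain e i a e' i' a' where "v = pt e i a" "w = pt e' i' a'" using assms ptE by metis
  then have "w = U (i' - i) (X (a' - a) v)" using assms(1) by (simp add: pt_iff)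
  then show ?thesis using that by blast
qed

lemma blk_U_cong:
  assumes "blk v = blk w" "v \<in> V" "w \<in> V" shows "blk (U k v) = blk (U k w)"
  using blk_eqE[OF assms] by (metis blk_simps(1) tr_commute(1))

lemma blk_S_cong:
  assumes "blk v = blk w" "v \<in> V" "w \<in> V" shows "blk (S v) = blk (S w)"
  using blk_eqE[OF assms] by (metis blk_simps(1) tr_commute(2))

lemma blk_U_iff: "v \<in> V \<Longrightarrow> blk (U c v) = blk (U d v) \<longleftrightarrow> c mod 3 = d mod 3"
proof (elim ptE)
  fix e i a assume v: "v = pt e i a"
  have "(i + c) mod 3 = (i + d) mod 3 \<longleftrightarrow> c mod 3 = d mod 3"
    using cong_add_lcancel[of i c d "3::int"] by (simp add: cong_def)
  then show ?thesis using v by (simp add: blk_pt)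
qed

lemma X_permutes: "X c permutes V"
proof (rule bij_imp_permutes)
  show "bij_betw (X c) V V"
    by (rule bij_betw_byWitness[where f' = "X (- c)"]) auto
qed (simp add: X_out)

lemma U_permutes: "U c permutes V"
proof (rule bij_imp_permutes)
  show "bij_betw (U c) V V"
    by (rule bij_betw_byWitness[where f' = "U (- c)"]) auto
qed (simp add: U_out)

lemma S_permutes: "S permutes V"
proof (rule bij_imp_permutes)
  show "bij_betw S V V"
    by (rule bij_betw_byWitness[where f' = S]) auto
qed (simp add: S_out)

lemma X_funpow: "X c ^^ n = X (int n * c)"
  by (induction n) (auto simp: fun_eq_iff algebra_simps)

lemma U_funpow: "U c ^^ n = U (int n * c)"
  by (induction n) (auto simp: fun_eq_iff algebra_simps)

lemma X1_pow_p: "X 1 ^^ p = id"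
  using X_cong[of "int p" 0] by (simp add: X_funpow fun_eq_iff)

lemma U1_pow_3: "U 1 ^^ 3 = id"
  using U_cong[of 3 0] by (simp add: U_funpow fun_eq_iff)

lemma block_eq: "v \<in> V \<Longrightarrow> {w\<in>V. blk w = blk v} = (\<lambda>a. X a v) ` {0..<int p}"
proof (intro equalityI subsetI)
  fix w assume v: "v \<in> V" and "w \<in> {w\<in>V. blk w = blk v}"
  then obtain c where "w = X c v" using blk_eqE[of v w] by auto
  then have "w = X (c mod int p) v" using X_cong[of c "c mod int p"] by simp
  then show "w \<in> (\<lambda>a. X a v) ` {0..<int p}" by auto
qed auto

lemma card_block: "v \<in> V \<Longrightarrow> card {w\<in>V. blk w = blk v} = p"
proof -
  assume v: "v \<in> V"
  have "inj_on (\<lambda>a. X a v) {0..<int p}" by (rule inj_onI) (simp add: X_eq_iff[OF v])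
  then show ?thesis by (simp add: block_eq[OF v] card_image)
qed

text \<open>What is kept of a Cayley digraph: invariance under the three generating right
  translations. \<open>Rinv_CE\<close> provides it for connection sets.\<close>

definition Rinv :: "(vtx \<Rightarrow> vtx \<Rightarrow> bool) \<Rightarrow> bool" where
  "Rinv E \<longleftrightarrow> (\<forall>v\<in>V. \<forall>w\<in>V. (\<forall>c. E (X c v) (X c w) = E v w) \<and> (\<forall>c. E (U c v) (U c w) = E v w) \<and> E (S v) (S w) = E v w)"

lemma RinvD:
  assumes "Rinv E" "v \<in> V" "w \<in> V"
  shows "E (X c v) (X c w) = E v w" "E (U c v) (U c w) = E v w" "E (S v) (S w) = E v w"
  using assms by (auto simp: Rinv_def)

definition iso :: "(vtx \<Rightarrow> vtx \<Rightarrow> bool) \<Rightarrow> (vtx \<Rightarrow> vtx \<Rightarrow> bool) \<Rightarrow> (vtx \<Rightarrow> vtx) \<Rightarrow> bool" where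
  "iso E E' f \<longleftrightarrow> f permutes V \<and> (\<forall>v\<in>V. \<forall>w\<in>V. E v w = E' (f v) (f w))"

lemma isoD: assumes "iso E E' f" shows "f permutes V" "\<And>v w. v \<in> V \<Longrightarrow> w \<in> V \<Longrightarrow> E v w = E' (f v) (f w)"
  using assms by (auto simp: iso_def)

lemma perm_V [simp]: "f permutes V \<Longrightarrow> f v \<in> V \<longleftrightarrow> v \<in> V"
  by (simp add: permutes_in_image)

lemma iso_comp: "iso E E' f \<Longrightarrow> iso E' E'' g \<Longrightarrow> iso E E'' (g \<circ> f)"
  by (auto simp: iso_def intro: permutes_compose)

lemma iso_pinv: assumes "iso E E' f" shows "iso E' E (pinv f)"
proof -
  note f = isoD[OF assms]
  have "E' v w = E (pinv f v) (pinv f w)" if "v \<in> V" "w \<in> V" for v w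
    using f(2)[of "pinv f v" "pinv f w"] that permutes_inv[OF f(1)] permutes_inverses[OF f(1)] by simp
  then show ?thesis using permutes_inv[OF f(1)] by (simp add: iso_def)
qed

lemma iso_tr: assumes "Rinv E" shows "iso E E (X c)" "iso E E (U c)" "iso E E S"
  using assms X_permutes U_permutes S_permutes by (auto simp: iso_def RinvD)

definition Aut :: "(vtx \<Rightarrow> vtx \<Rightarrow> bool) \<Rightarrow> (vtx \<Rightarrow> vtx) set" where
  "Aut E = {g. iso E E g}"

lemma perm_group_sub:
  assumes "\<And>g. g \<in> G \<Longrightarrow> g \<in> Aut E" "id \<in> G" "\<And>g h. g \<in> G \<Longrightarrow> h \<in> G \<Longrightarrow> g \<circ> h \<in> G"
  shows "perm_group V G"
  using assms finite_V by (auto simp: perm_group_def Aut_def iso_def)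

lemma id_Aut: "id \<in> Aut E" by (auto simp: Aut_def iso_def permutes_id)

lemma comp_Aut: "g \<in> Aut E \<Longrightarrow> h \<in> Aut E \<Longrightarrow> g \<circ> h \<in> Aut E"
  using iso_comp by (auto simp: Aut_def)

lemma perm_group_Aut: "perm_group V (Aut E)"
  using perm_group_sub[of "Aut E" E] id_Aut comp_Aut by blast

lemma tr_Aut: assumes "Rinv E" shows "X c \<in> Aut E" "U c \<in> Aut E" "S \<in> Aut E"
  using iso_tr[OF assms] by (auto simp: Aut_def)

lemma conj_Aut: "iso E E' f \<Longrightarrow> g \<in> Aut E' \<Longrightarrow> pinv f \<circ> g \<circ> f \<in> Aut E"
  unfolding Aut_def using iso_comp iso_pinv by (metis mem_Collect_eq)

lemma conj_pow: assumes "f permutes V" "g ^^ n = id" shows "(pinv f \<circ> g \<circ> f) ^^ n = id"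
proof -
  have "(pinv f \<circ> g \<circ> f) ^^ k = pinv f \<circ> (g ^^ k) \<circ> f" for k
    by (induction k) (auto simp: fun_eq_iff permutes_inverses[OF assms(1)])
  then show ?thesis using assms(2) by (simp add: fun_eq_iff permutes_inverses[OF assms(1)])
qed

lemma conj_conj: assumes "f permutes V" "g permutes V"
  shows "pinv (f \<circ> g) \<circ> h \<circ> (f \<circ> g) = pinv g \<circ> (pinv f \<circ> h \<circ> f) \<circ> g"
proof -
  have "bij f" "bij g" using assms permutes_bij by auto
  then show ?thesis by (simp add: o_inv_distrib comp_assoc)
qed

section \<open>Maps affine on blocks\<close>

text \<open>The multiplier may vary from block to block; \<open>ex_const\<close> later makes it
  constant.\<close>

definition aff :: "(vtx \<Rightarrow> vtx) \<Rightarrow> bool" where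
  "aff f \<longleftrightarrow> (\<forall>v\<in>V. \<exists>c. \<forall>a. f (X a v) = X (c * a) (f v))"

definition bpres :: "(vtx \<Rightarrow> vtx) \<Rightarrow> bool" where
  "bpres f \<longleftrightarrow> (\<forall>v\<in>V. \<forall>w\<in>V. blk v = blk w \<longrightarrow> blk (f v) = blk (f w))"

lemma bpresD: "bpres f \<Longrightarrow> v \<in> V \<Longrightarrow> w \<in> V \<Longrightarrow> blk v = blk w \<Longrightarrow> blk (f v) = blk (f w)"
  unfolding bpres_def by blast

lemma aff_bpres: "aff f \<Longrightarrow> bpres f"
  unfolding bpres_def
proof (intro ballI impI)
  fix v w assume f: "aff f" and h: "v \<in> V" "w \<in> V" "blk v = blk w"
  obtain a where a: "w = X a v" using blk_eqE[OF h(3,1,2)] by blast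
  obtain c where "\<And>a. f (X a v) = X (c * a) (f v)" using f h(1) unfolding aff_def by blast
  then show "blk (f v) = blk (f w)" using a by simp
qed

text \<open>All blocks have \<open>p\<close> points, so \<open>f\<close> maps a block onto a whole
  block and two blocks cannot be merged.\<close>

lemma bpres_inj:
  assumes f: "f permutes V" "bpres f" and vw: "v \<in> V" "w \<in> V" "blk (f v) = blk (f w)"
  shows "blk v = blk w"
proof -
  let ?B = "{w\<in>V. blk w = blk v}" and ?C = "{w\<in>V. blk w = blk (f v)}"
  have "f ` ?B \<subseteq> ?C"
  proof
    fix u assume "u \<in> f ` ?B"
    then obtain w where "w \<in> V" "blk w = blk v" "u = f w" by blast
    then show "u \<in> ?C" using f(1) bpresD[OF f(2), of w v] vw by simp
  qed
  moreover have "card (f ` ?B) = card ?C"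
    using card_image[OF inj_on_subset[OF permutes_inj_on[OF f(1), of UNIV]], of ?B]
      card_block[of v] card_block[of "f v"] vw f by simp
  ultimately have "f ` ?B = ?C" using finite_V by (intro card_subset_eq) auto
  moreover have "f w \<in> ?C" using vw f by simp
  ultimately have "f w \<in> f ` ?B" by simp
  then obtain w' where w': "w' \<in> ?B" "f w = f w'" by (elim imageE)
  then have "w = w'" using injD[OF permutes_inj[OF f(1)]] by blast
  then show ?thesis using w' by simp
qed

lemma aff_mult_unit:
  assumes "f permutes V" "v \<in> V" "\<And>a. f (X a v) = X (c * a) (f v)"
  shows "\<not> int p dvd c"
proof
  assume "int p dvd c"
  then have "X (c * 1) (f v) = X 0 (f v)" using X_cong[of "c * 1" 0] by simp
  then have "f (X 1 v) = f (X 0 v)" using assms(3)[of 1] assms(3)[of 0] by simp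
  then have "X 1 v = X 0 v" using permutes_inj[OF assms(1)] by (rule injD[rotated])
  then show False using X_eq_iff[OF assms(2), of 1 0] p_gt1 by simp
qed

lemma unit_inverse: assumes "\<not> int p dvd c" obtains d where "(c * d) mod int p = 1"
proof -
  have "coprime c (int p)" using assms prime_p by (metis coprime_commute prime_imp_coprime_int prime_nat_int_transfer)
  then obtain d where "[c * d = 1] (mod int p)" using cong_solve_coprime_int by blast
  then have "(c * d) mod int p = 1" using p_gt1 by (simp add: cong_def)
  then show ?thesis using that by blast
qed

lemma mod_mult_one: assumes "(c * d) mod int p = 1" shows "(c * (d * a)) mod int p = a mod int p" "(d * (c * a)) mod int p = a mod int p"
proof -
  have "(c * (d * a)) mod int p = ((c * d) mod int p * a) mod int p" by (simp add: mod_simps algebra_simps)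
  then show "(c * (d * a)) mod int p = a mod int p" using assms by simp
  then show "(d * (c * a)) mod int p = a mod int p" by (simp add: algebra_simps)
qed

lemma aff_pinv: assumes f: "f permutes V" "aff f" shows "aff (pinv f)"
  unfolding aff_def
proof
  fix w assume w: "w \<in> V"
  define v where "v = pinv f w"
  have v: "v \<in> V" "f v = w" using w permutes_inv[OF f(1)] permutes_inverses[OF f(1)] by (auto simp: v_def)
  obtain c where c: "\<And>a. f (X a v) = X (c * a) (f v)" using f(2) v(1) unfolding aff_def by blast
  obtain d where d: "(c * d) mod int p = 1" using unit_inverse aff_mult_unit[OF f(1) v(1) c] by blast
  have "pinv f (X a w) = X (d * a) v" for a
  proof -
    have "f (X (d * a) v) = X a w" using c[of "d * a"] v X_cong[OF mod_mult_one(1)[OF d, of a]] by simp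
    then show ?thesis using permutes_inverses(2)[OF f(1)] by metis
  qed
  then show "\<exists>c. \<forall>a. pinv f (X a w) = X (c * a) (pinv f w)" using v_def by blast
qed

lemma aff_comp: assumes "g permutes V" "aff f" "aff g" shows "aff (f \<circ> g)"
  unfolding aff_def
proof
  fix v assume v: "v \<in> V"
  obtain c where c: "\<And>a. g (X a v) = X (c * a) (g v)" using assms v unfolding aff_def by blast
  obtain d where d: "\<And>a. f (X a (g v)) = X (d * a) (f (g v))" using assms v unfolding aff_def by (metis perm_V)
  have "(f \<circ> g) (X a v) = X ((d * c) * a) ((f \<circ> g) v)" for a using c d by (simp add: algebra_simps)
  then show "\<exists>c. \<forall>a. (f \<circ> g) (X a v) = X (c * a) ((f \<circ> g) v)" by blast
qed

lemma aff_tr: "aff (X c)" "aff (U c)" "aff S" "aff id"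
proof -
  show "aff (X c)" unfolding aff_def by (intro ballI exI[of _ 1]) (simp add: add.commute)
  show "aff (U c)" unfolding aff_def by (intro ballI exI[of _ 1]) (simp add: tr_commute)
  show "aff S" unfolding aff_def by (intro ballI exI[of _ "-1"]) (simp add: tr_commute)
  show "aff id" unfolding aff_def by (intro ballI exI[of _ 1]) simp
qed

lemma X_in_group: assumes "perm_group V P" "X 1 \<in> P" shows "X c \<in> P"
proof -
  have "X c = X 1 ^^ nat (c mod int p)" unfolding X_funpow by (rule X_cong) simp
  then show ?thesis using perm_group_funpow[OF assms] by simp
qed

lemma U_in_group: assumes "perm_group V P" "U 1 \<in> P" shows "U c \<in> P"
proof -
  have "U c = U 1 ^^ nat (c mod 3)" unfolding U_funpow by (rule U_cong) simp
  then show ?thesis using perm_group_funpow[OF assms] by simp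
qed

text \<open>A group of \<open>p\<close>-power order induces on \<open>p\<close> points at most the
  cyclic group of shifts: corrected by a shift, the element fixes a point, and as the number of its
  fixed points in the block is divisible by \<open>p\<close>, it fixes the whole block.\<close>

lemma pgroup_block_shift:
  assumes P: "perm_group V P" "card P = p ^ k" "X 1 \<in> P"
    and g: "g \<in> P" and v: "v \<in> V" and B: "\<And>h w. h \<in> P \<Longrightarrow> w \<in> V \<Longrightarrow> blk w = blk v \<Longrightarrow> blk (h w) = blk v"
  obtains c where "\<And>a. g (X a v) = X (a + c) v"
proof -
  note Pd = perm_groupD[OF P(1)]
  have "blk (g v) = blk v" using B g v by simp
  then obtain c where c: "g v = X c v" using blk_eqE[of v "g v"] v Pd(2)[OF g] by auto
  define h where "h = X (- c) \<circ> g"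
  have h: "h \<in> P" using Pd(4)[OF X_in_group[OF P(1,3)] g] by (simp add: h_def)
  have hv: "h v = v" using c by (simp add: h_def)
  let ?B = "{w\<in>V. blk w = blk v}"
  have "[card ?B = card {w\<in>?B. h w = w}] (mod p)"
  proof (rule card_fixpoints_cong[where k = k])
    show "(h ^^ p ^ k) x = x" for x using perm_group_pow_card[OF P(1) h] P(2) by (simp add: fun_eq_iff)
    show "h x \<in> ?B" if "x \<in> ?B" for x using that B[OF h, of x] Pd(2)[OF h] by simp
  qed (use finite_V prime_p in auto)
  then have "p dvd card {w\<in>?B. h w = w}" using card_block[OF v] by (simp add: cong_def dvd_eq_mod_eq_0)
  moreover have "card {w\<in>?B. h w = w} > 0" using v hv finite_V by (auto simp: card_gt_0_iff)
  ultimately have "card {w\<in>?B. h w = w} \<ge> card ?B" using card_block[OF v] dvd_imp_le by simp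
  then have fx: "{w\<in>?B. h w = w} = ?B" using finite_V by (intro card_seteq) auto
  have "g (X a v) = X (a + c) v" for a
  proof -
    have "X a v \<in> {w\<in>?B. h w = w}" unfolding fx using v by simp
    then have "h (X a v) = X a v" by simp
    then have "X c (h (X a v)) = X c (X a v)" by simp
    then show ?thesis by (simp add: h_def add.commute)
  qed
  then show ?thesis using that by blast
qed

text \<open>On each block the conjugate \<open>y\<close> of \<open>X 1\<close> is a shift by some
  unit \<open>c\<close>, and \<open>f\<close> turns it into the shift by 1; so \<open>f\<close> is
  affine there with the inverse of \<open>c\<close> as multiplier.\<close>

lemma aff_from_pgroup:
  assumes P: "perm_group V P" "card P = p ^ k" "X 1 \<in> P"
    and B: "\<And>h w. h \<in> P \<Longrightarrow> w \<in> V \<Longrightarrow> blk (h w) = blk w"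
    and f: "f permutes V" "pinv f \<circ> X 1 \<circ> f \<in> P"
  shows "aff f"
  unfolding aff_def
proof
  fix v assume v: "v \<in> V"
  define y where "y = pinv f \<circ> X 1 \<circ> f"
  have "y \<in> P" using f by (simp add: y_def)
  then obtain c where c: "\<And>a. y (X a v) = X (a + c) v"
    using pgroup_block_shift[OF P, of y v] v B by metis
  have fy: "f (y w) = X 1 (f w)" for w by (simp add: y_def permutes_inverses[OF f(1)])
  have n: "f (X (int n * c) v) = X (int n) (f v)" for n
  proof (induction n)
    case (Suc n)
    have "f (X (int (Suc n) * c) v) = f (y (X (int n * c) v))" by (simp add: c algebra_simps)
    then show ?case using Suc by (simp add: fy add.commute)
  qed simp
  have "\<not> int p dvd c"
  proof
    assume "int p dvd c"
    then have "X c v = X 0 v" using X_cong[of c 0] by simp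
    then have "X 1 (f v) = X 0 (f v)" using n[of 1] by simp
    then show False using X_eq_iff[of "f v" 1 0] v f(1) p_gt1 by simp
  qed
  then obtain d where d: "(c * d) mod int p = 1" using unit_inverse by blast
  have "f (X a v) = X (d * a) (f v)" for a
  proof -
    define m where "m = nat ((d * a) mod int p)"
    have m: "int m mod int p = (d * a) mod int p" by (simp add: m_def)
    have "(int m * c) mod int p = ((d * a) mod int p * c) mod int p" using m by (metis mod_mult_left_eq)
    also have "\<dots> = (c * (d * a)) mod int p" by (simp add: mod_simps algebra_simps)
    finally have "X (int m * c) v = X a v" using X_cong mod_mult_one(1)[OF d, of a] by metis
    then show ?thesis using n[of m] X_cong[OF m] by simp
  qed
  then show "\<exists>c. \<forall>a. f (X a v) = X (c * a) (f v)" by blast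
qed

text \<open>Sylow's theorem is applied in the group of automorphisms fixing every block. It contains
  the conjugate of \<open>X 1\<close> because \<open>f\<close> maps blocks to blocks while
  \<open>X 1\<close> fixes each of them.\<close>

lemma ex_aff_of_bpres:
  assumes E: "Rinv E" "Rinv E'" and f: "iso E E' f" "bpres f"
  obtains f' where "iso E E' f'" "aff f'"
proof -
  note fp = isoD(1)[OF f(1)]
  define G where "G = {g \<in> Aut E. \<forall>v\<in>V. blk (g v) = blk v}"
  have GA: "g \<in> Aut E" if "g \<in> G" for g using that by (simp add: G_def)
  have Gp: "g permutes V" if "g \<in> G" for g using GA[OF that] by (simp add: Aut_def iso_def)
  have G: "perm_group V G"
  proof (rule perm_group_sub[of G E])
    show "g \<circ> h \<in> G" if "g \<in> G" "h \<in> G" for g h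
      using that comp_Aut Gp[OF that(2)] by (auto simp: G_def)
  qed (auto simp: G_def id_Aut)
  have X1: "X 1 \<in> G" using tr_Aut[OF E(1)] by (simp add: G_def)
  define y where "y = pinv f \<circ> X 1 \<circ> f"
  have yG: "y \<in> G"
  proof -
    have "blk (y v) = blk v" if v: "v \<in> V" for v
    proof (rule bpres_inj[OF fp f(2)])
      have "f (y v) = X 1 (f v)" by (simp add: y_def permutes_inverses[OF fp])
      then show "blk (f (y v)) = blk (f v)" by simp
    qed (use v fp permutes_inv[OF fp] in \<open>auto simp: y_def\<close>)
    moreover have "y \<in> Aut E" using conj_Aut[OF f(1)] tr_Aut[OF E(2)] by (simp add: y_def)
    ultimately show ?thesis by (simp add: G_def)
  qed
  obtain P g k where P: "perm_group V P" "P \<subseteq> G" "card P = p ^ k" "g \<in> G" "X 1 \<in> P" "pinv g \<circ> y \<circ> g \<in> P"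
    using sylow_conj[OF G prime_p X1 X1_pow_p yG] conj_pow[OF fp X1_pow_p] y_def by metis
  have "aff (f \<circ> g)"
  proof (rule aff_from_pgroup[OF P(1,3,5)])
    show "f \<circ> g permutes V" using fp Gp[OF P(4)] permutes_compose by blast
    show "pinv (f \<circ> g) \<circ> X 1 \<circ> (f \<circ> g) \<in> P" using P(6) conj_conj[OF fp Gp[OF P(4)]] by (simp add: y_def)
  qed (use P(2) in \<open>auto simp: G_def\<close>)
  moreover have "iso E E' (f \<circ> g)" using iso_comp f(1) GA[OF P(4)] by (auto simp: Aut_def)
  ultimately show ?thesis using that by blast
qed

section \<open>Sylow 3-subgroups acting on the six blocks\<close>

definition rep :: "bool \<times> int \<Rightarrow> vtx" where "rep b = pt (fst b) (snd b) 0"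

lemma rep_V [simp]: "rep b \<in> V" by (simp add: rep_def)

lemma blk_rep: "v \<in> V \<Longrightarrow> blk (rep (blk v)) = blk v"
  by (elim ptE) (simp add: rep_def blk_pt)

lemma blk_range: "v \<in> V \<Longrightarrow> blk v \<in> UNIV \<times> {0..<3}"
  by (elim ptE) (simp add: blk_pt)

lemma fst_blk: "fst (blk v) = sgn v" by (simp add: blk_def sgn_def)

text \<open>The orbit of a block has a power of 3 as length. It contains the three blocks of one
  half, thanks to \<open>U 1\<close>, and there are only six blocks; so it is exactly that
  half.\<close>

lemma three_group_sgn:
  assumes P: "perm_group V P" "card P = 3 ^ k" "U 1 \<in> P" "\<And>g. g \<in> P \<Longrightarrow> bpres g"
    and g: "g \<in> P" "v \<in> V"
  shows "sgn (g v) = sgn v"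
proof -
  note Pd = perm_groupD[OF P(1)]
  define act where "act = (\<lambda>g b. blk (g (rep b)))"
  define Ob where "Ob = (\<lambda>g. act g (blk v)) ` P"
  have actb: "act h (blk w) = blk (h w)" if "h \<in> P" "w \<in> V" for h w
    unfolding act_def by (rule bpresD[OF P(4)[OF that(1)]]) (use that blk_rep in auto)
  have "card P = card Ob * card {g\<in>P. act g (blk v) = act id (blk v)}"
    unfolding Ob_def
  proof (rule card_orbit_stabilizer[OF P(1)])
    fix a b assume ab: "a \<in> P" "b \<in> P"
    have "act (a \<circ> b) (blk v) = blk (a (b v))" using actb[OF Pd(4)[OF ab] g(2)] by simp
    also have "\<dots> = act a (blk (b v))" by (rule actb[symmetric]) (use ab Pd(2) g(2) in auto)
    also have "blk (b v) = act b (blk v)" by (rule actb[symmetric]) (use ab g(2) in auto)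
    finally show "act (a \<circ> b) (blk v) = act a (act b (blk v))" .
  qed
  then have "card Ob dvd 3 ^ k" using P(2) by simp
  then obtain j where j: "card Ob = 3 ^ j" using divides_primepow_nat[of 3 "card Ob" k] by auto
  have sub: "Ob \<subseteq> UNIV \<times> {0..<3}"
  proof
    fix b assume "b \<in> Ob"
    then obtain h where "h \<in> P" "b = act h (blk v)" by (auto simp: Ob_def)
    then show "b \<in> UNIV \<times> {0..<3}" using actb[OF _ g(2)] blk_range[of "h v"] Pd(2)[of h] g(2) by auto
  qed
  have "card (UNIV \<times> {0..<3} :: (bool \<times> int) set) = 6" by (simp add: card_cartesian_product)
  moreover have "finite (UNIV \<times> {0..<3} :: (bool \<times> int) set)" by simp
  ultimately have c6: "card Ob \<le> 6" "finite Ob" using card_mono[OF _ sub] finite_subset[OF sub] by auto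
  define T where "T = {sgn v} \<times> {0..<3::int}"
  have TO: "T \<subseteq> Ob"
  proof
    fix b assume "b \<in> T"
    then obtain i where i: "b = (sgn v, i)" "0 \<le> i" "i < 3" by (auto simp: T_def)
    obtain e j a where v: "v = pt e j a" using g(2) ptE by blast
    have "blk (U (i - j) v) = b" using v i by (simp add: blk_pt)
    then have "act (U (i - j)) (blk v) = b" using actb[OF U_in_group[OF P(1,3)] g(2)] by simp
    then show "b \<in> Ob" unfolding Ob_def using U_in_group[OF P(1,3), of "i - j"] by blast
  qed
  have cT: "card T = 3" by (simp add: T_def card_cartesian_product)
  have "3 \<le> card Ob" using card_mono[OF c6(2) TO] cT by simp
  then have "j = 1"
  proof -
    have "j \<noteq> 0" using \<open>3 \<le> card Ob\<close> j by (cases j) auto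
    moreover have "j < 2"
    proof (rule ccontr)
      assume "\<not> j < 2"
      then have "(3::nat) ^ 2 \<le> 3 ^ j" by (intro power_increasing) auto
      then show False using j c6(1) by simp
    qed
    ultimately show ?thesis by simp
  qed
  then have "T = Ob" using card_subset_eq[OF c6(2) TO] cT j by simp
  moreover have "blk (g v) \<in> Ob" unfolding Ob_def using actb[OF g] g(1) by (metis image_eqI)
  ultimately have "fst (blk (g v)) = sgn v" by (auto simp: T_def)
  then show ?thesis by (simp add: fst_blk)
qed

lemma derangement3:
  fixes a b c :: int
  assumes "a \<in> {0..<3}" "b \<in> {0..<3}" "c \<in> {0..<3}" "a \<noteq> 0" "b \<noteq> 1" "c \<noteq> 2" "a \<noteq> b" "b \<noteq> c" "a \<noteq> c"
  shows "(a = 1 \<and> b = 2 \<and> c = 0) \<or> (a = 2 \<and> b = 0 \<and> c = 1)"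
  using assms by (simp only: atLeastLessThan_iff) presburger

text \<open>On the three blocks of a half, \<open>y\<close> is a permutation without fixed points,
  hence one of the two 3-cycles.\<close>

lemma three_group_blocks:
  assumes P: "perm_group V P" "card P = 3 ^ k" "U 1 \<in> P" "\<And>g. g \<in> P \<Longrightarrow> bpres g"
    and y: "y \<in> P" "\<And>v. v \<in> V \<Longrightarrow> blk (y v) \<noteq> blk v"
  shows "\<exists>\<epsilon>\<in>{1, -1}. \<forall>v\<in>V. sgn v = e \<longrightarrow> blk (y v) = blk (U \<epsilon> v)"
proof -
  note Pd = perm_groupD[OF P(1)]
  define f where "f = (\<lambda>i. snd (blk (y (pt e i 0))))"
  have sg: "blk (y (pt e i 0)) = (e, f i)" for i
    using three_group_sgn[OF P y(1), of "pt e i 0"] fst_blk[of "y (pt e i 0)"]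
    by (simp add: f_def prod_eq_iff)
  have r: "f i \<in> {0..<3}" for i
    using blk_range[of "y (pt e i 0)"] Pd(2)[OF y(1)] by (simp add: f_def mem_Times_iff)
  have nf: "f i \<noteq> i mod 3" for i using y(2)[of "pt e i 0"] sg[of i] by (simp add: blk_pt)
  have inj: "i mod 3 = j mod 3" if "f i = f j" for i j
    using bpres_inj[OF Pd(2)[OF y(1)] P(4)[OF y(1)], of "pt e i 0" "pt e j 0"] sg that by (simp add: blk_pt)
  have fm: "blk (y v) = (e, f (snd (blk v)))" if "v \<in> V" "sgn v = e" for v
  proof -
    have "blk (y v) = blk (y (rep (blk v)))"
      by (rule bpresD[OF P(4)[OF y(1)]]) (use that blk_rep in auto)
    then show ?thesis using sg that by (simp add: rep_def fst_blk)
  qed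
  have "(f 0 = 1 \<and> f 1 = 2 \<and> f 2 = 0) \<or> (f 0 = 2 \<and> f 1 = 0 \<and> f 2 = 1)"
    by (rule derangement3) (use r nf[of 0] nf[of 1] nf[of 2] inj[of 0 1] inj[of 1 2] inj[of 0 2] in auto)
  then have "\<exists>\<epsilon>\<in>{1, -1}. \<forall>i\<in>{0,1,2}. f i = (i + \<epsilon>) mod 3" by auto
  then obtain \<epsilon> where \<epsilon>: "\<epsilon> \<in> {1, -1}" "\<And>i. i \<in> {0,1,2} \<Longrightarrow> f i = (i + \<epsilon>) mod 3" by blast
  have "blk (y v) = blk (U \<epsilon> v)" if v: "v \<in> V" "sgn v = e" for v
  proof -
    obtain e' i a where va: "v = pt e' i a" using v ptE by blast
    then have "e' = e" using v by simp
    moreover have "i mod 3 \<in> {0,1,2}" using int_ge_cases3[of i] by auto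
    ultimately show ?thesis using fm[OF v] \<epsilon>(2)[of "i mod 3"] va by (simp add: blk_pt mod_simps)
  qed
  then show ?thesis using \<epsilon>(1) by blast
qed

text \<open>\<open>\<epsilon>\<close> is indexed by the half because Sylow's theorem controls the
  sign on rotations and on reflections separately. The sign condition concerns blocks only;
  \<open>three_group_exact\<close> makes it exact.\<close>

definition halves :: "(bool \<Rightarrow> int) \<Rightarrow> (vtx \<Rightarrow> vtx) \<Rightarrow> bool" where
  "halves \<epsilon> f \<longleftrightarrow> (\<forall>e. \<epsilon> e \<in> {1, -1}) \<and> (\<forall>v\<in>V. sgn (f v) = sgn v) \<and>
    (\<forall>v\<in>V. blk (f (U 1 v)) = blk (U (\<epsilon> (sgn v)) (f v)))"

lemma halves_of_three_group:
  assumes P: "perm_group V P" "card P = 3 ^ k" "U 1 \<in> P" "\<And>g. g \<in> P \<Longrightarrow> bpres g"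
    and f: "f permutes V" "bpres f" "pinv f \<circ> U 1 \<circ> f \<in> P"
  shows "\<exists>\<epsilon>. halves \<epsilon> f \<or> halves \<epsilon> (S \<circ> f)"
proof -
  define y where "y = pinv f \<circ> U 1 \<circ> f"
  have yP: "y \<in> P" using f by (simp add: y_def)
  have yV: "y v \<in> V" if "v \<in> V" for v using perm_groupD(2)[OF P(1) yP] that by simp
  have fy: "f (y v) = U 1 (f v)" for v by (simp add: y_def permutes_inverses[OF f(1)])
  have mv: "blk (y v) \<noteq> blk v" if v: "v \<in> V" for v
  proof
    assume "blk (y v) = blk v"
    then have "blk (f (y v)) = blk (f v)" by (rule bpresD[OF f(2) yV[OF v] v])
    then show False using blk_U_iff[of "f v" 1 0] v f(1) by (simp add: fy)
  qed
  have "\<forall>e. \<exists>\<epsilon>\<in>{1, -1}. \<forall>v\<in>V. sgn v = e \<longrightarrow> blk (y v) = blk (U \<epsilon> v)"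
    using three_group_blocks[OF P yP mv] by blast
  then obtain \<epsilon> where "\<forall>e. \<epsilon> e \<in> {1, -1} \<and> (\<forall>v\<in>V. sgn v = e \<longrightarrow> blk (y v) = blk (U (\<epsilon> e) v))"
    unfolding Bex_def choice_iff by blast
  then have \<epsilon>: "\<And>e. \<epsilon> e \<in> {1, -1}" "\<And>v. v \<in> V \<Longrightarrow> blk (y v) = blk (U (\<epsilon> (sgn v)) v)" by blast+
  have fU: "blk (f (U 1 v)) = blk (U (\<epsilon> (sgn v)) (f v))" if v: "v \<in> V" for v
  proof -
    have fV: "f v \<in> V" "f (U 1 v) \<in> V" using v f(1) by auto
    have a: "blk (f (U (\<epsilon> (sgn w)) w)) = blk (U 1 (f w))" if w: "w \<in> V" for w
      using bpresD[OF f(2) yV[OF w] _ \<epsilon>(2)[OF w]] w fy by simp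
    consider "\<epsilon> (sgn v) = 1" | "\<epsilon> (sgn v) = -1" using \<epsilon>(1)[of "sgn v"] by auto
    then show ?thesis
    proof cases
      case 1 then show ?thesis using a[OF v] by simp
    next
      case 2
      have "blk (f v) = blk (U 1 (f (U 1 v)))" using a[of "U 1 v"] v 2 by simp
      then have "blk (U (-1) (f v)) = blk (U (-1) (U 1 (f (U 1 v))))"
        by (rule blk_U_cong) (use fV in auto)
      then show ?thesis using 2 by simp
    qed
  qed
  have sU: "sgn (f (U (int n) v)) = sgn (f v)" if "v \<in> V" for v n
  proof (induction n)
    case (Suc n)
    have "blk (f (U 1 (U (int n) v))) = blk (U (\<epsilon> (sgn v)) (f (U (int n) v)))" using fU[of "U (int n) v"] that by simp
    then have "sgn (f (U 1 (U (int n) v))) = sgn (U (\<epsilon> (sgn v)) (f (U (int n) v)))" by (rule blk_sgn)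
    then have "sgn (f (U 1 (U (int n) v))) = sgn (f (U (int n) v))" by simp
    then show ?case using Suc by (simp add: add.commute)
  qed simp
  have ss: "sgn (f v) = sgn (f w)" if vw: "v \<in> V" "w \<in> V" "sgn v = sgn w" for v w
  proof -
    obtain c k where w: "w = U k (X c v)" using sgn_eqE[OF vw(3,1,2)] by blast
    have "U k = U (int (nat (k mod 3)))" by (rule U_cong) simp
    then have "sgn (f w) = sgn (f (X c v))" using sU[of "X c v" "nat (k mod 3)"] vw w by simp
    also have "\<dots> = sgn (f v)" by (rule blk_sgn, rule bpresD[OF f(2)]) (use vw in auto)
    finally show ?thesis by simp
  qed
  define F where "F e = sgn (f (pt e 0 0))" for e
  have F: "sgn (f v) = F (sgn v)" if "v \<in> V" for v using ss[of v "pt (sgn v) 0 0"] that by (simp add: F_def)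
  have "\<exists>v\<in>V. sgn (f v) = e" for e
  proof (rule bexI[of _ "pinv f (pt e 0 0)"])
    show "sgn (f (pinv f (pt e 0 0))) = e" by (simp add: permutes_inverses[OF f(1)])
    show "pinv f (pt e 0 0) \<in> V" using permutes_inv[OF f(1)] by simp
  qed
  then have surj: "\<exists>d. F d = e" for e using F by metis
  show ?thesis
  proof (cases "F False")
    case False
    then have "F True" using surj[of True] by (metis (full_types))
    then have "sgn (f v) = sgn v" if "v \<in> V" for v using F[OF that] False by (cases "sgn v") auto
    then have "halves \<epsilon> f" using \<epsilon>(1) fU unfolding halves_def by blast
    then show ?thesis by blast
  next
    case True
    then have "\<not> F True" using surj[of False] by (metis (full_types))
    then have sg: "sgn (f v) = (\<not> sgn v)" if "v \<in> V" for v using F[OF that] True by (cases "sgn v") auto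
    \<comment> \<open>\<open>S\<close> inverts \<open>U\<close>, so restoring the halves by
      \<open>S\<close> flips both signs.\<close>
    have "halves (\<lambda>e. - \<epsilon> e) (S \<circ> f)" unfolding halves_def
    proof (intro conjI allI ballI)
      show "- \<epsilon> e \<in> {1, -1}" for e using \<epsilon>(1)[of e] by auto
      fix v assume v: "v \<in> V"
      have fV: "f v \<in> V" "f (U 1 v) \<in> V" using v f(1) by auto
      show "sgn ((S \<circ> f) v) = sgn v" using sg[OF v] fV by simp
      have "blk (S (f (U 1 v))) = blk (S (U (\<epsilon> (sgn v)) (f v)))"
        by (rule blk_S_cong[OF fU[OF v]]) (use fV in auto)
      then show "blk ((S \<circ> f) (U 1 v)) = blk (U (- \<epsilon> (sgn v)) ((S \<circ> f) v))" by (simp add: tr_commute)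
    qed
    then show ?thesis by blast
  qed
qed

text \<open>Carried out in the group of affine automorphisms: composing with them keeps
  \<open>f\<close> affine, and the conjugate of \<open>U 1\<close> belongs to it.\<close>

lemma ex_halves:
  assumes E: "Rinv E" "Rinv E'" and f: "iso E E' f" "aff f"
  obtains f' \<epsilon> where "iso E E' f'" "aff f'" "halves \<epsilon> f'"
proof -
  note fp = isoD(1)[OF f(1)]
  define G where "G = {g \<in> Aut E. aff g}"
  have Gp: "g permutes V" if "g \<in> G" for g using that by (simp add: G_def Aut_def iso_def)
  have G: "perm_group V G"
    by (rule perm_group_sub[of G E]) (use Gp in \<open>auto simp: G_def id_Aut comp_Aut aff_tr intro!: aff_comp\<close>)
  have U1: "U 1 \<in> G" using tr_Aut[OF E(1)] aff_tr by (simp add: G_def)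
  define y where "y = pinv f \<circ> U 1 \<circ> f"
  have yG: "y \<in> G"
  proof -
    have "aff (pinv f \<circ> (U 1 \<circ> f))"
      by (rule aff_comp[OF permutes_compose[OF fp U_permutes] aff_pinv[OF fp f(2)] aff_comp[OF fp aff_tr(2) f(2)]])
    then show ?thesis using conj_Aut[OF f(1)] tr_Aut[OF E(2)] by (simp add: y_def G_def comp_assoc)
  qed
  have y3: "y ^^ 3 = id" unfolding y_def by (rule conj_pow[OF fp U1_pow_3])
  have p3: "prime (3::nat)" by simp
  obtain P g k where P: "perm_group V P" "P \<subseteq> G" "card P = 3 ^ k" "g \<in> G" "U 1 \<in> P" "pinv g \<circ> y \<circ> g \<in> P"
    using sylow_conj[OF G p3 U1 U1_pow_3 yG y3] by metis
  have fg: "f \<circ> g permutes V" using fp Gp[OF P(4)] permutes_compose by blast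
  have afg: "aff (f \<circ> g)" using aff_comp[OF Gp[OF P(4)] f(2)] P(4) by (simp add: G_def)
  have ifg: "iso E E' (f \<circ> g)" using iso_comp f(1) P(4) by (auto simp: Aut_def G_def)
  have bP: "bpres h" if "h \<in> P" for h using that P(2) aff_bpres by (auto simp: G_def)
  have yfg: "pinv (f \<circ> g) \<circ> U 1 \<circ> (f \<circ> g) \<in> P" using P(6) conj_conj[OF fp Gp[OF P(4)]] by (simp add: y_def)
  obtain \<epsilon> where "halves \<epsilon> (f \<circ> g) \<or> halves \<epsilon> (S \<circ> (f \<circ> g))"
    using halves_of_three_group[OF P(1,3,5) bP fg aff_bpres[OF afg] yfg] by blast
  then show ?thesis
  proof
    assume "halves \<epsilon> (f \<circ> g)" then show ?thesis using that ifg afg by blast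
  next
    assume "halves \<epsilon> (S \<circ> (f \<circ> g))"
    moreover have "aff (S \<circ> (f \<circ> g))" by (rule aff_comp[OF fg aff_tr(3) afg])
    moreover have "iso E E' (S \<circ> (f \<circ> g))" by (rule iso_comp[OF ifg iso_tr(3)[OF E(2)]])
    ultimately show ?thesis using that by blast
  qed
qed

section \<open>Non-uniformly joined blocks and the multiplier\<close>

text \<open>The join from one block to the other is all or nothing, so it survives any rearrangement
  inside the two blocks.\<close>

definition unif :: "(vtx \<Rightarrow> vtx \<Rightarrow> bool) \<Rightarrow> vtx \<Rightarrow> vtx \<Rightarrow> bool" where
  "unif E v w \<longleftrightarrow> (\<forall>a b. E (X a v) (X b w) = E v w)"

lemma unifD: "unif E v w \<Longrightarrow> E (X a v) (X b w) = E v w"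
  unfolding unif_def by blast

text \<open>Across non-uniformly joined blocks the multiplier of an affine isomorphism must agree
  (\<open>nonunif_mult\<close>), so it is constant on the classes of the transitive closure of this relation.\<close>

definition K :: "(vtx \<Rightarrow> vtx \<Rightarrow> bool) \<Rightarrow> (vtx \<times> vtx) set" where
  "K E = {(v, w). v \<in> V \<and> w \<in> V \<and> (blk v = blk w \<or> \<not> unif E v w \<or> \<not> unif E w v)}"

lemma X_solve:
  assumes "\<not> int p dvd c"
  obtains r where "(c * r) mod int p = d mod int p"
proof -
  obtain e where "(c * e) mod int p = 1" using unit_inverse[OF assms] by blast
  then have "(c * (e * d)) mod int p = d mod int p" by (rule mod_mult_one(1))
  then show ?thesis using that by blast
qed

text \<open>If the multipliers differ, pulling the common shift by \<open>r\<close> back through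
  \<open>f\<close> shifts the two blocks by \<open>i * r\<close> and \<open>j * r\<close>, with
  \<open>i - j\<close> a unit. Together with the common shifts this reaches every pair of shifts, so
  the join would be uniform.\<close>

lemma nonunif_mult:
  assumes E: "Rinv E" "Rinv E'" and f: "iso E E' f" and vw: "v \<in> V" "w \<in> V"
    and m: "\<And>a. f (X a v) = X (m * a) (f v)" and n: "\<And>a. f (X a w) = X (n * a) (f w)"
    and nu: "\<not> unif E v w"
  shows "m mod int p = n mod int p"
proof (rule ccontr)
  assume ne: "m mod int p \<noteq> n mod int p"
  note fp = isoD(1)[OF f]
  obtain i where i: "(m * i) mod int p = 1" using unit_inverse aff_mult_unit[OF fp vw(1) m] by blast
  obtain j where j: "(n * j) mod int p = 1" using unit_inverse aff_mult_unit[OF fp vw(2) n] by blast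
  have ij: "\<not> int p dvd (i - j)"
  proof
    assume "int p dvd (i - j)"
    then have h: "i mod int p = j mod int p" by (simp add: mod_eq_dvd_iff)
    have "m mod int p = (m * (n * j)) mod int p"
      using j by (metis mod_mult_right_eq mult.right_neutral)
    also have "\<dots> = (n * (m * j)) mod int p" by (simp add: algebra_simps)
    also have "\<dots> = (n * (m * i)) mod int p" using h by (metis mod_mult_right_eq)
    also have "\<dots> = n mod int p" using i by (metis mod_mult_right_eq mult.right_neutral)
    finally show False using ne by simp
  qed
  have fV: "f v \<in> V" "f w \<in> V" using fp vw by auto
  have "E (X a v) (X b w) = E v w" for a b
  proof -
    obtain r where r: "((i - j) * r) mod int p = (a - b) mod int p" using X_solve[OF ij] by blast
    define t where "t = a - i * r"
    have tb: "b mod int p = (t + j * r) mod int p"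
    proof -
      have "int p dvd ((i - j) * r - (a - b))" using r by (simp add: mod_eq_dvd_iff)
      then have "int p dvd (b - (t + j * r))" by (simp add: t_def algebra_simps)
      then show ?thesis by (simp add: mod_eq_dvd_iff)
    qed
    have "E (X a v) (X b w) = E (X t (X (i * r) v)) (X t (X (j * r) w))"
      using X_cong[OF tb] by (simp add: t_def)
    also have "\<dots> = E (X (i * r) v) (X (j * r) w)" by (rule RinvD(1)[OF E(1)]) (use vw in auto)
    also have "\<dots> = E' (f (X (i * r) v)) (f (X (j * r) w))" by (rule isoD(2)[OF f]) (use vw in auto)
    also have "\<dots> = E' (X r (f v)) (X r (f w))"
      using X_cong[OF mod_mult_one(1)[OF i, of r]] X_cong[OF mod_mult_one(1)[OF j, of r]]
      by (simp add: m n)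
    also have "\<dots> = E' (f v) (f w)" by (rule RinvD(1)[OF E(2) fV])
    also have "\<dots> = E v w" by (rule isoD(2)[OF f vw, symmetric])
    finally show ?thesis .
  qed
  then show False using nu unfolding unif_def by blast
qed

lemma K_sym: "(v, w) \<in> K E \<Longrightarrow> (w, v) \<in> K E" by (auto simp: K_def)

lemma KV: "(v, w) \<in> K E \<Longrightarrow> v \<in> V \<and> w \<in> V" by (auto simp: K_def)

lemma Ks_sym: "(v, w) \<in> (K E)\<^sup>* \<Longrightarrow> (w, v) \<in> (K E)\<^sup>*"
  using sym_rtrancl[of "K E"] K_sym by (metis symD symI)

lemma unif_X:
  assumes u: "unif E v w" shows "unif E (X c v) (X d w)"
proof -
  have "E (X a (X c v)) (X b (X d w)) = E (X c v) (X d w)" for a b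
    using unifD[where E = E, OF u, of "a + c" "b + d"] unifD[where E = E, OF u, of c d] by simp
  then show ?thesis unfolding unif_def by blast
qed

lemma unif_X_iff: "unif E (X c v) (X d w) \<longleftrightarrow> unif E v w"
proof
  assume "unif E (X c v) (X d w)"
  from unif_X[OF this, of "- c" "- d"] show "unif E v w" by simp
qed (rule unif_X)

lemma unif_blk:
  assumes "blk v = blk v'" "blk w = blk w'" "v \<in> V" "w \<in> V" "v' \<in> V" "w' \<in> V"
  shows "unif E v w \<longleftrightarrow> unif E v' w'"
proof -
  obtain c where c: "v' = X c v" using blk_eqE[OF assms(1,3,5)] .
  obtain d where d: "w' = X d w" using blk_eqE[OF assms(2,4,6)] .
  show ?thesis by (simp add: c d unif_X_iff)
qed

lemma K_blk:
  assumes "blk v = blk v'" "blk w = blk w'" "v \<in> V" "w \<in> V" "v' \<in> V" "w' \<in> V" "(v, w) \<in> K E"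
  shows "(v', w') \<in> K E"
  using unif_blk[OF assms(1-6)] unif_blk[OF assms(2,1,4,3,6,5)] assms unfolding K_def by simp

lemma unif_aff_iso:
  assumes f: "iso E E' f" "aff f" and vw: "v \<in> V" "w \<in> V"
  shows "unif E v w \<longleftrightarrow> unif E' (f v) (f w)"
proof -
  note fp = isoD(1)[OF f(1)]
  have 1: "unif E' (f v) (f w)" if u: "unif E v w" and f: "iso E E' f" "aff f" and vw: "v \<in> V" "w \<in> V" for E E' f v w
    unfolding unif_def
  proof (intro allI)
    fix a b
    note fp = isoD(1)[OF f(1)]
    have ex: "\<exists>a'. X a (f v) = f (X a' v)" if v: "v \<in> V" for a v
    proof -
      have "blk (pinv f (X a (f v))) = blk v"
        by (rule bpres_inj[OF fp aff_bpres[OF f(2)]])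
          (use v fp permutes_inv[OF fp] permutes_inverses[OF fp] in auto)
      moreover have "pinv f (X a (f v)) \<in> V" using v fp permutes_inv[OF fp] by simp
      ultimately obtain c where "pinv f (X a (f v)) = X c v" using blk_eqE[of v] v by metis
      then have "X a (f v) = f (X c v)" using permutes_inverses(1)[OF fp] by metis
      then show ?thesis by blast
    qed
    obtain a' b' where ab: "X a (f v) = f (X a' v)" "X b (f w) = f (X b' w)" using ex vw by blast
    have "E' (X a (f v)) (X b (f w)) = E (X a' v) (X b' w)"
      unfolding ab by (rule isoD(2)[OF f(1), symmetric]) (use vw in auto)
    also have "\<dots> = E v w" by (rule unifD[OF u])
    also have "\<dots> = E' (f v) (f w)" by (rule isoD(2)[OF f(1) vw])
    finally show "E' (X a (f v)) (X b (f w)) = E' (f v) (f w)" .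
  qed
  have 2: "unif E v w" if "unif E' (f v) (f w)"
  proof -
    have "unif E (pinv f (f v)) (pinv f (f w))"
      by (rule 1[OF that iso_pinv[OF f(1)] aff_pinv[OF fp f(2)]]) (use vw fp in auto)
    then show ?thesis by (simp add: permutes_inverses[OF fp])
  qed
  show ?thesis using 1[OF _ f vw] 2 by blast
qed

lemma K_iso:
  assumes f: "iso E E' f" "aff f" and vw: "v \<in> V" "w \<in> V"
  shows "(v, w) \<in> K E \<longleftrightarrow> (f v, f w) \<in> K E'"
proof -
  note fp = isoD(1)[OF f(1)]
  have "blk v = blk w \<longleftrightarrow> blk (f v) = blk (f w)"
    using bpresD[OF aff_bpres[OF f(2)] vw] bpres_inj[OF fp aff_bpres[OF f(2)] vw] by blast
  then show ?thesis using unif_aff_iso[OF f vw] unif_aff_iso[OF f vw(2,1)] vw fp unfolding K_def by simp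
qed

lemma Ks_map:
  assumes "\<And>v w. (v, w) \<in> K E \<Longrightarrow> (g v, g w) \<in> K E'" "(v, w) \<in> (K E)\<^sup>*"
  shows "(g v, g w) \<in> (K E')\<^sup>*"
  using assms(2) by (induction rule: rtrancl_induct) (use assms(1) in \<open>auto intro: rtrancl_into_rtrancl\<close>)

lemma K_tr:
  assumes "Rinv E" "(v, w) \<in> K E"
  shows "(X c v, X c w) \<in> K E" "(U c v, U c w) \<in> K E" "(S v, S w) \<in> K E"
  using KV[OF assms(2)] assms(2) K_iso[OF iso_tr(1)[OF assms(1)] aff_tr(1), of v w c]
    K_iso[OF iso_tr(2)[OF assms(1)] aff_tr(2), of v w c] K_iso[OF iso_tr(3)[OF assms(1)] aff_tr(3), of v w]
  by auto

lemma blk_f_U: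
  assumes f: "f permutes V" and h: "halves \<epsilon> f" "\<epsilon> True = \<epsilon> False" and v: "v \<in> V"
  shows "blk (f (U i v)) = blk (U (\<epsilon> False * i) (f v))"
proof -
  have hU: "blk (f (U 1 w)) = blk (U (\<epsilon> False) (f w))" if "w \<in> V" for w
    using h that unfolding halves_def by (cases "sgn w") auto
  have n: "blk (f (U (int n) v)) = blk (U (\<epsilon> False * int n) (f v))" for n
  proof (induction n)
    case (Suc n)
    have fV: "f v \<in> V" "f (U (int n) v) \<in> V" using v f by auto
    have "blk (f (U 1 (U (int n) v))) = blk (U (\<epsilon> False) (f (U (int n) v)))" by (rule hU) (use v in simp)
    also have "\<dots> = blk (U (\<epsilon> False) (U (\<epsilon> False * int n) (f v)))"
      by (rule blk_U_cong[OF Suc]) (use fV in auto)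
    finally show ?case by (simp add: algebra_simps)
  qed simp
  have "U i = U (int (nat (i mod 3)))" by (rule U_cong) simp
  moreover have "U (\<epsilon> False * int (nat (i mod 3))) = U (\<epsilon> False * i)" by (rule U_cong) (simp add: mod_simps)
  ultimately show ?thesis using n[of "nat (i mod 3)"] by simp
qed

section \<open>Translations between blocks\<close>

definition tr :: "bool \<Rightarrow> int \<Rightarrow> vtx \<Rightarrow> vtx" where
  "tr e i v = (if e then S (U i v) else U i v)"

definition tri :: "bool \<Rightarrow> int \<Rightarrow> vtx \<Rightarrow> vtx" where
  "tri e i v = (if e then U (- i) (S v) else U (- i) v)"

definition sg :: "bool \<Rightarrow> int" where "sg e = (if e then -1 else 1)"

lemma sg_sg [simp]: "sg e * sg e = 1" by (simp add: sg_def)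

lemma tr_X: "tr e i (X a v) = X (sg e * a) (tr e i v)" "tri e i (X a v) = X (sg e * a) (tri e i v)"
  by (auto simp: tr_def tri_def sg_def tr_commute)

lemma tr_V [simp]: "v \<in> V \<Longrightarrow> tr e i v \<in> V" "v \<in> V \<Longrightarrow> tri e i v \<in> V"
  by (auto simp: tr_def tri_def)

lemma tri_tr [simp]: "tri e i (tr e i v) = v"
  by (auto simp: tr_def tri_def)

lemma tri_blk_cong: "blk v = blk w \<Longrightarrow> v \<in> V \<Longrightarrow> w \<in> V \<Longrightarrow> blk (tri e i v) = blk (tri e i w)"
  unfolding tri_def using blk_U_cong[of "S v" "S w"] blk_S_cong[of v w] blk_U_cong[of v w] by simp

lemma tr_E: "Rinv E \<Longrightarrow> v \<in> V \<Longrightarrow> w \<in> V \<Longrightarrow> E (tr e i v) (tr e i w) = E v w"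
  "Rinv E \<Longrightarrow> v \<in> V \<Longrightarrow> w \<in> V \<Longrightarrow> E (tri e i v) (tri e i w) = E v w"
  by (auto simp: tr_def tri_def RinvD)

lemma tr_K: "Rinv E \<Longrightarrow> (v, w) \<in> K E \<Longrightarrow> (tr e i v, tr e i w) \<in> K E"
  using K_tr by (auto simp: tr_def)

lemma tr_to_block: assumes "v \<in> V" "w \<in> V" obtains e i where "blk (tr e i v) = blk w"
proof -
  obtain e i a e' i' a' where vw: "v = pt e i a" "w = pt e' i' a'" using assms ptE by metis
  show ?thesis
  proof (cases "e = e'")
    case True
    then have "blk (tr False (i' - i) v) = blk w" using vw by (simp add: tr_def blk_pt)
    then show ?thesis using that by blast
  next
    case False
    then have "blk (tr True (- i' - i) v) = blk w" using vw by (auto simp: tr_def blk_pt)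
    then show ?thesis using that by blast
  qed
qed

text \<open>On either half \<open>f\<close> sends the block index \<open>i\<close> to a constant
  plus \<open>\<epsilon> * i\<close>, with the same sign; so it normalizes the action of the
  translations on the six blocks. What matters in \<open>ex_const_straight\<close> is that
  \<open>j\<close> works for all \<open>w\<close> at once.\<close>

lemma tr_match:
  assumes f: "f permutes V" "bpres f" and h: "halves \<epsilon> f" "\<epsilon> True = \<epsilon> False"
  shows "\<exists>j. \<forall>w\<in>V. blk (f (tr e i w)) = blk (tr e j (f w))"
proof (cases e)
  case False
  then show ?thesis using blk_f_U[OF f(1) h] by (auto simp: tr_def)
next
  case True
  let ?\<eta> = "\<epsilon> False"
  define w0 where "w0 = pt False 0 0"
  have w0: "w0 \<in> V" by (simp add: w0_def)
  have fS: "sgn (f (S w0)) = sgn (S (f w0))"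
    using h(1) f(1) w0 unfolding halves_def by simp
  have SV: "S (f w0) \<in> V" "f (S w0) \<in> V" using w0 f(1) by auto
  \<comment> \<open>\<open>k\<close> measures on blocks how far \<open>f\<close> is from commuting
    with \<open>S\<close> at one vertex; \<open>step\<close>, \<open>stepX\<close> and
    \<open>k1\<close> spread the same \<open>k\<close> over \<open>V\<close>.\<close>
  obtain c k where ck: "f (S w0) = U k (X c (S (f w0)))"
    using sgn_eqE[OF fS[symmetric] SV] .
  have k0: "blk (f (S w0)) = blk (U k (S (f w0)))" using ck
    by (simp add: tr_commute(1)[symmetric])
  have step: "blk (f (S (U i w))) = blk (U k (S (f (U i w))))"
    if w: "w \<in> V" "blk (f (S w)) = blk (U k (S (f w)))" for i w
  proof -
    have fV: "f w \<in> V" "f (S w) \<in> V" "f (U i w) \<in> V" using w f(1) by auto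
    have "blk (f (S (U i w))) = blk (f (U (- i) (S w)))" by (simp add: tr_commute)
    also have "\<dots> = blk (U (?\<eta> * (- i)) (f (S w)))" by (rule blk_f_U[OF f(1) h]) (use w in simp)
    also have "\<dots> = blk (U (?\<eta> * (- i)) (U k (S (f w))))" by (rule blk_U_cong[OF w(2)]) (use fV in auto)
    also have "\<dots> = blk (U k (S (U (?\<eta> * i) (f w))))" by (simp add: tr_commute algebra_simps)
    also have "\<dots> = blk (U k (S (f (U i w))))"
      by (rule blk_U_cong[OF blk_S_cong[OF blk_f_U[OF f(1) h w(1), symmetric]]]) (use fV in auto)
    finally show ?thesis .
  qed
  have stepX: "blk (f (S (X a w))) = blk (U k (S (f (X a w))))"
    if w: "w \<in> V" "blk (f (S w)) = blk (U k (S (f w)))" for a w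
  proof -
    have "blk (f (S (X a w))) = blk (f (S w))" by (rule bpresD[OF f(2)]) (use w in \<open>auto simp: tr_commute\<close>)
    also have "\<dots> = blk (U k (S (f w)))" by (rule w(2))
    also have "\<dots> = blk (U k (S (f (X a w))))"
      by (rule blk_U_cong[OF blk_S_cong[OF bpresD[OF f(2)]]]) (use w f(1) in auto)
    finally show ?thesis .
  qed
  have k1: "blk (f (S (S w0))) = blk (U k (S (f (S w0))))"
  proof -
    have "blk (U k (S (f (S w0)))) = blk (U k (S (U k (S (f w0)))))"
      by (rule blk_U_cong[OF blk_S_cong[OF k0]]) (use w0 f(1) in auto)
    then show ?thesis by (simp add: tr_commute)
  qed
  have all: "blk (f (S w)) = blk (U k (S (f w)))" if w: "w \<in> V" for w
  proof (cases "sgn w")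
    case True
    then have "sgn (S w0) = sgn w" by (simp add: w0_def)
    then obtain c i where "w = U i (X c (S w0))" using sgn_eqE[OF _ in_V(3)[OF w0] w] by blast
    then show ?thesis using step[OF _ stepX[OF _ k1]] w0 by simp
  next
    case False
    then have "sgn w0 = sgn w" by (simp add: w0_def)
    then obtain c i where "w = U i (X c w0)" using sgn_eqE[OF _ w0 w] by blast
    then show ?thesis using step[OF _ stepX[OF _ k0]] w0 by simp
  qed
  have "blk (f (tr e i w)) = blk (tr e (?\<eta> * i - k) (f w))" if w: "w \<in> V" for w
  proof -
    have "blk (f (S (U i w))) = blk (U k (S (f (U i w))))" by (rule all) (use w in simp)
    also have "\<dots> = blk (U k (S (U (?\<eta> * i) (f w))))"
      by (rule blk_U_cong[OF blk_S_cong[OF blk_f_U[OF f(1) h w]]]) (use w f(1) in auto)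
    also have "\<dots> = blk (S (U (?\<eta> * i - k) (f w)))" by (simp add: tr_commute)
    finally show ?thesis using True by (simp add: tr_def)
  qed
  then show ?thesis by blast
qed

text \<open>Replacing \<open>f\<close> on the reflections by its conjugate under \<open>S\<close> (followed by a shift) repairs an isomorphism
  that acts differently on the two halves; it costs nothing on arcs inside the halves.\<close>

definition fold :: "int \<Rightarrow> (vtx \<Rightarrow> vtx) \<Rightarrow> vtx \<Rightarrow> vtx" where
  "fold t f v = (if v \<in> V \<and> sgn v then X t (S (f (S v))) else f v)"

lemma fold_False: "\<not> sgn v \<Longrightarrow> fold t f v = f v"
  and fold_True: "v \<in> V \<Longrightarrow> sgn v \<Longrightarrow> fold t f v = X t (S (f (S v)))"
  by (auto simp: fold_def)

lemma fold_sgn: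
  assumes "f permutes V" "\<And>v. v \<in> V \<Longrightarrow> sgn (f v) = sgn v" "v \<in> V"
  shows "fold t f v \<in> V" "sgn (fold t f v) = sgn v"
  using assms by (cases "sgn v"; simp add: fold_False fold_True)+

text \<open>Inside a half the new map is \<open>f\<close> composed with translations. For arcs
  across the halves, \<open>cross\<close> offers a substitute \<open>w'\<close> that
  \<open>f\<close> sends to the new image of \<open>w\<close> and that is joined to \<open>v\<close>
  exactly as \<open>w\<close> is.\<close>

lemma iso_fold:
  assumes E: "Rinv E" "Rinv E'" and f: "iso E E' f" and sg: "\<And>v. v \<in> V \<Longrightarrow> sgn (f v) = sgn v"
    and cross: "\<And>v w. v \<in> V \<Longrightarrow> w \<in> V \<Longrightarrow> \<not> sgn v \<Longrightarrow> sgn w \<Longrightarrow>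
      \<exists>w'\<in>V. fold t f w = f w' \<and> E v w' = E v w \<and> E w' v = E w v"
  shows "iso E E' (fold t f)"
proof -
  note fp = isoD(1)[OF f]
  have inj: "v = w" if vw: "v \<in> V" "w \<in> V" "fold t f v = fold t f w" for v w
  proof -
    have ss: "sgn v = sgn w" using fold_sgn(2)[OF fp sg] vw by metis
    show ?thesis
    proof (cases "sgn v")
      case False
      then have "f v = f w" using vw ss by (simp add: fold_False)
      then show ?thesis using injD[OF permutes_inj[OF fp]] by blast
    next
      case True
      then have "X t (S (f (S v))) = X t (S (f (S w)))" using vw ss by (simp add: fold_True)
      then have "X (- t) (X t (S (f (S v)))) = X (- t) (X t (S (f (S w))))" by (rule arg_cong)
      then have "S (S (f (S v))) = S (S (f (S w)))" by simp
      then have "f (S v) = f (S w)" by simp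
      then have "S v = S w" using injD[OF permutes_inj[OF fp]] by blast
      then have "S (S v) = S (S w)" by simp
      then show ?thesis by simp
    qed
  qed
  have perm: "fold t f permutes V"
  proof (rule inj_imp_permutes)
    show "inj_on (fold t f) V" by (rule inj_onI, rule inj)
    show "fold t f v \<in> V" if "v \<in> V" for v by (rule fold_sgn(1)[OF fp sg that])
    show "fold t f v = v" if "v \<notin> V" for v using that fp by (simp add: fold_def permutes_not_in)
  qed (rule finite_V)
  have "E v w = E' (fold t f v) (fold t f w)" if vw: "v \<in> V" "w \<in> V" for v w
  proof (cases "sgn v"; cases "sgn w")
    assume "\<not> sgn v" "\<not> sgn w"
    then show ?thesis using isoD(2)[OF f vw] by (simp add: fold_False)
  next
    assume s: "sgn v" "sgn w"
    have "E v w = E (S v) (S w)" using RinvD(3)[OF E(1) vw] by simp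
    also have "\<dots> = E' (f (S v)) (f (S w))" by (rule isoD(2)[OF f]) (use vw in auto)
    also have "\<dots> = E' (S (f (S v))) (S (f (S w)))"
      by (rule RinvD(3)[OF E(2), symmetric]) (use vw fp in auto)
    also have "\<dots> = E' (X t (S (f (S v)))) (X t (S (f (S w))))"
      by (rule RinvD(1)[OF E(2), symmetric]) (use vw fp in auto)
    finally show ?thesis using s vw by (simp add: fold_True)
  next
    assume s: "\<not> sgn v" "sgn w"
    obtain w' where w': "w' \<in> V" "fold t f w = f w'" "E v w' = E v w" using cross[OF vw s] by blast
    have "E v w = E' (f v) (f w')" using isoD(2)[OF f vw(1) w'(1)] w'(3) by simp
    then show ?thesis using s w' by (simp add: fold_False)
  next
    assume s: "sgn v" "\<not> sgn w"
    obtain v' where v': "v' \<in> V" "fold t f v = f v'" "E v' w = E v w" using cross[OF vw(2,1) s(2,1)] by blast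
    have "E v w = E' (f v') (f w)" using isoD(2)[OF f v'(1) vw(2)] v'(3) by simp
    then show ?thesis using s v' by (simp add: fold_False)
  qed
  then show ?thesis using perm unfolding iso_def by blast
qed

section \<open>Opposite signs on rotations and reflections\<close>

lemma int_mod3_gen:
  fixes P :: "int \<Rightarrow> bool"
  assumes "P 0" "\<And>c d. P c \<Longrightarrow> P d \<Longrightarrow> P (c + d)" "\<epsilon> = 1 \<or> \<epsilon> = -1" "P (2 * \<epsilon>)" "\<And>c d. c mod 3 = d mod 3 \<Longrightarrow> P c = P d"
  shows "P k"
proof -
  have 4: "P (2 * \<epsilon> + 2 * \<epsilon>)" using assms by blast
  have "P 1 \<and> P 2"
  proof (cases "\<epsilon> = 1")
    case True
    then have "P 2 \<and> P 4" using assms(4) 4 by simp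
    then show ?thesis using assms(5)[of 4 1] by simp
  next
    case False
    then have "\<epsilon> = -1" using assms(3) by simp
    then have "P (-2) \<and> P (-4)" using assms(4) 4 by simp
    then show ?thesis using assms(5)[of "-2" 1] assms(5)[of "-4" 2] by simp
  qed
  then have "P (k mod 3)" using int_ge_cases3[of k] assms(1) by auto
  then show ?thesis using assms(5)[of "k mod 3" k] by simp
qed

lemma halves_back:
  assumes f: "f permutes V" and h: "halves \<epsilon> f" and v: "v \<in> V"
  shows "blk (f (U (\<epsilon> (sgn v)) v)) = blk (U 1 (f v))"
proof -
  have hU: "blk (f (U 1 w)) = blk (U (\<epsilon> (sgn w)) (f w))" if "w \<in> V" for w
    using h that unfolding halves_def by blast
  consider "\<epsilon> (sgn v) = 1" | "\<epsilon> (sgn v) = -1" using h unfolding halves_def by auto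
  then show ?thesis
  proof cases
    case 1 then show ?thesis using hU[OF v] by simp
  next
    case 2
    have "blk (f v) = blk (U (-1) (f (U (-1) v)))" using hU[of "U (-1) v"] v 2 by simp
    then have "blk (U 1 (f v)) = blk (U 1 (U (-1) (f (U (-1) v))))" by (rule blk_U_cong) (use v f in auto)
    then show ?thesis using 2 by simp
  qed
qed

text \<open>Following the opposite shifts in \<open>s\<close> by a common shift cancels one of them
  and doubles the other, and 2 generates the residues modulo 3. So arcs across the halves ignore
  every shift by \<open>U\<close> of either end.\<close>

lemma cross_shift:
  assumes E: "Rinv E" and \<epsilon>: "\<epsilon> = 1 \<or> \<epsilon> = (-1::int)"
    and s: "\<And>v w. v \<in> V \<Longrightarrow> w \<in> V \<Longrightarrow> sgn v = e \<Longrightarrow> sgn w = (\<not> e) \<Longrightarrow> E (U \<epsilon> v) (U (- \<epsilon>) w) = E v w"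
    and vw: "v \<in> V" "w \<in> V" "sgn v = e" "sgn w = (\<not> e)"
  shows "E (U k v) w = E v w" "E v (U k w) = E v w"
proof -
  have 1: "E (U k v) w = E v w" if "v \<in> V" "w \<in> V" "sgn v = e" "sgn w = (\<not> e)" for v w k
  proof -
    define Q where "Q = (\<lambda>k. \<forall>v\<in>V. sgn v = e \<longrightarrow> E (U k v) w = E v w)"
    have "Q k"
    proof (rule int_mod3_gen[OF _ _ \<epsilon>])
      show "Q 0" by (simp add: Q_def)
      show "Q (c + d)" if "Q c" "Q d" for c d
        unfolding Q_def
      proof (intro ballI impI)
        fix v assume v: "v \<in> V" "sgn v = e"
        have "U d v \<in> V" "sgn (U d v) = e" using v by auto
        then have "E (U c (U d v)) w = E (U d v) w" using that(1) unfolding Q_def by blast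
        also have "\<dots> = E v w" using that(2) v unfolding Q_def by blast
        finally show "E (U (c + d) v) w = E v w" by simp
      qed
      show "Q (2 * \<epsilon>)" unfolding Q_def
      proof (intro ballI impI)
        fix v assume v: "v \<in> V" "sgn v = e"
        have "E (U (2 * \<epsilon>) v) w = E (U \<epsilon> (U \<epsilon> v)) (U \<epsilon> (U (- \<epsilon>) w))" by simp
        also have "\<dots> = E (U \<epsilon> v) (U (- \<epsilon>) w)" by (rule RinvD(2)[OF E]) (use v that in auto)
        also have "\<dots> = E v w" by (rule s) (use v that in auto)
        finally show "E (U (2 * \<epsilon>) v) w = E v w" .
      qed
      show "Q c = Q d" if "c mod 3 = d mod 3" for c d using U_cong[OF that] by (simp add: Q_def)
    qed
    then show ?thesis using that unfolding Q_def by blast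
  qed
  show "E (U k v) w = E v w" by (rule 1[OF vw])
  have "E v (U k w) = E (U (- k) v) (U (- k) (U k w))" by (rule RinvD(2)[OF E, symmetric]) (use vw in auto)
  also have "\<dots> = E v w" using 1[OF vw, of "- k"] by simp
  finally show "E v (U k w) = E v w" .
qed

text \<open>Suppose a pair across the halves is in \<open>K\<close>. With opposite signs,
  transporting \<open>U 1\<close> through \<open>f\<close> shifts its ends in opposite directions,
  and a common shift then links \<open>w\<close> to a doubly shifted \<open>v\<close>. Hence each
  half lies in a single class, the pair joins the two classes, and everything is connected.\<close>

lemma not_K_cross:
  assumes E: "Rinv E" "Rinv E'" and f: "iso E E' f" "aff f" and h: "halves \<epsilon> f" "\<epsilon> True \<noteq> \<epsilon> False"
    and nc: "\<not> (\<forall>v\<in>V. \<forall>w\<in>V. (v, w) \<in> (K E)\<^sup>*)"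
    and vw: "v \<in> V" "w \<in> V" "sgn v \<noteq> sgn w"
  shows "(v, w) \<notin> K E"
proof
  assume vwK: "(v, w) \<in> K E"
  note fp = isoD(1)[OF f(1)]
  have main: "(v, U k v) \<in> (K E)\<^sup>*" if vw: "v \<in> V" "w \<in> V" "sgn v \<noteq> sgn w" and vwK: "(v, w) \<in> K E" for v w k
  proof -
    let ?\<eta> = "\<epsilon> (sgn v)"
    have \<eta>: "?\<eta> = 1 \<or> ?\<eta> = -1" using h(1) unfolding halves_def by auto
    have \<eta>w: "\<epsilon> (sgn w) = - ?\<eta>"
    proof -
      have "\<epsilon> (sgn w) = 1 \<or> \<epsilon> (sgn w) = -1" using h(1) unfolding halves_def by auto
      moreover have "\<epsilon> (sgn w) \<noteq> ?\<eta>" using h(2) vw(3) by (cases "sgn v"; cases "sgn w") auto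
      ultimately show ?thesis using \<eta> by auto
    qed
    have "(f v, f w) \<in> K E'" using K_iso[OF f vw(1,2)] vwK by blast
    then have "(U 1 (f v), U 1 (f w)) \<in> K E'" by (rule K_tr(2)[OF E(2)])
    then have "(f (U ?\<eta> v), f (U (- ?\<eta>) w)) \<in> K E'"
      by (rule K_blk[rotated 6]) (use halves_back[OF fp h(1) vw(1)] halves_back[OF fp h(1) vw(2)] vw fp \<eta>w in auto)
    then have "(U ?\<eta> v, U (- ?\<eta>) w) \<in> K E" using K_iso[OF f in_V(2)[OF vw(1)] in_V(2)[OF vw(2)]] by blast
    then have "(U ?\<eta> (U ?\<eta> v), U ?\<eta> (U (- ?\<eta>) w)) \<in> K E" by (rule K_tr(2)[OF E(1)])
    then have "(U (2 * ?\<eta>) v, w) \<in> K E" by simp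
    then have "(w, U (2 * ?\<eta>) v) \<in> K E" by (rule K_sym)
    then have b: "(v, U (2 * ?\<eta>) v) \<in> (K E)\<^sup>*" by (rule converse_rtrancl_into_rtrancl[OF vwK r_into_rtrancl])
    show ?thesis
    proof (rule int_mod3_gen[where P = "\<lambda>k. (v, U k v) \<in> (K E)\<^sup>*", OF _ _ \<eta>])
      show "(v, U (c + d) v) \<in> (K E)\<^sup>*" if "(v, U c v) \<in> (K E)\<^sup>*" "(v, U d v) \<in> (K E)\<^sup>*" for c d
      proof -
        have "(U c v, U c (U d v)) \<in> (K E)\<^sup>*" by (rule Ks_map[OF K_tr(2)[OF E(1)] that(2)])
        then show ?thesis using that(1) by simp
      qed
      show "((v, U c v) \<in> (K E)\<^sup>*) = ((v, U d v) \<in> (K E)\<^sup>*)" if "c mod 3 = d mod 3" for c d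
        using U_cong[OF that] by simp
    qed (use b in auto)
  qed
  have X: "(u, X c u) \<in> K E" if "u \<in> V" for u c using that by (simp add: K_def)
  have all: "(v, u) \<in> (K E)\<^sup>*" if u: "u \<in> V" for u
  proof (cases "sgn v = sgn u")
    case True
    then obtain c k where "u = U k (X c v)" using sgn_eqE[OF True vw(1) u] by blast
    then have "u = X c (U k v)" by (simp add: tr_commute)
    then show ?thesis using main[OF vw vwK, of k] X[of "U k v" c] vw by simp
  next
    case False
    then have "sgn w = sgn u" using vw(3) by auto
    then obtain c k where "u = U k (X c w)" using sgn_eqE[OF _ vw(2) u] by blast
    then have "u = X c (U k w)" by (simp add: tr_commute)
    then have "(w, u) \<in> (K E)\<^sup>*" using main[OF vw(2,1) vw(3)[symmetric] K_sym[OF vwK], of k] X[of "U k w" c] vw by simp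
    then show ?thesis using vwK by simp
  qed
  have "(u, u') \<in> (K E)\<^sup>*" if "u \<in> V" "u' \<in> V" for u u'
    using Ks_sym[OF all[OF that(1)]] all[OF that(2)] by simp
  then show False using nc by blast
qed

text \<open>Joins across the halves are uniform by \<open>not_K_cross\<close> and ignore
  \<open>U\<close> by \<open>cross_shift\<close>, so they depend on the direction alone. The
  reflections can then be treated by the conjugate of what \<open>f\<close> does on rotations, which
  has the sign of the rotations.\<close>

lemma ex_untwist:
  assumes E: "Rinv E" "Rinv E'" and f: "iso E E' f" "aff f" and h: "halves \<epsilon> f" "\<epsilon> True \<noteq> \<epsilon> False"
    and nc: "\<not> (\<forall>v\<in>V. \<forall>w\<in>V. (v, w) \<in> (K E)\<^sup>*)"
  shows "iso E E' (fold 0 f)" "aff (fold 0 f)" "halves (\<lambda>_. \<epsilon> False) (fold 0 f)"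
proof -
  note fp = isoD(1)[OF f(1)]
  have sg: "sgn (f v) = sgn v" if "v \<in> V" for v using h that unfolding halves_def by blast
  have \<epsilon>1: "\<epsilon> e = 1 \<or> \<epsilon> e = -1" for e using h unfolding halves_def by auto
  have un: "unif E v w" if "v \<in> V" "w \<in> V" "sgn v \<noteq> sgn w" for v w
    using not_K_cross[OF E f h nc that] that unfolding K_def by blast
  have tw: "E (U (\<epsilon> e) v) (U (- \<epsilon> e) w) = E v w" if vw: "v \<in> V" "w \<in> V" "sgn v = e" "sgn w = (\<not> e)" for v w e
  proof -
    have \<epsilon>w: "\<epsilon> (sgn w) = - \<epsilon> e" using \<epsilon>1[of True] \<epsilon>1[of False] h(2) vw by (cases e) auto
    have bv: "blk (U 1 (f v)) = blk (f (U (\<epsilon> e) v))" using halves_back[OF fp h(1) vw(1)] vw by simp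
    have bw: "blk (U 1 (f w)) = blk (f (U (- \<epsilon> e) w))" using halves_back[OF fp h(1) vw(2)] \<epsilon>w by simp
    have fV: "U 1 (f v) \<in> V" "f (U (\<epsilon> e) v) \<in> V" "U 1 (f w) \<in> V" "f (U (- \<epsilon> e) w) \<in> V" using vw fp by auto
    obtain c where c: "f (U (\<epsilon> e) v) = X c (U 1 (f v))" using blk_eqE[OF bv fV(1,2)] .
    obtain d where d: "f (U (- \<epsilon> e) w) = X d (U 1 (f w))" using blk_eqE[OF bw fV(3,4)] .
    have "unif E' (f v) (f w)" using un[of v w] unif_aff_iso[OF f vw(1,2)] vw by auto
    then have u: "unif E' (U 1 (f v)) (U 1 (f w))"
      using unif_aff_iso[OF iso_tr(2)[OF E(2)] aff_tr(2), of "f v" "f w" 1] vw fp by simp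
    have "E (U (\<epsilon> e) v) (U (- \<epsilon> e) w) = E' (f (U (\<epsilon> e) v)) (f (U (- \<epsilon> e) w))"
      by (rule isoD(2)[OF f(1)]) (use vw in auto)
    also have "\<dots> = E' (U 1 (f v)) (U 1 (f w))" unfolding c d by (rule unifD[OF u])
    also have "\<dots> = E' (f v) (f w)" by (rule RinvD(2)[OF E(2)]) (use vw fp in auto)
    also have "\<dots> = E v w" by (rule isoD(2)[OF f(1) vw(1,2), symmetric])
    finally show ?thesis .
  qed
  have const: "E v w = E v w' \<and> E w v = E w' v" if vw: "v \<in> V" "w \<in> V" "w' \<in> V" "\<not> sgn v" "sgn w" "sgn w'" for v w w'
  proof -
    have "sgn w = sgn w'" using vw by simp
    then obtain c k where w': "w' = U k (X c w)" using sgn_eqE[OF _ vw(2,3)] by blast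
    have "E v w' = E v (X c w)" unfolding w'
    proof (rule cross_shift(2)[where e = False, OF E(1) \<epsilon>1[of False]], rule tw)
    qed (use vw in auto)
    moreover have "E v (X c w) = E v w" using unifD[OF un[of v w], of 0 c] vw by simp
    moreover have "E w' v = E (X c w) v" unfolding w'
    proof (rule cross_shift(1)[where e = True, OF E(1) \<epsilon>1[of True]], rule tw)
    qed (use vw in auto)
    moreover have "E (X c w) v = E w v" using unifD[OF un[of w v], of c 0] vw by simp
    ultimately show ?thesis by simp
  qed
  have f2V: "fold 0 f v \<in> V" if "v \<in> V" for v by (rule fold_sgn(1)[OF fp sg that])
  show "iso E E' (fold 0 f)"
  proof (rule iso_fold[OF E f(1) sg])
    fix v w assume vw: "v \<in> V" "w \<in> V" "\<not> sgn v" "sgn w"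
    define w' where "w' = pinv f (fold 0 f w)"
    have fw: "f w' = fold 0 f w" by (simp add: w'_def permutes_inverses[OF fp])
    have w'V: "w' \<in> V" using f2V[OF vw(2)] permutes_inv[OF fp] by (simp add: w'_def)
    have "sgn w' = sgn (fold 0 f w)" using sg[OF w'V] fw by simp
    then have "sgn w'" using fold_sgn(2)[OF fp sg vw(2)] vw by simp
    then show "\<exists>w'\<in>V. fold 0 f w = f w' \<and> E v w' = E v w \<and> E w' v = E w v"
      using const[OF vw(1,2) w'V vw(3,4)] fw[symmetric] w'V by blast
  qed
  show "aff (fold 0 f)" unfolding aff_def
  proof
    fix v assume v: "v \<in> V"
    show "\<exists>c. \<forall>a. fold 0 f (X a v) = X (c * a) (fold 0 f v)"
    proof (cases "sgn v")
      case False
      obtain c where "\<And>a. f (X a v) = X (c * a) (f v)" using f(2) v unfolding aff_def by blast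
      then have "\<forall>a. fold 0 f (X a v) = X (c * a) (fold 0 f v)" using False by (simp add: fold_False)
      then show ?thesis by blast
    next
      case True
      obtain c where "\<And>a. f (X a (S v)) = X (c * a) (f (S v))" using f(2) in_V(3)[OF v] unfolding aff_def by blast
      then have "\<forall>a. fold 0 f (X a v) = X (c * a) (fold 0 f v)" using True v by (simp add: fold_True tr_commute)
      then show ?thesis by blast
    qed
  qed
  show "halves (\<lambda>_. \<epsilon> False) (fold 0 f)" unfolding halves_def
  proof (intro conjI allI ballI)
    show "\<epsilon> False \<in> {1, -1}" using \<epsilon>1[of False] by auto
    fix v assume v: "v \<in> V"
    show "sgn (fold 0 f v) = sgn v" by (rule fold_sgn(2)[OF fp sg v])
    show "blk (fold 0 f (U 1 v)) = blk (U (\<epsilon> False) (fold 0 f v))"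
    proof (cases "sgn v")
      case False
      have "blk (f (U 1 v)) = blk (U (\<epsilon> (sgn v)) (f v))" using h(1) v unfolding halves_def by blast
      then show ?thesis using False by (simp add: fold_False)
    next
      case True
      have "blk (f (U 1 (S (U 1 v)))) = blk (U (\<epsilon> (sgn (S (U 1 v)))) (f (S (U 1 v))))"
        using h(1) v unfolding halves_def by simp
      then have "blk (f (S v)) = blk (U (\<epsilon> False) (f (S (U 1 v))))"
        using True v by (simp add: tr_commute)
      then have "blk (U (- \<epsilon> False) (f (S v))) = blk (U (- \<epsilon> False) (U (\<epsilon> False) (f (S (U 1 v)))))"
        by (rule blk_U_cong) (use v fp in auto)
      then have "blk (S (U (- \<epsilon> False) (f (S v)))) = blk (S (f (S (U 1 v))))"
        by (intro blk_S_cong) (use v fp in auto)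
      then show ?thesis using True v by (simp add: fold_True tr_commute)
    qed
  qed
qed

section \<open>A common multiplier on all blocks\<close>

lemma mult_const_on_K:
  assumes E: "Rinv E" "Rinv E'" and f: "iso E E' f" and m: "\<And>v a. v \<in> V \<Longrightarrow> f (X a v) = X (m v * a) (f v)"
    and vw: "(v, w) \<in> (K E)\<^sup>*"
  shows "m v mod int p = m w mod int p"
  using vw
proof (induction rule: rtrancl_induct)
  case (step w u)
  note fp = isoD(1)[OF f]
  have V: "w \<in> V" "u \<in> V" using KV step by auto
  have "m w mod int p = m u mod int p"
  proof (cases "blk w = blk u")
    case True
    obtain c where u: "u = X c w" using blk_eqE[OF True V] .
    have "f (X 1 u) = f (X (1 + c) w)" by (simp add: u)
    also have "\<dots> = X (m w) (f u)" using m[OF V(1), of "1 + c"] m[OF V(1), of c]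
      by (simp add: u algebra_simps)
    finally have "X (m w) (f u) = X (m u) (f u)" using m[OF V(2), of 1] by simp
    then show ?thesis using X_eq_iff[of "f u" "m w" "m u"] V fp by simp
  next
    case False
    then consider "\<not> unif E w u" | "\<not> unif E u w" using step unfolding K_def by blast
    then show ?thesis
    proof cases
      case 1 show ?thesis by (rule nonunif_mult[OF E f V m[OF V(1)] m[OF V(2)] 1])
    next
      case 2 show ?thesis by (rule nonunif_mult[OF E f V(2,1) m[OF V(2)] m[OF V(1)] 2, symmetric])
    qed
  qed
  then show ?case using step by simp
qed simp

text \<open>The behaviour of \<open>f\<close> on the class of a base vertex is copied to all
  classes: \<open>g\<close> brings \<open>v\<close> into that class by \<open>r v\<close>, applies
  \<open>f\<close>, and goes back by \<open>q v\<close>. Vertices related by \<open>K\<close> share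
  \<open>r\<close> and \<open>q\<close>, so their arcs survive. All other joins are uniform, so
  there it suffices that \<open>g\<close> and \<open>f\<close> agree on blocks, and
  \<open>q v\<close> is chosen for that.\<close>

lemma ex_const_straight:
  assumes E: "Rinv E" "Rinv E'" and f: "iso E E' f" "aff f" and h: "halves \<epsilon> f" "\<epsilon> True = \<epsilon> False"
  shows "\<exists>f' c. iso E E' f' \<and> (\<forall>v\<in>V. \<forall>a. f' (X a v) = X (c * a) (f' v))"
proof -
  note fp = isoD(1)[OF f(1)]
  note bf = aff_bpres[OF f(2)]
  obtain m where m: "\<And>v a. v \<in> V \<Longrightarrow> f (X a v) = X (m v * a) (f v)"
    using f(2) unfolding aff_def by (metis (full_types))
  define v0 where "v0 = pt False 0 0"
  have v0: "v0 \<in> V" by (simp add: v0_def)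
  define c where "c = m v0"
  \<comment> \<open>The predicate under \<open>SOME\<close> depends only on the class of
    \<open>v\<close>, so vertices of one class get literally the same translation
    (\<open>\<kappa>_cong\<close>).\<close>
  define \<kappa> where "\<kappa> v = (SOME q. (tr (fst q) (snd q) v, v0) \<in> (K E)\<^sup>*)" for v
  define J where "J q = (SOME j. \<forall>w\<in>V. blk (f (tr (fst q) (snd q) w)) = blk (tr (fst q) j (f w)))" for q
  have J: "blk (f (tr (fst q) (snd q) w)) = blk (tr (fst q) (J q) (f w))" if "w \<in> V" for q w
    using someI_ex[OF tr_match[OF fp bf h, of "fst q" "snd q"]] that unfolding J_def by blast
  have \<kappa>: "(tr (fst (\<kappa> v)) (snd (\<kappa> v)) v, v0) \<in> (K E)\<^sup>*" if v: "v \<in> V" for v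
  proof -
    obtain e i where "blk (tr e i v) = blk v0" using tr_to_block[OF v v0] .
    then have "(tr e i v, v0) \<in> K E" using v v0 by (simp add: K_def)
    then have "(tr (fst (e, i)) (snd (e, i)) v, v0) \<in> (K E)\<^sup>*" by simp
    then show ?thesis unfolding \<kappa>_def by (rule someI)
  qed
  have \<kappa>_cong: "\<kappa> v = \<kappa> w" if "(v, w) \<in> K E" for v w
  proof -
    have "((tr e i v, v0) \<in> (K E)\<^sup>*) = ((tr e i w, v0) \<in> (K E)\<^sup>*)" for e i
      using tr_K[OF E(1) that, of e i] K_sym[OF tr_K[OF E(1) that, of e i]]
        converse_rtrancl_into_rtrancl[of _ _ "K E" v0] by blast
    then show ?thesis unfolding \<kappa>_def by simp
  qed
  define r where "r v w = tr (fst (\<kappa> v)) (snd (\<kappa> v)) w" for v w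
  define q where "q v w = tri (fst (\<kappa> v)) (J (\<kappa> v)) w" for v w
  define s where "s v = sg (fst (\<kappa> v))" for v
  have rX: "r v (X a w) = X (s v * a) (r v w)" and qX: "q v (X a w) = X (s v * a) (q v w)" for v a w
    by (simp_all add: r_def q_def s_def tr_X)
  have rV: "r v w \<in> V" "q v w \<in> V" if "w \<in> V" for v w using that by (simp_all add: r_def q_def)
  have rE: "E (r v w) (r v u) = E w u" "E' (q v w) (q v u) = E' w u" if "w \<in> V" "u \<in> V" for v w u
    using that tr_E(1)[OF E(1)] tr_E(2)[OF E(2)] by (simp_all add: r_def q_def)
  have cong: "r v = r w" "q v = q w" "s v = s w" if "(v, w) \<in> K E" for v w
    using \<kappa>_cong[OF that] by (simp_all add: r_def q_def s_def fun_eq_iff)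
  have ss: "s v * s v = 1" for v by (simp add: s_def)
  define g where "g v = (if v \<in> V then q v (f (r v v)) else v)" for v
  have g: "g v = q v (f (r v v))" if "v \<in> V" for v using that by (simp add: g_def)
  have gV: "g v \<in> V" if "v \<in> V" for v using g[OF that] rV that fp by simp
  have gb: "blk (g v) = blk (f v)" if v: "v \<in> V" for v
  proof -
    have "blk (f (r v v)) = blk (tr (fst (\<kappa> v)) (J (\<kappa> v)) (f v))" unfolding r_def by (rule J[OF v])
    then have "blk (q v (f (r v v))) = blk (q v (tr (fst (\<kappa> v)) (J (\<kappa> v)) (f v)))"
      unfolding q_def by (rule tri_blk_cong) (use rV v fp in auto)
    then show ?thesis using g[OF v] by (simp add: q_def)
  qed
  have gX: "g (X a v) = X (c * a) (g v)" if v: "v \<in> V" for v a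
  proof -
    have "(v, X a v) \<in> K E" using v by (simp add: K_def)
    note cg = cong[OF this]
    have "m (r v v) mod int p = c mod int p"
      using mult_const_on_K[OF E f(1) m \<kappa>[OF v]] by (simp add: r_def c_def)
    \<comment> \<open>If the translations involve \<open>S\<close>, the shift is inverted twice, on
      the way in and on the way back, so the multiplier of the base vertex remains.\<close>
    then have mc: "(s v * (m (r v v) * (s v * a))) mod int p = (c * a) mod int p"
    proof -
      have "(s v * (m (r v v) * (s v * a))) = (s v * s v) * (m (r v v) * a)" by (simp add: algebra_simps)
      then have "(s v * (m (r v v) * (s v * a))) = m (r v v) * a" by (simp only: ss mult_1)
      then show ?thesis using \<open>m (r v v) mod int p = c mod int p\<close> by (metis mod_mult_left_eq)
    qed
    have "g (X a v) = q v (f (r v (X a v)))" using g[of "X a v"] v cg by simp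
    also have "\<dots> = X (s v * (m (r v v) * (s v * a))) (g v)"
      using m[OF rV(1)[OF v]] by (simp add: rX qX g[OF v])
    also have "\<dots> = X (c * a) (g v)" using X_cong[OF mc] by simp
    finally show ?thesis .
  qed
  have inj: "v = w" if vw: "v \<in> V" "w \<in> V" "g v = g w" for v w
  proof -
    have "blk (f v) = blk (f w)" using gb[OF vw(1)] gb[OF vw(2)] vw(3) by simp
    then have "blk v = blk w" by (rule bpres_inj[OF fp bf vw(1,2)])
    then obtain a where w: "w = X a v" using blk_eqE vw(1,2) by blast
    then have "X (c * a) (g v) = X 0 (g v)" using gX[OF vw(1), of a] vw(3) by simp
    then have "(c * a) mod int p = 0" using X_eq_iff[OF gV[OF vw(1)], of "c * a" 0] by simp
    then have "int p dvd c * a" by (simp add: dvd_eq_mod_eq_0)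
    moreover have "\<not> int p dvd c" unfolding c_def by (rule aff_mult_unit[OF fp v0 m[OF v0]])
    ultimately have "int p dvd a" using prime_p by (simp add: prime_dvd_mult_iff)
    then have "X a v = X 0 v" using X_cong[of a 0] by simp
    then show ?thesis using w by simp
  qed
  have gp: "g permutes V"
  proof (rule inj_imp_permutes)
    show "inj_on g V" by (rule inj_onI, rule inj)
    show "g v \<in> V" if "v \<in> V" for v by (rule gV[OF that])
    show "g v = v" if "v \<notin> V" for v using that by (simp add: g_def)
  qed (rule finite_V)
  have "E v w = E' (g v) (g w)" if vw: "v \<in> V" "w \<in> V" for v w
  proof (cases "(v, w) \<in> K E")
    case True
    have "E v w = E (r v v) (r v w)" using rE vw by simp
    also have "\<dots> = E' (f (r v v)) (f (r v w))" by (rule isoD(2)[OF f(1)]) (use rV vw in auto)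
    also have "\<dots> = E' (q v (f (r v v))) (q v (f (r v w)))" using rE rV vw fp by simp
    finally show ?thesis using cong[OF True] by (simp add: g[OF vw(1)] g[OF vw(2)])
  next
    case False
    then have "unif E v w" using vw unfolding K_def by blast
    then have u: "unif E' (f v) (f w)" using unif_aff_iso[OF f vw] by blast
    have fV: "f v \<in> V" "f w \<in> V" using vw fp by auto
    obtain a where a: "g v = X a (f v)" using blk_eqE[OF gb[OF vw(1), symmetric] fV(1) gV[OF vw(1)]] .
    obtain b where b: "g w = X b (f w)" using blk_eqE[OF gb[OF vw(2), symmetric] fV(2) gV[OF vw(2)]] .
    have "E' (g v) (g w) = E' (f v) (f w)" unfolding a b by (rule unifD[OF u])
    then show ?thesis using isoD(2)[OF f(1) vw] by simp
  qed
  then have "iso E E' g" using gp unfolding iso_def by blast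
  then show ?thesis using gX by blast
qed

text \<open>With different signs there are two cases: either \<open>K\<close> connects everything
  and the multiplier is constant already, or \<open>ex_untwist\<close> produces equal signs.\<close>

lemma ex_const:
  assumes E: "Rinv E" "Rinv E'" and f: "iso E E' f" "aff f"
  obtains f' c where "iso E E' f'" "\<And>v a. v \<in> V \<Longrightarrow> f' (X a v) = X (c * a) (f' v)"
proof -
  obtain f1 \<epsilon> where f1: "iso E E' f1" "aff f1" "halves \<epsilon> f1" using ex_halves[OF E f] .
  have "\<exists>f' c. iso E E' f' \<and> (\<forall>v\<in>V. \<forall>a. f' (X a v) = X (c * a) (f' v))"
  proof (cases "\<epsilon> True = \<epsilon> False")
    case True
    then show ?thesis by (rule ex_const_straight[OF E f1])
  next
    case False
    show ?thesis
    proof (cases "\<forall>v\<in>V. \<forall>w\<in>V. (v, w) \<in> (K E)\<^sup>*")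
      case True
      obtain m where m: "\<And>v a. v \<in> V \<Longrightarrow> f1 (X a v) = X (m v * a) (f1 v)"
        using f1(2) unfolding aff_def by (metis (full_types))
      define v0 where "v0 = pt False 0 0"
      have "f1 (X a v) = X (m v0 * a) (f1 v)" if v: "v \<in> V" for v a
      proof -
        have "(v, v0) \<in> (K E)\<^sup>*" using True v by (simp add: v0_def)
        then have "m v mod int p = m v0 mod int p" using mult_const_on_K[OF E f1(1) m, of v v0] by simp
        then have "(m v * a) mod int p = (m v0 * a) mod int p" by (rule mod_mult_cong) simp
        from X_cong[OF this] show ?thesis using m[OF v, of a] by simp
      qed
      then show ?thesis using f1(1) by blast
    next
      case nc: False
      show ?thesis by (rule ex_const_straight[OF E ex_untwist[OF E f1(1,2,3) False nc]]) simp
    qed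
  qed
  then show ?thesis using that by blast
qed

section \<open>Isomorphisms in standard form\<close>

text \<open>One multiplier and one sign for both halves, now exactly and not only on blocks.
  \<open>AG_of_cay_iso\<close> removes the translation part of such a map and finds a
  \<open>gm\<close>.\<close>

definition std :: "(vtx \<Rightarrow> vtx) \<Rightarrow> bool" where
  "std f \<longleftrightarrow> (\<exists>c. \<exists>\<epsilon>\<in>{1, -1}. \<forall>v\<in>V. sgn (f v) = sgn v \<and>
     (\<forall>a. f (X a v) = X (c * a) (f v)) \<and> (\<forall>k. f (U k v) = U (\<epsilon> * k) (f v)))"

lemma U_step_all:
  assumes "\<And>v. v \<in> V \<Longrightarrow> P v \<Longrightarrow> f (U 1 v) = U \<epsilon> (f v)" "\<And>v k. P v \<Longrightarrow> P (U k v)" "v \<in> V" "P v"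
  shows "f (U k v) = U (\<epsilon> * k) (f v)"
proof -
  have n: "f (U (int n) v) = U (\<epsilon> * int n) (f v)" for n
  proof (induction n)
    case (Suc n)
    have "f (U 1 (U (int n) v)) = U \<epsilon> (f (U (int n) v))" by (rule assms(1)) (use assms in auto)
    then show ?case using Suc by (simp add: algebra_simps)
  qed simp
  have "U k = U (int (nat (k mod 3)))" by (rule U_cong) simp
  moreover have "U (\<epsilon> * int (nat (k mod 3))) = U (\<epsilon> * k)" by (rule U_cong) (simp add: mod_simps)
  ultimately show ?thesis using n[of "nat (k mod 3)"] by simp
qed

text \<open>On blocks the conjugate \<open>y\<close> of \<open>U 1\<close> agrees with a power of
  \<open>U\<close>, so at \<open>v\<close> they differ by a shift by some \<open>s\<close>. The
  quotient of the two lies in a 3-group commuting with \<open>X\<close>, hence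
  \<open>3 ^ k * s\<close> is divisible by \<open>p\<close>, and so is \<open>s\<close>.\<close>

lemma three_group_exact:
  assumes P: "perm_group V P" "card P = 3 ^ k" "U 1 \<in> P" "\<And>g v a. g \<in> P \<Longrightarrow> g (X a v) = X a (g v)"
    and f: "f permutes V" "bpres f" "pinv f \<circ> U 1 \<circ> f \<in> P" and h: "halves \<epsilon> f" and v: "v \<in> V"
  shows "f (U 1 v) = U (\<epsilon> (sgn v)) (f v)"
proof -
  define y where "y = pinv f \<circ> U 1 \<circ> f"
  have yP: "y \<in> P" using f by (simp add: y_def)
  have yV: "y v \<in> V" if "v \<in> V" for v using perm_groupD(2)[OF P(1) yP] that by simp
  have fy: "f (y v) = U 1 (f v)" for v by (simp add: y_def permutes_inverses[OF f(1)])
  have ye: "y v = U (\<epsilon> (sgn v)) v" if v: "v \<in> V" for v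
  proof -
    have "blk (f (U (\<epsilon> (sgn v)) v)) = blk (f (y v))" using halves_back[OF f(1) h v] fy by simp
    then have b: "blk (U (\<epsilon> (sgn v)) v) = blk (y v)" by (rule bpres_inj[OF f(1,2), rotated 2]) (use v yV in auto)
    obtain s where s: "y v = X s (U (\<epsilon> (sgn v)) v)" using blk_eqE[OF b in_V(2)[OF v] yV[OF v]] .
    define g where "g = U (- \<epsilon> (sgn v)) \<circ> y"
    have gP: "g \<in> P" using perm_groupD(4)[OF P(1) U_in_group[OF P(1,3)] yP] by (simp add: g_def)
    have gv: "g v = X s v" by (simp add: g_def s tr_commute)
    have "(g ^^ n) v = X (int n * s) v" for n
    proof (induction n)
      case (Suc n)
      have "g (X (int n * s) v) = X (int n * s) (g v)" by (rule P(4)[OF gP])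
      then show ?case using Suc gv by (simp add: algebra_simps)
    qed simp
    moreover have "g ^^ (3 ^ k) = id" using perm_group_pow_card[OF P(1) gP] P(2) by simp
    ultimately have "X (int (3 ^ k) * s) v = X 0 v" by (metis id_apply tr_simps(4))
    then have "(int (3 ^ k) * s) mod int p = 0" using X_eq_iff[OF v, of "int (3 ^ k) * s" 0] by simp
    then have "int p dvd 3 ^ k * s" by (simp add: dvd_eq_mod_eq_0)
    moreover have "\<not> int p dvd 3 ^ k"
    proof
      assume "int p dvd 3 ^ k"
      then have "int p dvd 3" using prime_p prime_dvd_power by (metis prime_nat_int_transfer)
      then show False using p_gt_3 zdvd_imp_le[of "int p" 3] by simp
    qed
    ultimately have "int p dvd s" using prime_p by (simp add: prime_dvd_mult_iff)
    then have "X s = X 0" using X_cong[of s 0] by simp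
    then show ?thesis using s by simp
  qed
  have a: "f (U (\<epsilon> (sgn w)) w) = U 1 (f w)" if w: "w \<in> V" for w by (subst ye[OF w, symmetric]) (rule fy)
  consider "\<epsilon> (sgn v) = 1" | "\<epsilon> (sgn v) = -1" using h unfolding halves_def by auto
  then show ?thesis
  proof cases
    case 1 then show ?thesis using a[OF v] by simp
  next
    case 2
    have "f v = U 1 (f (U 1 v))" using a[of "U 1 v"] v 2 by simp
    then have "U (-1) (f v) = U (-1) (U 1 (f (U 1 v)))" by (rule arg_cong)
    then show ?thesis using 2 by simp
  qed
qed

text \<open>If the signs differ, arcs across the halves ignore \<open>U\<close> by
  \<open>cross_shift\<close>; folding is harmless when it changes \<open>f\<close> on reflections
  only by powers of \<open>U\<close>.\<close>

lemma ex_std_of_exact: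
  assumes E: "Rinv E" "Rinv E'" and f: "iso E E' f" and cX: "\<And>v a. v \<in> V \<Longrightarrow> f (X a v) = X (c * a) (f v)"
    and h: "halves \<epsilon> f" and fU: "\<And>v. v \<in> V \<Longrightarrow> f (U 1 v) = U (\<epsilon> (sgn v)) (f v)"
  obtains f' where "iso E E' f'" "std f'"
proof -
  note fp = isoD(1)[OF f]
  have sg: "sgn (f v) = sgn v" if "v \<in> V" for v using h that unfolding halves_def by blast
  have \<epsilon>1: "\<epsilon> e = 1 \<or> \<epsilon> e = -1" for e using h unfolding halves_def by auto
  have \<epsilon>2: "\<epsilon> e * \<epsilon> e = 1" for e using \<epsilon>1[of e] by auto
  have fUk: "f (U k v) = U (\<epsilon> (sgn v) * k) (f v)" if "v \<in> V" for v k
    by (rule U_step_all[where P = "\<lambda>w. sgn w = sgn v"]) (use fU that in auto)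
  show ?thesis
  proof (cases "\<epsilon> True = \<epsilon> False")
    case True
    then have "\<epsilon> e = \<epsilon> False" for e by (cases e) auto
    then have "std f" unfolding std_def using sg cX fUk \<epsilon>1[of False]
      by (intro exI[of _ c] bexI[of _ "\<epsilon> False"]) auto
    then show ?thesis using that f by blast
  next
    case False
    have tw: "E (U (\<epsilon> e) v) (U (- \<epsilon> e) w) = E v w" if vw: "v \<in> V" "w \<in> V" "sgn v = e" "sgn w = (\<not> e)" for v w e
    proof -
      have \<epsilon>w: "\<epsilon> (sgn w) = - \<epsilon> e" using \<epsilon>1[of True] \<epsilon>1[of False] False vw by (cases e) auto
      have "E (U (\<epsilon> e) v) (U (- \<epsilon> e) w) = E' (f (U (\<epsilon> e) v)) (f (U (- \<epsilon> e) w))"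
        by (rule isoD(2)[OF f]) (use vw in auto)
      also have "\<dots> = E' (U 1 (f v)) (U 1 (f w))" using fUk[OF vw(1)] fUk[OF vw(2)] vw(3) \<epsilon>w \<epsilon>2[of e] by simp
      also have "\<dots> = E' (f v) (f w)" by (rule RinvD(2)[OF E(2)]) (use vw fp in auto)
      also have "\<dots> = E v w" by (rule isoD(2)[OF f vw(1,2), symmetric])
      finally show ?thesis .
    qed
    obtain e1 \<alpha> a0 where A: "f (pt False 0 0) = pt e1 \<alpha> a0" using ptE[of "f (pt False 0 0)"] fp pt_V by (metis perm_V)
    obtain e2 \<beta> b where B: "f (pt True 0 0) = pt e2 \<beta> b" using ptE[of "f (pt True 0 0)"] fp pt_V by (metis perm_V)
    have e12: "e1 = False" "e2 = True" using sg[of "pt False 0 0"] sg[of "pt True 0 0"] A B by simp_all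
    have fF: "f (pt False i a) = pt False (\<alpha> + \<epsilon> False * i) (a0 + c * a)" for i a
      using fUk[of "X a (pt False 0 0)" i] cX[of "pt False 0 0" a] A e12 by simp
    have fT: "f (pt True i a) = pt True (\<beta> + \<epsilon> True * i) (b + c * a)" for i a
      using fUk[of "X a (pt True 0 0)" i] cX[of "pt True 0 0" a] B e12 by simp
    \<comment> \<open>Makes the folded map agree with \<open>f\<close> on reflections in the
      coordinate modulo \<open>p\<close>, which is \<open>b + c * a\<close> for both; the
      discrepancy modulo 3 is the power \<open>l\<close> of \<open>U\<close> computed below.\<close>
    define t where "t = a0 + b"
    have sg': "sgn (fold t f v) = sgn v" if "v \<in> V" for v by (rule fold_sgn(2)[OF fp sg that])
    have "iso E E' (fold t f)"
    proof (rule iso_fold[OF E f sg])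
      fix v w assume vw: "v \<in> V" "w \<in> V" "\<not> sgn v" "sgn w"
      obtain e i a where w: "w = pt e i a" using vw(2) ptE by blast
      have e: "e = True" using w vw by simp
      define l where "l = \<epsilon> True * (\<epsilon> False * i - \<alpha> - \<beta> - \<epsilon> True * i)"
      have l: "\<epsilon> True * l = \<epsilon> False * i - \<alpha> - \<beta> - \<epsilon> True * i"
        unfolding l_def mult.assoc[symmetric] \<epsilon>2 by simp
      have "fold t f w = pt True (\<epsilon> False * i - \<alpha>) (b + c * a)"
        using w e by (simp add: fold_True fF t_def add.commute)
      moreover have "\<epsilon> False * i - \<alpha> = \<beta> + \<epsilon> True * (i + l)"
        using l by (simp add: distrib_left)
      ultimately have "fold t f w = pt True (\<beta> + \<epsilon> True * (i + l)) (b + c * a)" by simp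
      also have "\<dots> = f (U l w)" using w e by (simp add: fT)
      finally have 1: "fold t f w = f (U l w)" .
      have 2: "E v (U l w) = E v w"
      proof (rule cross_shift(2)[where e = False, OF E(1) \<epsilon>1[of False]], rule tw)
      qed (use vw in auto)
      have 3: "E (U l w) v = E w v"
      proof (rule cross_shift(1)[where e = True, OF E(1) \<epsilon>1[of True]], rule tw)
      qed (use vw in auto)
      show "\<exists>w'\<in>V. fold t f w = f w' \<and> E v w' = E v w \<and> E w' v = E w v"
        using 1 2 3 in_V(2)[OF vw(2)] by blast
    qed
    moreover have "std (fold t f)" unfolding std_def
    proof (intro exI[of _ c] bexI[of _ "\<epsilon> False"] ballI conjI allI)
      fix v assume v: "v \<in> V"
      show "sgn (fold t f v) = sgn v" by (rule sg'[OF v])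
      show "fold t f (X a v) = X (c * a) (fold t f v)" for a
        using cX[OF v, of a] cX[OF in_V(3)[OF v], of "- a"] v
        by (cases "sgn v") (simp_all add: fold_False fold_True tr_commute add.commute)
      show "fold t f (U k v) = U (\<epsilon> False * k) (fold t f v)" for k
        using fUk[OF v, of k] fUk[OF in_V(3)[OF v], of "- k"] v
        by (cases "sgn v") (simp_all add: fold_False fold_True tr_commute)
    next
      show "\<epsilon> False \<in> {1, -1}" using \<epsilon>1[of False] by auto
    qed
    ultimately show ?thesis using that by blast
  qed
qed

text \<open>Thanks to the constant multiplier the conjugate of \<open>U 1\<close> commutes with
  \<open>X\<close>. So Sylow's theorem can be used in the centralizer of \<open>X\<close>, where the
  conjugator does not affect the multiplier.\<close>

lemma ex_std:
  assumes E: "Rinv E" "Rinv E'" and f: "iso E E' f" "aff f"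
  obtains f' where "iso E E' f'" "std f'"
proof -
  have "\<exists>f1 c. iso E E' f1 \<and> (\<forall>v\<in>V. \<forall>a. f1 (X a v) = X (c * a) (f1 v))"
    by (rule ex_const[OF E f]) blast
  then obtain f1 c where f1: "iso E E' f1" and c: "\<And>v a. v \<in> V \<Longrightarrow> f1 (X a v) = X (c * a) (f1 v)"
    by blast
  note fp = isoD(1)[OF f1]
  have cX: "f1 (X a v) = X (c * a) (f1 v)" for a v
    using c[of v a] fp by (cases "v \<in> V") (simp_all add: X_out permutes_not_in)
  define G where "G = {g \<in> Aut E. \<forall>v a. g (X a v) = X a (g v)}"
  have Gp: "g permutes V" if "g \<in> G" for g using that by (simp add: G_def Aut_def iso_def)
  have GX: "g (X a v) = X a (g v)" if "g \<in> G" for g a v using that by (simp add: G_def)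
  have G: "perm_group V G"
    by (rule perm_group_sub[of G E]) (auto simp: G_def id_Aut comp_Aut)
  have U1: "U 1 \<in> G" using tr_Aut[OF E(1)] by (simp add: G_def tr_commute)
  define y where "y = pinv f1 \<circ> U 1 \<circ> f1"
  have yG: "y \<in> G"
  proof -
    have "y (X a v) = X a (y v)" for a v
    proof -
      have "f1 (y (X a v)) = f1 (X a (y v))"
        by (simp add: y_def permutes_inverses[OF fp] cX tr_commute)
      then show ?thesis using injD[OF permutes_inj[OF fp]] by blast
    qed
    then show ?thesis using conj_Aut[OF f1] tr_Aut[OF E(2)] by (simp add: y_def G_def)
  qed
  have y3: "y ^^ 3 = id" unfolding y_def by (rule conj_pow[OF fp U1_pow_3])
  have p3: "prime (3::nat)" by simp
  obtain P g k where P: "perm_group V P" "P \<subseteq> G" "card P = 3 ^ k" "g \<in> G" "U 1 \<in> P" "pinv g \<circ> y \<circ> g \<in> P"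
    using sylow_conj[OF G p3 U1 U1_pow_3 yG y3] by metis
  define f2 where "f2 = f1 \<circ> g"
  have f2p: "f2 permutes V" unfolding f2_def using fp Gp[OF P(4)] permutes_compose by blast
  have f2X: "f2 (X a v) = X (c * a) (f2 v)" for a v by (simp add: f2_def GX[OF P(4)] cX)
  have f2i: "iso E E' f2" using iso_comp f1 P(4) by (auto simp: Aut_def G_def f2_def)
  have PX: "h (X a v) = X a (h v)" if "h \<in> P" for h a v using that P(2) GX by blast
  have bP: "bpres h" if "h \<in> P" for h
  proof -
    have "aff h" unfolding aff_def using PX[OF that] by (intro ballI exI[of _ 1]) simp
    then show ?thesis by (rule aff_bpres)
  qed
  have aff2: "aff f2" unfolding aff_def using f2X by blast
  have y2: "pinv f2 \<circ> U 1 \<circ> f2 \<in> P" using P(6) conj_conj[OF fp Gp[OF P(4)]] by (simp add: y_def f2_def)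
  obtain \<epsilon> where "halves \<epsilon> f2 \<or> halves \<epsilon> (S \<circ> f2)"
    using halves_of_three_group[OF P(1,3,5) bP f2p aff_bpres[OF aff2] y2] by blast
  then show ?thesis
  proof
    assume h: "halves \<epsilon> f2"
    show ?thesis
      by (rule ex_std_of_exact[OF E f2i f2X h three_group_exact[OF P(1,3,5) PX f2p aff_bpres[OF aff2] y2 h]])
        (use that in auto)
  next
    assume h: "halves \<epsilon> (S \<circ> f2)"
    define f3 where "f3 = S \<circ> f2"
    have f3p: "f3 permutes V" unfolding f3_def by (rule permutes_compose[OF f2p S_permutes])
    have f3i: "iso E E' f3" unfolding f3_def by (rule iso_comp[OF f2i iso_tr(3)[OF E(2)]])
    have f3X: "f3 (X a v) = X ((- c) * a) (f3 v)" for a v by (simp add: f3_def f2X tr_commute)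
    have aff3: "aff f3" unfolding aff_def using f3X by blast
    \<comment> \<open>As \<open>S\<close> inverts \<open>U\<close>, the conjugate of
      \<open>U 1\<close> by \<open>f3\<close> is the inverse of the one by \<open>f2\<close>, and so
      in the same 3-group.\<close>
    have y3: "pinv f3 \<circ> U 1 \<circ> f3 \<in> P"
    proof -
      define z where "z = pinv f2 \<circ> U 1 \<circ> f2"
      have "f3 ((pinv f3 \<circ> U 1 \<circ> f3) v) = f3 (pinv z v)" for v
      proof -
        have "f2 (z (pinv z v)) = f2 v" using y2 perm_group_inv_simps(4)[OF P(1), of z] by (simp add: z_def)
        then have "U 1 (f2 (pinv z v)) = f2 v" by (simp add: z_def permutes_inverses[OF f2p])
        then have "U (-1) (U 1 (f2 (pinv z v))) = U (-1) (f2 v)" by (rule arg_cong)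
        then have "f2 (pinv z v) = U (-1) (f2 v)" by simp
        then show ?thesis by (simp add: permutes_inverses[OF f3p]) (simp add: f3_def tr_commute)
      qed
      then have "(pinv f3 \<circ> U 1 \<circ> f3) v = pinv z v" for v using injD[OF permutes_inj[OF f3p]] by blast
      then have "pinv f3 \<circ> U 1 \<circ> f3 = pinv z" by (rule ext)
      then show ?thesis using perm_group_inv[OF P(1), of z] y2 by (simp add: z_def)
    qed
    have h: "halves \<epsilon> f3" using h by (simp add: f3_def)
    show ?thesis
      by (rule ex_std_of_exact[OF E f3i f3X h three_group_exact[OF P(1,3,5) PX f3p aff_bpres[OF aff3] y3 h]])
        (use that in auto)
  qed
qed

lemma std_form:
  assumes f: "f permutes V" "std f"
  obtains c \<epsilon> \<alpha> \<beta> a b where "\<epsilon> \<in> {1, -1}" "\<not> int p dvd c"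
    "\<And>i x. f (pt False i x) = pt False (\<alpha> + \<epsilon> * i) (a + c * x)"
    "\<And>i x. f (pt True i x) = pt True (\<beta> + \<epsilon> * i) (b + c * x)"
proof -
  obtain c \<epsilon> where e: "\<epsilon> \<in> {1, -1}" and sg: "\<And>v. v \<in> V \<Longrightarrow> sgn (f v) = sgn v"
    and fX: "\<And>v a. v \<in> V \<Longrightarrow> f (X a v) = X (c * a) (f v)" and fU: "\<And>v k. v \<in> V \<Longrightarrow> f (U k v) = U (\<epsilon> * k) (f v)"
    using f(2) unfolding std_def by blast
  have fV: "f (pt e 0 0) \<in> V" for e using f(1) by simp
  obtain e1 \<alpha> a where A: "f (pt False 0 0) = pt e1 \<alpha> a" using ptE[OF fV] .
  obtain e2 \<beta> b where B: "f (pt True 0 0) = pt e2 \<beta> b" using ptE[OF fV] .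
  have e12: "e1 = False" "e2 = True" using sg[of "pt False 0 0"] sg[of "pt True 0 0"] A B by simp_all
  have "f (pt False i x) = pt False (\<alpha> + \<epsilon> * i) (a + c * x)" for i x
    using fU[of "X x (pt False 0 0)" i] fX[of "pt False 0 0" x] A e12 by simp
  moreover have "f (pt True i x) = pt True (\<beta> + \<epsilon> * i) (b + c * x)" for i x
    using fU[of "X x (pt True 0 0)" i] fX[of "pt True 0 0" x] B e12 by simp
  moreover have "\<not> int p dvd c"
    by (rule aff_mult_unit[OF f(1) pt_V[of False 0 0] fX[OF pt_V]])
  ultimately show ?thesis using that e by blast
qed

section \<open>A Sylow subgroup with an orbit of length 25\<close>

text \<open>The only obstruction to Sylow \<open>p\<close>-subgroups preserving blocks: six blocks contain an orbit of more than
  \<open>p\<close> points only if \<open>p = 5\<close>, and then it is the union of five of them.\<close>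

definition exc :: "(vtx \<Rightarrow> vtx \<Rightarrow> bool) \<Rightarrow> (vtx \<Rightarrow> vtx) set \<Rightarrow> vtx \<Rightarrow> bool" where
  "exc E P s \<longleftrightarrow> perm_group V P \<and> (\<exists>k. card P = p ^ k) \<and> P \<subseteq> Aut E \<and> X 1 \<in> P \<and> s \<in> V \<and> p = 5 \<and>
     (\<forall>g\<in>P. \<forall>v\<in>V. blk (g v) = blk s \<longleftrightarrow> blk v = blk s) \<and>
     (\<forall>v\<in>V. \<forall>w\<in>V. blk v \<noteq> blk s \<longrightarrow> blk w \<noteq> blk s \<longrightarrow> (\<exists>g\<in>P. g v = w))"

lemma excD:
  assumes "exc E P s"
  shows "perm_group V P" "\<exists>k. card P = p ^ k" "\<And>g. g \<in> P \<Longrightarrow> g \<in> Aut E" "X 1 \<in> P" "s \<in> V" "p = 5"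
    "\<And>g v. g \<in> P \<Longrightarrow> v \<in> V \<Longrightarrow> blk (g v) = blk s \<longleftrightarrow> blk v = blk s"
    "\<And>v w. v \<in> V \<Longrightarrow> w \<in> V \<Longrightarrow> blk v \<noteq> blk s \<Longrightarrow> blk w \<noteq> blk s \<Longrightarrow> \<exists>g\<in>P. g v = w"
proof -
  note d = assms[unfolded exc_def]
  show "perm_group V P" "\<exists>k. card P = p ^ k" "X 1 \<in> P" "s \<in> V" "p = 5" using d by blast+
  show "\<And>g. g \<in> P \<Longrightarrow> g \<in> Aut E" using d by blast
  show "\<And>g v. g \<in> P \<Longrightarrow> v \<in> V \<Longrightarrow> blk (g v) = blk s \<longleftrightarrow> blk v = blk s" using d by blast
  show "\<And>v w. v \<in> V \<Longrightarrow> w \<in> V \<Longrightarrow> blk v \<noteq> blk s \<Longrightarrow> blk w \<noteq> blk s \<Longrightarrow> \<exists>g\<in>P. g v = w" using d by blast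
qed

lemma orbit_dichotomy:
  assumes P: "perm_group V P" "card P = p ^ k" "P \<subseteq> Aut E" "X 1 \<in> P"
  shows "(\<forall>g\<in>P. \<forall>v\<in>V. blk (g v) = blk v) \<or> (\<exists>s. exc E P s)"
proof (rule disjCI)
  note Pd = perm_groupD[OF P(1)]
  assume "\<not> (\<exists>s. exc E P s)"
  then have nex: "\<not> exc E P s" for s by blast
  define Ob where "Ob v = (\<lambda>g. g v) ` P" for v
  have cO: "\<exists>j. card (Ob v) = p ^ j" for v
  proof -
    have "card P = card (Ob v) * card {g\<in>P. g v = id v}"
      unfolding Ob_def by (rule card_orbit_stabilizer[OF P(1), of "\<lambda>g v. g v"]) simp
    then have "p ^ k = card (Ob v) * card {g\<in>P. g v = id v}" using P(2) by simp
    then have "card (Ob v) dvd p ^ k" by (rule dvdI)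
    then show ?thesis using divides_primepow_nat[OF prime_p, of "card (Ob v)" k] by blast
  qed
  have OV: "Ob v \<subseteq> V" if "v \<in> V" for v using Pd(2) that by (auto simp: Ob_def)
  have BO: "{w\<in>V. blk w = blk v} \<subseteq> Ob v" if "v \<in> V" for v
    unfolding block_eq[OF that] Ob_def using X_in_group[OF P(1,4)] by blast
  have Oself: "v \<in> Ob v" for v unfolding Ob_def using imageI[OF Pd(3), of "\<lambda>g. g v"] by simp
  have Oeq: "Ob w = Ob v" if vw: "w \<in> Ob v" for v w
  proof -
    obtain g where g: "g \<in> P" "w = g v" using vw by (auto simp: Ob_def)
    show ?thesis
    proof (intro equalityI subsetI)
      fix u assume "u \<in> Ob w"
      then obtain h where "h \<in> P" "u = (h \<circ> g) v" using g by (auto simp: Ob_def)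
      then show "u \<in> Ob v" unfolding Ob_def using Pd(4)[OF _ g(1)] by blast
    next
      fix u assume "u \<in> Ob v"
      then obtain h where h: "h \<in> P" "u = h v" by (auto simp: Ob_def)
      then have "u = (h \<circ> pinv g) w" using g perm_group_inv_simps[OF P(1) g(1)] by simp
      then show "u \<in> Ob w" unfolding Ob_def using Pd(4)[OF h(1) perm_group_inv[OF P(1) g(1)]] by blast
    qed
  qed
  have "Ob v = {w\<in>V. blk w = blk v}" if v: "v \<in> V" for v
  proof (rule ccontr)
    assume ne: "Ob v \<noteq> {w\<in>V. blk w = blk v}"
    have fO: "finite (Ob v)" using OV[OF v] finite_V finite_subset by blast
    obtain j where j: "card (Ob v) = p ^ j" using cO by blast
    have "p < card (Ob v)" using psubset_card_mono[OF fO, of "{w\<in>V. blk w = blk v}"] BO[OF v] ne card_block[OF v] by auto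
    then have "p ^ 1 < p ^ j" using j by simp
    then have j2: "2 \<le> j" using p_gt_3 power_less_imp_less_exp[of p 1 j] by simp
    have le: "p ^ j \<le> 6 * p" using card_mono[OF finite_V OV[OF v]] card_V j by simp
    have "p ^ 2 \<le> p ^ j" using j2 p_gt_3 by (intro power_increasing) auto
    then have "p * p \<le> 6 * p" using le by (simp only: power2_eq_square)
    then have "p \<le> 6" by simp
    then have "p \<in> {4, 5, 6}" using p_gt_3 by auto
    moreover have "\<not> prime (4::nat)" "\<not> prime (6::nat)" using prime_nat_iff[of 4] prime_nat_iff[of 6] by (auto intro: dvdI[of _ 2 2] dvdI[of _ 2 3])
    ultimately have p5: "p = 5" using prime_p by auto
    have "j = 2"
    proof (rule ccontr)
      assume "j \<noteq> 2"
      then have "(5::nat) ^ 3 \<le> 5 ^ j" using j2 by (intro power_increasing) auto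
      then show False using le p5 by simp
    qed
    then have c25: "card (Ob v) = 25" using j p5 by simp
    define Sg where "Sg = V - Ob v"
    have cS: "card Sg = 5" using card_Diff_subset[OF fO OV[OF v]] c25 card_V p5 by (simp add: Sg_def)
    then obtain s where s: "s \<in> Sg" by (metis card.empty ex_in_conv numeral_eq_iff zero_neq_numeral)
    have sV: "s \<in> V" using s by (simp add: Sg_def)
    have "{w\<in>V. blk w = blk s} \<subseteq> Sg"
    proof
      fix w assume w: "w \<in> {w\<in>V. blk w = blk s}"
      then have "w \<in> Ob s" using BO[OF sV] by blast
      then have "Ob w = Ob s" by (rule Oeq)
      then have "w \<notin> Ob v" using Oeq[of w v] Oself[of s] s by (auto simp: Sg_def)
      then show "w \<in> Sg" using w by (simp add: Sg_def)
    qed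
    then have Seq: "{w\<in>V. blk w = blk s} = Sg"
    proof (rule card_subset_eq[rotated])
      show "finite Sg" using finite_V by (simp add: Sg_def)
      show "card {w\<in>V. blk w = blk s} = card Sg" using card_block[OF sV] cS p5 by simp
    qed
    have inS: "w \<in> Sg \<longleftrightarrow> blk w = blk s" if "w \<in> V" for w using that Seq by blast
    have gO: "g w \<in> Ob v \<longleftrightarrow> w \<in> Ob v" if g: "g \<in> P" for g w
    proof -
      have "g w \<in> Ob w" using g by (auto simp: Ob_def)
      then have "Ob (g w) = Ob w" by (rule Oeq)
      then show ?thesis using Oeq[of w v] Oeq[of "g w" v] Oself[of w] Oself[of "g w"] by auto
    qed
    have "exc E P s" unfolding exc_def
    proof (intro conjI ballI impI)
      fix g u assume "g \<in> P" "u \<in> V"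
      then show "blk (g u) = blk s \<longleftrightarrow> blk u = blk s"
        using gO[of g u] inS[of u] inS[of "g u"] Pd(2)[of g] by (simp add: Sg_def)
    next
      fix u w assume uw: "u \<in> V" "w \<in> V" "blk u \<noteq> blk s" "blk w \<noteq> blk s"
      then have "u \<in> Ob v" "w \<in> Ob v" using inS[OF uw(1)] inS[OF uw(2)] by (simp_all add: Sg_def)
      then have "w \<in> Ob u" using Oeq[of u v] by simp
      then show "\<exists>g\<in>P. g u = w" by (auto simp: Ob_def)
    qed (use P sV p5 in auto)
    then show False using nex by blast
  qed
  moreover have "g v \<in> Ob v" if "g \<in> P" for g v using that by (auto simp: Ob_def)
  ultimately show "\<forall>g\<in>P. \<forall>v\<in>V. blk (g v) = blk v" by blast
qed

section \<open>Digraphs with constant joins between distinct blocks\<close>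

definition W0 :: "(vtx \<Rightarrow> vtx \<Rightarrow> bool) \<Rightarrow> vtx \<Rightarrow> bool \<Rightarrow> bool \<Rightarrow> bool" where
  "W0 E s a b \<longleftrightarrow> (\<forall>v\<in>V. \<forall>w\<in>V. blk v = blk s \<longrightarrow> blk w \<noteq> blk s \<longrightarrow> E v w = a \<and> E w v = b)"

lemma tr_blk_iff:
  assumes "v \<in> V" "w \<in> V" shows "blk (tr e i v) = blk (tr e i w) \<longleftrightarrow> blk v = blk w"
proof
  assume "blk (tr e i v) = blk (tr e i w)"
  then have "blk (tri e i (tr e i v)) = blk (tri e i (tr e i w))" by (rule tri_blk_cong) (use assms in auto)
  then show "blk v = blk w" by simp
next
  assume "blk v = blk w"
  then show "blk (tr e i v) = blk (tr e i w)"
    unfolding tr_def using blk_U_cong[of v w i] blk_S_cong[of "U i v" "U i w"] assms by simp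
qed

lemma W0_all:
  assumes E: "Rinv E" and W: "W0 E s a b" "s \<in> V" and vw: "v \<in> V" "w \<in> V" "blk v \<noteq> blk w"
  shows "E v w = a"
proof -
  obtain e i where ei: "blk (tr e i v) = blk s" using tr_to_block[OF vw(1) W(2)] .
  then have "blk (tr e i w) \<noteq> blk s" using tr_blk_iff[OF vw(1,2), of e i] vw(3) by metis
  then have "E (tr e i v) (tr e i w) = a" using W(1) ei vw unfolding W0_def by simp
  then show ?thesis using tr_E(1)[OF E vw(1,2)] by simp
qed

text \<open>In the target, pairs deviating from \<open>a\<close> lie inside blocks. So if two
  distinct vertices \<open>u\<close> and \<open>X j u\<close> deviate, \<open>f\<close> keeps
  \<open>v\<close> and \<open>X j v\<close> in one block for every \<open>v\<close>, and
  \<open>j\<close> generates all shifts. Otherwise both digraphs are constant off the diagonal,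
  loops are constant too, and the identity is an isomorphism.\<close>

lemma bpres_of_const:
  assumes E: "Rinv E" "Rinv E'" and f: "iso E E' f"
    and W: "\<And>v w. v \<in> V \<Longrightarrow> w \<in> V \<Longrightarrow> blk v \<noteq> blk w \<Longrightarrow> E v w = a"
    and W': "\<And>v w. v \<in> V \<Longrightarrow> w \<in> V \<Longrightarrow> blk v \<noteq> blk w \<Longrightarrow> E' v w = a"
  obtains f' where "iso E E' f'" "bpres f'"
proof (cases "\<exists>v\<in>V. \<exists>w\<in>V. v \<noteq> w \<and> E v w \<noteq> a")
  case False
  note fp = isoD(1)[OF f]
  have Ea: "E v w = a" if "v \<in> V" "w \<in> V" "v \<noteq> w" for v w using False that by blast
  have Ea': "E' v w = a" if vw: "v \<in> V" "w \<in> V" "v \<noteq> w" for v w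
  proof -
    have "pinv f v \<in> V" "pinv f w \<in> V" "pinv f v \<noteq> pinv f w"
      using vw permutes_inv[OF fp] permutes_inverses(1)[OF fp] by (auto, metis)
    then show ?thesis using Ea isoD(2)[OF f, of "pinv f v" "pinv f w"] permutes_inverses(1)[OF fp] by simp
  qed
  have loop: "E v v = E w w" if vw: "v \<in> V" "w \<in> V" for v w
  proof -
    obtain e i where "blk (tr e i v) = blk w" using tr_to_block[OF vw] .
    then obtain c where "w = X c (tr e i v)" using blk_eqE tr_V(1)[OF vw(1)] vw(2) by blast
    then show ?thesis using RinvD(1)[OF E(1)] tr_E(1)[OF E(1)] vw tr_V by simp
  qed
  have "E v w = E' v w" if vw: "v \<in> V" "w \<in> V" for v w
  proof (cases "v = w")
    case True
    have "E' v v = E (pinv f v) (pinv f v)"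
      using isoD(2)[OF f, of "pinv f v" "pinv f v"] vw permutes_inv[OF fp] permutes_inverses(1)[OF fp] by simp
    also have "\<dots> = E v v" by (rule loop) (use vw permutes_inv[OF fp] in auto)
    finally show ?thesis using True by simp
  qed (use Ea Ea' vw in simp)
  then have "iso E E' id" by (simp add: iso_def permutes_id)
  moreover have "bpres id" by (rule aff_bpres[OF aff_tr(4)])
  ultimately show ?thesis by (rule that)
next
  case True
  note fp = isoD(1)[OF f]
  obtain u w where u: "u \<in> V" "w \<in> V" "u \<noteq> w" "E u w \<noteq> a" using True by blast
  have "blk u = blk w" using W[OF u(1,2)] u(4) by blast
  then obtain j where w: "w = X j u" using blk_eqE u by blast
  have j: "\<not> int p dvd j"
  proof
    assume "int p dvd j"
    then have "X j u = X 0 u" using X_cong[of j 0] by simp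
    then show False using w u by simp
  qed
  have same: "blk (f v) = blk (f v')" if "v \<in> V" "v' \<in> V" "E v v' \<noteq> a" for v v'
    using W'[of "f v" "f v'"] isoD(2)[OF f that(1,2)] that fp by auto
  have step: "blk (f (X j v)) = blk (f v)" if v: "v \<in> V" for v
  proof (cases "sgn u = sgn v")
    case True
    then obtain c k where vu: "v = U k (X c u)" using sgn_eqE[OF _ u(1) v] by blast
    have "E v (X j v) = E (U k (X c u)) (U k (X c (X j u)))" by (simp add: vu tr_commute add.commute)
    also have "\<dots> = E (X c u) (X c (X j u))" by (rule RinvD(2)[OF E(1)]) (use u in auto)
    also have "\<dots> = E u (X j u)" by (rule RinvD(1)[OF E(1)]) (use u in auto)
    finally show ?thesis using same[OF v in_V(1)[OF v]] u w by simp
  next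
    case False
    then have "sgn (S u) = sgn v" using u by auto
    then obtain c k where vu: "v = U k (X c (S u))" using sgn_eqE[OF _ in_V(3)[OF u(1)] v] by blast
    \<comment> \<open>On the other half \<open>S\<close> reverses shifts, so the deviating pair
      appears with its ends exchanged.\<close>
    have "E (X j v) v = E (U k (X (c + j) (S u))) (U k (X (c + j) (S (X j u))))"
      by (simp add: vu tr_commute add.commute)
    also have "\<dots> = E (X (c + j) (S u)) (X (c + j) (S (X j u)))" by (rule RinvD(2)[OF E(1)]) (use u in auto)
    also have "\<dots> = E (S u) (S (X j u))" by (rule RinvD(1)[OF E(1)]) (use u in auto)
    also have "\<dots> = E u (X j u)" by (rule RinvD(3)[OF E(1)]) (use u in auto)
    finally show ?thesis using same[OF in_V(1)[OF v] v] u w by simp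
  qed
  have n: "blk (f (X (j * int n) v)) = blk (f v)" if "v \<in> V" for v n
  proof (induction n)
    case (Suc n)
    have "blk (f (X j (X (j * int n) v))) = blk (f (X (j * int n) v))" by (rule step) (use that in simp)
    then show ?case using Suc by (simp add: algebra_simps)
  qed simp
  have "bpres f" unfolding bpres_def
  proof (intro ballI impI)
    fix v v' assume vv: "v \<in> V" "v' \<in> V" "blk v = blk v'"
    then obtain c where c: "v' = X c v" using blk_eqE by blast
    obtain r where r: "(j * r) mod int p = c mod int p" using X_solve[OF j] .
    have "(j * int (nat (r mod int p))) mod int p = c mod int p" using r by (simp add: mod_simps)
    then have "v' = X (j * int (nat (r mod int p))) v" using X_cong c by metis
    then show "blk (f v) = blk (f v')" using n[OF vv(1), of "nat (r mod int p)"] by metis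
  qed
  then show ?thesis using that f by blast
qed

section \<open>The centralizer of \<open>X\<close> and its action on the blocks\<close>

definition CX :: "(vtx \<Rightarrow> vtx \<Rightarrow> bool) \<Rightarrow> (vtx \<Rightarrow> vtx) set" where
  "CX E = {g \<in> Aut E. \<forall>v a. g (X a v) = X a (g v)}"

lemma CXD: assumes "g \<in> CX E"
  shows "g permutes V" "iso E E g" "g (X a v) = X a (g v)" "v \<in> V \<Longrightarrow> w \<in> V \<Longrightarrow> E (g v) (g w) = E v w" "aff g" "bpres g"
proof -
  show g: "iso E E g" using assms by (simp add: CX_def Aut_def)
  then show "g permutes V" by (rule isoD)
  show *: "g (X a v) = X a (g v)" for a v using assms by (simp add: CX_def)
  show "v \<in> V \<Longrightarrow> w \<in> V \<Longrightarrow> E (g v) (g w) = E v w" using isoD(2)[OF g] by simp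
  show "aff g" unfolding aff_def by (intro ballI exI[of _ 1]) (simp add: *)
  then show "bpres g" by (rule aff_bpres)
qed

lemma perm_group_CX: "perm_group V (CX E)"
  by (rule perm_group_sub[of _ E]) (auto simp: CX_def id_Aut comp_Aut)

lemma blk_CX_iff:
  assumes "g \<in> CX E" "v \<in> V" "w \<in> V" shows "blk (g v) = blk (g w) \<longleftrightarrow> blk v = blk w"
  using bpres_inj[OF CXD(1,6)[OF assms(1)] assms(2,3)] bpresD[OF CXD(6)[OF assms(1)] assms(2,3)] by blast

text \<open>\<open>P\<close> preserves the block of \<open>s\<close> and is transitive on the other
  vertices, so the join to one vertex determines the joins to all.\<close>

lemma exc_W0_of_unif:
  assumes e: "exc E P s" and w: "w \<in> V" "blk w \<noteq> blk s" and u: "unif E s w" "unif E w s"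
  shows "W0 E s (E s w) (E w s)"
  unfolding W0_def
proof (intro ballI impI)
  note ed = excD[OF e]
  fix v' w' assume h: "v' \<in> V" "w' \<in> V" "blk v' = blk s" "blk w' \<noteq> blk s"
  obtain g where g: "g \<in> P" "g w = w'" using ed(8)[OF w(1) h(2) w(2) h(4)] by blast
  note gi = isoD[OF ed(3)[OF g(1), unfolded Aut_def mem_Collect_eq]]
  define u where "u = pinv g v'"
  have gu: "g u = v'" by (simp add: u_def permutes_inverses[OF gi(1)])
  have uV: "u \<in> V" using h(1) permutes_inv[OF gi(1)] by (simp add: u_def)
  have "blk u = blk s" using ed(7)[OF g(1) uV] gu h by simp
  then have "blk s = blk u" by simp
  then obtain c where c: "u = X c s" using blk_eqE[OF _ ed(5) uV] by blast
  have "E v' w' = E u w" "E w' v' = E w u" using gi(2)[OF uV w(1)] gi(2)[OF w(1) uV] g gu by simp_all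
  moreover have "E (X c s) (X 0 w) = E s w" "E (X 0 w) (X c s) = E w s"
    using unifD[OF assms(4)] unifD[OF assms(5)] by blast+
  ultimately show "E v' w' = E s w \<and> E w' v' = E w s" using c by simp
qed

lemma five_prime: "prime (5::nat)"
proof -
  have "\<And>m. m dvd (5::nat) \<Longrightarrow> m = 1 \<or> m = 5"
  proof -
    fix m :: nat assume m: "m dvd 5"
    then have "m \<le> 5" by (rule dvd_imp_le) simp
    then have "m = 0 \<or> m = 1 \<or> m = 2 \<or> m = 3 \<or> m = 4 \<or> m = 5" by auto
    then show "m = 1 \<or> m = 5" using m by auto
  qed
  then show ?thesis by (simp add: prime_nat_iff)
qed

text \<open>The stabilizer \<open>K0\<close> of \<open>s\<close> fixes its block pointwise.
  \<open>P\<close> has orbits of 5 and of 25 points, so 5 divides \<open>card K0\<close>.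
  Conjugation by \<open>X 1\<close> permutes \<open>K0\<close> with fifth power 1, hence the number
  of elements commuting with \<open>X\<close> is divisible by 5; one of them is not the identity,
  and a power of it has order 5.\<close>

lemma exc_commuting:
  assumes e: "exc E P s"
  obtains k where "k \<in> P" "k \<in> CX E" "k \<noteq> id" "\<And>a. k (X a s) = X a s" "k ^^ 5 = id"
proof -
  note ed = excD[OF e]
  note Pd = perm_groupD[OF ed(1)]
  obtain m where m: "card P = 5 ^ m" using ed(2,6) by auto
  define K0 where "K0 = {g\<in>P. g s = s}"
  have K0fix: "g (X a s) = X a s" if "g \<in> K0" for g a
  proof -
    have gP: "g \<in> P" "g s = s" using that by (auto simp: K0_def)
    have cP: "card P = p ^ m" using m ed(6) by simp
    obtain c where c: "\<And>a. g (X a s) = X (a + c) s"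
      using pgroup_block_shift[OF ed(1) cP ed(4) gP(1) ed(5)] ed(7) by blast
    then have "X c s = X 0 s" using gP(2) c[of 0] by simp
    then have "c mod int p = 0" using X_eq_iff[OF ed(5), of c 0] by simp
    then have "(a + c) mod int p = a mod int p" using mod_add_cong[of a "int p" a c 0] by simp
    from X_cong[OF this] show ?thesis using c[of a] by simp
  qed
  have c1: "card P = 5 * card K0"
  proof -
    have "(\<lambda>g. g s) ` P = {w\<in>V. blk w = blk s}"
    proof (intro equalityI subsetI)
      fix w assume "w \<in> (\<lambda>g. g s) ` P"
      then obtain g where "g \<in> P" "w = g s" by blast
      then show "w \<in> {w\<in>V. blk w = blk s}" using ed(7)[of g s] ed(5) Pd(2)[of g] by simp
    next
      fix w assume "w \<in> {w\<in>V. blk w = blk s}"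
      then have "w \<in> (\<lambda>a. X a s) ` {0..<int p}" using block_eq[OF ed(5)] by simp
      then show "w \<in> (\<lambda>g. g s) ` P" using X_in_group[OF ed(1,4)] by blast
    qed
    then show ?thesis using card_orbit_stabilizer[OF ed(1), of "\<lambda>g v. g v" s] card_block[OF ed(5)] ed(6)
      by (simp add: K0_def)
  qed
  obtain w0 where w0: "w0 \<in> V" "blk w0 \<noteq> blk s"
    using blk_U_iff[OF ed(5), of 1 0] in_V(2)[OF ed(5), of 1] by simp
  have c2: "25 dvd card P"
  proof -
    have "(\<lambda>g. g w0) ` P = V - {w\<in>V. blk w = blk s}"
    proof (intro equalityI subsetI)
      fix w assume "w \<in> (\<lambda>g. g w0) ` P"
      then obtain g where "g \<in> P" "w = g w0" by blast
      then show "w \<in> V - {w\<in>V. blk w = blk s}" using ed(7)[of g w0] w0 Pd(2)[of g] by simp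
    next
      fix w assume "w \<in> V - {w\<in>V. blk w = blk s}"
      then have "w \<in> V" "blk w \<noteq> blk s" by auto
      then show "w \<in> (\<lambda>g. g w0) ` P" using ed(8)[OF w0(1) _ w0(2)] by blast
    qed
    moreover have "card (V - {w\<in>V. blk w = blk s}) = 25"
      using card_Diff_subset[of "{w\<in>V. blk w = blk s}" V] finite_V card_block[OF ed(5)] card_V ed(6) by simp
    ultimately have "card P = 25 * card {g\<in>P. g w0 = id w0}"
      using card_orbit_stabilizer[OF ed(1), of "\<lambda>g v. g v" w0] by simp
    then show ?thesis by simp
  qed
  then obtain z where "card P = 25 * z" by (elim dvdE)
  then have "card K0 = 5 * z" using c1 by simp
  then have d5: "5 dvd card K0" by simp
  define \<phi> where "\<phi> g = X 1 \<circ> g \<circ> X (-1)" for g :: "vtx \<Rightarrow> vtx"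
  have \<phi>n: "(\<phi> ^^ n) g = X (int n) \<circ> g \<circ> X (- int n)" for n g
  proof (induction n)
    case (Suc n)
    have "X (- int n - 1) = X (- 1 - int n)" by (rule arg_cong[of _ _ X]) simp
    then show ?case using Suc by (simp add: \<phi>_def fun_eq_iff)
  qed (simp add: fun_eq_iff)
  have \<phi>K: "\<phi> g \<in> K0" if g: "g \<in> K0" for g
  proof -
    have "\<phi> g \<in> P" unfolding \<phi>_def using Pd(4) X_in_group[OF ed(1,4)] g by (simp add: K0_def)
    moreover have "\<phi> g s = s" using K0fix[OF g, of "-1"] by (simp add: \<phi>_def)
    ultimately show ?thesis by (simp add: K0_def)
  qed
  have "[card K0 = card {g\<in>K0. \<phi> g = g}] (mod 5)"
  proof (rule card_fixpoints_cong_prime[OF _ five_prime])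
    show "finite K0" using Pd(5) by (simp add: K0_def)
    show "\<phi> g \<in> K0" if "g \<in> K0" for g by (rule \<phi>K[OF that])
    have "X 5 = X 0" "X (- 5) = X 0" by (rule X_cong, simp add: ed(6))+
    then show "(\<phi> ^^ 5) g = g" for g by (simp add: \<phi>n fun_eq_iff)
  qed
  then have "5 dvd card {g\<in>K0. \<phi> g = g}" using d5 cong_dvd_iff by blast
  moreover have idm: "id \<in> {g\<in>K0. \<phi> g = g}" using Pd(3) by (simp add: K0_def \<phi>_def fun_eq_iff)
  moreover have "finite {g\<in>K0. \<phi> g = g}" using Pd(5) by (simp add: K0_def)
  ultimately have "{g\<in>K0. \<phi> g = g} \<noteq> {id}" by auto
  then obtain g where g: "g \<in> K0" "\<phi> g = g" "g \<noteq> id" using idm by blast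
  have g1: "g (X 1 v) = X 1 (g v)" for v using fun_cong[OF g(2), of "X 1 v"] by (simp add: \<phi>_def)
  have gn: "g (X (int n) v) = X (int n) (g v)" for n v
  proof (induction n)
    case (Suc n)
    have "g (X 1 (X (int n) v)) = X 1 (g (X (int n) v))" by (rule g1)
    then show ?case using Suc by simp
  qed simp
  have gX: "g (X a v) = X a (g v)" for a v
  proof -
    have "X a = X (int (nat (a mod int p)))" by (rule X_cong) simp
    then show ?thesis using gn[of "nat (a mod int p)" v] by simp
  qed
  have gP: "g \<in> P" using g by (simp add: K0_def)
  have ex: "\<exists>n. g ^^ (5 ^ n) = id" using perm_group_pow_card[OF ed(1) gP] m by metis
  define n where "n = (LEAST n. g ^^ (5 ^ n) = id)"
  have n: "g ^^ (5 ^ n) = id" unfolding n_def by (rule LeastI_ex[OF ex])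
  have n0: "n \<noteq> 0" using n g(3) by (cases n) auto
  then have nm: "g ^^ (5 ^ (n - 1)) \<noteq> id" using not_less_Least[of "n - 1" "\<lambda>n. g ^^ (5 ^ n) = id"] by (simp add: n_def)
  define k where "k = g ^^ (5 ^ (n - 1))"
  have "k ^^ 5 = g ^^ (5 ^ (n - 1) * 5)" unfolding k_def by (rule funpow_mult)
  also have "5 ^ (n - 1) * 5 = (5::nat) ^ n" using n0 by (cases n) auto
  finally have k5: "k ^^ 5 = id" using n by (rule trans)
  have pw: "(g ^^ j) (X a v) = X a ((g ^^ j) v)" for j a v by (induction j) (simp_all add: gX)
  have pf: "(g ^^ j) (X a s) = X a s" for j a by (induction j) (simp_all add: K0fix[OF g(1)])
  have kP: "k \<in> P" unfolding k_def by (rule perm_group_funpow[OF ed(1) gP])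
  show ?thesis
  proof (rule that)
    show "k \<in> CX E" using ed(3)[OF kP] pw unfolding CX_def k_def by simp
    show "k \<noteq> id" using nm by (simp add: k_def)
    show "k (X a s) = X a s" for a by (simp add: k_def pf)
  qed (use kP k5 in auto)
qed

text \<open>If \<open>k\<close> fixes every block, then it properly shifts one block while fixing
  that of \<open>s\<close> pointwise. This makes the join between the two uniform, and
  \<open>exc_W0_of_unif\<close> spreads it.\<close>

lemma exc_cases:
  assumes E: "Rinv E" and e: "exc E P s"
  shows "(\<exists>a b. W0 E s a b) \<or> (\<exists>k\<in>CX E. (\<forall>a. k (X a s) = X a s) \<and> k ^^ 5 = id \<and> (\<exists>v\<in>V. blk (k v) \<noteq> blk v))"
proof -
  note ed = excD[OF e]
  obtain k where k: "k \<in> P" "k \<in> CX E" "k \<noteq> id" "\<And>a. k (X a s) = X a s" "k ^^ 5 = id"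
    using exc_commuting[OF e] by blast
  show ?thesis
  proof (cases "\<exists>v\<in>V. blk (k v) \<noteq> blk v")
    case True
    then show ?thesis using k by blast
  next
    case False
    obtain w where kw: "k w \<noteq> w" using k(3) by (auto simp: fun_eq_iff)
    have w: "w \<in> V" using kw permutes_not_in[OF CXD(1)[OF k(2)]] by blast
    then have b: "blk w = blk (k w)" using False by auto
    obtain c where c: "k w = X c w" using blk_eqE[OF b w] w CXD(1)[OF k(2)] perm_V by blast
    have nd: "\<not> int p dvd c"
    proof
      assume "int p dvd c"
      then have "X c w = X 0 w" using X_cong[of c 0] by simp
      then show False using c kw by simp
    qed
    have bw: "blk w \<noteq> blk s"
    proof
      assume "blk w = blk s"
      then have "blk s = blk w" by simp
      then obtain a where "w = X a s" using blk_eqE[OF _ ed(5) w] by blast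
      then show False using kw k(4) by simp
    qed
    have kn: "(k ^^ n) (X a w) = X (a + int n * c) w" for n a
      by (induction n) (simp_all add: CXD(3)[OF k(2)] c algebra_simps)
    have ks: "(k ^^ n) (X a s) = X a s" for n a by (induction n) (simp_all add: k(4))
    have kE: "E ((k ^^ n) u) ((k ^^ n) v) = E u v" if "u \<in> V" "v \<in> V" for n u v
      using CXD(4)[OF perm_group_funpow[OF perm_group_CX k(2)] that] .
    have ex: "\<exists>n. X d w = (k ^^ n) w" for d
    proof -
      obtain r where r: "(c * r) mod int p = d mod int p" using X_solve[OF nd] .
      have "(int (nat (r mod int p)) * c) mod int p = d mod int p" using r by (simp add: mod_simps mult.commute)
      from X_cong[OF this] have "X d w = (k ^^ nat (r mod int p)) w" using kn[of "nat (r mod int p)" 0] by simp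
      then show ?thesis by blast
    qed
    have sw: "E s (X d w) = E s w" "E (X d w) s = E w s" for d
    proof -
      obtain n where n: "X d w = (k ^^ n) w" using ex by blast
      have "(k ^^ n) s = s" using ks[of n 0] by simp
      then show "E s (X d w) = E s w" "E (X d w) s = E w s" using kE[of s w n] kE[of w s n] n ed(5) w by simp_all
    qed
    have "unif E s w" unfolding unif_def
    proof (intro allI)
      fix a b
      have "E (X a s) (X b w) = E (X a s) (X a (X (b - a) w))" by simp
      also have "\<dots> = E s (X (b - a) w)" by (rule RinvD(1)[OF E]) (use ed(5) w in auto)
      finally show "E (X a s) (X b w) = E s w" using sw by simp
    qed
    moreover have "unif E w s" unfolding unif_def
    proof (intro allI)
      fix a b
      have "E (X a w) (X b s) = E (X b (X (a - b) w)) (X b s)" by simp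
      also have "\<dots> = E (X (a - b) w) s" by (rule RinvD(1)[OF E]) (use ed(5) w in auto)
      finally show "E (X a w) (X b s) = E w s" using sw by simp
    qed
    ultimately show ?thesis using exc_W0_of_unif[OF e w bw] by blast
  qed
qed

definition BL :: "(bool \<times> int) set" where "BL = UNIV \<times> {0..<3}"

lemma BL_simps: "finite BL" "card BL = 6" "v \<in> V \<Longrightarrow> blk v \<in> BL"
  using blk_range by (auto simp: BL_def card_cartesian_product)

lemma blk_rep_BL: "b \<in> BL \<Longrightarrow> blk (rep b) = b"
  by (cases b) (simp add: BL_def rep_def blk_pt)

text \<open>On the five blocks other than that of \<open>s\<close> the map \<open>k\<close> is a
  non-trivial permutation with fifth power 1, hence a 5-cycle.\<close>

lemma five_cycle_blocks:
  assumes k: "k \<in> CX E" "\<And>a. k (X a s) = X a s" "k ^^ 5 = id" and m: "v \<in> V" "blk (k v) \<noteq> blk v"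
    and s: "s \<in> V" and w0: "w0 \<in> V" "blk w0 \<noteq> blk s" and w: "w \<in> V" "blk w \<noteq> blk s"
  shows "\<exists>i. blk ((k ^^ i) w0) = blk w"
proof -
  define B where "B = BL - {blk s}"
  have B: "finite B" "card B = 5" using BL_simps s by (simp_all add: B_def)
  have kC: "k ^^ d \<in> CX E" for d by (rule perm_group_funpow[OF perm_group_CX k(1)])
  have kV: "(k ^^ d) u \<in> V" if "u \<in> V" for d u using CXD(1)[OF kC] that by simp
  have ks: "(k ^^ d) s = s" for d by (induction d) (use k(2)[of 0] in simp_all)
  have ns: "blk ((k ^^ d) u) \<noteq> blk s" if u: "u \<in> V" "blk u \<noteq> blk s" for d u
    using blk_CX_iff[OF kC u(1) s, of d] u(2) ks by simp
  have nofix: "blk ((k ^^ d) u) \<noteq> blk u" if u: "u \<in> V" "blk u \<noteq> blk s" and d: "0 < d" "d < 5" for d u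
  proof
    assume fx: "blk ((k ^^ d) u) = blk u"
    define F where "F b = blk ((k ^^ d) (rep b))" for b
    have Fb: "F (blk u) = blk ((k ^^ d) u)" if "u \<in> V" for u
      unfolding F_def using blk_CX_iff[OF kC, of "rep (blk u)" u d] blk_rep[OF that] that by simp
    have Fn: "(F ^^ n) (blk u) = blk ((k ^^ (d * n)) u)" if "u \<in> V" for u n
    proof (induction n)
      case (Suc n)
      have "(F ^^ Suc n) (blk u) = blk ((k ^^ d) ((k ^^ (d * n)) u))" using Suc Fb[OF kV[OF that]] by simp
      then show ?case by (simp add: funpow_add)
    qed simp
    have FB: "F b \<in> B" if "b \<in> B" for b
    proof -
      have "blk (rep b) \<noteq> blk s" using that blk_rep_BL by (auto simp: B_def)
      then show ?thesis using ns[of "rep b" d] BL_simps(3)[OF kV[of "rep b" d]] by (simp add: B_def F_def)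
    qed
    have "[card B = card {b\<in>B. F b = b}] (mod 5)"
    proof (rule card_fixpoints_cong_prime[OF B(1) five_prime FB])
      fix b assume "b \<in> B"
      then have b: "blk (rep b) = b" using blk_rep_BL by (simp add: B_def)
      have "k ^^ (d * 5) = (k ^^ 5) ^^ d" by (simp add: funpow_mult mult.commute)
      then have "k ^^ (d * 5) = id" using k(3) by simp
      then show "(F ^^ 5) b = b" using Fn[of "rep b" 5] b by simp
    qed
    then have "5 dvd card {b\<in>B. F b = b}" using B(2) by (simp add: cong_def dvd_eq_mod_eq_0)
    moreover have "card {b\<in>B. F b = b} > 0"
    proof -
      have "blk u \<in> {b\<in>B. F b = b}" using u fx Fb[OF u(1)] BL_simps(3)[OF u(1)] by (simp add: B_def)
      then show ?thesis using B(1) by (auto simp: card_gt_0_iff)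
    qed
    ultimately have "5 \<le> card {b\<in>B. F b = b}" by (rule dvd_imp_le)
    then have all: "{b\<in>B. F b = b} = B" using B by (intro card_seteq) auto
    have fixall: "blk ((k ^^ (d * n)) v) = blk v" for n
    proof -
      have vs: "blk v \<noteq> blk s"
      proof
        assume "blk v = blk s"
        then have "blk (k v) = blk (k s)" using blk_CX_iff[OF k(1) m(1) s] by simp
        then show False using m(2) \<open>blk v = blk s\<close> k(2)[of 0] by simp
      qed
      then have "blk v \<in> B" using BL_simps(3)[OF m(1)] by (simp add: B_def)
      then have "blk v \<in> {b\<in>B. F b = b}" unfolding all .
      then have "F (blk v) = blk v" by simp
      then have "(F ^^ n) (blk v) = blk v" by (induction n) simp_all
      then show ?thesis using Fn[OF m(1), of n] by simp
    qed
    \<comment> \<open>Inverts \<open>d\<close> modulo 5, in order to return from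
      \<open>k ^^ d\<close> to \<open>k\<close> itself, which moves the block of
      \<open>v\<close>.\<close>
    have "\<exists>n q. d * n = 5 * q + 1"
    proof -
      have "d = 1 \<or> d = 2 \<or> d = 3 \<or> d = 4" using d by auto
      then show ?thesis
      proof (elim disjE)
        assume "d = 1" then have "d * 1 = 5 * 0 + 1" by simp then show ?thesis by blast
      next
        assume "d = 2" then have "d * 3 = 5 * 1 + 1" by simp then show ?thesis by blast
      next
        assume "d = 3" then have "d * 2 = 5 * 1 + 1" by simp then show ?thesis by blast
      next
        assume "d = 4" then have "d * 4 = 5 * 3 + 1" by simp then show ?thesis by blast
      qed
    qed
    then obtain n q where nq: "d * n = 5 * q + 1" by blast
    have "k ^^ (5 * q) = (k ^^ 5) ^^ q" by (simp add: funpow_mult)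
    then have "k ^^ (5 * q) = id" using k(3) by simp
    then have "k ^^ (d * n) = k" unfolding nq by (simp add: funpow_add)
    then show False using fixall[of n] m(2) by simp
  qed
  have inj: "inj_on (\<lambda>i. blk ((k ^^ i) w0)) {..<5}"
  proof (rule linorder_inj_onI)
    fix i j :: nat assume ij: "i < j" "i \<in> {..<5}" "j \<in> {..<5}"
    have "(k ^^ (j - i)) ((k ^^ i) w0) = (k ^^ (j - i + i)) w0" by (simp only: funpow_add comp_apply)
    then have "(k ^^ (j - i)) ((k ^^ i) w0) = (k ^^ j) w0" using ij by simp
    moreover have "0 < j - i" "j - i < 5" using ij by auto
    then have "blk ((k ^^ (j - i)) ((k ^^ i) w0)) \<noteq> blk ((k ^^ i) w0)"
      by (rule nofix[OF kV[OF w0(1)] ns[OF w0]])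
    ultimately show "blk ((k ^^ i) w0) \<noteq> blk ((k ^^ j) w0)" by simp
  qed auto
  have sub: "(\<lambda>i. blk ((k ^^ i) w0)) ` {..<5} \<subseteq> B"
  proof -
    have "blk ((k ^^ i) w0) \<in> B" for i
      using ns[OF w0, of i] BL_simps(3)[OF kV[OF w0(1), of i]] by (simp add: B_def)
    then show ?thesis by blast
  qed
  have "card ((\<lambda>i. blk ((k ^^ i) w0)) ` {..<5}) = card B" using card_image[OF inj] B(2) by simp
  then have "(\<lambda>i. blk ((k ^^ i) w0)) ` {..<5} = B" by (rule card_subset_eq[OF B(1) sub])
  moreover have "blk w \<in> B" using w BL_simps(3) by (simp add: B_def)
  ultimately have "blk w \<in> (\<lambda>i. blk ((k ^^ i) w0)) ` {..<5}" by simp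
  then obtain i where "blk w = blk ((k ^^ i) w0)" by blast
  then show ?thesis by metis
qed

text \<open>\<open>U 1\<close> moves the block of \<open>s\<close>, while the powers of
  \<open>k\<close> fix it and are transitive on the other five; so the action on blocks is
  transitive with a transitive stabilizer.\<close>

lemma two_transitive_blocks:
  assumes E: "Rinv E" and k: "k \<in> CX E" "\<And>a. k (X a s) = X a s" "k ^^ 5 = id" and m: "u \<in> V" "blk (k u) \<noteq> blk u"
    and s: "s \<in> V" and w0: "w0 \<in> V" "blk w0 \<noteq> blk s" and vw: "v \<in> V" "w \<in> V" "blk v \<noteq> blk w"
  shows "\<exists>l\<in>CX E. blk (l s) = blk v \<and> blk (l w0) = blk w"
proof -
  note cyc = five_cycle_blocks[OF k m s]
  have kC: "k ^^ d \<in> CX E" for d by (rule perm_group_funpow[OF perm_group_CX k(1)])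
  have ks: "(k ^^ d) s = s" for d by (induction d) (use k(2)[of 0] in simp_all)
  have UC: "U 1 \<in> CX E" using tr_Aut(2)[OF E, of 1] by (simp add: CX_def tr_commute)
  have Us: "U 1 s \<in> V" "blk (U 1 s) \<noteq> blk s" using blk_U_iff[OF s, of 1 0] s by simp_all
  have "\<exists>l\<in>CX E. blk (l s) = blk v"
  proof (cases "blk v = blk s")
    case True
    then show ?thesis using perm_groupD(3)[OF perm_group_CX, of E] by (intro bexI[of _ id]) auto
  next
    case False
    obtain i where "blk ((k ^^ i) (U 1 s)) = blk v" using cyc[OF Us vw(1) False] by blast
    then show ?thesis using perm_groupD(4)[OF perm_group_CX kC UC, of i] by (intro bexI[of _ "k ^^ i \<circ> U 1"]) auto
  qed
  then obtain l where l: "l \<in> CX E" "blk (l s) = blk v" by blast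
  note li = perm_group_inv[OF perm_group_CX l(1)] perm_group_inv_simps[OF perm_group_CX l(1)]
  have iV: "pinv l w \<in> V" using CXD(1)[OF li(1)] vw by simp
  have "blk (pinv l w) \<noteq> blk s"
  proof
    assume "blk (pinv l w) = blk s"
    then have "blk (l (pinv l w)) = blk (l s)" using blk_CX_iff[OF l(1) iV s] by simp
    then show False using l vw li by simp
  qed
  then obtain j where j: "blk ((k ^^ j) w0) = blk (pinv l w)" using cyc[OF w0 iV] by blast
  have kwV: "(k ^^ j) w0 \<in> V" using CXD(1)[OF kC] w0 by simp
  have "blk (l ((k ^^ j) w0)) = blk (l (pinv l w))" using blk_CX_iff[OF l(1) kwV iV] j by simp
  then have "blk ((l \<circ> k ^^ j) w0) = blk w" using li by simp
  moreover have "blk ((l \<circ> k ^^ j) s) = blk v" using l(2) ks by simp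
  ultimately show ?thesis using perm_groupD(4)[OF perm_group_CX l(1) kC, of j] by blast
qed

section \<open>Height digraphs\<close>

definition heights :: "(vtx \<Rightarrow> vtx \<Rightarrow> bool) \<Rightarrow> (vtx \<Rightarrow> int) \<Rightarrow> (int \<Rightarrow> bool) \<Rightarrow> (int \<Rightarrow> bool) \<Rightarrow> bool" where
  "heights E h C D \<longleftrightarrow> (\<forall>v\<in>V. \<forall>a. 5 dvd (h (X a v) - (h v + a))) \<and>
    (\<forall>x y. 5 dvd (x - y) \<longrightarrow> C x = C y \<and> D x = D y) \<and> (\<forall>x. C (- x) = C x \<and> D (- x) = D x) \<and>
    (\<forall>v\<in>V. \<forall>w\<in>V. E v w = (if blk v = blk w then D (h w - h v) else C (h w - h v)))"

lemma five_dvd_double: "5 dvd (2 * x) \<Longrightarrow> 5 dvd (x :: int)"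
  by presburger

text \<open>By 2-transitivity the arcs between any two blocks are a shift \<open>d v w\<close> of one pattern. Summing
  \<open>d a b + d b c + d c a\<close> over \<open>c\<close> gives an antisymmetric function that is constant on pairs of distinct blocks,
  hence zero modulo 5; so \<open>d\<close> is a coboundary, i.e. a difference of heights.\<close>

lemma heights_of_two_transitive:
  assumes E: "Rinv E" and p5: "p = 5" and s: "s \<in> V" and w0: "w0 \<in> V" "blk w0 \<noteq> blk s"
    and tt: "\<And>v w. v \<in> V \<Longrightarrow> w \<in> V \<Longrightarrow> blk v \<noteq> blk w \<Longrightarrow> \<exists>l\<in>CX E. blk (l s) = blk v \<and> blk (l w0) = blk w"
    and c_def: "c = (\<lambda>j. E s (X j w0))"
    and c_even: "\<And>j. c (- j) = c j"
    and c_inj: "\<And>d d'. (\<And>j. c (j + d) = c (j + d')) \<Longrightarrow> 5 dvd (d - d')"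
  shows "\<exists>h C D. heights E h C D"
proof -
  have c_mod: "c x = c y" if "5 dvd (x - y)" for x y
  proof -
    have "X x = X y" by (rule X_cong) (use that p5 in \<open>simp add: mod_eq_dvd_iff\<close>)
    then show ?thesis by (simp add: c_def)
  qed
  define isd where "isd v w d \<longleftrightarrow> (\<forall>j. E v (X j w) = c (j + d))" for v w d
  have uniq: "5 dvd (d - d')" if "isd v w d" "isd v w d'" for v w d d'
    using that c_inj[of d d'] unfolding isd_def by simp
  have isd_ex: "\<exists>d. isd v w d" if vw: "v \<in> V" "w \<in> V" "blk v \<noteq> blk w" for v w
  proof -
    obtain l where l: "l \<in> CX E" "blk (l s) = blk v" "blk (l w0) = blk w" using tt[OF vw] by blast
    have lV: "l s \<in> V" "l w0 \<in> V" using CXD(1)[OF l(1)] s w0 by auto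
    obtain x where x: "v = X x (l s)" using blk_eqE[OF l(2) lV(1) vw(1)] .
    obtain y where y: "w = X y (l w0)" using blk_eqE[OF l(3) lV(2) vw(2)] .
    have "E v (X j w) = c (j + (y - x))" for j
    proof -
      have "E v (X j w) = E (X x (l s)) (X x (l (X (j + (y - x)) w0)))"
        by (simp add: x y CXD(3)[OF l(1)])
      also have "\<dots> = E (l s) (l (X (j + (y - x)) w0))"
        by (rule RinvD(1)[OF E]) (use CXD(1)[OF l(1)] s w0 in auto)
      also have "\<dots> = E s (X (j + (y - x)) w0)" by (rule CXD(4)[OF l(1)]) (use s w0 in auto)
      finally show ?thesis by (simp add: c_def)
    qed
    then show ?thesis unfolding isd_def by blast
  qed
  define dd where "dd v w = (SOME d. isd v w d)" for v w
  have dd: "isd v w (dd v w)" if "v \<in> V" "w \<in> V" "blk v \<noteq> blk w" for v w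
    unfolding dd_def by (rule someI_ex[OF isd_ex[OF that]])
  have ddX: "5 dvd (dd (X a v) (X b w) - (dd v w + (b - a)))" if vw: "v \<in> V" "w \<in> V" "blk v \<noteq> blk w" for v w a b
  proof (rule uniq)
    show "isd (X a v) (X b w) (dd (X a v) (X b w))" by (rule dd) (use vw in auto)
    show "isd (X a v) (X b w) (dd v w + (b - a))" unfolding isd_def
    proof
      fix j
      have "E (X a v) (X j (X b w)) = E (X a v) (X a (X (j + (b - a)) w))" by simp
      also have "\<dots> = E v (X (j + (b - a)) w)" by (rule RinvD(1)[OF E]) (use vw in auto)
      also have "\<dots> = c (j + (b - a) + dd v w)" using dd[OF vw] unfolding isd_def by blast
      finally show "E (X a v) (X j (X b w)) = c (j + (dd v w + (b - a)))" by (simp add: algebra_simps)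
    qed
  qed
  have ddL: "5 dvd (dd (l v) (l w) - dd v w)" if l: "l \<in> CX E" and vw: "v \<in> V" "w \<in> V" "blk v \<noteq> blk w" for l v w
  proof (rule uniq)
    show "isd (l v) (l w) (dd (l v) (l w))"
      by (rule dd) (use vw CXD(1)[OF l] blk_CX_iff[OF l vw(1,2)] in auto)
    show "isd (l v) (l w) (dd v w)" unfolding isd_def
    proof
      fix j
      have "E (l v) (X j (l w)) = E (l v) (l (X j w))" by (simp add: CXD(3)[OF l])
      also have "\<dots> = E v (X j w)" by (rule CXD(4)[OF l]) (use vw in auto)
      finally show "E (l v) (X j (l w)) = c (j + dd v w)" using dd[OF vw] unfolding isd_def by blast
    qed
  qed
  have SS: "blk (S v) \<noteq> blk (S w)" if "v \<in> V" "w \<in> V" "blk v \<noteq> blk w" for v w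
    using tr_blk_iff[OF that(1,2), of True 0] that(3) by (simp add: tr_def)
  have ddS: "5 dvd (dd (S v) (S w) + dd v w)" if vw: "v \<in> V" "w \<in> V" "blk v \<noteq> blk w" for v w
  proof -
    have "isd (S v) (S w) (- dd v w)" unfolding isd_def
    proof
      fix j
      have "E (S v) (X j (S w)) = E (S v) (S (X (- j) w))" by (simp add: tr_commute)
      also have "\<dots> = E v (X (- j) w)" by (rule RinvD(3)[OF E]) (use vw in auto)
      also have "\<dots> = c (- j + dd v w)" using dd[OF vw] unfolding isd_def by blast
      also have "\<dots> = c (- (- j + dd v w))" by (rule c_even[symmetric])
      finally show "E (S v) (X j (S w)) = c (j + - dd v w)" by simp
    qed
    moreover have "isd (S v) (S w) (dd (S v) (S w))" by (rule dd[OF in_V(3)[OF vw(1)] in_V(3)[OF vw(2)] SS[OF vw]])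
    ultimately show ?thesis using uniq by fastforce
  qed
  \<comment> \<open>By 2-transitivity \<open>dd v w + dd w v\<close> is congruent to
    \<open>z\<close> for all pairs of distinct blocks; \<open>S\<close> negates it, so
    \<open>2 * z\<close> and hence \<open>z\<close> vanish modulo 5.\<close>
  define z where "z = dd s w0 + dd w0 s"
  have sw0: "blk s \<noteq> blk w0" using w0 by simp
  have sumz: "5 dvd (dd v w + dd w v - z)" if vw: "v \<in> V" "w \<in> V" "blk v \<noteq> blk w" for v w
  proof -
    obtain l where l: "l \<in> CX E" "blk (l s) = blk v" "blk (l w0) = blk w" using tt[OF vw] by blast
    have lV: "l s \<in> V" "l w0 \<in> V" using CXD(1)[OF l(1)] s w0 by auto
    obtain x where x: "v = X x (l s)" using blk_eqE[OF l(2) lV(1) vw(1)] .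
    obtain y where y: "w = X y (l w0)" using blk_eqE[OF l(3) lV(2) vw(2)] .
    have bl: "blk (l s) \<noteq> blk (l w0)" "blk (l w0) \<noteq> blk (l s)" using l vw by auto
    have "dd v w + dd w v - z = (dd (X x (l s)) (X y (l w0)) - (dd (l s) (l w0) + (y - x)))
      + (dd (X y (l w0)) (X x (l s)) - (dd (l w0) (l s) + (x - y)))
      + (dd (l s) (l w0) - dd s w0) + (dd (l w0) (l s) - dd w0 s)"
      by (simp add: x y z_def)
    also have "5 dvd \<dots>"
      by (intro dvd_add ddX ddL[OF l(1)] lV bl s w0(1) sw0 sw0[symmetric])
    finally show ?thesis .
  qed
  have "5 dvd z"
  proof -
    have "2 * z = (dd (S s) (S w0) + dd s w0) + (dd (S w0) (S s) + dd w0 s)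
      - (dd (S s) (S w0) + dd (S w0) (S s) - z)" by (simp add: z_def)
    also have "5 dvd \<dots>"
      by (intro dvd_diff dvd_add ddS sumz SS in_V s w0(1) sw0 sw0[symmetric])
    finally show ?thesis by (rule five_dvd_double)
  qed
  have anti: "5 dvd (dd v w + dd w v)" if vw: "v \<in> V" "w \<in> V" "blk v \<noteq> blk w" for v w
    using dvd_add[OF sumz[OF vw] \<open>5 dvd z\<close>] by simp
  define \<tau> where "\<tau> u v w = dd u v + dd v w + dd w u" for u v w
  have \<tau>_cong: "5 dvd (\<tau> u' v' w' - \<tau> u v w)"
    if V: "u \<in> V" "v \<in> V" "w \<in> V" "u' \<in> V" "v' \<in> V" "w' \<in> V"
      and b: "blk u = blk u'" "blk v = blk v'" "blk w = blk w'" and ne: "blk u \<noteq> blk v" "blk v \<noteq> blk w" "blk w \<noteq> blk u"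
    for u v w u' v' w'
  proof -
    obtain x where x: "u' = X x u" using blk_eqE[OF b(1) V(1,4)] .
    obtain y where y: "v' = X y v" using blk_eqE[OF b(2) V(2,5)] .
    obtain t where t: "w' = X t w" using blk_eqE[OF b(3) V(3,6)] .
    have "\<tau> u' v' w' - \<tau> u v w = (dd (X x u) (X y v) - (dd u v + (y - x)))
      + (dd (X y v) (X t w) - (dd v w + (t - y))) + (dd (X t w) (X x u) - (dd w u + (x - t)))"
      by (simp add: \<tau>_def x y t)
    also have "5 dvd \<dots>" by (intro dvd_add ddX V ne)
    finally show ?thesis .
  qed
  have \<tau>_L: "5 dvd (\<tau> (l u) (l v) (l w) - \<tau> u v w)"
    if l: "l \<in> CX E" and V: "u \<in> V" "v \<in> V" "w \<in> V" and ne: "blk u \<noteq> blk v" "blk v \<noteq> blk w" "blk w \<noteq> blk u" for l u v w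
  proof -
    have "\<tau> (l u) (l v) (l w) - \<tau> u v w = (dd (l u) (l v) - dd u v) + (dd (l v) (l w) - dd v w) + (dd (l w) (l u) - dd w u)"
      by (simp add: \<tau>_def)
    also have "5 dvd \<dots>" by (intro dvd_add ddL[OF l] V ne)
    finally show ?thesis .
  qed
  define T where "T a b = (\<Sum>q\<in>BL - {a, b}. \<tau> (rep a) (rep b) (rep q))" for a b
  define T0 where "T0 = (\<Sum>q\<in>BL - {blk s, blk w0}. \<tau> s w0 (rep q))"
  have bs: "blk s \<in> BL" "blk w0 \<in> BL" using BL_simps(3) s w0 by auto
  have TT0: "5 dvd (T a b - T0)" if ab: "a \<in> BL" "b \<in> BL" "a \<noteq> b" for a b
  proof -
    have "blk (rep a) \<noteq> blk (rep b)" using ab blk_rep_BL by simp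
    then obtain l where l: "l \<in> CX E" "blk (l s) = a" "blk (l w0) = b"
      using tt[of "rep a" "rep b"] ab blk_rep_BL by auto
    have lp: "l permutes V" by (rule CXD(1)[OF l(1)])
    define \<mu> where "\<mu> q = blk (l (rep q))" for q
    have \<mu>i: "\<mu> q = \<mu> q' \<longleftrightarrow> q = q'" if "q \<in> BL" "q' \<in> BL" for q q'
      unfolding \<mu>_def using blk_CX_iff[OF l(1), of "rep q" "rep q'"] blk_rep_BL that by simp
    have \<mu>s: "\<mu> q = a \<longleftrightarrow> q = blk s" "\<mu> q = b \<longleftrightarrow> q = blk w0" if "q \<in> BL" for q
      unfolding \<mu>_def using blk_CX_iff[OF l(1), of "rep q" s] blk_CX_iff[OF l(1), of "rep q" w0] blk_rep_BL that l s w0 by simp_all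
    have \<mu>B: "\<mu> q \<in> BL" for q unfolding \<mu>_def by (rule BL_simps(3)) (use lp in simp)
    have bij: "bij_betw \<mu> (BL - {blk s, blk w0}) (BL - {a, b})"
    proof -
      have inj: "inj_on \<mu> (BL - {blk s, blk w0})" by (rule inj_onI) (use \<mu>i in auto)
      have sub: "\<mu> ` (BL - {blk s, blk w0}) \<subseteq> BL - {a, b}"
      proof
        fix r assume "r \<in> \<mu> ` (BL - {blk s, blk w0})"
        then obtain q where q: "q \<in> BL" "q \<noteq> blk s" "q \<noteq> blk w0" "r = \<mu> q" by blast
        then show "r \<in> BL - {a, b}" using \<mu>s[OF q(1)] \<mu>B[of q] by simp
      qed
      have "card (BL - {blk s, blk w0}) = card (BL - {a, b})"
        using ab bs sw0 BL_simps(1) by (simp add: card_Diff_subset)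
      then have "\<mu> ` (BL - {blk s, blk w0}) = BL - {a, b}"
        using BL_simps(1) card_image[OF inj] by (intro card_subset_eq[OF _ sub]) auto
      then show ?thesis using inj by (simp add: bij_betw_def)
    qed
    have "T a b = (\<Sum>q\<in>BL - {blk s, blk w0}. \<tau> (rep a) (rep b) (rep (\<mu> q)))"
      unfolding T_def by (rule sum.reindex_bij_betw[OF bij, symmetric])
    then have "T a b - T0 = (\<Sum>q\<in>BL - {blk s, blk w0}. \<tau> (rep a) (rep b) (rep (\<mu> q)) - \<tau> s w0 (rep q))"
      by (simp add: T0_def sum_subtractf)
    also have "5 dvd \<dots>"
    proof (rule dvd_sum)
      fix q assume q: "q \<in> BL - {blk s, blk w0}"
      then have qB: "q \<in> BL" and bq: "blk (rep q) = q" using blk_rep_BL by auto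
      have V: "l s \<in> V" "l w0 \<in> V" "l (rep q) \<in> V" using lp s w0 by auto
      have "5 dvd (\<tau> (rep a) (rep b) (rep (\<mu> q)) - \<tau> (l s) (l w0) (l (rep q)))"
      proof (rule \<tau>_cong[OF V rep_V rep_V rep_V])
        show "blk (l s) = blk (rep a)" "blk (l w0) = blk (rep b)" using l ab blk_rep_BL by auto
        show "blk (l (rep q)) = blk (rep (\<mu> q))" using blk_rep_BL[OF \<mu>B[of q]] by (simp add: \<mu>_def)
        show "blk (l s) \<noteq> blk (l w0)" using l ab by simp
        show "blk (l w0) \<noteq> blk (l (rep q))" using \<mu>s(2)[OF qB] q l by (auto simp: \<mu>_def)
        show "blk (l (rep q)) \<noteq> blk (l s)" using \<mu>s(1)[OF qB] q l by (auto simp: \<mu>_def)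
      qed
      moreover have "5 dvd (\<tau> (l s) (l w0) (l (rep q)) - \<tau> s w0 (rep q))"
        by (rule \<tau>_L[OF l(1) s w0(1) rep_V sw0]) (use q bq in auto)
      ultimately have "5 dvd ((\<tau> (rep a) (rep b) (rep (\<mu> q)) - \<tau> (l s) (l w0) (l (rep q))) + (\<tau> (l s) (l w0) (l (rep q)) - \<tau> s w0 (rep q)))"
        by (rule dvd_add)
      then show "5 dvd (\<tau> (rep a) (rep b) (rep (\<mu> q)) - \<tau> s w0 (rep q))" by simp
    qed
    finally show ?thesis .
  qed
  have rne: "blk (rep a) \<noteq> blk (rep b)" if "a \<in> BL" "b \<in> BL" "a \<noteq> b" for a b using that blk_rep_BL by simp
  have Tanti: "5 dvd (T a b + T b a)" if ab: "a \<in> BL" "b \<in> BL" "a \<noteq> b" for a b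
  proof -
    have "T a b + T b a = (\<Sum>q\<in>BL - {a, b}. \<tau> (rep a) (rep b) (rep q) + \<tau> (rep b) (rep a) (rep q))"
      by (simp add: T_def sum.distrib insert_commute)
    also have "5 dvd \<dots>"
    proof (rule dvd_sum)
      fix q assume q: "q \<in> BL - {a, b}"
      have "\<tau> (rep a) (rep b) (rep q) + \<tau> (rep b) (rep a) (rep q) =
        (dd (rep a) (rep b) + dd (rep b) (rep a)) + (dd (rep b) (rep q) + dd (rep q) (rep b)) + (dd (rep q) (rep a) + dd (rep a) (rep q))"
        by (simp add: \<tau>_def)
      also have "5 dvd \<dots>" by (intro dvd_add anti rep_V rne) (use q ab in auto)
      finally show "5 dvd (\<tau> (rep a) (rep b) (rep q) + \<tau> (rep b) (rep a) (rep q))" .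
    qed
    finally show ?thesis .
  qed
  have T0: "5 dvd T0"
  proof -
    have "2 * T0 = (T (blk s) (blk w0) + T (blk w0) (blk s)) - (T (blk s) (blk w0) - T0) - (T (blk w0) (blk s) - T0)" by simp
    also have "5 dvd \<dots>" by (intro dvd_diff Tanti TT0 bs sw0 sw0[symmetric])
    finally show ?thesis by (rule five_dvd_double)
  qed
  \<comment> \<open>An average over the six blocks: since 6 is 1 modulo 5, the plain sum already has
    \<open>A a - A b\<close> congruent to the value of \<open>dd\<close> on the representatives of
    \<open>a\<close> and \<open>b\<close>.\<close>
  define A where "A a = (\<Sum>q\<in>BL - {a}. dd (rep a) (rep q))" for a
  have main: "5 dvd (dd (rep a) (rep b) + A b - A a)" if ab: "a \<in> BL" "b \<in> BL" "a \<noteq> b" for a b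
  proof -
    let ?R = "BL - {a, b}"
    have cR: "card ?R = 4" using ab BL_simps by (simp add: card_Diff_subset)
    have Aa: "A a = dd (rep a) (rep b) + (\<Sum>q\<in>?R. dd (rep a) (rep q))"
    proof -
      have "BL - {a} - {b} = ?R" by blast
      then show ?thesis unfolding A_def using ab BL_simps(1) sum.remove[of "BL - {a}" b "\<lambda>q. dd (rep a) (rep q)"] by simp
    qed
    have Ab: "A b = dd (rep b) (rep a) + (\<Sum>q\<in>?R. dd (rep b) (rep q))"
    proof -
      have "BL - {b} - {a} = ?R" by blast
      then show ?thesis unfolding A_def using ab BL_simps(1) sum.remove[of "BL - {b}" a "\<lambda>q. dd (rep b) (rep q)"] by simp
    qed
    have Tab: "T a b = 4 * dd (rep a) (rep b) + (\<Sum>q\<in>?R. dd (rep b) (rep q)) + (\<Sum>q\<in>?R. dd (rep q) (rep a))"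
      using cR by (simp add: T_def \<tau>_def sum.distrib)
    have "5 dvd (\<Sum>q\<in>?R. dd (rep q) (rep a) + dd (rep a) (rep q))"
      by (rule dvd_sum, rule anti[OF rep_V rep_V rne]) (use ab in auto)
    then have an: "5 dvd ((\<Sum>q\<in>?R. dd (rep q) (rep a)) + (\<Sum>q\<in>?R. dd (rep a) (rep q)))" by (simp add: sum.distrib)
    have "dd (rep a) (rep b) + A b - A a = (T a b - T0) + T0 + (dd (rep a) (rep b) + dd (rep b) (rep a))
       - ((\<Sum>q\<in>?R. dd (rep q) (rep a)) + (\<Sum>q\<in>?R. dd (rep a) (rep q))) - 5 * dd (rep a) (rep b)"
      unfolding Aa Ab Tab by simp
    also have "5 dvd \<dots>"
      by (intro dvd_diff dvd_add TT0 T0 anti rep_V rne ab an dvd_triv_left)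
    finally show ?thesis .
  qed
  define h where "h v = snd (snd v) - A (blk v)" for v :: vtx
  have vrep: "v = X (snd (snd v)) (rep (blk v))" if "v \<in> V" for v
    using that by (elim ptE) (simp add: rep_def blk_pt, simp add: pt_def)
  have hX: "5 dvd (h (X a v) - (h v + a))" if "v \<in> V" for v a
    using that
  proof (elim ptE)
    fix e i x assume v: "v = pt e i x"
    have "((x + a) mod int p) mod int p = (x mod int p + a) mod int p" by (simp add: mod_simps)
    then have "int p dvd ((x + a) mod int p - (x mod int p + a))" by (simp only: mod_eq_dvd_iff)
    moreover have "h (X a v) - (h v + a) = (x + a) mod int p - (x mod int p + a)"
      using v by (simp add: h_def blk_pt) (simp add: pt_def)
    moreover have "int p = 5" using p5 by simp
    ultimately show ?thesis by metis
  qed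
  have ddh: "5 dvd (dd v w - (h w - h v))" if vw: "v \<in> V" "w \<in> V" "blk v \<noteq> blk w" for v w
  proof -
    let ?x = "snd (snd v)" and ?y = "snd (snd w)" and ?a = "blk v" and ?b = "blk w"
    have ab: "?a \<in> BL" "?b \<in> BL" using vw BL_simps(3) by auto
    have "dd v w - (h w - h v) = (dd (X ?x (rep ?a)) (X ?y (rep ?b)) - (dd (rep ?a) (rep ?b) + (?y - ?x)))
       + (dd (rep ?a) (rep ?b) + A ?b - A ?a)"
      unfolding vrep[OF vw(1), symmetric] vrep[OF vw(2), symmetric] by (simp add: h_def)
    also have "5 dvd \<dots>" by (intro dvd_add ddX rep_V rne ab vw main)
    finally show ?thesis .
  qed
  define D where "D j = E s (X j s)" for j
  have D_mod: "D x = D y" if "5 dvd (x - y)" for x y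
  proof -
    have "X x = X y" by (rule X_cong) (use that p5 in \<open>simp add: mod_eq_dvd_iff\<close>)
    then show ?thesis by (simp add: D_def)
  qed
  have Dv: "E v (X j v) = D j" if v: "v \<in> V" for v j
  proof -
    have "\<exists>w\<in>V. blk v \<noteq> blk w" using blk_U_iff[OF v, of 1 0] v by (intro bexI[of _ "U 1 v"]) auto
    then obtain w where "w \<in> V" "blk v \<noteq> blk w" by blast
    then obtain l where l: "l \<in> CX E" "blk (l s) = blk v" using tt[OF v] by blast
    have lV: "l s \<in> V" using CXD(1)[OF l(1)] s by simp
    obtain x where x: "v = X x (l s)" using blk_eqE[OF l(2) lV v] .
    have "E v (X j v) = E (X x (l s)) (X x (l (X j s)))" by (simp add: x CXD(3)[OF l(1)] add.commute)
    also have "\<dots> = E (l s) (l (X j s))" by (rule RinvD(1)[OF E]) (use CXD(1)[OF l(1)] s in auto)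
    also have "\<dots> = E s (X j s)" by (rule CXD(4)[OF l(1)]) (use s in auto)
    finally show ?thesis by (simp add: D_def)
  qed
  have D_even: "D (- j) = D j" for j
  proof -
    have "D (- j) = E (S s) (X (- j) (S s))" using Dv[of "S s" "- j"] s by simp
    also have "\<dots> = E (S s) (S (X j s))" by (simp add: tr_commute)
    also have "\<dots> = D j" unfolding D_def by (rule RinvD(3)[OF E]) (use s in auto)
    finally show ?thesis .
  qed
  have "E v w = (if blk v = blk w then D (h w - h v) else c (h w - h v))" if vw: "v \<in> V" "w \<in> V" for v w
  proof (cases "blk v = blk w")
    case True
    obtain a where a: "w = X a v" using blk_eqE[OF True vw] .
    have "E v w = D a" using Dv[OF vw(1)] a by simp
    also have "\<dots> = D (h w - h v)"
      by (rule D_mod) (use hX[OF vw(1), of a] a in \<open>simp add: dvd_diff_commute algebra_simps\<close>)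
    finally show ?thesis using True by simp
  next
    case False
    have "E v (X 0 w) = c (0 + dd v w)" using dd[OF vw False] unfolding isd_def by blast
    also have "\<dots> = c (h w - h v)" by (rule c_mod) (use ddh[OF vw False] in simp)
    finally show ?thesis using False by simp
  qed
  then have "heights E h c D" unfolding heights_def using hX c_mod D_mod c_even D_even by blast
  then show ?thesis by blast
qed

text \<open>A uniform join from \<open>s\<close> to one block becomes uniform both ways by an
  automorphism exchanging the two blocks, which would give \<open>W0\<close>. So the pattern
  \<open>c0\<close> is not constant and, 5 being prime, has no proper period. Its reflection
  symmetry comes from \<open>S\<close>, followed by an element of \<open>CX E\<close> matching the
  blocks again.\<close>

lemma exc_heights:
  assumes E: "Rinv E" and e: "exc E P s" and nW: "\<not> (\<exists>a b. W0 E s a b)"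
  shows "\<exists>h C D. heights E h C D"
proof -
  note ed = excD[OF e]
  note s = ed(5) and p5 = ed(6)
  have "\<exists>k\<in>CX E. (\<forall>a. k (X a s) = X a s) \<and> k ^^ 5 = id \<and> (\<exists>v\<in>V. blk (k v) \<noteq> blk v)"
    using exc_cases[OF E e] nW by blast
  then obtain k u where k: "k \<in> CX E" "\<And>a. k (X a s) = X a s" "k ^^ 5 = id" and m: "u \<in> V" "blk (k u) \<noteq> blk u"
    by blast
  define w1 where "w1 = U 1 s"
  have w1: "w1 \<in> V" "blk w1 \<noteq> blk s" using blk_U_iff[OF s, of 1 0] s by (simp_all add: w1_def)
  note tt = two_transitive_blocks[OF E k m s]
  have nu: "\<not> unif E s w1"
  proof
    assume u: "unif E s w1"
    obtain l where l: "l \<in> CX E" "blk (l s) = blk w1" "blk (l w1) = blk s" using tt[OF w1 w1(1) s w1(2)] by blast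
    have lV: "l s \<in> V" "l w1 \<in> V" using CXD(1)[OF l(1)] s w1 by auto
    have "unif E (l s) (l w1)" using unif_aff_iso[OF CXD(2,5)[OF l(1)] s w1(1)] u by blast
    then have "unif E w1 s" using unif_blk[OF l(2,3) lV w1(1) s] by blast
    then show False using exc_W0_of_unif[OF e w1 u] nW by blast
  qed
  define c0 where "c0 j = E s (X j w1)" for j
  have c0_mod: "c0 x = c0 y" if "5 dvd (x - y)" for x y
  proof -
    have "X x = X y" by (rule X_cong) (use that p5 in \<open>simp add: mod_eq_dvd_iff\<close>)
    then show ?thesis by (simp add: c0_def)
  qed
  have c0_const: False if "\<And>x y. c0 x = c0 y"
  proof -
    have "unif E s w1" unfolding unif_def
    proof (intro allI)
      fix a b
      have "E (X a s) (X b w1) = E (X a s) (X a (X (b - a) w1))" by simp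
      also have "\<dots> = E s (X (b - a) w1)" by (rule RinvD(1)[OF E]) (use s w1 in auto)
      also have "\<dots> = E s (X 0 w1)" using that[of "b - a" 0] by (simp add: c0_def)
      finally show "E (X a s) (X b w1) = E s w1" by simp
    qed
    then show False using nu by blast
  qed
  have c0_inj: "5 dvd (d - d')" if h: "\<And>j. c0 (j + d) = c0 (j + d')" for d d'
  proof (rule ccontr)
    assume nd: "\<not> 5 dvd (d - d')"
    have step: "c0 (x + (d - d')) = c0 x" for x using h[of "x - d'"] by (simp add: algebra_simps)
    have n: "c0 (x + int n * (d - d')) = c0 x" for x n
    proof (induction n)
      case (Suc n)
      have "c0 (x + int (Suc n) * (d - d')) = c0 ((x + int n * (d - d')) + (d - d'))" by (simp add: algebra_simps)
      then show ?case using step Suc by simp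
    qed simp
    have "c0 x = c0 y" for x y
    proof -
      have nd': "\<not> int p dvd (d - d')" using nd p5 by simp
      obtain r where r: "((d - d') * r) mod int p = (y - x) mod int p" using X_solve[OF nd'] .
      have "((d - d') * int (nat (r mod int p))) mod int p = (y - x) mod int p" using r by (simp add: mod_simps)
      then have "int p dvd ((d - d') * int (nat (r mod int p)) - (y - x))" by (simp only: mod_eq_dvd_iff)
      then have "5 dvd ((x + int (nat (r mod int p)) * (d - d')) - y)" using p5 by (simp add: algebra_simps)
      then show ?thesis using c0_mod n[of x "nat (r mod int p)"] by metis
    qed
    then show False by (rule c0_const)
  qed
  have "\<exists>t. \<forall>j. c0 j = c0 (t - j)"
  proof -
    have Sb: "blk (S s) \<noteq> blk (S w1)" using tr_blk_iff[OF s w1(1), of True 0] w1(2) by (simp add: tr_def)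
    obtain l where l: "l \<in> CX E" "blk (l s) = blk (S s)" "blk (l w1) = blk (S w1)"
      using tt[OF w1 in_V(3)[OF s] in_V(3)[OF w1(1)] Sb] by blast
    have lV: "l s \<in> V" "l w1 \<in> V" using CXD(1)[OF l(1)] s w1 by auto
    obtain x where x: "S s = X x (l s)" using blk_eqE[OF l(2) lV(1) in_V(3)[OF s]] .
    obtain y where y: "S w1 = X y (l w1)" using blk_eqE[OF l(3) lV(2) in_V(3)[OF w1(1)]] .
    have "c0 j = c0 (y - x - j)" for j
    proof -
      have "c0 j = E (S s) (S (X j w1))" unfolding c0_def by (rule RinvD(3)[OF E, symmetric]) (use s w1 in auto)
      also have "\<dots> = E (X x (l s)) (X x (l (X (y - x - j) w1)))"
        by (simp add: tr_commute x y CXD(3)[OF l(1)] algebra_simps)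
      also have "\<dots> = E (l s) (l (X (y - x - j) w1))" by (rule RinvD(1)[OF E]) (use CXD(1)[OF l(1)] s w1 in auto)
      also have "\<dots> = E s (X (y - x - j) w1)" by (rule CXD(4)[OF l(1)]) (use s w1 in auto)
      finally show ?thesis by (simp add: c0_def)
    qed
    then show ?thesis by blast
  qed
  then obtain t where t: "\<And>j. c0 j = c0 (t - j)" by blast
  \<comment> \<open>3 is the inverse of 2 modulo 5: moving the base vertex by half of
    \<open>t\<close> centres the symmetry at 0, so that \<open>c\<close> is even.\<close>
  define w0 where "w0 = X (3 * t) w1"
  define c where "c = (\<lambda>j. E s (X j w0))"
  have w0: "w0 \<in> V" "blk w0 \<noteq> blk s" using w1 by (simp_all add: w0_def)
  have cc0: "c j = c0 (j + 3 * t)" for j by (simp add: c_def c0_def w0_def)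
  show ?thesis
  proof (rule heights_of_two_transitive[OF E p5 s w0 _ c_def])
    show "\<exists>l\<in>CX E. blk (l s) = blk v \<and> blk (l w0) = blk w" if "v \<in> V" "w \<in> V" "blk v \<noteq> blk w" for v w
      by (rule tt[OF w0 that])
    show "c (- j) = c j" for j
    proof -
      have "c (- j) = c0 (t - (- j + 3 * t))" unfolding cc0 by (rule t)
      also have "\<dots> = c0 (j + 3 * t)" by (rule c0_mod) simp
      finally show ?thesis by (simp add: cc0)
    qed
    show "5 dvd (d - d')" if "\<And>j. c (j + d) = c (j + d')" for d d'
    proof -
      have "5 dvd ((d + 3 * t) - (d' + 3 * t))"
        by (rule c0_inj) (use that in \<open>simp add: cc0 algebra_simps\<close>)
      then show ?thesis by simp
    qed
  qed
qed

lemma residues5: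
  assumes "\<And>x y :: int. 5 dvd (x - y) \<Longrightarrow> C x = C y" "\<And>x. C (- x) = C x"
  shows "C x = C (if x mod 5 \<in> {0} then 0 else if x mod 5 \<in> {1, 4} then 1 else 2)"
proof -
  have "x mod 5 \<in> {0,1,2,3,4}" by (simp, presburger)
  then have "x mod 5 = 0 \<or> x mod 5 = 1 \<or> x mod 5 = 2 \<or> x mod 5 = 3 \<or> x mod 5 = 4" by blast
  moreover have "C x = C (x mod 5)" by (rule assms(1)) (simp add: mod_eq_dvd_iff[symmetric])
  moreover have "C 4 = C 1" using assms(1)[of 4 "-1"] assms(2)[of 1] by simp
  moreover have "C 3 = C 2" using assms(1)[of 3 "-2"] assms(2)[of 2] by simp
  ultimately show ?thesis by auto
qed

text \<open>Serves as an isomorphism invariant: \<open>heights_iso\<close> recovers from it how many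
  of the values at 1 and 2 are true, for \<open>C\<close> and for \<open>D\<close>. The factor 5
  counts the other blocks.\<close>

lemma heights_degree:
  assumes p5: "p = 5" and h: "heights E h C D" and v: "v \<in> V"
  shows "card {w\<in>V. E v w} = of_bool (D 0) + 2 * of_bool (D 1) + 2 * of_bool (D 2)
    + 5 * (of_bool (C 0) + 2 * of_bool (C 1) + 2 * of_bool (C 2))"
proof -
  \<comment> \<open>Coordinates on \<open>V\<close> given by the block and by the height relative to
    \<open>v\<close>.\<close>
  define g where "g q = X (snd q + h v - h (rep (fst q))) (rep (fst q))" for q
  have hX: "5 dvd (h (X a w) - (h w + a))" if "w \<in> V" for w a using h that unfolding heights_def by blast
  have m: "C x = C y" "D x = D y" if "5 dvd (x - y)" for x y using h that unfolding heights_def by blast+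
  have ev: "C (- x) = C x" "D (- x) = D x" for x using h unfolding heights_def by blast+
  have Evw: "E v w = (if blk v = blk w then D (h w - h v) else C (h w - h v))" if "w \<in> V" for w
    using h v that unfolding heights_def by blast
  have gV: "g q \<in> V" for q by (simp add: g_def)
  have gb: "blk (g q) = fst q" if "fst q \<in> BL" for q using blk_rep_BL[OF that] by (simp add: g_def)
  have gh: "5 dvd (h (g q) - h v - snd q)" for q
    using hX[of "rep (fst q)" "snd q + h v - h (rep (fst q))"] by (simp add: g_def algebra_simps)
  have inj: "inj_on g (BL \<times> {0..<5})"
  proof (rule inj_onI)
    fix q r assume qr: "q \<in> BL \<times> {0..<5}" "r \<in> BL \<times> {0..<5}" "g q = g r"
    then have f: "fst q = fst r" using gb[of q] gb[of r] by auto
    have "5 dvd ((h (g r) - h v - snd r) - (h (g q) - h v - snd q))" by (rule dvd_diff[OF gh gh])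
    then have "5 dvd (snd q - snd r)" using qr(3) by simp
    moreover have "0 \<le> snd q" "snd q < 5" "0 \<le> snd r" "snd r < 5" using qr by auto
    ultimately have "snd q = snd r" by presburger
    then show "q = r" using f by (simp add: prod_eq_iff)
  qed
  have img: "g ` (BL \<times> {0..<5}) = V"
  proof (rule card_subset_eq[OF finite_V])
    show "g ` (BL \<times> {0..<5}) \<subseteq> V" using gV by blast
    show "card (g ` (BL \<times> {0..<5})) = card V"
      using card_image[OF inj] BL_simps card_V p5 by (simp add: card_cartesian_product)
  qed
  have "card {w\<in>V. E v w} = (\<Sum>w\<in>V. of_bool (E v w))"
    using finite_V by (simp add: of_bool_def sum.If_cases Int_def)
  also have "\<dots> = (\<Sum>q\<in>BL \<times> {0..<5}. of_bool (E v (g q)))"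
    unfolding img[symmetric] by (rule sum.reindex_cong[OF inj]) auto
  also have "\<dots> = (\<Sum>q\<in>BL \<times> {0..<5}. of_bool (if blk v = fst q then D (snd q) else C (snd q)))"
  proof (rule sum.cong)
    fix q assume q: "q \<in> BL \<times> {0..<5::int}"
    then have "blk (g q) = fst q" using gb by auto
    then show "of_bool (E v (g q)) = (of_bool (if blk v = fst q then D (snd q) else C (snd q)) :: nat)"
      using Evw[OF gV[of q]] m(1)[of "h (g q) - h v" "snd q"] m(2)[of "h (g q) - h v" "snd q"] gh[of q] by simp
  qed simp
  also have "\<dots> = (\<Sum>b\<in>BL. \<Sum>j\<in>{0..<5}. of_bool (if blk v = b then D j else C j))"
    by (subst sum.cartesian_product) (simp add: case_prod_beta)
  also have "\<dots> = (\<Sum>b\<in>BL. if b = blk v then (\<Sum>j\<in>{0..<5}. of_bool (D j)) else (\<Sum>j\<in>{0..<5}. of_bool (C j)))"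
    by (intro sum.cong) auto
  also have "\<dots> = (\<Sum>j\<in>{0..<5}. of_bool (D j)) + 5 * (\<Sum>j\<in>{0..<5}. of_bool (C j))"
  proof -
    have "BL \<inter> {b. b = blk v} = {blk v}" "BL \<inter> - {b. b = blk v} = BL - {blk v}" using BL_simps(3)[OF v] by auto
    then show ?thesis using BL_simps v by (simp add: sum.If_cases card_Diff_subset)
  qed
  also have "{0..<5::int} = {0, 1, 2, 3, 4}" by auto
  finally have "card {w\<in>V. E v w} = (\<Sum>j\<in>{0,1,2,3,4}. of_bool (D j)) + 5 * (\<Sum>j\<in>{0,1,2,3,4::int}. of_bool (C j))" .
  moreover have "C 4 = C 1" "C 3 = C 2" "D 4 = D 1" "D 3 = D 2"
    using m[of 4 "-1"] m[of 3 "-2"] ev[of 1] ev[of 2] by auto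
  ultimately show ?thesis by simp
qed

text \<open>Distinguishes the height digraphs in which \<open>C\<close> and \<open>D\<close> agree off 0, whose blocks are not determined by the digraph.\<close>

definition twin :: "(vtx \<Rightarrow> vtx \<Rightarrow> bool) \<Rightarrow> bool" where
  "twin E \<longleftrightarrow> (\<exists>v\<in>V. \<exists>w\<in>V. v \<noteq> w \<and> (\<forall>t\<in>V. t \<noteq> v \<longrightarrow> t \<noteq> w \<longrightarrow> E v t = E w t))"

lemma twin_iso: assumes f: "iso E E' f" and t: "twin E" shows "twin E'"
proof -
  note fp = isoD(1)[OF f]
  obtain v w where vw: "v \<in> V" "w \<in> V" "v \<noteq> w" "\<And>t. t \<in> V \<Longrightarrow> t \<noteq> v \<Longrightarrow> t \<noteq> w \<Longrightarrow> E v t = E w t"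
    using t unfolding twin_def by blast
  have "E' (f v) t = E' (f w) t" if tt: "t \<in> V" "t \<noteq> f v" "t \<noteq> f w" for t
  proof -
    define u where "u = pinv f t"
    have u: "f u = t" "u \<in> V" using tt permutes_inverses(1)[OF fp] permutes_inv[OF fp] by (auto simp: u_def)
    have "u \<noteq> v" "u \<noteq> w" using u tt by auto
    then have "E v u = E w u" by (rule vw(4)[OF u(2)])
    then show ?thesis using isoD(2)[OF f vw(1) u(2)] isoD(2)[OF f vw(2) u(2)] u by simp
  qed
  moreover have "f v \<noteq> f w" using vw(3) injD[OF permutes_inj[OF fp]] by blast
  moreover have "f v \<in> V" "f w \<in> V" using vw fp by auto
  ultimately show ?thesis unfolding twin_def by blast
qed

text \<open>If \<open>C\<close> and \<open>D\<close> agree off 0, two vertices of equal height in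
  different blocks have the same arcs to all other vertices. Conversely twins have equal height,
  since otherwise a third block would show a non-zero period of \<open>C\<close>; they then lie in
  different blocks, and the vertex \<open>X 1 v\<close> compares \<open>D 1\<close> with
  \<open>C 1\<close>.\<close>

lemma heights_twin:
  assumes p5: "p = 5" and h: "heights E h C D" and C12: "C 1 \<noteq> C 2" and D12: "D 1 \<noteq> D 2"
  shows "twin E \<longleftrightarrow> C 1 = D 1"
proof -
  have hX: "5 dvd (h (X a w) - (h w + a))" if "w \<in> V" for w a using h that unfolding heights_def by blast
  have m: "C x = C y" "D x = D y" if "5 dvd (x - y)" for x y using h that unfolding heights_def by blast+
  have ev: "C (- x) = C x" "D (- x) = D x" for x using h unfolding heights_def by blast+
  have Evw: "E v w = (if blk v = blk w then D (h w - h v) else C (h w - h v))" if "v \<in> V" "w \<in> V" for v w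
    using h that unfolding heights_def by blast
  note rC = residues5[of C, OF m(1) ev(1)] and rD = residues5[of D, OF m(2) ev(2)]
  have hit: "\<exists>t\<in>V. blk t = b \<and> 5 dvd (h t - x)" if "b \<in> BL" for b x
  proof -
    have "5 dvd (h (X (x - h (rep b)) (rep b)) - x)" using hX[of "rep b" "x - h (rep b)"] by simp
    then show ?thesis using blk_rep_BL[OF that] by (intro bexI[of _ "X (x - h (rep b)) (rep b)"]) auto
  qed
  have sameblk: "v = w" if vwq: "v \<in> V" "w \<in> V" "blk v = blk w" "5 dvd (h v - h w)" for v w
  proof -
    obtain a where a: "w = X a v" using blk_eqE[OF vwq(3,1,2)] .
    have "5 dvd ((h v - h w) + (h (X a v) - (h v + a)))" by (rule dvd_add[OF vwq(4) hX[OF vwq(1)]])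
    then have "5 dvd a" using a by simp
    then have "X a = X 0" using X_cong[of a 0] p5 by simp
    then show ?thesis using a by simp
  qed
  show ?thesis
  proof
    assume e: "C 1 = D 1"
    have "C 2 = D 2" using e C12 D12 by auto
    then have CD: "C x = D x" if "\<not> 5 dvd x" for x
      using rC[of x] rD[of x] e that by (auto simp: dvd_eq_mod_eq_0)
    define v where "v = rep (False, 0)"
    have v: "v \<in> V" "blk v = (False, 0)" using blk_rep_BL[of "(False, 0)"] by (simp_all add: v_def BL_def)
    obtain w where w: "w \<in> V" "blk w = (True, 0)" "5 dvd (h w - h v)" using hit[of "(True, 0)" "h v"] by (auto simp: BL_def)
    have "E v t = E w t" if t: "t \<in> V" "t \<noteq> v" "t \<noteq> w" for t
    proof (cases "5 dvd (h t - h v)")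
      case True
      then have "5 dvd ((h t - h v) - (h w - h v))" using w(3) by (rule dvd_diff)
      then have tw: "5 dvd (h t - h w)" by simp
      then have "blk t \<noteq> blk v" "blk t \<noteq> blk w" using sameblk[OF t(1) v(1)] sameblk[OF t(1) w(1)] t True by auto
      moreover have "C (h t - h v) = C (h t - h w)" by (rule m(1)) (use w(3) in simp)
      ultimately show ?thesis using Evw[OF v(1) t(1)] Evw[OF w(1) t(1)] by simp
    next
      case False
      have "C (h t - h v) = C (h t - h w)" by (rule m(1)) (use w(3) in simp)
      moreover have "\<not> 5 dvd (h t - h w)"
      proof
        assume "5 dvd (h t - h w)"
        then have "5 dvd ((h t - h w) + (h w - h v))" using w(3) by (rule dvd_add)
        then show False using False by simp
      qed
      ultimately show ?thesis using CD[OF False] CD[of "h t - h w"] Evw[OF v(1) t(1)] Evw[OF w(1) t(1)] by simp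
    qed
    moreover have "v \<noteq> w" using v w by auto
    ultimately show "twin E" unfolding twin_def using v w by blast
  next
    assume "twin E"
    then obtain v w where vw: "v \<in> V" "w \<in> V" "v \<noteq> w" "\<And>t. t \<in> V \<Longrightarrow> t \<noteq> v \<Longrightarrow> t \<noteq> w \<Longrightarrow> E v t = E w t"
      unfolding twin_def by blast
    have "5 dvd (h w - h v)"
    proof (rule ccontr)
      assume nd: "\<not> 5 dvd (h w - h v)"
      have "card (BL - {blk v, blk w}) \<noteq> 0"
        using diff_card_le_card_Diff[of "{blk v, blk w}" BL] BL_simps(2) card_insert_le_m1[of 2 "{blk w}" "blk v"] by simp
      then have "BL - {blk v, blk w} \<noteq> {}" using card.empty by metis
      then obtain b where b: "b \<in> BL" "b \<noteq> blk v" "b \<noteq> blk w" by blast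
      have Ceq: "C (x - h v) = C (x - h w)" for x
      proof -
        obtain t where t: "t \<in> V" "blk t = b" "5 dvd (h t - x)" using hit[OF b(1)] by blast
        have "E v t = E w t" by (rule vw(4)[OF t(1)]) (use t b in auto)
        then have "C (h t - h v) = C (h t - h w)" using Evw[OF vw(1) t(1)] Evw[OF vw(2) t(1)] t b by simp
        moreover have "C (h t - h v) = C (x - h v)" "C (h t - h w) = C (x - h w)" by (rule m(1), use t in simp)+
        ultimately show ?thesis by simp
      qed
      define d where "d = h w - h v"
      have per: "C (x + d) = C x" for x using Ceq[of "x + h w"] by (simp add: d_def algebra_simps)
      have p2: "C (x + d + d) = C x" for x using per[of "x + d"] per[of x] by simp
      have "d mod 5 \<noteq> 0" using nd by (simp add: d_def dvd_eq_mod_eq_0)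
      then have "d mod 5 = 1 \<or> d mod 5 = 2 \<or> d mod 5 = 3 \<or> d mod 5 = 4" by presburger
      then have "C 1 = C 2"
      proof (elim disjE)
        assume "d mod 5 = 1"
        then have "5 dvd ((1 + d) - 2)" by presburger
        from m(1)[OF this] show ?thesis using per[of 1] by simp
      next
        assume "d mod 5 = 4"
        then have "5 dvd ((2 + d) - 1)" by presburger
        from m(1)[OF this] show ?thesis using per[of 2] by simp
      next
        assume "d mod 5 = 2"
        then have "5 dvd ((- 1 + d + d) - (- 2))" by presburger
        from m(1)[OF this] show ?thesis using p2[of "- 1"] ev by simp
      next
        assume "d mod 5 = 3"
        then have "5 dvd ((- 2 + d + d) - (- 1))" by presburger
        from m(1)[OF this] show ?thesis using p2[of "- 2"] ev by simp
      qed
      then show False using C12 by blast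
    qed
    then have vwh: "5 dvd (h w - h v)" .
    have bn: "blk v \<noteq> blk w" using sameblk[OF vw(1,2)] vw(3) vwh by (metis dvd_diff_commute)
    define t where "t = X 1 v"
    have tV: "t \<in> V" "blk t = blk v" using vw by (simp_all add: t_def)
    have ht: "5 dvd (h t - h v - 1)" using hX[OF vw(1), of 1] by (simp add: t_def algebra_simps)
    have "t \<noteq> v" using X_eq_iff[OF vw(1), of 1 0] p_gt1 by (simp add: t_def)
    then have "E v t = E w t" by (rule vw(4)[OF tV(1)]) (use tV bn in auto)
    moreover have "E v t = D (h t - h v)" using Evw[OF vw(1) tV(1)] tV by simp
    moreover have "E w t = C (h t - h w)" using Evw[OF vw(2) tV(1)] tV bn by simp
    moreover have "D (h t - h v) = D 1" by (rule m(2)) (use ht in simp)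
    moreover have "C (h t - h w) = C 1"
    proof (rule m(1))
      have "5 dvd ((h t - h v - 1) - (h w - h v))" by (rule dvd_diff[OF ht vwh])
      then show "5 dvd (h t - h w - 1)" by (simp add: algebra_simps)
    qed
    ultimately show "C 1 = D 1" by simp
  qed
qed

text \<open>Each vertex is shifted inside its block until its new height is \<open>m\<close> times
  the old one. Equality of blocks is untouched, so only the functions of the height difference have
  to correspond.\<close>

lemma heights_scale:
  assumes p5: "p = 5" and E: "heights E h C D" "heights E' h' C' D'"
    and m: "\<not> 5 dvd m" "\<And>x. C' (m * x) = C x" "\<And>x. D' (m * x) = D x"
  obtains f' where "iso E E' f'" "bpres f'"
proof -
  have hX: "5 dvd (h (X a w) - (h w + a))" "5 dvd (h' (X a w) - (h' w + a))" if "w \<in> V" for w a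
    using E that unfolding heights_def by blast+
  have m': "C' x = C' y" "D' x = D' y" if "5 dvd (x - y)" for x y using E(2) that unfolding heights_def by blast+
  define f where "f v = (if v \<in> V then X (m * h v - h' v) v else v)" for v
  have f: "f v = X (m * h v - h' v) v" if "v \<in> V" for v using that by (simp add: f_def)
  have fV: "f v \<in> V" "blk (f v) = blk v" if "v \<in> V" for v using f[OF that] that by simp_all
  have fh: "5 dvd (h' (f v) - m * h v)" if "v \<in> V" for v
    using hX(2)[OF that, of "m * h v - h' v"] f[OF that] by simp
  have inj: "v = w" if vw: "v \<in> V" "w \<in> V" "f v = f w" for v w
  proof -
    have "blk v = blk w" using fV(2)[OF vw(1)] fV(2)[OF vw(2)] vw(3) by simp
    then obtain a where a: "w = X a v" using blk_eqE vw(1,2) by blast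
    have "5 dvd ((h' (f v) - m * h v) - (h' (f w) - m * h w))" by (rule dvd_diff[OF fh[OF vw(1)] fh[OF vw(2)]])
    then have "5 dvd (m * (h w - h v))" using vw(3) by (simp add: algebra_simps)
    moreover have "prime (5::int)" using five_prime by (metis of_nat_numeral prime_nat_int_transfer)
    ultimately have "5 dvd (h w - h v)" using m(1) by (simp add: prime_dvd_mult_iff)
    then have "5 dvd ((h w - h v) - (h (X a v) - (h v + a)))" using hX(1)[OF vw(1)] by (rule dvd_diff)
    then have "5 dvd a" using a by simp
    then have "X a = X 0" using X_cong[of a 0] p5 by simp
    then show ?thesis using a by simp
  qed
  have "f permutes V"
  proof (rule inj_imp_permutes)
    show "inj_on f V" by (rule inj_onI, rule inj)
    show "f v \<in> V" if "v \<in> V" for v by (rule fV(1)[OF that])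
    show "f v = v" if "v \<notin> V" for v using that by (simp add: f_def)
  qed (rule finite_V)
  moreover have "E v w = E' (f v) (f w)" if vw: "v \<in> V" "w \<in> V" for v w
  proof -
    have "5 dvd ((h' (f w) - m * h w) - (h' (f v) - m * h v))" by (rule dvd_diff[OF fh[OF vw(2)] fh[OF vw(1)]])
    then have d: "5 dvd ((h' (f w) - h' (f v)) - m * (h w - h v))" by (simp add: algebra_simps)
    have "E v w = (if blk v = blk w then D (h w - h v) else C (h w - h v))"
      using E(1) vw unfolding heights_def by blast
    also have "\<dots> = (if blk v = blk w then D' (h' (f w) - h' (f v)) else C' (h' (f w) - h' (f v)))"
      using m'[OF d] m(2,3) by simp
    also have "\<dots> = E' (f v) (f w)" using E(2) fV[OF vw(1)] fV[OF vw(2)] unfolding heights_def by simp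
    finally show ?thesis .
  qed
  ultimately have "iso E E' f" unfolding iso_def by blast
  moreover have "bpres f" unfolding bpres_def using fV(2) by simp
  ultimately show ?thesis by (rule that)
qed

text \<open>Multiplication by 2 modulo 5 exchanges the classes of 1, 4 and of 2, 3, on each of which
  an even function is constant.\<close>

lemma scale_two:
  assumes C: "\<And>x y :: int. 5 dvd (x - y) \<Longrightarrow> C x = C y" "\<And>x. C (- x) = C x"
    and C': "\<And>x y :: int. 5 dvd (x - y) \<Longrightarrow> C' x = C' y" "\<And>x. C' (- x) = C' x"
    and e: "C' 0 = C 0" "C' 2 = C 1" "C' 1 = C 2"
  shows "C' (2 * x) = C x"
proof -
  note r = residues5[of C x, OF C] residues5[of C' "2 * x", OF C']
  have "x mod 5 = 0 \<or> x mod 5 = 1 \<or> x mod 5 = 2 \<or> x mod 5 = 3 \<or> x mod 5 = 4" by presburger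
  then consider "x mod 5 = 0" "(2 * x) mod 5 = 0" | "x mod 5 \<in> {1, 4}" "(2 * x) mod 5 \<in> {2, 3}"
    | "x mod 5 \<in> {2, 3}" "(2 * x) mod 5 \<in> {1, 4}"
  proof (elim disjE)
    assume "x mod 5 = 0" moreover have "(2 * x) mod 5 = 0" using calculation by presburger
    ultimately show thesis using that by simp
  next
    assume "x mod 5 = 1" moreover have "(2 * x) mod 5 = 2" using calculation by presburger
    ultimately show thesis using that by simp
  next
    assume "x mod 5 = 2" moreover have "(2 * x) mod 5 = 4" using calculation by presburger
    ultimately show thesis using that by simp
  next
    assume "x mod 5 = 3" moreover have "(2 * x) mod 5 = 1" using calculation by presburger
    ultimately show thesis using that by simp
  next
    assume "x mod 5 = 4" moreover have "(2 * x) mod 5 = 3" using calculation by presburger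
    ultimately show thesis using that by simp
  qed
  then show ?thesis
  proof cases
    case 1
    have "C x = C 0" by (rule C(1)) (use 1(1) in presburger)
    moreover have "C' (2 * x) = C' 0" by (rule C'(1)) (use 1(2) in presburger)
    ultimately show ?thesis using e by simp
  next
    case 2
    have "C x = C 1" by (rule trans[OF r(1)]) (use 2 in auto)
    moreover have "C' (2 * x) = C' 2" by (rule trans[OF r(2)]) (use 2(2) in auto)
    ultimately show ?thesis using e by simp
  next
    case 3
    have "C x = C 2" by (rule trans[OF r(1)]) (use 3 in auto)
    moreover have "C' (2 * x) = C' 1" by (rule trans[OF r(2)]) (use 3(2) in auto)
    ultimately show ?thesis using e by simp
  qed
qed

lemma scale_one:
  assumes C: "\<And>x y :: int. 5 dvd (x - y) \<Longrightarrow> C x = C y" "\<And>x. C (- x) = C x"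
    and C': "\<And>x y :: int. 5 dvd (x - y) \<Longrightarrow> C' x = C' y" "\<And>x. C' (- x) = C' x"
    and e: "C' 0 = C 0" "C' 1 = C 1" "C' 2 = C 2"
  shows "C' (1 * x) = C x"
proof -
  define r :: int where "r = (if x mod 5 \<in> {0} then 0 else if x mod 5 \<in> {1, 4} then 1 else 2)"
  have "C x = C r" "C' x = C' r" using residues5[of C x, OF C] residues5[of C' x, OF C'] by (simp_all only: r_def)
  moreover have "C r = C' r" using e by (simp add: r_def)
  ultimately show ?thesis by simp
qed

text \<open>Loops give \<open>D 0\<close>. Out-degrees give \<open>C 0\<close> and, up to exchanging
  1 and 2, the other values of \<open>C\<close> and of \<open>D\<close>. When both exchanges are
  visible, \<open>twin\<close> shows that they happen together, and then they are realized by
  doubling heights.\<close>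

lemma heights_iso:
  assumes p5: "p = 5" and f: "iso E E' f" and E: "heights E h C D" "heights E' h' C' D'"
  obtains f' where "iso E E' f'" "bpres f'"
proof -
  note fp = isoD(1)[OF f]
  define v where "v = rep (False, 0)"
  have v: "v \<in> V" by (simp add: v_def)
  have fv: "f v \<in> V" using v fp by simp
  have D0: "D' 0 = D 0"
  proof -
    have "E v v = D 0" using E(1) v unfolding heights_def by simp
    moreover have "E' (f v) (f v) = D' 0" using E(2) fv unfolding heights_def by simp
    ultimately show ?thesis using isoD(2)[OF f v v] by simp
  qed
  have "f ` {w\<in>V. E v w} = {w\<in>V. E' (f v) w}"
  proof (intro equalityI subsetI)
    fix w assume "w \<in> f ` {w\<in>V. E v w}"
    then obtain u where "u \<in> V" "E v u" "w = f u" by blast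
    then show "w \<in> {w\<in>V. E' (f v) w}" using isoD(2)[OF f v, of u] fp by simp
  next
    fix w assume "w \<in> {w\<in>V. E' (f v) w}"
    then have w: "w \<in> V" "E' (f v) w" by auto
    have "pinv f w \<in> V" using w permutes_inv[OF fp] by simp
    moreover have "f (pinv f w) = w" using permutes_inverses(1)[OF fp] .
    ultimately show "w \<in> f ` {w\<in>V. E v w}" using isoD(2)[OF f v, of "pinv f w"] w by (intro image_eqI[of _ _ "pinv f w"]) auto
  qed
  moreover have "card (f ` {w\<in>V. E v w}) = card {w\<in>V. E v w}"
    by (rule card_image[OF inj_on_subset[OF permutes_inj_on[OF fp, of UNIV]]]) simp
  ultimately have "card {w\<in>V. E v w} = card {w\<in>V. E' (f v) w}" by simp
  then have eq: "2 * (of_bool (D 1) + of_bool (D 2)) + 5 * (of_bool (C 0) + 2 * (of_bool (C 1) + of_bool (C 2)))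
     = 2 * (of_bool (D' 1) + of_bool (D' 2)) + 5 * (of_bool (C' 0) + 2 * (of_bool (C' 1) + of_bool (C' 2)) :: nat)"
    using heights_degree[OF p5 E(1) v] heights_degree[OF p5 E(2) fv] D0 by simp
  have b: "(of_bool x :: nat) \<le> 1" for x by simp
  \<comment> \<open>Parity determines \<open>z\<close>; what is left is \<open>d + 5 * c\<close>
    with \<open>d\<close> at most 2.\<close>
  have ar: "z = z' \<and> c = c' \<and> d = d'"
    if h: "2 * d + 5 * (z + 2 * c) = 2 * d' + 5 * (z' + 2 * c')" "d \<le> 2" "d' \<le> 2" "c \<le> 2" "c' \<le> 2" "z \<le> 1" "z' \<le> 1"
    for d z c d' z' c' :: nat
  proof -
    have "z = 0 \<or> z = 1" "z' = 0 \<or> z' = 1" using h by auto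
    moreover have "even (z + z')" using arg_cong[OF h(1), of even] by auto
    ultimately have z: "z = z'" by auto
    have "d = 0 \<or> d = 1 \<or> d = 2" "d' = 0 \<or> d' = 1 \<or> d' = 2" using h by auto
    then show ?thesis using h(1) z by (auto; presburger)
  qed
  have "(of_bool (C 0) :: nat) = of_bool (C' 0) \<and> (of_bool (C 1) + of_bool (C 2) :: nat) = of_bool (C' 1) + of_bool (C' 2)
     \<and> (of_bool (D 1) + of_bool (D 2) :: nat) = of_bool (D' 1) + of_bool (D' 2)"
    by (rule ar[OF eq]) (auto simp: of_bool_def)
  then have C0: "C' 0 = C 0" and Cs: "(C 1 = C' 1 \<and> C 2 = C' 2) \<or> (C 1 = C' 2 \<and> C 2 = C' 1)"
    and Ds: "(D 1 = D' 1 \<and> D 2 = D' 2) \<or> (D 1 = D' 2 \<and> D 2 = D' 1)"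
    by (auto simp: of_bool_def split: if_splits)
  have tw: "C 1 = D 1 \<longleftrightarrow> C' 1 = D' 1" if "C 1 \<noteq> C 2" "D 1 \<noteq> D 2"
  proof -
    have "C' 1 \<noteq> C' 2" "D' 1 \<noteq> D' 2" using that Cs Ds by auto
    then show ?thesis
      using heights_twin[OF p5 E(1) that] heights_twin[OF p5 E(2)] twin_iso[OF f] twin_iso[OF iso_pinv[OF f]] by blast
  qed
  have or: "(C 1 = C' 1 \<and> C 2 = C' 2 \<and> D 1 = D' 1 \<and> D 2 = D' 2) \<or> (C 1 = C' 2 \<and> C 2 = C' 1 \<and> D 1 = D' 2 \<and> D 2 = D' 1)"
    using Cs Ds tw by argo
  have m: "C x = C y" "D x = D y" "C' x = C' y" "D' x = D' y" if "5 dvd (x - y)" for x y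
    using E that unfolding heights_def by blast+
  have ev: "C (- x) = C x" "D (- x) = D x" "C' (- x) = C' x" "D' (- x) = D' x" for x
    using E unfolding heights_def by blast+
  from or show ?thesis
  proof
    assume a: "C 1 = C' 1 \<and> C 2 = C' 2 \<and> D 1 = D' 1 \<and> D 2 = D' 2"
    show ?thesis
    proof (rule heights_scale[OF p5 E])
      show "\<not> 5 dvd (1::int)" by simp
      show "C' (1 * x) = C x" for x by (rule scale_one[where C = C and C' = C', OF m(1) ev(1) m(3) ev(3)]) (use a C0 in auto)
      show "D' (1 * x) = D x" for x by (rule scale_one[where C = D and C' = D', OF m(2) ev(2) m(4) ev(4)]) (use a D0 in auto)
    qed (rule that)
  next
    assume a: "C 1 = C' 2 \<and> C 2 = C' 1 \<and> D 1 = D' 2 \<and> D 2 = D' 1"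
    show ?thesis
    proof (rule heights_scale[OF p5 E])
      show "\<not> 5 dvd (2::int)" by simp
      show "C' (2 * x) = C x" for x by (rule scale_two[where C = C and C' = C', OF m(1) ev(1) m(3) ev(3)]) (use a C0 in auto)
      show "D' (2 * x) = D x" for x by (rule scale_two[where C = D and C' = D', OF m(2) ev(2) m(4) ev(4)]) (use a D0 in auto)
    qed (rule that)
  qed
qed

text \<open>The block of \<open>f s\<close> is its orbit under \<open>X 1\<close>, that is, the
  image under \<open>f\<close> of the orbit of \<open>s\<close> under a conjugate lying in
  \<open>P\<close>; the latter orbit stays in the block of \<open>s\<close>.\<close>

lemma exc_block_image:
  assumes e: "exc E P s" and f: "f permutes V" "pinv f \<circ> X 1 \<circ> f \<in> P" and v: "v \<in> V"
  shows "blk (f v) = blk (f s) \<longleftrightarrow> blk v = blk s"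
proof -
  note ed = excD[OF e]
  note s = ed(5)
  have fs: "f s \<in> V" using s f by simp
  define y where "y = pinv f \<circ> X 1 \<circ> f"
  have fy: "f (y w) = X 1 (f w)" for w by (simp add: y_def permutes_inverses[OF f(1)])
  have yP: "y \<in> P" using f by (simp add: y_def)
  have yn: "f ((y ^^ n) s) = X (int n) (f s)" for n
    by (induction n) (simp_all add: fy add.commute)
  let ?B = "{w\<in>V. blk w = blk s}" and ?C = "{w\<in>V. blk w = blk (f s)}"
  have sub: "?C \<subseteq> f ` ?B"
  proof
    fix w assume "w \<in> ?C"
    then have "w \<in> (\<lambda>a. X a (f s)) ` {0..<int p}" using block_eq[OF fs] by simp
    then obtain a where a: "w = X a (f s)" "0 \<le> a" by auto
    have "w = f ((y ^^ nat a) s)" using yn[of "nat a"] a by simp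
    moreover have "y ^^ nat a \<in> P" by (rule perm_group_funpow[OF ed(1) yP])
    then have "blk ((y ^^ nat a) s) = blk s" "(y ^^ nat a) s \<in> V" using ed(7)[OF _ s] perm_groupD(2)[OF ed(1)] s by auto
    ultimately show "w \<in> f ` ?B" by blast
  qed
  have "card (f ` ?B) = card ?B" by (rule card_image[OF inj_on_subset[OF permutes_inj_on[OF f(1), of UNIV]]]) simp
  then have "card ?C = card (f ` ?B)" using card_block[OF s] card_block[OF fs] by simp
  then have eq: "?C = f ` ?B" using finite_V by (intro card_subset_eq[OF _ sub]) auto
  have "f v \<in> ?C \<longleftrightarrow> v \<in> ?B" unfolding eq using injD[OF permutes_inj[OF f(1)]] by blast
  then show ?thesis using v f by simp
qed

text \<open>Puts the target into the same exceptional situation as the source, so that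
  \<open>exc_heights\<close> can be applied to both.\<close>

lemma exc_transport:
  assumes e: "exc E P s" and f: "iso E E' f" "pinv f \<circ> X 1 \<circ> f \<in> P"
  shows "exc E' ((\<lambda>h. f \<circ> h \<circ> pinv f) ` P) (f s)"
  unfolding exc_def
proof (intro conjI ballI impI)
  note ed = excD[OF e]
  note fp = isoD(1)[OF f(1)]
  note fi = permutes_inverses[OF fp]
  note bi = exc_block_image[OF e fp f(2)]
  note Pd = perm_groupD[OF ed(1)]
  let ?P = "(\<lambda>h. f \<circ> h \<circ> pinv f) ` P"
  have pA: "?P \<subseteq> Aut E'"
  proof
    fix g assume "g \<in> ?P"
    then obtain h where h: "h \<in> P" "g = f \<circ> h \<circ> pinv f" by blast
    have "iso E E h" using ed(3)[OF h(1)] by (simp add: Aut_def)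
    then have "iso E' E' (f \<circ> h \<circ> pinv f)" using iso_comp iso_pinv[OF f(1)] f(1) by blast
    then show "g \<in> Aut E'" using h by (simp add: Aut_def)
  qed
  then show "?P \<subseteq> Aut E'" .
  show "perm_group V ?P"
  proof (rule perm_group_sub)
    show "g \<in> Aut E'" if "g \<in> ?P" for g using subsetD[OF pA that] .
    show "id \<in> ?P" by (rule image_eqI[OF _ Pd(3)]) (simp add: fun_eq_iff fi)
    fix g g' assume "g \<in> ?P" "g' \<in> ?P"
    then obtain h h' where h: "h \<in> P" "h' \<in> P" "g = f \<circ> h \<circ> pinv f" "g' = f \<circ> h' \<circ> pinv f" by blast
    have "g \<circ> g' = f \<circ> (h \<circ> h') \<circ> pinv f" by (simp add: h fun_eq_iff fi)
    then show "g \<circ> g' \<in> ?P" using Pd(4)[OF h(1,2)] by blast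
  qed
  have "inj_on (\<lambda>h. f \<circ> h \<circ> pinv f) P"
  proof (rule inj_onI)
    fix g h assume gh: "f \<circ> g \<circ> pinv f = f \<circ> h \<circ> pinv f"
    show "g = h"
    proof
      fix v
      have "f (g v) = f (h v)" using fun_cong[OF gh, of "f v"] by (simp add: fi)
      then show "g v = h v" using injD[OF permutes_inj[OF fp]] by blast
    qed
  qed
  then have "card ?P = card P" by (rule card_image)
  then show "\<exists>k. card ?P = p ^ k" using ed(2) by simp
  have "X 1 = f \<circ> (pinv f \<circ> X 1 \<circ> f) \<circ> pinv f" by (simp add: fun_eq_iff fi)
  then show "X 1 \<in> ?P" using f(2) by blast
  show "f s \<in> V" using fp ed(5) by simp
  show "p = 5" by (rule ed(6))
  {
    fix g v assume "g \<in> ?P" and v: "v \<in> V"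
    then obtain h where h: "h \<in> P" "g = f \<circ> h \<circ> pinv f" by blast
    have iV: "pinv f v \<in> V" using v permutes_inv[OF fp] by simp
    then have hV: "h (pinv f v) \<in> V" using Pd(2)[OF h(1)] by simp
    show "blk (g v) = blk (f s) \<longleftrightarrow> blk v = blk (f s)"
      using bi[OF hV] bi[OF iV] ed(7)[OF h(1) iV] h(2) by (simp add: fi)
  }
  fix v w assume vw: "v \<in> V" "w \<in> V" "blk v \<noteq> blk (f s)" "blk w \<noteq> blk (f s)"
  have iV: "pinv f v \<in> V" "pinv f w \<in> V" using vw permutes_inv[OF fp] by simp_all
  have "blk (pinv f v) \<noteq> blk s" "blk (pinv f w) \<noteq> blk s"
    using bi[OF iV(1)] bi[OF iV(2)] vw by (simp_all add: fi)
  then obtain h where h: "h \<in> P" "h (pinv f v) = pinv f w" using ed(8)[OF iV] by blast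
  then have "(f \<circ> h \<circ> pinv f) v = w" by (simp add: fi)
  then show "\<exists>g\<in>?P. g v = w" using h(1) by blast
qed

text \<open>In the exceptional case \<open>W0\<close> is carried over by \<open>f1\<close> in both
  directions. So source and target either both have constant joins or both have heights, and are
  compared by \<open>bpres_of_const\<close> or \<open>heights_iso\<close>.\<close>

lemma ex_bpres:
  assumes E: "Rinv E" "Rinv E'" and f: "iso E E' f"
  obtains f' where "iso E E' f'" "bpres f'"
proof -
  note fp = isoD(1)[OF f]
  define y where "y = pinv f \<circ> X 1 \<circ> f"
  have yA: "y \<in> Aut E" unfolding y_def by (rule conj_Aut[OF f tr_Aut(1)[OF E(2)]])
  have yp: "y ^^ p = id" unfolding y_def by (rule conj_pow[OF fp X1_pow_p])
  obtain P g k where P: "perm_group V P" "P \<subseteq> Aut E" "card P = p ^ k" "g \<in> Aut E" "X 1 \<in> P" "pinv g \<circ> y \<circ> g \<in> P"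
    using sylow_conj[OF perm_group_Aut prime_p tr_Aut(1)[OF E(1)] X1_pow_p yA yp] by metis
  have gi: "iso E E g" using P(4) by (simp add: Aut_def)
  note gp = isoD(1)[OF gi] gi
  define f1 where "f1 = f \<circ> g"
  have f1: "iso E E' f1" unfolding f1_def by (rule iso_comp[OF gp(2) f])
  note f1p = isoD(1)[OF f1]
  have y1: "pinv f1 \<circ> X 1 \<circ> f1 \<in> P" using P(6) conj_conj[OF fp gp(1)] by (simp add: y_def f1_def)
  from orbit_dichotomy[OF P(1,3,2,5)] show ?thesis
  proof
    assume "\<forall>g\<in>P. \<forall>v\<in>V. blk (g v) = blk v"
    then have "aff f1" by (intro aff_from_pgroup[OF P(1,3,5) _ f1p y1]) auto
    then show ?thesis using that f1 aff_bpres by blast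
  next
    assume "\<exists>s. exc E P s"
    then obtain s where e: "exc E P s" by blast
    note ed = excD[OF e]
    note e' = exc_transport[OF e f1 y1]
    note bi = exc_block_image[OF e f1p y1]
    have fs: "f1 s \<in> V" using ed(5) f1p by simp
    have W: "W0 E s a b \<longleftrightarrow> W0 E' (f1 s) a b" for a b
    proof
      assume w: "W0 E s a b"
      show "W0 E' (f1 s) a b" unfolding W0_def
      proof (intro ballI impI)
        fix v w' assume h: "v \<in> V" "w' \<in> V" "blk v = blk (f1 s)" "blk w' \<noteq> blk (f1 s)"
        have iV: "pinv f1 v \<in> V" "pinv f1 w' \<in> V" using h permutes_inv[OF f1p] by simp_all
        have fi: "f1 (pinv f1 v) = v" "f1 (pinv f1 w') = w'" by (simp_all add: permutes_inverses[OF f1p])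
        have "blk (pinv f1 v) = blk s" "blk (pinv f1 w') \<noteq> blk s" using bi[OF iV(1)] bi[OF iV(2)] fi h by simp_all
        then have "E (pinv f1 v) (pinv f1 w') = a \<and> E (pinv f1 w') (pinv f1 v) = b"
          using w iV unfolding W0_def by blast
        then show "E' v w' = a \<and> E' w' v = b" using isoD(2)[OF f1 iV] isoD(2)[OF f1 iV(2,1)] fi by simp
      qed
    next
      assume w: "W0 E' (f1 s) a b"
      show "W0 E s a b" unfolding W0_def
      proof (intro ballI impI)
        fix v w' assume h: "v \<in> V" "w' \<in> V" "blk v = blk s" "blk w' \<noteq> blk s"
        have "f1 v \<in> V" "f1 w' \<in> V" "blk (f1 v) = blk (f1 s)" "blk (f1 w') \<noteq> blk (f1 s)"
          using bi[OF h(1)] bi[OF h(2)] h f1p by simp_all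
        then have "E' (f1 v) (f1 w') = a \<and> E' (f1 w') (f1 v) = b" using w unfolding W0_def by blast
        then show "E v w' = a \<and> E w' v = b" using isoD(2)[OF f1 h(1,2)] isoD(2)[OF f1 h(2,1)] by simp
      qed
    qed
    show ?thesis
    proof (cases "\<exists>a b. W0 E s a b")
      case True
      then obtain a b where w: "W0 E s a b" by blast
      then have w': "W0 E' (f1 s) a b" using W by blast
      show ?thesis
        by (rule bpres_of_const[OF E f1 W0_all[OF E(1) w ed(5)] W0_all[OF E(2) w' fs]]) (auto intro: that)
    next
      case False
      then have "\<not> (\<exists>a b. W0 E' (f1 s) a b)" using W by blast
      then obtain h' C' D' where h': "heights E' h' C' D'" using exc_heights[OF E(2) e'] by blast
      obtain h C D where h: "heights E h C D" using exc_heights[OF E(1) e False] by blast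
      show ?thesis by (rule heights_iso[OF ed(6) f1 h h']) (rule that)
    qed
  qed
qed

lemma ex_std_iso:
  assumes E: "Rinv E" "Rinv E'" and f: "iso E E' f"
  obtains f' where "iso E E' f'" "std f'"
proof -
  obtain f1 where f1: "iso E E' f1" "bpres f1" using ex_bpres[OF E f] .
  obtain f2 where f2: "iso E E' f2" "aff f2" using ex_aff_of_bpres[OF E f1] .
  show ?thesis using ex_std[OF E f2] that by blast
qed

section \<open>Transfer to the dihedral group\<close>

definition num :: "bool \<Rightarrow> int \<Rightarrow> int \<Rightarrow> int" where
  "num e i a = (if e then - (int p * i + 3 * a) else int p * i + 3 * a)"

definition \<phi> :: "vtx \<Rightarrow> nat \<times> bool" where
  "\<phi> v = (nat (num (fst v) (fst (snd v)) (snd (snd v)) mod (3 * int p)), fst v)"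

abbreviation DG where "DG \<equiv> dihedral (3 * p)"

lemma carrier_DG: "carrier DG = {0..<3 * p} \<times> UNIV"
  by (simp add: dihedral_def)

lemma num_cong: "num e (i mod 3) (a mod int p) mod (3 * int p) = num e i a mod (3 * int p)"
proof -
  define qi ri qa ra where d: "qi = i div 3" "ri = i mod 3" "qa = a div int p" "ra = a mod int p"
  have i: "i = 3 * qi + ri" and a: "a = int p * qa + ra" by (simp_all add: d)
  have "(int p * i + 3 * a) - (int p * ri + 3 * ra) = 3 * int p * (qi + qa)"
    unfolding i a by (simp add: algebra_simps)
  also have "3 * int p dvd \<dots>" by (rule dvd_triv_left)
  finally have "(int p * i + 3 * a) mod (3 * int p) = (int p * ri + 3 * ra) mod (3 * int p)"
    by (simp only: mod_eq_dvd_iff)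
  from this mod_minus_cong[OF this] have "num e i a mod (3 * int p) = num e ri ra mod (3 * int p)"
    unfolding num_def by (cases e) (simp_all only: if_True if_False)
  then show ?thesis by (simp only: d)
qed

lemma \<phi>_pt: "\<phi> (pt e i a) = (nat (num e i a mod (3 * int p)), e)"
  by (simp add: \<phi>_def pt_def num_cong)

lemma prime_int_p: "prime (int p)" using prime_p by simp

lemma three_not_dvd: "\<not> 3 dvd int p"
proof
  assume "3 dvd int p"
  then have "3 dvd p" by (metis int_dvd_int_iff of_nat_numeral)
  then have "(3::nat) = 1 \<or> 3 = p" using prime_nat_iff[THEN iffD1, OF prime_p] by blast
  then show False using p_gt_3 by simp
qed

lemma num_inj:
  assumes "num e i a mod (3 * int p) = num e i' a' mod (3 * int p)"
  shows "i mod 3 = i' mod 3" "a mod int p = a' mod int p"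
proof -
  have "3 * int p dvd num e i a - num e i' a'" using assms by (simp only: mod_eq_dvd_iff)
  moreover have "num e i a - num e i' a' = (int p * i + 3 * a) - (int p * i' + 3 * a') \<or>
    num e i a - num e i' a' = - ((int p * i + 3 * a) - (int p * i' + 3 * a'))" by (simp add: num_def)
  ultimately have d: "3 * int p dvd (int p * i + 3 * a) - (int p * i' + 3 * a')" by (metis dvd_minus_iff)
  have "3 dvd (int p * i + 3 * a) - (int p * i' + 3 * a')" using d by (rule dvd_mult_left)
  then have "3 dvd ((int p * i + 3 * a) - (int p * i' + 3 * a')) - 3 * (a - a')" by (rule dvd_diff) simp
  then have "3 dvd int p * (i - i')" by (simp add: algebra_simps)
  moreover note three_not_dvd
  moreover have "prime (3::int)" by simp
  ultimately have "3 dvd (i - i')" using prime_dvd_mult_iff by blast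
  then show "i mod 3 = i' mod 3" by (simp only: mod_eq_dvd_iff)
  have "int p dvd (int p * i + 3 * a) - (int p * i' + 3 * a')" using d by (rule dvd_mult_right)
  then have "int p dvd ((int p * i + 3 * a) - (int p * i' + 3 * a')) - int p * (i - i')" by (rule dvd_diff) simp
  then have "int p dvd 3 * (a - a')" by (simp add: algebra_simps)
  moreover have "\<not> int p dvd 3" using p_gt_3 zdvd_imp_le[of "int p" 3] by auto
  ultimately have "int p dvd (a - a')" using prime_dvd_mult_iff[OF prime_int_p] by blast
  then show "a mod int p = a' mod int p" by (simp only: mod_eq_dvd_iff)
qed

lemma nat_mod_eq: "nat (x mod (3 * int p)) = nat (y mod (3 * int p)) \<longleftrightarrow> x mod (3 * int p) = y mod (3 * int p)"
proof -
  have "0 \<le> x mod (3 * int p)" "0 \<le> y mod (3 * int p)" by simp_all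
  then show ?thesis by linarith
qed

lemma bij_\<phi>: "bij_betw \<phi> V (carrier DG)"
proof -
  have inj: "inj_on \<phi> V"
  proof (rule inj_onI)
    fix v w assume h: "v \<in> V" "w \<in> V" "\<phi> v = \<phi> w"
    obtain e i a where v: "v = pt e i a" using h(1) ptE by blast
    obtain e' i' a' where w: "w = pt e' i' a'" using h(2) ptE by blast
    have hh: "(nat (num e i a mod (3 * int p)), e) = (nat (num e' i' a' mod (3 * int p)), e')"
      using h(3) unfolding v w \<phi>_pt .
    then have e: "e = e'" by simp
    have "num e i a mod (3 * int p) = num e i' a' mod (3 * int p)" using hh e nat_mod_eq by simp
    then show "v = w" using num_inj[of e i a i' a'] e by (simp add: v w pt_iff)
  qed
  have sub: "\<phi> ` V \<subseteq> carrier DG"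
  proof
    fix x assume "x \<in> \<phi> ` V"
    then obtain v where v: "v \<in> V" "x = \<phi> v" by blast
    obtain e i a where "v = pt e i a" using v(1) ptE by blast
    then have x: "x = (nat (num e i a mod (3 * int p)), e)" using v \<phi>_pt by simp
    have "num e i a mod (3 * int p) < 3 * int p" by (rule pos_mod_bound) (simp add: p_pos)
    then show "x \<in> carrier DG" unfolding x carrier_DG by (simp add: nat_less_iff)
  qed
  have "card (\<phi> ` V) = card (carrier DG)"
    using card_image[OF inj] card_V by (simp add: carrier_DG card_cartesian_product)
  then have "\<phi> ` V = carrier DG" by (intro card_subset_eq[OF _ sub]) (simp add: carrier_DG)
  then show ?thesis using inj by (simp add: bij_betw_def)
qed

lemma \<phi>_inj: "v \<in> V \<Longrightarrow> w \<in> V \<Longrightarrow> \<phi> v = \<phi> w \<longleftrightarrow> v = w"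
  using bij_betw_imp_inj_on[OF bij_\<phi>] by (auto dest: inj_onD)

lemma \<phi>_carrier: "v \<in> V \<Longrightarrow> \<phi> v \<in> carrier DG"
  using bij_betwE[OF bij_\<phi>] by blast

lemma \<phi>_surj: "x \<in> carrier DG \<Longrightarrow> \<exists>v\<in>V. x = \<phi> v"
  using bij_\<phi> by (auto simp: bij_betw_def)

lemma one_DG: "\<one>\<^bsub>DG\<^esub> = \<phi> (pt False 0 0)"
  by (simp add: dihedral_def \<phi>_pt num_def)

text \<open>Because of the sign in \<open>num\<close>, the effect of a right factor on the last two
  coordinates does not depend on \<open>e\<close>: it adds its own coordinates, after negating the
  old ones if it is a reflection.\<close>

lemma mult_DG:
  "\<phi> (pt e i a) \<otimes>\<^bsub>DG\<^esub> \<phi> (pt e' i' a') =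
    \<phi> (pt (e \<noteq> e') (if e' then i' - i else i + i') (if e' then a' - a else a + a'))"
proof -
  let ?n = "3 * int p"
  let ?x = "num e i a" and ?y = "num e' i' a'"
  have n0: "?n > 0" by (simp add: p_pos)
  have yb: "0 \<le> ?y mod ?n" "?y mod ?n < ?n" "0 \<le> ?x mod ?n" using n0 by simp_all
  have nn: "int (3 * p) = ?n" by simp
  have 1: "int (nat (?x mod ?n)) = ?x mod ?n" "int (nat (?y mod ?n)) = ?y mod ?n" using yb by simp_all
  have le: "nat (?y mod ?n) \<le> 3 * p" using yb by linarith
  have "int ((nat (?x mod ?n) + (if e then 3 * p - nat (?y mod ?n) else nat (?y mod ?n))) mod (3 * p))
      = (?x + (if e then - ?y else ?y)) mod ?n"
  proof (cases e)
    case True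
    have "int ((nat (?x mod ?n) + (3 * p - nat (?y mod ?n))) mod (3 * p)) = (?x mod ?n + (?n - ?y mod ?n)) mod ?n"
      using le 1 by (simp add: zmod_int of_nat_diff add_diff_eq)
    also have "\<dots> = (?x mod ?n - ?y mod ?n + ?n) mod ?n" by (simp add: algebra_simps)
    also have "\<dots> = (?x - ?y) mod ?n" by (simp add: mod_simps)
    finally show ?thesis using True by simp
  next
    case False
    then show ?thesis using 1 by (simp add: zmod_int mod_simps)
  qed
  moreover have "(?x + (if e then - ?y else ?y)) =
     num (e \<noteq> e') (if e' then i' - i else i + i') (if e' then a' - a else a + a')"
    by (auto simp: num_def algebra_simps)
  ultimately have "(nat (?x mod ?n) + (if e then 3 * p - nat (?y mod ?n) else nat (?y mod ?n))) mod (3 * p)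
     = nat (num (e \<noteq> e') (if e' then i' - i else i + i') (if e' then a' - a else a + a') mod ?n)"
    by (metis nat_int)
  then show ?thesis by (simp add: \<phi>_pt dihedral_def)
qed

section \<open>Cayley digraphs and automorphisms in coordinates\<close>

definition CE :: "(nat \<times> bool) set \<Rightarrow> vtx \<Rightarrow> vtx \<Rightarrow> bool" where
  "CE A v w \<longleftrightarrow> (\<phi> v, \<phi> w) \<in> cay_arcs DG A"

lemma CE_iff: "v \<in> V \<Longrightarrow> CE A v w \<longleftrightarrow> (\<exists>s\<in>A. \<phi> w = s \<otimes>\<^bsub>DG\<^esub> \<phi> v)"
  using \<phi>_carrier by (auto simp: CE_def cay_arcs_def)

text \<open>Associativity: connection sets multiply on the left, so right multiplication preserves
  arcs.\<close>

lemma CE_mult: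
  assumes A: "A \<subseteq> carrier DG" and v: "v \<in> V" and w: "w \<in> V" and c: "CE A v w"
    and f: "\<And>v. v \<in> V \<Longrightarrow> f v \<in> V \<and> \<phi> (f v) = \<phi> v \<otimes>\<^bsub>DG\<^esub> \<phi> (pt e i a)"
  shows "CE A (f v) (f w)"
proof -
  obtain s where s: "s \<in> A" "\<phi> w = s \<otimes>\<^bsub>DG\<^esub> \<phi> v" using c CE_iff[OF v] by blast
  obtain u where u: "u \<in> V" "s = \<phi> u" using \<phi>_surj A s by blast
  obtain e1 i1 a1 where u1: "u = pt e1 i1 a1" using u(1) ptE by blast
  obtain e2 i2 a2 where v1: "v = pt e2 i2 a2" using v ptE by blast
  have "\<phi> (f w) = (s \<otimes>\<^bsub>DG\<^esub> \<phi> v) \<otimes>\<^bsub>DG\<^esub> \<phi> (pt e i a)" using f[OF w] s by simp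
  also have "\<dots> = s \<otimes>\<^bsub>DG\<^esub> (\<phi> v \<otimes>\<^bsub>DG\<^esub> \<phi> (pt e i a))"
    unfolding u(2) u1 v1 mult_DG by (rule arg_cong[of _ _ \<phi>]) (auto simp: algebra_simps)
  also have "\<dots> = s \<otimes>\<^bsub>DG\<^esub> \<phi> (f v)" using f[OF v] by simp
  finally show ?thesis using CE_iff f[OF v] s(1) by blast
qed

lemma tr_mult:
  assumes "v \<in> V"
  shows "\<phi> (X c v) = \<phi> v \<otimes>\<^bsub>DG\<^esub> \<phi> (pt False 0 c)" "\<phi> (U c v) = \<phi> v \<otimes>\<^bsub>DG\<^esub> \<phi> (pt False c 0)"
    "\<phi> (S v) = \<phi> v \<otimes>\<^bsub>DG\<^esub> \<phi> (pt True 0 0)"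
  using assms by (elim ptE; simp add: mult_DG)+

lemma Rinv_CE: assumes A: "A \<subseteq> carrier DG" shows "Rinv (CE A)"
  unfolding Rinv_def
proof (intro ballI conjI allI)
  fix v w assume vw: "v \<in> V" "w \<in> V"
  have X: "CE A (X c v) (X c w)" if "v \<in> V" "w \<in> V" "CE A v w" for c v w
    by (rule CE_mult[OF A that]) (use tr_mult(1) in auto)
  have U: "CE A (U c v) (U c w)" if "v \<in> V" "w \<in> V" "CE A v w" for c v w
    by (rule CE_mult[OF A that]) (use tr_mult(2) in auto)
  have S: "CE A (S v) (S w)" if "v \<in> V" "w \<in> V" "CE A v w" for v w
    by (rule CE_mult[OF A that]) (use tr_mult(3) in auto)
  show "CE A (X c v) (X c w) = CE A v w" for c
    using X[OF vw, of c] X[of "X c v" "X c w" "- c"] vw by auto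
  show "CE A (U c v) (U c w) = CE A v w" for c
    using U[OF vw, of c] U[of "U c v" "U c w" "- c"] vw by auto
  show "CE A (S v) (S w) = CE A v w" using S[OF vw] S[of "S v" "S w"] vw by auto
qed

lemma CE_base:
  assumes A: "A \<subseteq> carrier DG" and w: "w \<in> V"
  shows "CE A (pt False 0 0) w \<longleftrightarrow> \<phi> w \<in> A"
proof -
  have "s \<otimes>\<^bsub>DG\<^esub> \<phi> (pt False 0 0) = s" if sA: "s \<in> A" for s
  proof -
    obtain u where u: "u \<in> V" "s = \<phi> u" using \<phi>_surj A sA by blast
    obtain e i a where "u = pt e i a" using u(1) ptE by blast
    then show ?thesis using u by (simp add: mult_DG)
  qed
  then show ?thesis using CE_iff[OF pt_V] by metis
qed

text \<open>The automorphism that raises rotations to the power \<open>r\<close> and adds the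
  constants \<open>s\<close>, \<open>t\<close> to the coordinates of reflections.\<close>

definition gm :: "int \<Rightarrow> int \<Rightarrow> int \<Rightarrow> vtx \<Rightarrow> vtx" where
  "gm r s t v = (if v \<in> V then pt (fst v) (r * fst (snd v) + (if fst v then s else 0)) (r * snd (snd v) + (if fst v then t else 0)) else v)"

lemma gm_pt: "gm r s t (pt e i a) = pt e (r * i + (if e then s else 0)) (r * a + (if e then t else 0))"
proof -
  have m: "(r * (x mod n) + z) mod n = (r * x + z) mod n" for x n z :: int
    by (rule mod_add_cong[OF mod_mult_right_eq refl])
  show ?thesis by (simp add: gm_def) (simp add: pt_def m mod_mult_right_eq)
qed

lemma gm_out: "v \<notin> V \<Longrightarrow> gm r s t v = v" by (simp add: gm_def)

lemma gm_V: "v \<in> V \<Longrightarrow> gm r s t v \<in> V" by (simp add: gm_def)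

definition unit3 :: "int \<Rightarrow> bool" where "unit3 r \<longleftrightarrow> \<not> 3 dvd r \<and> \<not> int p dvd r"

lemma gm_permutes: assumes r: "unit3 r" shows "gm r s t permutes V"
proof (rule inj_imp_permutes)
  show "inj_on (gm r s t) V"
  proof (rule inj_onI)
    fix v w assume h: "v \<in> V" "w \<in> V" "gm r s t v = gm r s t w"
    obtain e i a where v: "v = pt e i a" using h(1) ptE by blast
    obtain e' i' a' where w: "w = pt e' i' a'" using h(2) ptE by blast
    let ?s = "if e then s else 0" and ?t = "if e then t else 0"
    have ee: "e = e'" and i: "(r * i + ?s) mod 3 = (r * i' + ?s) mod 3" and a: "(r * a + ?t) mod int p = (r * a' + ?t) mod int p"
      using h(3) unfolding v w gm_pt pt_iff by auto
    have "3 dvd (r * i + ?s) - (r * i' + ?s)" using i by (simp only: mod_eq_dvd_iff)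
    moreover have "(r * i + ?s) - (r * i' + ?s) = r * (i - i')" by (simp add: algebra_simps)
    ultimately have "3 dvd r * (i - i')" by (simp only:)
    moreover have "prime (3::int)" by simp
    ultimately have 1: "3 dvd i - i'" using r unfolding unit3_def using prime_dvd_mult_iff by blast
    have "int p dvd (r * a + ?t) - (r * a' + ?t)" using a by (simp only: mod_eq_dvd_iff)
    moreover have "(r * a + ?t) - (r * a' + ?t) = r * (a - a')" by (simp add: algebra_simps)
    ultimately have "int p dvd r * (a - a')" by (simp only:)
    then have "int p dvd a - a'" using r prime_int_p unfolding unit3_def using prime_dvd_mult_iff by blast
    then show "v = w" using 1 ee by (simp only: v w pt_iff mod_eq_dvd_iff simp_thms)
  qed
qed (auto simp: finite_V gm_V gm_out)

definition AG :: "(vtx \<Rightarrow> vtx) set" where "AG = {gm r s t | r s t. unit3 r}"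

lemma unit3_mult: "unit3 r \<Longrightarrow> unit3 r' \<Longrightarrow> unit3 (r * r')"
  unfolding unit3_def using prime_dvd_mult_iff[OF prime_int_p] prime_dvd_mult_iff[of "3::int"] by simp

lemma gm_comp: "gm r s t \<circ> gm r' s' t' = gm (r * r') (r * s' + s) (r * t' + t)"
proof
  fix v
  show "(gm r s t \<circ> gm r' s' t') v = gm (r * r') (r * s' + s) (r * t' + t) v"
    by (cases "v \<in> V") (auto elim!: ptE simp: gm_pt gm_out algebra_simps)
qed

lemma gm_id: "gm 1 0 0 = id"
proof
  fix v show "gm 1 0 0 v = id v" by (cases "v \<in> V") (auto elim!: ptE simp: gm_pt gm_out)
qed

lemma perm_group_AG: "perm_group V AG"
  unfolding perm_group_def
proof (intro conjI ballI)
  have "unit3 1" using p_gt1 by (simp add: unit3_def)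
  then show "id \<in> AG" unfolding AG_def gm_id[symmetric] by blast
  show "g \<circ> h \<in> AG" if "g \<in> AG" "h \<in> AG" for g h
    using that unfolding AG_def using gm_comp unit3_mult by blast
qed (auto simp: finite_V AG_def gm_permutes)

lemma unit3_CRT:
  assumes "\<epsilon> \<in> {1, -1}" "\<not> int p dvd c"
  obtains r where "unit3 r" "r mod 3 = \<epsilon> mod 3" "r mod int p = c mod int p"
proof -
  have "coprime 3 (int p)"
    by (rule prime_imp_coprime[OF _ three_not_dvd]) simp
  then obtain r where r: "[r = \<epsilon>] (mod 3)" "[r = c] (mod int p)"
    using binary_chinese_remainder_int by blast
  have r': "r mod 3 = \<epsilon> mod 3" "r mod int p = c mod int p" using r by (auto simp: cong_def)
  have "\<not> 3 dvd r" using r'(1) assms(1) by (auto simp: dvd_eq_mod_eq_0)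
  moreover have "\<not> int p dvd r" using r'(2) assms(2) by (simp add: dvd_eq_mod_eq_0)
  ultimately show ?thesis using that r' by (simp add: unit3_def)
qed

text \<open>The standard isomorphism is composed with the right translations undoing
  \<open>\<alpha>\<close> and \<open>a\<close>, so that it fixes the identity, whose out-neighbours
  are the connection set. The Chinese remainder theorem merges the sign modulo 3 and the multiplier
  modulo \<open>p\<close> into one unit \<open>r\<close>.\<close>

lemma AG_of_cay_iso:
  assumes A: "A \<subseteq> carrier DG" and B: "B \<subseteq> carrier DG" and c: "cay_iso DG A B"
  shows "\<exists>g\<in>AG. \<forall>v\<in>V. \<phi> v \<in> A \<longleftrightarrow> \<phi> (g v) \<in> B"
proof -
  obtain f0 where f0: "bij_betw f0 (carrier DG) (carrier DG)"
    "\<And>x y. x \<in> carrier DG \<Longrightarrow> y \<in> carrier DG \<Longrightarrow> (x, y) \<in> cay_arcs DG A \<longleftrightarrow> (f0 x, f0 y) \<in> cay_arcs DG B"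
    using c unfolding cay_iso_def by blast
  define \<psi> where "\<psi> = inv_into V \<phi>"
  have \<psi>: "\<phi> (\<psi> x) = x" "\<psi> x \<in> V" if "x \<in> carrier DG" for x
    using that bij_\<phi> unfolding \<psi>_def bij_betw_def by (auto intro: f_inv_into_f inv_into_into)
  have b\<psi>: "bij_betw \<psi> (carrier DG) V" unfolding \<psi>_def by (rule bij_betw_inv_into[OF bij_\<phi>])
  define f where "f v = (if v \<in> V then \<psi> (f0 (\<phi> v)) else v)" for v
  have fv: "\<phi> (f v) = f0 (\<phi> v)" if "v \<in> V" for v
    using that \<psi>(1) bij_betwE[OF f0(1)] \<phi>_carrier by (simp add: f_def)
  have "bij_betw (\<psi> \<circ> (f0 \<circ> \<phi>)) V V"
    by (rule bij_betw_trans[OF bij_betw_trans[OF bij_\<phi> f0(1)] b\<psi>])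
  then have "bij_betw f V V" by (rule bij_betw_cong[THEN iffD1, rotated]) (simp add: f_def)
  then have fp: "f permutes V" by (rule bij_imp_permutes) (simp add: f_def)
  have "iso (CE A) (CE B) f" unfolding iso_def
    using fp f0(2) fv \<phi>_carrier by (simp add: CE_def)
  then obtain f1 where f1: "iso (CE A) (CE B) f1" "std f1" using ex_std_iso[OF Rinv_CE[OF A] Rinv_CE[OF B]] by blast
  have "\<exists>c \<epsilon> \<alpha> \<beta> a b. \<epsilon> \<in> {1, -1} \<and> \<not> int p dvd c \<and>
    (\<forall>i x. f1 (pt False i x) = pt False (\<alpha> + \<epsilon> * i) (a + c * x)) \<and>
    (\<forall>i x. f1 (pt True i x) = pt True (\<beta> + \<epsilon> * i) (b + c * x))"
    by (rule std_form[OF isoD(1)[OF f1(1)] f1(2)]) blast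
  then obtain c \<epsilon> \<alpha> \<beta> a b where s: "\<epsilon> \<in> {1, -1}" "\<not> int p dvd c"
    "\<And>i x. f1 (pt False i x) = pt False (\<alpha> + \<epsilon> * i) (a + c * x)"
    "\<And>i x. f1 (pt True i x) = pt True (\<beta> + \<epsilon> * i) (b + c * x)"
    by blast
  obtain r where r: "unit3 r" "r mod 3 = \<epsilon> mod 3" "r mod int p = c mod int p" using unit3_CRT[OF s(1,2)] .
  have rm: "(r * i + z) mod 3 = (\<epsilon> * i + z) mod 3" "(r * x + z) mod int p = (c * x + z) mod int p" for i x z
    by (intro mod_add_cong mod_mult_cong r refl)+
  define g where "g = gm r (\<beta> - \<alpha>) (b - a)"
  have g: "g v = X (- a) (U (- \<alpha>) (f1 v))" if v: "v \<in> V" for v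
  proof -
    obtain e i x where v': "v = pt e i x" using v ptE by blast
    show ?thesis
    proof (cases e)
      case True
      then show ?thesis using rm(1)[of i "\<beta> - \<alpha>"] rm(2)[of x "b - a"]
        by (simp add: v' g_def gm_pt s pt_iff algebra_simps)
    next
      case False
      then show ?thesis using rm(1)[of i 0] rm(2)[of x 0]
        by (simp add: v' g_def gm_pt s pt_iff algebra_simps)
    qed
  qed
  have g0: "g (pt False 0 0) = pt False 0 0" by (simp add: g_def gm_pt)
  have "\<phi> v \<in> A \<longleftrightarrow> \<phi> (g v) \<in> B" if v: "v \<in> V" for v
  proof -
    have f1V: "f1 w \<in> V" if "w \<in> V" for w using isoD(1)[OF f1(1)] that by simp
    have "\<phi> v \<in> A \<longleftrightarrow> CE A (pt False 0 0) v" by (rule CE_base[OF A v, symmetric])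
    also have "\<dots> \<longleftrightarrow> CE B (f1 (pt False 0 0)) (f1 v)" by (rule isoD(2)[OF f1(1) pt_V v])
    also have "\<dots> \<longleftrightarrow> CE B (U (- \<alpha>) (f1 (pt False 0 0))) (U (- \<alpha>) (f1 v))"
      by (rule RinvD(2)[OF Rinv_CE[OF B], symmetric]) (use f1V v in auto)
    also have "\<dots> \<longleftrightarrow> CE B (g (pt False 0 0)) (g v)"
      unfolding g[OF v] g[OF pt_V] by (rule RinvD(1)[OF Rinv_CE[OF B], symmetric]) (use f1V v in auto)
    also have "\<dots> \<longleftrightarrow> \<phi> (g v) \<in> B" unfolding g0 by (rule CE_base[OF B]) (simp add: g_def gm_V v)
    finally show ?thesis .
  qed
  moreover have "g \<in> AG" using r(1) by (auto simp: AG_def g_def)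
  ultimately show ?thesis by blast
qed

lemma auto_of_AG:
  assumes g: "g \<in> AG"
  obtains \<sigma> where "\<sigma> \<in> auto DG" "\<And>v. v \<in> V \<Longrightarrow> \<sigma> (\<phi> v) = \<phi> (g v)"
proof -
  obtain r s t where g': "g = gm r s t" "unit3 r" using g by (auto simp: AG_def)
  define \<psi> where "\<psi> = inv_into V \<phi>"
  \<comment> \<open>Restricted to the carrier because the members of \<open>auto\<close> are
    extensional.\<close>
  define \<sigma> where "\<sigma> = restrict (\<lambda>x. \<phi> (g (\<psi> x))) (carrier DG)"
  have \<psi>\<phi>: "\<psi> (\<phi> v) = v" if "v \<in> V" for v
    unfolding \<psi>_def by (rule inv_into_f_f[OF bij_betw_imp_inj_on[OF bij_\<phi>] that])
  have \<sigma>: "\<sigma> (\<phi> v) = \<phi> (g v)" if "v \<in> V" for v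
    using \<phi>_carrier[OF that] \<psi>\<phi>[OF that] by (simp add: \<sigma>_def)
  have gb: "bij_betw g V V" unfolding g'(1) by (rule permutes_imp_bij[OF gm_permutes[OF g'(2)]])
  have "bij_betw (g \<circ> \<psi>) (carrier DG) V"
    unfolding \<psi>_def by (rule bij_betw_trans[OF bij_betw_inv_into[OF bij_\<phi>] gb])
  then have "bij_betw (\<phi> \<circ> (g \<circ> \<psi>)) (carrier DG) (carrier DG)"
    by (rule bij_betw_trans[OF _ bij_\<phi>])
  then have "bij_betw \<sigma> (carrier DG) (carrier DG)"
    by (rule bij_betw_cong[THEN iffD1, rotated]) (simp add: \<sigma>_def)
  then have "\<sigma> \<in> Bij (carrier DG)" by (simp add: Bij_def \<sigma>_def)
  moreover have "\<sigma> \<in> hom DG DG"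
  proof (rule homI)
    fix x assume "x \<in> carrier DG"
    then obtain v where "v \<in> V" "x = \<phi> v" using \<phi>_surj by blast
    then show "\<sigma> x \<in> carrier DG" using \<sigma> \<phi>_carrier gm_V g' by simp
  next
    fix x y assume "x \<in> carrier DG" "y \<in> carrier DG"
    then obtain v w where vw: "v \<in> V" "x = \<phi> v" "w \<in> V" "y = \<phi> w" using \<phi>_surj by meson
    obtain e i a where v: "v = pt e i a" using vw(1) ptE by blast
    obtain e' i' a' where w: "w = pt e' i' a'" using vw(3) ptE by blast
    have "\<sigma> (x \<otimes>\<^bsub>DG\<^esub> y) = \<phi> (g (pt (e \<noteq> e') (if e' then i' - i else i + i') (if e' then a' - a else a + a')))"
      unfolding vw v w mult_DG by (rule \<sigma>) simp
    also have "\<dots> = \<phi> (g v) \<otimes>\<^bsub>DG\<^esub> \<phi> (g w)"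
      unfolding v w g'(1) gm_pt mult_DG by (rule arg_cong[of _ _ \<phi>]) (auto simp: algebra_simps)
    finally show "\<sigma> (x \<otimes>\<^bsub>DG\<^esub> y) = \<sigma> x \<otimes>\<^bsub>DG\<^esub> \<sigma> y" using vw \<sigma> by simp
  qed
  ultimately have "\<sigma> \<in> auto DG" by (simp add: auto_def)
  then show ?thesis using that \<sigma> by blast
qed

lemma cay_iso_of_auto:
  assumes \<sigma>: "\<sigma> \<in> auto DG" and A: "A \<subseteq> carrier DG"
  shows "cay_iso DG A (\<sigma> ` A)"
proof -
  have h: "\<sigma> \<in> hom DG DG" and b: "bij_betw \<sigma> (carrier DG) (carrier DG)"
    using \<sigma> by (auto simp: auto_def Bij_def)
  have hm: "\<sigma> (x \<otimes>\<^bsub>DG\<^esub> y) = \<sigma> x \<otimes>\<^bsub>DG\<^esub> \<sigma> y" if "x \<in> carrier DG" "y \<in> carrier DG" for x y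
    by (rule hom_mult[OF h that])
  have inj: "inj_on \<sigma> (carrier DG)" using b by (simp add: bij_betw_def)
  have cl: "x \<otimes>\<^bsub>DG\<^esub> y \<in> carrier DG" if xy: "x \<in> carrier DG" "y \<in> carrier DG" for x y
  proof -
    obtain v w where vw: "v \<in> V" "x = \<phi> v" "w \<in> V" "y = \<phi> w" using \<phi>_surj xy by meson
    obtain e i a where v: "v = pt e i a" using vw(1) ptE by blast
    obtain e' i' a' where w: "w = pt e' i' a'" using vw(3) ptE by blast
    show ?thesis unfolding vw v w mult_DG by (rule \<phi>_carrier) simp
  qed
  have "(x, y) \<in> cay_arcs DG A \<longleftrightarrow> (\<sigma> x, \<sigma> y) \<in> cay_arcs DG (\<sigma> ` A)" if xy: "x \<in> carrier DG" "y \<in> carrier DG" for x y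
  proof
    assume "(x, y) \<in> cay_arcs DG A"
    then obtain s where s: "s \<in> A" "y = s \<otimes>\<^bsub>DG\<^esub> x" by (auto simp: cay_arcs_def)
    then have "\<sigma> y = \<sigma> s \<otimes>\<^bsub>DG\<^esub> \<sigma> x" using hm A xy by blast
    then show "(\<sigma> x, \<sigma> y) \<in> cay_arcs DG (\<sigma> ` A)"
      using s(1) bij_betwE[OF b] xy unfolding cay_arcs_def by blast
  next
    assume "(\<sigma> x, \<sigma> y) \<in> cay_arcs DG (\<sigma> ` A)"
    then obtain s where s: "s \<in> A" "\<sigma> y = \<sigma> s \<otimes>\<^bsub>DG\<^esub> \<sigma> x" by (auto simp: cay_arcs_def)
    have sc: "s \<in> carrier DG" using s A by blast
    then have "\<sigma> y = \<sigma> (s \<otimes>\<^bsub>DG\<^esub> x)" using s(2) hm xy by simp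
    then have "y = s \<otimes>\<^bsub>DG\<^esub> x" using inj_onD[OF inj] xy cl[OF sc xy(1)] by blast
    then show "(x, y) \<in> cay_arcs DG A" using s(1) xy unfolding cay_arcs_def by blast
  qed
  then show ?thesis using b unfolding cay_iso_def by blast
qed

end

section \<open>Counting invariant subsets\<close>

definition fixsets :: "('a \<Rightarrow> 'a) \<Rightarrow> 'a set \<Rightarrow> 'a set set" where
  "fixsets f W = {A. A \<subseteq> W \<and> f ` A = A}"

text \<open>The condition on \<open>j\<close> says that every cycle in \<open>W\<close> has length
  exactly \<open>m\<close>; an empty \<open>W\<close> passes with any positive
  \<open>m\<close>.\<close>

definition ucyc :: "('a \<Rightarrow> 'a) \<Rightarrow> 'a set \<Rightarrow> nat \<Rightarrow> bool" where
  "ucyc f W m \<longleftrightarrow> finite W \<and> m > 0 \<and> (\<forall>w\<in>W. f w \<in> W \<and> (\<forall>j. (f ^^ j) w = w \<longleftrightarrow> m dvd j))"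

lemma ucycD:
  assumes "ucyc f W m"
  shows "finite W" "m > 0" "\<And>w. w \<in> W \<Longrightarrow> f w \<in> W" "\<And>w j. w \<in> W \<Longrightarrow> (f ^^ j) w = w \<longleftrightarrow> m dvd j"
  using assms by (auto simp: ucyc_def)

lemma ucyc_inj: assumes u: "ucyc f W m" shows "inj_on f W"
proof (rule inj_onI)
  fix v w assume h: "v \<in> W" "w \<in> W" "f v = f w"
  have "(f ^^ m) v = (f ^^ (m - 1)) (f v)" for v
  proof -
    have "(f ^^ Suc (m - 1)) v = (f ^^ (m - 1)) (f v)" by (simp add: funpow_Suc_right del: funpow.simps(2))
    then show ?thesis using ucycD(2)[OF u] by simp
  qed
  then have "(f ^^ m) v = (f ^^ m) w" using h(3) by simp
  then show "v = w" using ucycD(4)[OF u h(1), of m] ucycD(4)[OF u h(2), of m] by simp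
qed

lemma ucyc_image: "ucyc f W m \<Longrightarrow> f ` W = W"
  by (rule endo_inj_surj) (auto simp: ucyc_inj dest: ucycD)

text \<open>Invariant subsets are the unions of cycles, and there are \<open>card W div m\<close>
  cycles.\<close>

lemma card_fixsets_ucyc:
  assumes u: "ucyc f W m"
  shows "card (fixsets f W) = 2 ^ (card W div m)"
proof -
  note ud = ucycD[OF u]
  define orb where "orb w = (\<lambda>j. (f ^^ j) w) ` {..<m}" for w
  have inW: "(f ^^ j) w \<in> W" if "w \<in> W" for j w by (induction j) (use that ud(3) in auto)
  have per: "(f ^^ (m * q)) w = w" if "w \<in> W" for w q using ud(4)[OF that, of "m * q"] by simp
  have md: "(f ^^ j) w = (f ^^ (j mod m)) w" if w: "w \<in> W" for j w
  proof -
    have "(f ^^ j) w = (f ^^ (j mod m + m * (j div m))) w" by simp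
    also have "\<dots> = (f ^^ (j mod m)) ((f ^^ (m * (j div m))) w)" by (simp only: funpow_add comp_apply)
    finally show ?thesis using per[OF w] by simp
  qed
  have inorb: "(f ^^ j) w \<in> orb w" if "w \<in> W" for j w
    unfolding orb_def by (rule image_eqI, rule md[OF that]) (use ud(2) in simp)
  have self: "w \<in> orb w" if "w \<in> W" for w using inorb[OF that, of 0] by simp
  have orbW: "orb w \<subseteq> W" if "w \<in> W" for w using inW[OF that] by (auto simp: orb_def)
  have orb_eq: "orb v = orb w" if w: "w \<in> W" and v: "v \<in> orb w" for v w
  proof -
    obtain i where i: "i < m" "v = (f ^^ i) w" using v by (auto simp: orb_def)
    have vW: "v \<in> W" using orbW[OF w] v by blast
    have 1: "orb v \<subseteq> orb w"
    proof
      fix x assume "x \<in> orb v"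
      then obtain j where "x = (f ^^ j) ((f ^^ i) w)" using i by (auto simp: orb_def)
      then have "x = (f ^^ (j + i)) w" by (simp add: funpow_add)
      then show "x \<in> orb w" using inorb[OF w] by simp
    qed
    have "orb w \<subseteq> orb v"
    proof
      fix x assume "x \<in> orb w"
      then obtain j where "x = (f ^^ j) w" by (auto simp: orb_def)
      also have "w = (f ^^ (m - i + i)) w" using i per[OF w, of 1] by simp
      also have "\<dots> = (f ^^ (m - i)) v" using i by (simp only: funpow_add comp_apply)
      also have "(f ^^ j) ((f ^^ (m - i)) v) = (f ^^ (j + (m - i))) v" by (simp only: funpow_add comp_apply)
      finally show "x \<in> orb v" using inorb[OF vW] by simp
    qed
    then show ?thesis using 1 by blast
  qed
  have corb: "card (orb w) = m" if w: "w \<in> W" for w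
  proof -
    have "inj_on (\<lambda>j. (f ^^ j) w) {..<m}"
    proof (rule linorder_inj_onI)
      fix i j :: nat assume ij: "i < j" "i \<in> {..<m}" "j \<in> {..<m}"
      show "(f ^^ i) w \<noteq> (f ^^ j) w"
      proof
        assume "(f ^^ i) w = (f ^^ j) w"
        then have "(f ^^ (m - j)) ((f ^^ i) w) = (f ^^ (m - j)) ((f ^^ j) w)" by simp
        then have "(f ^^ (m - j + i)) w = (f ^^ (m - j + j)) w" by (simp only: funpow_add comp_apply)
        then have "(f ^^ (m - j + i)) w = w" using ij per[OF w, of 1] by simp
        then have "m dvd (m - j + i)" using ud(4)[OF w] by simp
        moreover have "0 < m - j + i" "m - j + i < m" using ij by auto
        ultimately show False using dvd_imp_le by fastforce
      qed
    qed auto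
    then show ?thesis unfolding orb_def by (simp add: card_image)
  qed
  define Q where "Q = orb ` W"
  have UQ: "\<Union> Q = W" using orbW self by (auto simp: Q_def)
  have disj: "C = C'" if CC: "C \<in> Q" "C' \<in> Q" "x \<in> C" "x \<in> C'" for C C' x
  proof -
    obtain w w' where w: "w \<in> W" "C = orb w" "w' \<in> W" "C' = orb w'" using CC by (auto simp: Q_def)
    then show ?thesis using orb_eq[OF w(1), of x] orb_eq[OF w(3), of x] CC by simp
  qed
  have finQ: "finite Q" using ud(1) by (simp add: Q_def)
  have "card (\<Union> Q) = (\<Sum>C\<in>Q. card C)"
  proof (rule card_Union_disjoint)
    show "disjoint Q" unfolding pairwise_def disjnt_def using disj by blast
    show "finite C" if "C \<in> Q" for C using that by (auto simp: Q_def orb_def)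
  qed
  also have "\<dots> = (\<Sum>C\<in>Q. m)" by (rule sum.cong) (use corb in \<open>auto simp: Q_def\<close>)
  also have "\<dots> = card Q * m" by simp
  finally have cQ: "card W div m = card Q" using UQ ud(2) by simp
  have "bij_betw \<Union> (Pow Q) (fixsets f W)"
  proof (rule bij_betw_imageI)
    show "inj_on \<Union> (Pow Q)"
    proof (rule inj_onI)
      have sub: "R \<subseteq> R'" if RR: "R \<in> Pow Q" "R' \<in> Pow Q" "\<Union> R = \<Union> R'" for R R'
      proof
        fix C assume C: "C \<in> R"
        then obtain w where w: "w \<in> W" "C = orb w" using RR(1) by (auto simp: Q_def)
        then have "w \<in> \<Union> R'" using self C RR(3) by blast
        then obtain C' where "C' \<in> R'" "w \<in> C'" by blast
        then show "C \<in> R'" using disj[of C C' w] C RR self w by blast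
      qed
      fix R R' assume "R \<in> Pow Q" "R' \<in> Pow Q" "\<Union> R = \<Union> R'"
      then show "R = R'" using sub[of R R'] sub[of R' R] by simp
    qed
    show "\<Union> ` Pow Q = fixsets f W"
    proof (intro equalityI subsetI)
      fix A assume "A \<in> \<Union> ` Pow Q"
      then obtain R where R: "R \<subseteq> Q" "A = \<Union> R" by blast
      have AW: "A \<subseteq> W" using R UQ by blast
      have "f x \<in> A" if xA: "x \<in> A" for x
      proof -
        obtain C where C: "C \<in> R" "x \<in> C" using xA R by blast
        then obtain w where w: "w \<in> W" "C = orb w" using R by (auto simp: Q_def)
        then obtain j where "x = (f ^^ j) w" using C by (auto simp: orb_def)
        then have "f x \<in> C" using inorb[OF w(1), of "Suc j"] w by simp
        then show ?thesis using C R by blast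
      qed
      then have "f ` A \<subseteq> A" by blast
      then have "f ` A = A" using endo_inj_surj[of A f] finite_subset[OF AW ud(1)] inj_on_subset[OF ucyc_inj[OF u] AW] by simp
      then show "A \<in> fixsets f W" using AW by (simp add: fixsets_def)
    next
      fix A assume "A \<in> fixsets f W"
      then have A: "A \<subseteq> W" "f ` A = A" by (auto simp: fixsets_def)
      have fj: "(f ^^ j) w \<in> A" if "w \<in> A" for j w by (induction j) (use that A(2) in auto)
      have "A = \<Union> (orb ` A)"
      proof (intro equalityI subsetI)
        fix x assume "x \<in> A" then show "x \<in> \<Union> (orb ` A)" using self A by blast
      next
        fix x assume "x \<in> \<Union> (orb ` A)"
        then obtain w j where "w \<in> A" "x = (f ^^ j) w" by (auto simp: orb_def)
        then show "x \<in> A" using fj by blast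
      qed
      moreover have "orb ` A \<in> Pow Q" using A by (auto simp: Q_def)
      ultimately show "A \<in> \<Union> ` Pow Q" by (rule image_eqI)
    qed
  qed
  then have "card (fixsets f W) = card (Pow Q)" by (rule bij_betw_same_card[symmetric])
  then show ?thesis using finQ cQ by (simp add: card_Pow)
qed

text \<open>Injectivity makes images commute with intersections, so an invariant set splits into an
  invariant part of each piece.\<close>

lemma card_fixsets_union:
  assumes inj: "inj_on f (W1 \<union> W2)" and d: "W1 \<inter> W2 = {}" and i: "f ` W1 = W1" "f ` W2 = W2"
  shows "card (fixsets f (W1 \<union> W2)) = card (fixsets f W1) * card (fixsets f W2)"
proof -
  have "bij_betw (\<lambda>(A, B). A \<union> B) (fixsets f W1 \<times> fixsets f W2) (fixsets f (W1 \<union> W2))"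
  proof (rule bij_betw_imageI)
    show "inj_on (\<lambda>(A, B). A \<union> B) (fixsets f W1 \<times> fixsets f W2)"
    proof (rule inj_onI, clarify)
      fix A B A' B' assume h: "A \<in> fixsets f W1" "B \<in> fixsets f W2" "A' \<in> fixsets f W1" "B' \<in> fixsets f W2" "A \<union> B = A' \<union> B'"
      have s: "A \<subseteq> W1" "B \<subseteq> W2" "A' \<subseteq> W1" "B' \<subseteq> W2" using h by (auto simp: fixsets_def)
      have "A = (A \<union> B) \<inter> W1" "A' = (A' \<union> B') \<inter> W1" "B = (A \<union> B) \<inter> W2" "B' = (A' \<union> B') \<inter> W2" using s d by blast+
      then show "A = A' \<and> B = B'" using h(5) by metis
    qed
    show "(\<lambda>(A, B). A \<union> B) ` (fixsets f W1 \<times> fixsets f W2) = fixsets f (W1 \<union> W2)"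
    proof (intro equalityI subsetI)
      fix C assume "C \<in> (\<lambda>(A, B). A \<union> B) ` (fixsets f W1 \<times> fixsets f W2)"
      then show "C \<in> fixsets f (W1 \<union> W2)" by (auto simp: fixsets_def image_Un)
    next
      fix C assume "C \<in> fixsets f (W1 \<union> W2)"
      then have C: "C \<subseteq> W1 \<union> W2" "f ` C = C" by (auto simp: fixsets_def)
      have 1: "f ` (C \<inter> W1) = C \<inter> W1" using inj_on_image_Int[OF inj C(1), of W1] i C by simp
      have 2: "f ` (C \<inter> W2) = C \<inter> W2" using inj_on_image_Int[OF inj C(1), of W2] i C by simp
      have "C = (C \<inter> W1) \<union> (C \<inter> W2)" using C by blast
      then show "C \<in> (\<lambda>(A, B). A \<union> B) ` (fixsets f W1 \<times> fixsets f W2)"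
        using 1 2 by (intro image_eqI[of _ _ "(C \<inter> W1, C \<inter> W2)"]) (auto simp: fixsets_def)
    qed
  qed
  then show ?thesis by (metis bij_betw_same_card card_cartesian_product)
qed

section \<open>Cycles of affine maps modulo a prime\<close>

definition am :: "int \<Rightarrow> int \<Rightarrow> int \<Rightarrow> int \<Rightarrow> int" where
  "am q r t a = (r * a + t) mod q"

lemma am_in: "q > 0 \<Longrightarrow> am q r t a \<in> {0..<q}"
  by (simp add: am_def)

lemma ucyc_am_shift:
  assumes q: "prime q" and r: "[r = 1] (mod int q)"
  shows "ucyc (am (int q) r t) {0..<int q} (if int q dvd t then 1 else q)"
  unfolding ucyc_def
proof (intro conjI ballI allI)
  have q0: "int q > 0" using prime_gt_0_nat[OF q] by simp
  have pq: "prime (int q)" using q by simp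
  show "(if int q dvd t then 1 else q) > 0" using q0 by simp
  fix a assume a: "a \<in> {0..<int q}"
  show "am (int q) r t a \<in> {0..<int q}" by (rule am_in[OF q0])
  fix j
  have n: "[(am (int q) r t ^^ j) a = a + int j * t] (mod int q)"
  proof (induction j)
    case (Suc j)
    have "[(am (int q) r t ^^ Suc j) a = r * (am (int q) r t ^^ j) a + t] (mod int q)"
      by (simp add: am_def cong_def)
    also have "[r * (am (int q) r t ^^ j) a + t = 1 * (a + int j * t) + t] (mod int q)"
      by (intro cong_add cong_mult Suc r cong_refl)
    finally show ?case by (simp add: algebra_simps)
  qed simp
  have in_r: "(am (int q) r t ^^ j) a \<in> {0..<int q}"
    by (cases j) (use a am_in[OF q0] in simp_all)
  have "(am (int q) r t ^^ j) a = a \<longleftrightarrow> [(am (int q) r t ^^ j) a = a] (mod int q)"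
    using in_r a by (auto simp: cong_def)
  also have "\<dots> \<longleftrightarrow> [a + int j * t = a + 0] (mod int q)" using n by (metis add.right_neutral cong_sym cong_trans)
  also have "\<dots> \<longleftrightarrow> int q dvd int j * t" by (simp only: cong_add_lcancel cong_0_iff)
  also have "\<dots> \<longleftrightarrow> int q dvd int j \<or> int q dvd t" by (rule prime_dvd_mult_iff[OF pq])
  finally show "(am (int q) r t ^^ j) a = a \<longleftrightarrow> (if int q dvd t then 1 else q) dvd j" by auto
qed simp

text \<open>If \<open>r\<close> is not 1 modulo \<open>q\<close>, the map has the fixed point
  \<open>- t / (r - 1)\<close>, and relative to it the map is multiplication by
  \<open>r\<close>.\<close>

lemma ucyc_am_scale:
  assumes q: "prime q" and r: "\<not> [int r = 1] (mod int q)" "coprime r q"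
  obtains a0 where "a0 \<in> {0..<int q}" "ucyc (am (int q) (int r) t) {a0} 1"
    "ucyc (am (int q) (int r) t) ({0..<int q} - {a0}) (ord q r)" "t = 0 \<Longrightarrow> a0 = 0"
proof -
  have q0: "int q > 0" using prime_gt_0_nat[OF q] by simp
  have pq: "prime (int q)" using q by simp
  let ?f = "am (int q) (int r) t"
  have "\<not> int q dvd (int r - 1)" using r(1) by (simp add: cong_iff_dvd_diff)
  then have "coprime (int r - 1) (int q)" using pq by (metis coprime_commute prime_imp_coprime)
  then obtain u where u: "[(int r - 1) * u = 1] (mod int q)" using cong_solve_coprime_int by blast
  define a0 where "a0 = (- t * u) mod int q"
  have a0: "[(int r - 1) * a0 = - t] (mod int q)"
  proof -
    have "[(int r - 1) * a0 = (int r - 1) * (- t * u)] (mod int q)" by (intro cong_mult cong_refl) (simp add: a0_def cong_def)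
    also have "(int r - 1) * (- t * u) = ((int r - 1) * u) * (- t)" by simp
    also have "[((int r - 1) * u) * (- t) = 1 * (- t)] (mod int q)" by (intro cong_mult u cong_refl)
    finally show ?thesis by simp
  qed
  have n: "[(?f ^^ j) a - a0 = int r ^ j * (a - a0)] (mod int q)" for j a
  proof (induction j)
    case (Suc j)
    have "[(?f ^^ Suc j) a - a0 = (int r * (?f ^^ j) a + t) - a0] (mod int q)"
      by (intro cong_diff cong_refl) (simp add: am_def cong_def)
    also have "(int r * (?f ^^ j) a + t) - a0 = int r * ((?f ^^ j) a - a0) + ((int r - 1) * a0 + t)" by (simp add: algebra_simps)
    also have "[\<dots> = int r * (int r ^ j * (a - a0)) + (- t + t)] (mod int q)"
      by (intro cong_add cong_mult Suc a0 cong_refl)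
    finally show ?case by (simp add: algebra_simps)
  qed simp
  have per: "(?f ^^ j) a = a \<longleftrightarrow> a = a0 \<or> ord q r dvd j" if a: "a \<in> {0..<int q}" for a j
  proof -
    have in_r: "(?f ^^ j) a \<in> {0..<int q}" by (cases j) (use a am_in[OF q0] in simp_all)
    have a0r: "a0 \<in> {0..<int q}" using q0 by (simp add: a0_def)
    have "(?f ^^ j) a = a \<longleftrightarrow> [(?f ^^ j) a = a] (mod int q)" using in_r a by (auto simp: cong_def)
    also have "\<dots> \<longleftrightarrow> int q dvd (?f ^^ j) a - a" by (rule cong_iff_dvd_diff)
    also have "\<dots> \<longleftrightarrow> int q dvd (int r ^ j - 1) * (a - a0)"
    proof -
      have "int q dvd ((?f ^^ j) a - a0) - int r ^ j * (a - a0)" using n by (simp only: cong_iff_dvd_diff)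
      moreover have "(?f ^^ j) a - a = (((?f ^^ j) a - a0) - int r ^ j * (a - a0)) + (int r ^ j - 1) * (a - a0)"
        by (simp add: algebra_simps)
      ultimately show ?thesis by (simp only: dvd_add_right_iff)
    qed
    also have "\<dots> \<longleftrightarrow> int q dvd (int r ^ j - 1) \<or> int q dvd (a - a0)" by (rule prime_dvd_mult_iff[OF pq])
    also have "int q dvd (int r ^ j - 1) \<longleftrightarrow> [int (r ^ j) = int 1] (mod int q)" by (simp add: cong_iff_dvd_diff)
    also have "\<dots> \<longleftrightarrow> [r ^ j = 1] (mod q)" by (rule cong_int_iff)
    also have "\<dots> \<longleftrightarrow> ord q r dvd j" by (rule ord_divides)
    also have "int q dvd (a - a0) \<longleftrightarrow> a = a0" using a a0r by (auto simp: cong_iff_dvd_diff[symmetric] cong_def)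
    finally show ?thesis by blast
  qed
  have a0r: "a0 \<in> {0..<int q}" using q0 by (simp add: a0_def)
  have f0: "?f a0 = a0" using per[OF a0r, of 1] by simp
  have fn: "?f a \<noteq> a0" if a: "a \<in> {0..<int q}" "a \<noteq> a0" for a
  proof
    assume h: "?f a = a0"
    have "[?f a - a0 = int r * (a - a0)] (mod int q)" using n[of 1 a] by simp
    then have "[0 = int r * (a - a0)] (mod int q)" using h by simp
    then have "int q dvd int r * (a - a0)" using cong_0_iff cong_sym by blast
    then have "int q dvd int r \<or> int q dvd a - a0" using prime_dvd_mult_iff[OF pq] by blast
    moreover have "\<not> int q dvd int r" using r(2) q by (metis coprime_absorb_left coprime_commute int_dvd_int_iff not_prime_unit)
    moreover have "\<not> int q dvd a - a0" using a a0r by (auto simp: cong_iff_dvd_diff[symmetric] cong_def)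
    ultimately show False by blast
  qed
  have o0: "ord q r > 0" using r(2) by (simp add: ord_eq_0 coprime_commute neq0_conv[symmetric] del: neq0_conv)
  show ?thesis
  proof (rule that)
    show "ucyc ?f {a0} 1" unfolding ucyc_def using per[OF a0r] f0 by simp
    show "ucyc ?f ({0..<int q} - {a0}) (ord q r)" unfolding ucyc_def
      using per fn o0 am_in[OF q0] by simp
    show "a0 = 0" if "t = 0" using that by (simp add: a0_def)
  qed (rule a0r)
qed

text \<open>\<open>n\<close> plays the part of the number of cycles. Recording only how many subsets
  are invariant lets pieces with different cycle lengths be added by
  \<open>ncyc_union\<close>.\<close>

definition ncyc :: "('a \<Rightarrow> 'a) \<Rightarrow> 'a set \<Rightarrow> nat \<Rightarrow> bool" where
  "ncyc f W n \<longleftrightarrow> inj_on f W \<and> f ` W = W \<and> card (fixsets f W) = 2 ^ n"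

lemma ncyc_ucyc: "ucyc f W m \<Longrightarrow> ncyc f W (card W div m)"
  by (simp add: ncyc_def ucyc_inj ucyc_image card_fixsets_ucyc)

lemma ncyc_union:
  assumes "ncyc f W1 n1" "ncyc f W2 n2" "W1 \<inter> W2 = {}"
  shows "ncyc f (W1 \<union> W2) (n1 + n2)"
proof -
  have i: "inj_on f W1" "f ` W1 = W1" "inj_on f W2" "f ` W2 = W2" using assms by (auto simp: ncyc_def)
  have inj: "inj_on f (W1 \<union> W2)"
    unfolding inj_on_Un using i assms(3) by auto
  show ?thesis using card_fixsets_union[OF inj assms(3) i(2,4)] inj i assms unfolding ncyc_def
    by (simp add: image_Un power_add)
qed

lemma ucyc_am_zero:
  assumes q: "prime q" and r: "coprime r q"
  shows "ucyc (am (int q) (int r) 0) {0} 1" "ucyc (am (int q) (int r) 0) ({0..<int q} - {0}) (ord q r)"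
proof -
  have "ucyc (am (int q) (int r) 0) {0} 1 \<and> ucyc (am (int q) (int r) 0) ({0..<int q} - {0}) (ord q r)"
  proof (cases "[int r = 1] (mod int q)")
    case True
    have u: "ucyc (am (int q) (int r) 0) {0..<int q} 1" using ucyc_am_shift[OF q True, of 0] by simp
    have "[r = 1] (mod q)" using True by (metis cong_int_iff of_nat_1)
    then have "ord q r dvd 1" using ord_divides[of r 1 q] by simp
    then have o: "ord q r = 1" by simp
    have fx: "am (int q) (int r) 0 a = a" if "a \<in> {0..<int q}" for a using ucycD(4)[OF u that, of 1] by simp
    have "(am (int q) (int r) 0 ^^ j) a = a" if "a \<in> {0..<int q}" for a j using ucycD(4)[OF u that] by simp
    then show ?thesis using o fx prime_gt_0_nat[OF q] by (simp add: ucyc_def)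
  next
    case False
    show ?thesis by (rule ucyc_am_scale[OF q False r, of 0]) simp
  qed
  then show "ucyc (am (int q) (int r) 0) {0} 1" "ucyc (am (int q) (int r) 0) ({0..<int q} - {0}) (ord q r)" by auto
qed

section \<open>Cycle counts of the automorphisms\<close>

context dih6 begin

lemma gm_tuple:
  assumes "i \<in> {0..<3}" "a \<in> {0..<int p}"
  shows "gm r s t (e, i, a) = (e, am 3 r (if e then s else 0) i, am (int p) r (if e then t else 0) a)"
  using assms by (simp add: gm_def V_def pt_def am_def)

text \<open>The map acts coordinatewise, so on a product of two pieces with constant cycle lengths a
  point returns at the common multiples of the two.\<close>

lemma ucyc_gm:
  assumes I: "I \<subseteq> {0..<3}" "ucyc (am 3 r (if e then s else 0)) I m1"
    and A: "A \<subseteq> {0..<int p}" "ucyc (am (int p) r (if e then t else 0)) A m2"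
  shows "ucyc (gm r s t) ({e} \<times> I \<times> A) (lcm m1 m2)"
proof -
  let ?f = "am 3 r (if e then s else 0)" and ?g = "am (int p) r (if e then t else 0)"
  have n: "(gm r s t ^^ j) (e, i, a) = (e, (?f ^^ j) i, (?g ^^ j) a) \<and> (?f ^^ j) i \<in> I \<and> (?g ^^ j) a \<in> A"
    if ia: "i \<in> I" "a \<in> A" for i a j
  proof (induction j)
    case (Suc j)
    have "gm r s t (e, (?f ^^ j) i, (?g ^^ j) a) = (e, ?f ((?f ^^ j) i), ?g ((?g ^^ j) a))"
      by (rule gm_tuple) (use Suc I(1) A(1) in auto)
    then show ?case using Suc ucycD(3)[OF I(2)] ucycD(3)[OF A(2)] by simp
  qed (use ia in simp)
  have per: "(gm r s t ^^ j) (e, i, a) = (e, i, a) \<longleftrightarrow> lcm m1 m2 dvd j" if ia: "i \<in> I" "a \<in> A" for i a j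
    using n[OF ia, of j] ucycD(4)[OF I(2) ia(1), of j] ucycD(4)[OF A(2) ia(2), of j] by (simp add: lcm_least_iff)
  have cl: "gm r s t (e, i, a) \<in> {e} \<times> I \<times> A" if ia: "i \<in> I" "a \<in> A" for i a
    using n[OF ia, of 1] by simp
  show ?thesis unfolding ucyc_def
    using ucycD(1,2)[OF I(2)] ucycD(1,2)[OF A(2)] per cl by (auto simp: lcm_pos_nat)
qed

lemma ncyc_gm:
  assumes I: "I \<subseteq> {0..<3}" "ucyc (am 3 r (if e then s else 0)) I m1"
    and A: "A \<subseteq> {0..<int p}" "ucyc (am (int p) r (if e then t else 0)) A m2"
  shows "ncyc (gm r s t) ({e} \<times> I \<times> A) (card I * card A div lcm m1 m2)"
  using ncyc_ucyc[OF ucyc_gm[OF assms]] by (simp add: card_cartesian_product)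

lemma coprime_parts:
  assumes "coprime r (3 * p)" shows "coprime r 3" "coprime r p"
  using assms by auto

lemma prime3: "prime (3::nat)" by simp

text \<open>On rotations 0 is fixed in both coordinates. The three summands belong to the rotations
  with only the coordinate modulo \<open>p\<close> non-zero, with only the one modulo 3 non-zero,
  and with both non-zero.\<close>

lemma ncyc_F:
  assumes r: "coprime r (3 * p)"
  shows "ncyc (gm (int r) s t) ({False} \<times> {0..<3} \<times> {0..<int p} - {(False, 0, 0)})
    ((p - 1) div ord p r + 2 div ord 3 r + 2 * (p - 1) div lcm (ord 3 r) (ord p r))"
proof -
  note cr = coprime_parts[OF r]
  note u3 = ucyc_am_zero[OF prime3 cr(1), unfolded of_nat_numeral] and up = ucyc_am_zero[OF prime_p cr(2)]
  let ?I = "{0..<3::int} - {0}" and ?A = "{0..<int p} - {0}"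
  have cA: "card ?A = p - 1" and cI: "card ?I = 2" by (simp_all add: card_Diff_subset)
  have 1: "ncyc (gm (int r) s t) ({False} \<times> {0} \<times> ?A) ((p - 1) div ord p r)"
    using ncyc_gm[of "{0}" "int r" False s 1 ?A t "ord p r"] u3 up cA by simp
  have 2: "ncyc (gm (int r) s t) ({False} \<times> ?I \<times> {0}) (2 div ord 3 r)"
    using ncyc_gm[of ?I "int r" False s "ord 3 r" "{0}" t 1] u3 up cI by simp
  have 3: "ncyc (gm (int r) s t) ({False} \<times> ?I \<times> ?A) (2 * (p - 1) div lcm (ord 3 r) (ord p r))"
    using ncyc_gm[of ?I "int r" False s "ord 3 r" ?A t "ord p r"] u3 up cA cI by simp
  have "ncyc (gm (int r) s t) (({False} \<times> {0} \<times> ?A \<union> {False} \<times> ?I \<times> {0}) \<union> {False} \<times> ?I \<times> ?A)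
    ((p - 1) div ord p r + 2 div ord 3 r + 2 * (p - 1) div lcm (ord 3 r) (ord p r))"
    by (intro ncyc_union 1 2 3) auto
  moreover have "({False} \<times> {0} \<times> ?A \<union> {False} \<times> ?I \<times> {0}) \<union> {False} \<times> ?I \<times> ?A =
    {False} \<times> {0..<3} \<times> {0..<int p} - {(False, 0, 0)}" using p_pos by auto
  ultimately show ?thesis by simp
qed

lemma ord_one_iff: assumes "n > 1" shows "ord n r = 1 \<longleftrightarrow> [int r = 1] (mod int n)"
proof -
  have "ord n r = 1 \<longleftrightarrow> ord n r dvd 1" by simp
  also have "\<dots> \<longleftrightarrow> [r ^ 1 = 1] (mod n)" by (rule ord_divides[symmetric])
  also have "\<dots> \<longleftrightarrow> [int r = int 1] (mod int n)" by (simp only: cong_int_iff power_one_right)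
  finally show ?thesis by simp
qed

lemma ncyc_T11:
  assumes "ord 3 r = 1" "ord p r = 1"
  shows "ncyc (gm (int r) s t) ({True} \<times> {0..<3} \<times> {0..<int p})
    (3 * p div lcm (if 3 dvd s then 1 else 3) (if int p dvd t then 1 else p))"
proof -
  have c: "[int r = 1] (mod int 3)" "[int r = 1] (mod int p)"
    using ord_one_iff[of 3 r] ord_one_iff[of p r] assms p_gt_3 by simp_all
  show ?thesis
    using ncyc_gm[of "{0..<3}" "int r" True s _ "{0..<int p}" t]
      ucyc_am_shift[OF prime3 c(1), of s] ucyc_am_shift[OF prime_p c(2), of t] by simp
qed

text \<open>Modulo \<open>p\<close> the affine map has a fixed point for every \<open>t\<close>, so
  the count varies with \<open>s\<close> alone.\<close>

lemma ncyc_T1: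
  assumes r: "coprime r (3 * p)" "ord 3 r = 1" "ord p r \<noteq> 1"
  shows "ncyc (gm (int r) s t) ({True} \<times> {0..<3} \<times> {0..<int p})
    (3 div (if 3 dvd s then 1 else 3) + 3 * (p - 1) div lcm (if 3 dvd s then 1 else 3) (ord p r))"
proof -
  note cr = coprime_parts[OF r(1)]
  have c: "[int r = 1] (mod int 3)" "\<not> [int r = 1] (mod int p)"
    using ord_one_iff[of 3 r] ord_one_iff[of p r] r p_gt_3 by simp_all
  obtain a0 where a0: "a0 \<in> {0..<int p}" "ucyc (am (int p) (int r) t) {a0} 1"
    "ucyc (am (int p) (int r) t) ({0..<int p} - {a0}) (ord p r)"
    using ucyc_am_scale[OF prime_p c(2) cr(2), of t] by blast
  let ?A = "{0..<int p} - {a0}" and ?m = "if 3 dvd s then 1 else 3 :: nat"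
  have cA: "card ?A = p - 1" using a0(1) by (simp add: card_Diff_subset)
  have u3: "ucyc (am 3 (int r) s) {0..<3} ?m" using ucyc_am_shift[OF prime3 c(1), of s] by simp
  have 1: "ncyc (gm (int r) s t) ({True} \<times> {0..<3} \<times> {a0}) (3 div ?m)"
    using ncyc_gm[of "{0..<3}" "int r" True s ?m "{a0}" t 1] u3 a0 by simp
  have 2: "ncyc (gm (int r) s t) ({True} \<times> {0..<3} \<times> ?A) (3 * (p - 1) div lcm ?m (ord p r))"
    using ncyc_gm[of "{0..<3}" "int r" True s ?m ?A t "ord p r"] u3 a0 cA by simp
  have "ncyc (gm (int r) s t) ({True} \<times> {0..<3} \<times> {a0} \<union> {True} \<times> {0..<3} \<times> ?A) (3 div ?m + 3 * (p - 1) div lcm ?m (ord p r))"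
    by (rule ncyc_union[OF 1 2]) auto
  moreover have "{True} \<times> {0..<3} \<times> {a0} \<union> {True} \<times> {0..<3} \<times> ?A = {True} \<times> {0..<3::int} \<times> {0..<int p}" using a0(1) by auto
  ultimately show ?thesis by simp
qed

text \<open>The mirror case: a fixed point modulo 3 for every \<open>s\<close>, and a pure shift by
  \<open>t\<close> modulo \<open>p\<close>.\<close>

lemma ncyc_Tp:
  assumes r: "coprime r (3 * p)" "ord 3 r = 2" "ord p r = 1"
  shows "ncyc (gm (int r) s t) ({True} \<times> {0..<3} \<times> {0..<int p})
    (p div (if int p dvd t then 1 else p) + 2 * p div lcm 2 (if int p dvd t then 1 else p))"
proof -
  note cr = coprime_parts[OF r(1)]
  have c: "\<not> [int r = 1] (mod int 3)" "[int r = 1] (mod int p)"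
    using ord_one_iff[of 3 r] ord_one_iff[of p r] r p_gt_3 by simp_all
  obtain i0 where i0: "i0 \<in> {0..<3}" "ucyc (am 3 (int r) s) {i0} 1" "ucyc (am 3 (int r) s) ({0..<3} - {i0}) 2"
    using ucyc_am_scale[OF prime3 c(1) cr(1), of s] r(2) by auto
  let ?I = "{0..<3} - {i0}" and ?m = "if int p dvd t then 1 else p"
  have cI: "card ?I = 2" using i0(1) by (simp add: card_Diff_subset)
  have up: "ucyc (am (int p) (int r) t) {0..<int p} ?m" by (rule ucyc_am_shift[OF prime_p c(2)])
  have 1: "ncyc (gm (int r) s t) ({True} \<times> {i0} \<times> {0..<int p}) (p div ?m)"
    using ncyc_gm[of "{i0}" "int r" True s 1 "{0..<int p}" t ?m] up i0 by simp
  have 2: "ncyc (gm (int r) s t) ({True} \<times> ?I \<times> {0..<int p}) (2 * p div lcm 2 ?m)"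
    using ncyc_gm[of ?I "int r" True s 2 "{0..<int p}" t ?m] up i0 cI by simp
  have "ncyc (gm (int r) s t) ({True} \<times> {i0} \<times> {0..<int p} \<union> {True} \<times> ?I \<times> {0..<int p}) (p div ?m + 2 * p div lcm 2 ?m)"
    by (rule ncyc_union[OF 1 2]) auto
  moreover have "{True} \<times> {i0} \<times> {0..<int p} \<union> {True} \<times> ?I \<times> {0..<int p} = {True} \<times> {0..<3::int} \<times> {0..<int p}" using i0(1) by auto
  ultimately show ?thesis by simp
qed

text \<open>Both coordinates have a fixed point. It cuts the reflections into four products, with
  the same count for all \<open>s\<close> and \<open>t\<close>.\<close>

lemma ncyc_T22:
  assumes r: "coprime r (3 * p)" "ord 3 r = 2" "ord p r \<noteq> 1"
  shows "ncyc (gm (int r) s t) ({True} \<times> {0..<3} \<times> {0..<int p})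
    (1 + 1 + (p - 1) div ord p r + 2 * (p - 1) div lcm 2 (ord p r))"
proof -
  note cr = coprime_parts[OF r(1)]
  have c: "\<not> [int r = 1] (mod int 3)" "\<not> [int r = 1] (mod int p)"
    using ord_one_iff[of 3 r] ord_one_iff[of p r] r p_gt_3 by simp_all
  obtain i0 where i0: "i0 \<in> {0..<3}" "ucyc (am 3 (int r) s) {i0} 1" "ucyc (am 3 (int r) s) ({0..<3} - {i0}) 2"
    using ucyc_am_scale[OF prime3 c(1) cr(1), of s] r(2) by auto
  obtain a0 where a0: "a0 \<in> {0..<int p}" "ucyc (am (int p) (int r) t) {a0} 1"
    "ucyc (am (int p) (int r) t) ({0..<int p} - {a0}) (ord p r)"
    using ucyc_am_scale[OF prime_p c(2) cr(2), of t] by blast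
  let ?I = "{0..<3} - {i0}" and ?A = "{0..<int p} - {a0}"
  have cI: "card ?I = 2" and cA: "card ?A = p - 1" using i0(1) a0(1) by (simp_all add: card_Diff_subset)
  have 1: "ncyc (gm (int r) s t) ({True} \<times> {i0} \<times> {a0}) 1"
    using ncyc_gm[of "{i0}" "int r" True s 1 "{a0}" t 1] i0 a0 by simp
  have 2: "ncyc (gm (int r) s t) ({True} \<times> ?I \<times> {a0}) 1"
    using ncyc_gm[of ?I "int r" True s 2 "{a0}" t 1] i0 a0 cI by simp
  have 3: "ncyc (gm (int r) s t) ({True} \<times> {i0} \<times> ?A) ((p - 1) div ord p r)"
    using ncyc_gm[of "{i0}" "int r" True s 1 ?A t "ord p r"] i0 a0 cA by simp
  have 4: "ncyc (gm (int r) s t) ({True} \<times> ?I \<times> ?A) (2 * (p - 1) div lcm 2 (ord p r))"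
    using ncyc_gm[of ?I "int r" True s 2 ?A t "ord p r"] i0 a0 cI cA by simp
  have "ncyc (gm (int r) s t) ((({True} \<times> {i0} \<times> {a0} \<union> {True} \<times> ?I \<times> {a0}) \<union> {True} \<times> {i0} \<times> ?A) \<union> {True} \<times> ?I \<times> ?A)
    (1 + 1 + (p - 1) div ord p r + 2 * (p - 1) div lcm 2 (ord p r))"
    by (intro ncyc_union 1 2 3 4) auto
  moreover have "(({True} \<times> {i0} \<times> {a0} \<union> {True} \<times> ?I \<times> {a0}) \<union> {True} \<times> {i0} \<times> ?A) \<union> {True} \<times> ?I \<times> ?A =
    {True} \<times> {0..<3::int} \<times> {0..<int p}" using i0(1) a0(1) by auto
  ultimately show ?thesis by simp
qed

definition org :: vtx where "org = (False, 0, 0)"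

definition N :: "nat \<Rightarrow> int \<Rightarrow> int \<Rightarrow> nat" where
  "N r s t = card (fixsets (gm (int r) s t) (V - {org}))"

lemma N_eq:
  assumes r: "coprime r (3 * p)" and T: "ncyc (gm (int r) s t) ({True} \<times> {0..<3} \<times> {0..<int p}) k"
  shows "N r s t = 2 ^ ((p - 1) div ord p r + 2 div ord 3 r + 2 * (p - 1) div lcm (ord 3 r) (ord p r) + k)"
proof -
  have "ncyc (gm (int r) s t) (({False} \<times> {0..<3} \<times> {0..<int p} - {(False, 0, 0)}) \<union> {True} \<times> {0..<3} \<times> {0..<int p})
     ((p - 1) div ord p r + 2 div ord 3 r + 2 * (p - 1) div lcm (ord 3 r) (ord p r) + k)"
    by (rule ncyc_union[OF ncyc_F[OF r] T]) auto
  moreover have "({False} \<times> {0..<3} \<times> {0..<int p} - {(False, 0, 0)}) \<union> {True} \<times> {0..<3} \<times> {0..<int p} = V - {org}"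
    by (auto simp: V_def org_def)
  ultimately show ?thesis by (simp add: N_def ncyc_def)
qed

lemma N11:
  assumes r: "coprime r (3 * p)" "ord 3 r = 1" "ord p r = 1"
  shows "N r s t = 2 ^ (3 * p - 1 + (if 3 dvd s then (if int p dvd t then 3 * p else 3) else (if int p dvd t then p else 1)))"
proof -
  have "lcm 3 p = 3 * p"
    using primes_coprime[OF prime3 prime_p] p_gt_3 by (simp add: lcm_coprime)
  moreover have "(p - 1) + 2 + 2 * (p - 1) = 3 * p - 1" using p_gt_3 by simp
  ultimately show ?thesis using N_eq[OF r(1) ncyc_T11[OF r(2,3)], of s t] r p_gt_3 by auto
qed

lemma ord_p_dvd: assumes "coprime r (3 * p)" shows "ord p r dvd p - 1" "ord p r > 0"
proof -
  have "coprime p r" using assms by (simp add: coprime_commute)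
  then have "ord p r dvd totient p" by (rule order_divides_totient)
  then show "ord p r dvd p - 1" using totient_prime[OF prime_p] by simp
  then show "ord p r > 0" using p_gt_3 by (intro Nat.gr0I) auto
qed

text \<open>With \<open>D = (p - 1) div ord p r\<close>, the rotations contribute
  \<open>3 * D + 2\<close> cycles; the reflections contribute \<open>3 + 3 * D\<close>,
  \<open>1 + D\<close> and \<open>1 + 3 * D\<close> in the three cases.\<close>

lemma N1:
  assumes r: "coprime r (3 * p)" "ord 3 r = 1" "ord p r \<noteq> 1"
  shows "3 dvd s \<Longrightarrow> N r s t = 2 ^ (5 + 6 * (p - 1) div ord p r)"
    "\<not> 3 dvd s \<Longrightarrow> \<not> 3 dvd ord p r \<Longrightarrow> N r s t = 2 ^ (3 + 4 * (p - 1) div ord p r)"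
    "\<not> 3 dvd s \<Longrightarrow> 3 dvd ord p r \<Longrightarrow> N r s t = 2 ^ (3 + 6 * (p - 1) div ord p r)"
proof -
  obtain D where D: "p - 1 = ord p r * D" using ord_p_dvd[OF r(1)] by (elim dvdE)
  note o = ord_p_dvd(2)[OF r(1)]
  have e: "k * (p - 1) div ord p r = k * D" for k
  proof -
    have "k * (p - 1) = k * D * ord p r" using D by simp
    then show ?thesis using div_mult_self_is_m[OF o, of "k * D"] by (simp only:)
  qed
  have e1: "(p - 1) div ord p r = D" using e[of 1] by simp
  have e2: "k * (p - Suc 0) div ord p r = k * D" "(p - Suc 0) div ord p r = D" for k using e[of k] e1 by simp_all
  note n = N_eq[OF r(1) ncyc_T1[OF r], of s t]
  show "3 dvd s \<Longrightarrow> N r s t = 2 ^ (5 + 6 * (p - 1) div ord p r)"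
    unfolding n using r(2) by (intro arg_cong[of _ _ "power (2::nat)"]) (simp add: e e1 e2)
  show "N r s t = 2 ^ (3 + 4 * (p - 1) div ord p r)" if "\<not> 3 dvd s" "\<not> 3 dvd ord p r"
  proof -
    have "coprime 3 (ord p r)" by (rule prime_imp_coprime[OF prime3 that(2)])
    then have "lcm 3 (ord p r) = 3 * ord p r" by (simp add: lcm_coprime)
    moreover have "3 * (p - 1) div (3 * ord p r) = D" using e1 by simp
    ultimately show ?thesis unfolding n using r(2) that by (intro arg_cong[of _ _ "power (2::nat)"]) (simp add: e e1 e2)
  qed
  show "N r s t = 2 ^ (3 + 6 * (p - 1) div ord p r)" if "\<not> 3 dvd s" "3 dvd ord p r"
  proof -
    have "lcm 3 (ord p r) = ord p r" using that(2) by (simp add: lcm_proj2_if_dvd_nat)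
    then show ?thesis unfolding n using r(2) that by (intro arg_cong[of _ _ "power (2::nat)"]) (simp add: e e1 e2)
  qed
qed

lemma N2p:
  assumes r: "coprime r (3 * p)" "ord 3 r = 2" "ord p r = 1"
  shows "N r s t = 2 ^ (2 * p - 1 + (if int p dvd t then 2 * p else 2))"
proof -
  have "odd p" using prime_p p_gt_3 prime_odd_nat by simp
  then have l: "lcm 2 p = 2 * p" by (simp add: lcm_coprime)
  have "(p - 1) + 1 + (p - 1) = 2 * p - 1" using p_gt_3 by simp
  then show ?thesis using N_eq[OF r(1) ncyc_Tp[OF r], of s t] r(2,3) l p_gt_3 by simp
qed

text \<open>With \<open>D = (p - 1) div ord p r\<close>, the two pieces where both coordinates move
  have \<open>2 * D\<close> cycles each if the order modulo \<open>p\<close> is even and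
  \<open>D\<close> each otherwise; all other pieces together have \<open>3 + 2 * D\<close>.\<close>

lemma N22:
  assumes r: "coprime r (3 * p)" "ord 3 r = 2" "ord p r \<noteq> 1"
  shows "N r s t = 2 ^ (3 + (if 2 dvd ord p r then 6 else 4) * (p - 1) div ord p r)"
proof -
  obtain D where D: "p - 1 = ord p r * D" using ord_p_dvd[OF r(1)] by (elim dvdE)
  note o = ord_p_dvd(2)[OF r(1)]
  have e: "k * (p - 1) div ord p r = k * D" for k
  proof -
    have "k * (p - 1) = k * D * ord p r" using D by simp
    then show ?thesis using div_mult_self_is_m[OF o, of "k * D"] by (simp only:)
  qed
  have e1: "(p - 1) div ord p r = D" using e[of 1] by simp
  have e2: "k * (p - Suc 0) div ord p r = k * D" "(p - Suc 0) div ord p r = D" for k using e[of k] e1 by simp_all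
  note n = N_eq[OF r(1) ncyc_T22[OF r], of s t]
  show ?thesis
  proof (cases "2 dvd ord p r")
    case True
    then have "lcm 2 (ord p r) = ord p r" by (simp add: lcm_proj2_if_dvd_nat)
    then show ?thesis unfolding n using r(2) True by (intro arg_cong[of _ _ "power (2::nat)"]) (simp add: e e1 e2)
  next
    case False
    then have "coprime 2 (ord p r)" by simp
    then have "lcm 2 (ord p r) = 2 * ord p r" by (simp add: lcm_coprime)
    moreover have "2 * (p - 1) div (2 * ord p r) = D" using e1 by simp
    ultimately show ?thesis unfolding n using r(2) False by (intro arg_cong[of _ _ "power (2::nat)"]) (simp add: e e1 e2)
  qed
qed

end

lemma card_quotient_bij:
  assumes h: "bij_betw h X Y" and PQ: "\<And>x y. x \<in> X \<Longrightarrow> y \<in> X \<Longrightarrow> Q (h x) (h y) \<longleftrightarrow> P x y"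
  shows "card (Y // {(x, y). x \<in> Y \<and> y \<in> Y \<and> Q x y}) = card (X // {(x, y). x \<in> X \<and> y \<in> X \<and> P x y})"
proof -
  let ?R = "{(x, y). x \<in> X \<and> y \<in> X \<and> P x y}" and ?S = "{(x, y). x \<in> Y \<and> y \<in> Y \<and> Q x y}"
  have hX: "h ` X = Y" and inj: "inj_on h X" using h by (auto simp: bij_betw_def)
  have cls: "?S `` {h x} = h ` (?R `` {x})" if x: "x \<in> X" for x
  proof (intro equalityI subsetI)
    fix y assume "y \<in> ?S `` {h x}"
    then have y: "y \<in> Y" "Q (h x) y" by auto
    then obtain z where "z \<in> X" "y = h z" using hX by blast
    then show "y \<in> h ` (?R `` {x})" using y PQ x by auto
  next
    fix y assume "y \<in> h ` (?R `` {x})"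
    then obtain z where "z \<in> X" "P x z" "y = h z" by auto
    then show "y \<in> ?S `` {h x}" using PQ[OF x] x hX by auto
  qed
  have "Y // ?S = (\<lambda>y. ?S `` {y}) ` Y" by (auto simp: quotient_def)
  also have "\<dots> = (\<lambda>y. ?S `` {y}) ` h ` X" by (simp only: hX)
  also have "\<dots> = (\<lambda>x. ?S `` {h x}) ` X" by (rule image_image)
  also have "\<dots> = (\<lambda>x. h ` (?R `` {x})) ` X" by (rule image_cong) (simp_all only: cls)
  also have "\<dots> = (`) h ` (X // ?R)" by (auto simp: quotient_def)
  finally have eq: "Y // ?S = (`) h ` (X // ?R)" .
  have "X // ?R \<subseteq> Pow X" by (auto simp: quotient_def)
  then have "inj_on ((`) h) (X // ?R)" using inj_on_image_Pow[OF inj] inj_on_subset by blast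
  then show ?thesis unfolding eq by (rule card_image)
qed

context dih6 begin

section \<open>The orbit count\<close>

definition Y :: "vtx set set" where "Y = Pow (V - {org})"

lemma org_pt: "org = pt False 0 0" by (simp add: org_def pt_def)

lemma gm_org: "gm r s t org = org" by (simp add: org_pt gm_pt)

lemma AG_org: "g \<in> AG \<Longrightarrow> g org = org" by (auto simp: AG_def gm_org)

lemma AG_perm: "g \<in> AG \<Longrightarrow> g permutes V" by (rule perm_groupD(2)[OF perm_group_AG])

lemma AG_image_Y: assumes "g \<in> AG" "A \<in> Y" shows "g ` A \<in> Y"
proof -
  have "g ` V = V" by (rule permutes_image[OF AG_perm[OF assms(1)]])
  moreover have "org \<notin> g ` A"
  proof
    assume "org \<in> g ` A"
    then obtain a where a: "a \<in> A" "g a = org" by auto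
    then have "g a = g org" using AG_org[OF assms(1)] by simp
    then have "a = org" using injD[OF permutes_inj[OF AG_perm[OF assms(1)]]] by blast
    then show False using a assms(2) by (auto simp: Y_def)
  qed
  ultimately show ?thesis using assms(2) by (auto simp: Y_def)
qed

lemma bij_conn: "bij_betw ((`) \<phi>) Y (conn_sets DG)"
proof -
  have o: "org \<in> V" by (simp add: org_pt)
  have "bij_betw \<phi> (V - {org}) (carrier DG - {\<one>\<^bsub>DG\<^esub>})"
    using bij_betw_DiffI[OF bij_\<phi>, of "{org}" "{\<one>\<^bsub>DG\<^esub>}"] o \<phi>_carrier[OF o] by (simp add: one_DG org_pt)
  then show ?thesis unfolding Y_def conn_sets_def by (rule bij_betw_Pow)
qed

lemma rel_conn:
  assumes A: "A \<in> Y" and B: "B \<in> Y"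
  shows "cay_iso DG (\<phi> ` A) (\<phi> ` B) \<longleftrightarrow> (\<exists>g\<in>AG. g ` A = B)"
    "(\<exists>\<sigma>\<in>auto DG. \<sigma> ` (\<phi> ` A) = \<phi> ` B) \<longleftrightarrow> (\<exists>g\<in>AG. g ` A = B)"
proof -
  have AV: "A \<subseteq> V" "B \<subseteq> V" using A B by (auto simp: Y_def)
  have AC: "\<phi> ` A \<subseteq> carrier DG" "\<phi> ` B \<subseteq> carrier DG" using AV \<phi>_carrier by blast+
  have mem: "\<phi> v \<in> \<phi> ` C \<longleftrightarrow> v \<in> C" if "v \<in> V" "C \<subseteq> V" for v C
    using \<phi>_inj[OF that(1)] that(2) by blast
  have 1: "\<exists>g\<in>AG. g ` A = B" if ci: "cay_iso DG (\<phi> ` A) (\<phi> ` B)"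
  proof -
    obtain g where g: "g \<in> AG" "\<forall>v\<in>V. \<phi> v \<in> \<phi> ` A \<longleftrightarrow> \<phi> (g v) \<in> \<phi> ` B"
      using AG_of_cay_iso[OF AC ci] by blast
    note gp = AG_perm[OF g(1)]
    have iff: "v \<in> A \<longleftrightarrow> g v \<in> B" if "v \<in> V" for v
      using g(2) that mem[OF that AV(1)] mem[of "g v" B] AV(2) gp by simp
    have "g ` A = B"
    proof (intro equalityI subsetI)
      fix x assume "x \<in> g ` A" then show "x \<in> B" using iff AV by blast
    next
      fix x assume x: "x \<in> B"
      then have xV: "x \<in> V" using AV by blast
      have gi: "g (pinv g x) = x" by (rule permutes_inverses(1)[OF gp])
      have "pinv g x \<in> V" using permutes_inv[OF gp] xV by simp
      then have "pinv g x \<in> A" using iff x gi by simp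
      then show "x \<in> g ` A" using gi by (metis imageI)
    qed
    then show ?thesis using g(1) by blast
  qed
  have 2: "\<exists>\<sigma>\<in>auto DG. \<sigma> ` (\<phi> ` A) = \<phi> ` B" if h: "\<exists>g\<in>AG. g ` A = B"
  proof -
    obtain g where g: "g \<in> AG" "g ` A = B" using h by blast
    obtain \<sigma> where s: "\<sigma> \<in> auto DG" "\<And>v. v \<in> V \<Longrightarrow> \<sigma> (\<phi> v) = \<phi> (g v)" using auto_of_AG[OF g(1)] by blast
    have "\<sigma> ` (\<phi> ` A) = (\<lambda>v. \<phi> (g v)) ` A" unfolding image_image by (rule image_cong) (use s(2) AV in auto)
    also have "\<dots> = \<phi> ` (g ` A)" by (simp only: image_image)
    finally have "\<sigma> ` (\<phi> ` A) = \<phi> ` B" by (simp only: g(2))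
    then show ?thesis using s(1) by blast
  qed
  have 3: "cay_iso DG (\<phi> ` A) (\<phi> ` B)" if "\<exists>\<sigma>\<in>auto DG. \<sigma> ` (\<phi> ` A) = \<phi> ` B"
    using cay_iso_of_auto AC(1) that by metis
  show "cay_iso DG (\<phi> ` A) (\<phi> ` B) \<longleftrightarrow> (\<exists>g\<in>AG. g ` A = B)"
    "(\<exists>\<sigma>\<in>auto DG. \<sigma> ` (\<phi> ` A) = \<phi> ` B) \<longleftrightarrow> (\<exists>g\<in>AG. g ` A = B)" using 1 2 3 by blast+
qed

definition orbs :: nat where
  "orbs = card (Y // {(A, B). A \<in> Y \<and> B \<in> Y \<and> (\<exists>g\<in>AG. g ` A = B)})"

lemma num_eq_orbs: "num_cay_digraphs DG = orbs" "num_aut_orbits DG = orbs"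
proof -
  show "num_cay_digraphs DG = orbs" unfolding num_cay_digraphs_def orbs_def
    by (rule card_quotient_bij[OF bij_conn]) (rule rel_conn(1))
  show "num_aut_orbits DG = orbs" unfolding num_aut_orbits_def orbs_def
    by (rule card_quotient_bij[OF bij_conn]) (rule rel_conn(2))
qed

text \<open>Unlike the index set of the final sums this contains 1, which corresponds to the
  automorphisms that fix all rotations.\<close>

definition UU :: "nat set" where "UU = {r. 0 < r \<and> r < 3 * p \<and> coprime r (3 * p)}"

definition par :: "nat \<times> nat \<times> nat \<Rightarrow> vtx \<Rightarrow> vtx" where
  "par q = gm (int (fst q)) (int (fst (snd q))) (int (snd (snd q)))"

lemma gm_cong:
  assumes "r mod 3 = r' mod 3" "r mod int p = r' mod int p" "s mod 3 = s' mod 3" "t mod int p = t' mod int p"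
  shows "gm r s t = gm r' s' t'"
proof
  fix v
  show "gm r s t v = gm r' s' t' v"
  proof (cases "v \<in> V")
    case True
    then obtain e i a where v: "v = pt e i a" using ptE by blast
    have "(r * i + (if e then s else 0)) mod 3 = (r' * i + (if e then s' else 0)) mod 3"
      by (intro mod_add_cong mod_mult_cong assms refl) (use assms in simp)
    moreover have "(r * a + (if e then t else 0)) mod int p = (r' * a + (if e then t' else 0)) mod int p"
      by (intro mod_add_cong mod_mult_cong assms refl) (use assms in simp)
    ultimately show ?thesis unfolding v gm_pt pt_iff by simp
  qed (simp add: gm_out)
qed

lemma coprime_3p: "coprime 3 p"
  using primes_coprime[OF prime3 prime_p] p_gt_3 by simp

lemma unit3_iff: "unit3 (int r) \<longleftrightarrow> coprime r (3 * p)"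
proof -
  have "coprime r 3 \<longleftrightarrow> \<not> 3 dvd r" using prime_imp_coprime[OF prime3, of r] by (metis coprime_absorb_left coprime_commute not_prime_unit prime3)
  moreover have "coprime r p \<longleftrightarrow> \<not> p dvd r" using prime_imp_coprime[OF prime_p, of r] by (metis coprime_absorb_left coprime_commute not_prime_unit prime_p)
  moreover have "3 dvd int r \<longleftrightarrow> 3 dvd r" by (metis int_dvd_int_iff of_nat_numeral)
  ultimately show ?thesis by (simp add: unit3_def)
qed

lemma cong_3p:
  assumes "x mod 3 = y mod 3" "x mod int p = y mod int p"
  shows "x mod (3 * int p) = y mod (3 * int p)"
proof -
  have "coprime 3 (int p)" by (rule prime_imp_coprime[OF _ three_not_dvd]) simp
  moreover have "3 dvd (x - y)" "int p dvd (x - y)" using assms by (simp_all only: mod_eq_dvd_iff)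
  ultimately have "3 * int p dvd (x - y)" using divides_mult by blast
  then show ?thesis by (simp only: mod_eq_dvd_iff)
qed

lemma AG_par: "AG = par ` (UU \<times> {..<3} \<times> {..<p})" "inj_on par (UU \<times> {..<3} \<times> {..<p})"
proof -
  show "AG = par ` (UU \<times> {..<3} \<times> {..<p})"
  proof (intro equalityI subsetI)
    fix g assume "g \<in> AG"
    then obtain r s t where g: "g = gm r s t" "unit3 r" by (auto simp: AG_def)
    define r' where "r' = nat (r mod (3 * int p))"
    have n0: "3 * int p > 0" by (simp add: p_pos)
    have ir: "int r' = r mod (3 * int p)" using n0 by (simp add: r'_def)
    have rm: "int r' mod 3 = r mod 3" "int r' mod int p = r mod int p"
      unfolding ir by (simp_all add: mod_mod_cancel)
    have "unit3 (int r')" using g(2) rm unfolding unit3_def by (metis dvd_eq_mod_eq_0)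
    then have cop: "coprime r' (3 * p)" by (simp add: unit3_iff)
    have "r' \<noteq> 0"
    proof
      assume "r' = 0" then show False using cop p_gt_3 by simp
    qed
    moreover have "r' < 3 * p" using ir n0 pos_mod_bound[OF n0, of r] by linarith
    ultimately have rU: "r' \<in> UU" using cop by (simp add: UU_def)
    have "g = par (r', nat (s mod 3), nat (t mod int p))"
      unfolding g par_def by (rule gm_cong) (simp_all add: rm)
    moreover have "nat (s mod 3) < 3" "nat (t mod int p) < p" by (simp_all add: nat_less_iff)
    ultimately show "g \<in> par ` (UU \<times> {..<3} \<times> {..<p})" using rU by blast
  next
    fix g assume "g \<in> par ` (UU \<times> {..<3} \<times> {..<p})"
    then obtain r s t where "g = gm (int r) (int s) (int t)" "r \<in> UU" by (auto simp: par_def)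
    then show "g \<in> AG" using unit3_iff by (auto simp: AG_def UU_def)
  qed
  show "inj_on par (UU \<times> {..<3} \<times> {..<p})"
  proof (rule inj_onI)
    fix q q' assume h: "q \<in> UU \<times> {..<3} \<times> {..<p}" "q' \<in> UU \<times> {..<3} \<times> {..<p}" "par q = par q'"
    obtain r s t where q: "q = (r, s, t)" by (cases q) auto
    obtain r' s' t' where q': "q' = (r', s', t')" by (cases q') auto
    have b: "r < 3 * p" "s < 3" "t < p" "r' < 3 * p" "s' < 3" "t' < p" using h q q' by (auto simp: UU_def)
    \<comment> \<open>The image of the first vertex reveals \<open>r\<close> modulo 3 and modulo
      \<open>p\<close>, that of the second reveals \<open>s\<close> and \<open>t\<close>.\<close>
    have "par q (pt False 1 1) = par q' (pt False 1 1)" "par q (pt True 0 0) = par q' (pt True 0 0)" using h(3) by simp_all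
    then have m: "int r mod 3 = int r' mod 3" "int r mod int p = int r' mod int p" "int s mod 3 = int s' mod 3" "int t mod int p = int t' mod int p"
      by (simp_all add: q q' par_def gm_pt pt_iff)
    have "int r mod (3 * int p) = int r' mod (3 * int p)" by (rule cong_3p[OF m(1,2)])
    then have "r = r'" using b by simp
    moreover have "s = s'" using m(3) b by simp
    moreover have "t = t'" using m(4) b by simp
    ultimately show "q = q'" by (simp add: q q')
  qed
qed

lemma UU_totatives: "UU = totatives (3 * p)"
proof -
  have "\<not> coprime (3 * p) (3 * p)" using p_gt_3 by simp
  then have "r \<noteq> 3 * p" if "coprime r (3 * p)" for r using that by blast
  then show ?thesis by (auto simp: UU_def totatives_def le_less)
qed

lemma card_UU: "card UU = 2 * (p - 1)"
proof -
  have "card UU = totient (3 * p)" by (simp add: UU_totatives totient_def)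
  also have "\<dots> = totient 3 * totient p" by (rule totient_mult_coprime[OF coprime_3p])
  finally show ?thesis using totient_prime[OF prime3] totient_prime[OF prime_p] by simp
qed

definition SS :: "nat \<Rightarrow> nat" where
  "SS r = (\<Sum>s<3. \<Sum>t<p. N r (int s) (int t))"

lemma burnside: "orbs * (6 * p * (p - 1)) = (\<Sum>r\<in>UU. SS r)"
proof -
  have "orbs * card AG = (\<Sum>g\<in>AG. card {A\<in>Y. g ` A = A})"
    unfolding orbs_def
  proof (rule burnside_count[OF perm_group_AG, where act = "(`)"])
    show "finite Y" using finite_V by (simp add: Y_def)
    show "g ` A \<in> Y" if "g \<in> AG" "A \<in> Y" for g A by (rule AG_image_Y[OF that])
  qed (simp_all add: image_comp)
  also have "\<dots> = (\<Sum>q\<in>UU \<times> {..<3} \<times> {..<p}. card {A\<in>Y. par q ` A = A})"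
    unfolding AG_par(1) by (rule sum.reindex_cong[OF AG_par(2)]) auto
  also have "\<dots> = (\<Sum>q\<in>UU \<times> {..<3} \<times> {..<p}. N (fst q) (int (fst (snd q))) (int (snd (snd q))))"
    by (rule sum.cong) (simp_all add: N_def fixsets_def Y_def par_def Collect_conj_eq Pow_def)
  also have "\<dots> = (\<Sum>r\<in>UU. SS r)"
    by (simp add: SS_def sum.cartesian_product case_prod_beta)
  also have "card AG = 6 * p * (p - 1)"
    unfolding AG_par(1) using card_image[OF AG_par(2)] card_UU by (simp add: card_cartesian_product)
  finally show ?thesis .
qed

lemma sum3: "(\<Sum>s<3. f (3 dvd int s)) = f True + 2 * (f False :: nat)"
proof -
  have "{..<3} = {0, 1, 2 :: nat}" by auto
  then show ?thesis by simp
qed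

lemma sump: "(\<Sum>t<p. f (int p dvd int t)) = f True + (p - 1) * (f False :: nat)"
proof -
  have "{..<p} = insert 0 {1..<p}" using p_pos by auto
  then have "(\<Sum>t<p. f (int p dvd int t)) = f True + (\<Sum>t\<in>{1..<p}. f (int p dvd int t))" by simp
  also have "(\<Sum>t\<in>{1..<p}. f (int p dvd int t)) = (\<Sum>t\<in>{1..<p}. f False)"
  proof (rule sum.cong)
    fix t assume "t \<in> {1..<p}"
    then have "\<not> int p dvd int t" using nat_dvd_not_less[of t p] by simp
    then show "f (int p dvd int t) = f False" by simp
  qed simp
  finally show ?thesis by simp
qed

text \<open>The 12 is \<open>2 ^ 3 + 2 * 2 ^ 1\<close>: for each non-zero \<open>t\<close> there is
  one \<open>s\<close> divisible by 3, with three cycles on reflections, and two others, with one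
  cycle each.\<close>

lemma SS_11:
  assumes r: "coprime r (3 * p)" "ord 3 r = 1" "ord p r = 1"
  shows "SS r = 2 ^ (3 * p - 1) * (2 ^ (3 * p) + 2 * 2 ^ p + (p - 1) * 12)"
proof -
  define f where "f = (\<lambda>x y. 2 ^ (3 * p - 1 + (if x then (if y then 3 * p else 3) else (if y then p else 1))) :: nat)"
  have "SS r = (\<Sum>s<3. \<Sum>t<p. f (3 dvd int s) (int p dvd int t))" by (simp only: SS_def N11[OF r] f_def)
  also have "\<dots> = (\<Sum>s<3. f (3 dvd int s) True + (p - 1) * f (3 dvd int s) False)"
    by (intro sum.cong refl sump)
  also have "\<dots> = f True True + (p - 1) * f True False + 2 * (f False True + (p - 1) * f False False)"
    by (rule sum3)
  finally have e: "SS r = f True True + (p - 1) * f True False + 2 * (f False True + (p - 1) * f False False)" .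
  define q where "q = p - 1"
  show ?thesis using e unfolding q_def[symmetric] by (simp add: f_def power_add algebra_simps)
qed

text \<open>One \<open>s\<close> is divisible by 3 and two are not. Hence the constants:
  \<open>2 ^ 5 = 16 * 2\<close> and \<open>2 * 2 ^ 3 = 16\<close>, which add up to 48 when the
  remaining exponents coincide.\<close>

lemma SS_1:
  assumes r: "coprime r (3 * p)" "ord 3 r = 1" "ord p r \<noteq> 1"
  shows "\<not> 3 dvd ord p r \<Longrightarrow> SS r = 16 * p * (2 ^ (4 * (p - 1) div ord p r) + 2 ^ (1 + 6 * (p - 1) div ord p r))"
    "3 dvd ord p r \<Longrightarrow> SS r = 48 * p * 2 ^ (6 * (p - 1) div ord p r)"
proof -
  show "SS r = 16 * p * (2 ^ (4 * (p - 1) div ord p r) + 2 ^ (1 + 6 * (p - 1) div ord p r))" if d: "\<not> 3 dvd ord p r"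
  proof -
    define f where "f = (\<lambda>x. p * 2 ^ (if x then 5 + 6 * (p - 1) div ord p r else 3 + 4 * (p - 1) div ord p r) :: nat)"
    have "(\<Sum>t<p. N r (int s) (int t)) = f (3 dvd int s)" for s
      using N1(1)[OF r, of "int s"] N1(2)[OF r, of "int s"] d by (cases "3 dvd int s") (simp_all only: f_def sum_constant card_lessThan if_True if_False of_nat_id not_False_eq_True simp_thms)
    then have "SS r = f True + 2 * f False" by (simp only: SS_def sum3)
    then show ?thesis by (simp add: f_def power_add algebra_simps)
  qed
  show "SS r = 48 * p * 2 ^ (6 * (p - 1) div ord p r)" if d: "3 dvd ord p r"
  proof -
    define f where "f = (\<lambda>x. p * 2 ^ (if x then 5 + 6 * (p - 1) div ord p r else 3 + 6 * (p - 1) div ord p r) :: nat)"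
    have "(\<Sum>t<p. N r (int s) (int t)) = f (3 dvd int s)" for s
      using N1(1)[OF r, of "int s"] N1(3)[OF r, of "int s"] d by (cases "3 dvd int s") (simp_all only: f_def sum_constant card_lessThan if_True if_False of_nat_id not_False_eq_True simp_thms)
    then have "SS r = f True + 2 * f False" by (simp only: SS_def sum3)
    then show ?thesis by (simp add: f_def power_add algebra_simps)
  qed
qed

lemma SS_2p:
  assumes r: "coprime r (3 * p)" "ord 3 r = 2" "ord p r = 1"
  shows "SS r = 3 * 2 ^ (2 * p - 1) * (2 ^ (2 * p) + (p - 1) * 4)"
proof -
  define f where "f = (\<lambda>y. 2 ^ (2 * p - 1 + (if y then 2 * p else 2)) :: nat)"
  have "SS r = (\<Sum>s<3::nat. \<Sum>t<p. f (int p dvd int t))" by (simp only: SS_def N2p[OF r] f_def)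
  also have "\<dots> = 3 * (f True + (p - 1) * f False)" by (simp only: sump sum_constant card_lessThan of_nat_id)
  finally show ?thesis by (simp add: f_def power_add algebra_simps)
qed

lemma SS_22:
  assumes r: "coprime r (3 * p)" "ord 3 r = 2" "ord p r \<noteq> 1"
  shows "SS r = 24 * p * 2 ^ ((if 2 dvd ord p r then 6 else 4) * (p - 1) div ord p r)"
  unfolding SS_def N22[OF r] by (simp add: power_add)

lemma coprime_of_mod:
  assumes "r mod 3 \<noteq> 0" "r mod p \<noteq> 0" shows "coprime r (3 * p)"
proof -
  have "coprime r 3" using prime_imp_coprime[OF prime3, of r] assms(1) by (simp add: coprime_commute dvd_eq_mod_eq_0)
  moreover have "coprime r p" using prime_imp_coprime[OF prime_p, of r] assms(2) by (simp add: coprime_commute dvd_eq_mod_eq_0)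
  ultimately show ?thesis by simp
qed

lemma ord_one_mod: "n > 1 \<Longrightarrow> ord n r = 1 \<longleftrightarrow> r mod n = 1" for r :: nat
  using ord_divides[of r 1 n] by (simp add: cong_def)

lemma ord3: assumes "coprime r (3 * p)" shows "ord 3 r = 1 \<or> ord 3 r = 2"
proof -
  have "ord 3 r dvd totient 3" by (rule order_divides_totient) (use assms in \<open>simp add: coprime_commute\<close>)
  then have d: "ord 3 r dvd 2" using totient_prime[OF prime3] by simp
  then have "ord 3 r \<le> 2" by (rule dvd_imp_le) simp
  moreover have "ord 3 r \<noteq> 0" using d by (metis dvd_0_left zero_neq_numeral)
  moreover have "x = 1 \<or> x = 2" if "x \<le> 2" "x \<noteq> 0" for x :: nat using that by auto
  ultimately show ?thesis by blast
qed

text \<open>This unit has order 1 modulo \<open>p\<close> without being 1. It satisfies the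
  conditions of none of the final sums, so its contribution goes into the closed terms.\<close>

lemma unique_reflection: "\<exists>r0. {r\<in>UU. ord 3 r = 2 \<and> ord p r = 1} = {r0}"
proof -
  have "\<exists>!r. r < 3 * p \<and> [r = 2] (mod 3) \<and> [r = 1] (mod p)"
    by (rule binary_chinese_remainder_unique_nat[OF coprime_3p]) (use p_gt_3 in auto)
  then obtain r0 where r0: "r0 < 3 * p" "[r0 = 2] (mod 3)" "[r0 = 1] (mod p)"
    and un: "\<And>r. r < 3 * p \<Longrightarrow> [r = 2] (mod 3) \<Longrightarrow> [r = 1] (mod p) \<Longrightarrow> r = r0" by blast
  have m0: "r0 mod 3 = 2" "r0 mod p = 1" using r0 p_gt_3 by (auto simp: cong_def)
  have c0: "coprime r0 (3 * p)" by (rule coprime_of_mod) (use m0 in auto)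
  have "r0 \<noteq> 0" using m0 by (intro notI) simp
  then have "r0 \<in> UU" using r0(1) c0 by (simp add: UU_def)
  moreover have "ord p r0 = 1" using ord_one_mod[of p r0] m0 p_gt_3 by simp
  moreover have "ord 3 r0 = 2" using ord3[OF c0] ord_one_mod[of 3 r0] m0 by auto
  moreover have "r = r0" if "r \<in> UU" "ord 3 r = 2" "ord p r = 1" for r
  proof (rule un)
    have cr: "coprime r (3 * p)" using that by (simp add: UU_def)
    show "r < 3 * p" using that by (simp add: UU_def)
    have "r mod p = 1" using ord_one_mod[of p r] that p_gt_3 by simp
    then show "[r = 1] (mod p)" using p_gt_3 by (simp add: cong_def)
    have "r mod 3 \<noteq> 1" using ord_one_mod[of 3 r] that by simp
    moreover have "r mod 3 \<noteq> 0"
    proof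
      assume "r mod 3 = 0"
      then have "3 dvd r" by (simp add: dvd_eq_mod_eq_0)
      then have "coprime 3 (3::nat)" using coprime_parts(1)[OF cr] coprime_divisors[of 3 r 3 3] by simp
      then show False by simp
    qed
    ultimately have "r mod 3 = 2" by linarith
    then show "[r = 2] (mod 3)" by (simp add: cong_def)
  qed
  ultimately have "{r\<in>UU. ord 3 r = 2 \<and> ord p r = 1} = {r0}" by blast
  then show ?thesis by blast
qed

lemma orbs_formula:
  defines "Us \<equiv> {r::nat. 1 < r \<and> r < 3 * p \<and> coprime r (3 * p)}"
  shows "real orbs =
        2 ^ (4 * p - 2) / (3 * real p * (real p - 1)) * (2 ^ (2 * p) + 5)
      + 2 ^ (2 * p) / real p * (2 ^ p + 1)
      + 8 / (3 * (real p - 1)) *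
          (\<Sum>r\<in>{r\<in>Us. ord 3 r = 1 \<and> \<not> 3 dvd ord p r}.
             (2 ^ (4 * (p - 1) div ord p r) + 2 ^ (1 + 6 * (p - 1) div ord p r)))
      + 8 / (real p - 1) *
          (\<Sum>r\<in>{r\<in>Us. ord 3 r = 1 \<and> 3 dvd ord p r}. 2 ^ (6 * (p - 1) div ord p r))
      + 4 / (real p - 1) *
          ((\<Sum>r\<in>{r\<in>Us. ord 3 r = 2 \<and> \<not> 2 dvd ord p r \<and> ord p r > 1}. 2 ^ (4 * (p - 1) div ord p r))
         + (\<Sum>r\<in>{r\<in>Us. ord 3 r = 2 \<and> 2 dvd ord p r}. 2 ^ (6 * (p - 1) div ord p r)))"
proof -
  let ?C1 = "{r\<in>Us. ord 3 r = 1 \<and> \<not> 3 dvd ord p r}" and ?C2 = "{r\<in>Us. ord 3 r = 1 \<and> 3 dvd ord p r}"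
  let ?D1 = "{r\<in>Us. ord 3 r = 2 \<and> \<not> 2 dvd ord p r \<and> ord p r > 1}" and ?D2 = "{r\<in>Us. ord 3 r = 2 \<and> 2 dvd ord p r}"
  let ?B = "{r\<in>UU. ord 3 r = 2 \<and> ord p r = 1}"
  obtain r0 where B: "?B = {r0}" using unique_reflection by blast
  have Us: "UU = insert 1 Us" "1 \<notin> Us" using p_gt_3 by (auto simp: UU_def Us_def)
  have Ucop: "coprime r (3 * p)" if "r \<in> Us" for r using that by (simp add: Us_def)
  have finU: "finite Us" by (simp add: Us_def)
  \<comment> \<open>Only 1 is congruent to 1 modulo both 3 and \<open>p\<close>; so on the sums with
    order 1 modulo 3 the order modulo \<open>p\<close> exceeds 1 and \<open>SS_1\<close>
    applies.\<close>
  have o1: "ord p r \<noteq> 1" if "r \<in> Us" "ord 3 r = 1" for r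
  proof
    assume "ord p r = 1"
    then have "r mod p = 1" "r mod 3 = 1" using ord_one_mod[of p r] ord_one_mod[of 3 r] that p_gt_3 by simp_all
    then have "int r mod 3 = 1 mod 3" "int r mod int p = 1 mod int p"
      using zmod_int[of r 3] zmod_int[of r p] p_gt1 by simp_all
    then have "int r mod (3 * int p) = 1 mod (3 * int p)" by (rule cong_3p)
    then show False using that(1) p_gt_3 by (simp add: Us_def)
  qed
  have r0: "r0 \<in> UU" "ord 3 r0 = 2" "ord p r0 = 1" using B by auto
  have "r0 \<noteq> 1" using r0(2) by (intro notI) simp
  then have r0U: "r0 \<in> Us" using r0(1) Us(1) by blast
  have split: "Us = ((({r0} \<union> ?C1) \<union> ?C2) \<union> ?D1) \<union> ?D2"
  proof (intro equalityI subsetI)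
    fix r assume r: "r \<in> Us"
    have opos: "ord p r > 0" using ord_p_dvd(2)[OF Ucop[OF r]] .
    consider "ord 3 r = 1" | "ord 3 r = 2" "ord p r = 1" | "ord 3 r = 2" "ord p r > 1"
      using ord3[OF Ucop[OF r]] opos by linarith
    then show "r \<in> ((({r0} \<union> ?C1) \<union> ?C2) \<union> ?D1) \<union> ?D2"
    proof cases
      case 1 then show ?thesis using r by auto
    next
      case 2
      then have "r \<in> ?B" using r Us(1) by blast
      then have "r \<in> {r0}" unfolding B .
      then show ?thesis by blast
    next
      case 3 then show ?thesis using r by auto
    qed
  qed (use r0U in auto)
  have "(\<Sum>r\<in>UU. SS r) = SS 1 + (\<Sum>r\<in>Us. SS r)" using Us finU by simp
  also have "(\<Sum>r\<in>Us. SS r) = (\<Sum>r\<in>((({r0} \<union> ?C1) \<union> ?C2) \<union> ?D1) \<union> ?D2. SS r)" by (rule arg_cong[OF split])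
  also have "\<dots> = SS r0 + sum SS ?C1 + sum SS ?C2 + sum SS ?D1 + sum SS ?D2"
  proof -
    have "finite ?C1" "finite ?C2" "finite ?D1" "finite ?D2" using finU by simp_all
    moreover have "({r0} \<union> ?C1 \<union> ?C2 \<union> ?D1) \<inter> ?D2 = {}" "({r0} \<union> ?C1 \<union> ?C2) \<inter> ?D1 = {}" "({r0} \<union> ?C1) \<inter> ?C2 = {}" "{r0} \<inter> ?C1 = {}"
      using r0 by auto
    ultimately show ?thesis by (simp only: sum.union_disjoint finite_Un finite.emptyI finite.insertI simp_thms) simp
  qed
  finally have total: "real (\<Sum>r\<in>UU. SS r) = real (SS 1) + (real (SS r0) + real (sum SS ?C1) + real (sum SS ?C2) + real (sum SS ?D1) + real (sum SS ?D2))"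
    by simp
  have p1: "real (p - 1) = real p - 1" using p_gt_3 by simp
  have p1s: "real (p - Suc 0) = real p - 1" using p_gt_3 by simp
  define a :: real where "a = 2 ^ p"
  have pw: "(2::real) ^ (2 * p) = a ^ 2" "(2::real) ^ (3 * p) = a ^ 3" "(2::real) ^ (3 * p - 1) = a ^ 3 / 2"
    "(2::real) ^ (2 * p - 1) = a ^ 2 / 2" "(2::real) ^ (4 * p - 2) = a ^ 4 / 4"
    using p_gt_3 by (simp_all add: a_def power_mult[symmetric] mult.commute power_diff)
  have S1: "real (SS 1) = a ^ 3 / 2 * (a ^ 3 + 2 * a + (real p - 1) * 12)"
  proof -
    have "SS 1 = 2 ^ (3 * p - 1) * (2 ^ (3 * p) + 2 * 2 ^ p + (p - 1) * 12)"
      by (rule SS_11) (use ord_one_mod[of 3 1] ord_one_mod[of p 1] p_gt_3 in auto)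
    then show ?thesis using pw p1 a_def by simp
  qed
  have S0: "real (SS r0) = 3 * (a ^ 2 / 2) * (a ^ 2 + (real p - 1) * 4)"
  proof -
    have "SS r0 = 3 * 2 ^ (2 * p - 1) * (2 ^ (2 * p) + (p - 1) * 4)"
      by (rule SS_2p[OF Ucop[OF r0U] r0(2,3)])
    then show ?thesis using pw p1 by simp
  qed
  define c1 c2 d1 d2 :: real where "c1 = (\<Sum>r\<in>?C1. (2 ^ (4 * (p - 1) div ord p r) + 2 ^ (1 + 6 * (p - 1) div ord p r)))"
    and "c2 = (\<Sum>r\<in>?C2. 2 ^ (6 * (p - 1) div ord p r))"
    and "d1 = (\<Sum>r\<in>?D1. 2 ^ (4 * (p - 1) div ord p r))" and "d2 = (\<Sum>r\<in>?D2. 2 ^ (6 * (p - 1) div ord p r))"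
  have C1: "real (sum SS ?C1) = 16 * real p * c1"
  proof -
    have "real (SS r) = 16 * real p * (2 ^ (4 * (p - 1) div ord p r) + 2 ^ (1 + 6 * (p - 1) div ord p r))" if "r \<in> ?C1" for r
      using SS_1(1)[of r] Ucop[of r] o1[of r] that by simp
    then have "(\<Sum>r\<in>?C1. real (SS r)) = (\<Sum>r\<in>?C1. 16 * real p * (2 ^ (4 * (p - 1) div ord p r) + 2 ^ (1 + 6 * (p - 1) div ord p r)))"
      by (rule sum.cong[OF refl])
    then show ?thesis by (simp only: of_nat_sum c1_def sum_distrib_left)
  qed
  have C2: "real (sum SS ?C2) = 48 * real p * c2"
  proof -
    have "real (SS r) = 48 * real p * 2 ^ (6 * (p - 1) div ord p r)" if "r \<in> ?C2" for r
      using SS_1(2)[of r] Ucop[of r] o1[of r] that by simp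
    then have "(\<Sum>r\<in>?C2. real (SS r)) = (\<Sum>r\<in>?C2. 48 * real p * 2 ^ (6 * (p - 1) div ord p r))"
      by (rule sum.cong[OF refl])
    then show ?thesis by (simp only: of_nat_sum c2_def sum_distrib_left)
  qed
  have D1: "real (sum SS ?D1) = 24 * real p * d1"
  proof -
    have "real (SS r) = 24 * real p * 2 ^ (4 * (p - 1) div ord p r)" if "r \<in> ?D1" for r
      using SS_22[of r] Ucop[of r] that by simp
    then have "(\<Sum>r\<in>?D1. real (SS r)) = (\<Sum>r\<in>?D1. 24 * real p * 2 ^ (4 * (p - 1) div ord p r))"
      by (rule sum.cong[OF refl])
    then show ?thesis by (simp only: of_nat_sum d1_def sum_distrib_left)
  qed
  have D2: "real (sum SS ?D2) = 24 * real p * d2"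
  proof -
    have "real (SS r) = 24 * real p * 2 ^ (6 * (p - 1) div ord p r)" if "r \<in> ?D2" for r
    proof -
      have "ord p r \<noteq> 1" using that by (intro notI) simp
      then show ?thesis using SS_22[of r] Ucop[of r] that by simp
    qed
    then have "(\<Sum>r\<in>?D2. real (SS r)) = (\<Sum>r\<in>?D2. 24 * real p * 2 ^ (6 * (p - 1) div ord p r))"
      by (rule sum.cong[OF refl])
    then show ?thesis by (simp only: of_nat_sum d2_def sum_distrib_left)
  qed
  define P where "P = real p"
  have P: "P \<noteq> 0" "P - 1 \<noteq> 0" using p_gt_3 by (simp_all add: P_def)
  have "real (orbs * (6 * p * (p - 1))) = real (\<Sum>r\<in>UU. SS r)" using burnside by (rule arg_cong)
  then have main: "real orbs * (6 * P * (P - 1)) = a ^ 3 / 2 * (a ^ 3 + 2 * a + (P - 1) * 12)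
      + (3 * (a ^ 2 / 2) * (a ^ 2 + (P - 1) * 4) + 16 * P * c1 + 48 * P * c2 + 24 * P * d1 + 24 * P * d2)"
    unfolding total S1 S0 C1 C2 D1 D2 by (simp add: p1s P_def)
  \<comment> \<open>The contributions of 1 and \<open>r0\<close> are regrouped: their terms without
    the factor \<open>P - 1\<close> add up to \<open>a ^ 4 / 2 * (a ^ 2 + 5)\<close>, those with it
    to \<open>6 * a ^ 2 * (a + 1) * (P - 1)\<close>. These are the first two summands times the
    order \<open>6 * P * (P - 1)\<close> of \<open>AG\<close>.\<close>
  have "(a ^ 4 / 4 / (3 * P * (P - 1)) * (a ^ 2 + 5) + a ^ 2 / P * (a + 1) + 8 / (3 * (P - 1)) * c1 + 8 / (P - 1) * c2 + 4 / (P - 1) * (d1 + d2))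
     * (6 * P * (P - 1)) = a ^ 3 / 2 * (a ^ 3 + 2 * a + (P - 1) * 12)
      + (3 * (a ^ 2 / 2) * (a ^ 2 + (P - 1) * 4) + 16 * P * c1 + 48 * P * c2 + 24 * P * d1 + 24 * P * d2)"
  proof -
    have e: "a ^ 4 / 4 / (3 * P * (P - 1)) * (a ^ 2 + 5) * (6 * P * (P - 1)) = a ^ 4 / 2 * (a ^ 2 + 5)"
      "a ^ 2 / P * (a + 1) * (6 * P * (P - 1)) = 6 * a ^ 2 * (a + 1) * (P - 1)"
      "8 / (3 * (P - 1)) * c1 * (6 * P * (P - 1)) = 16 * P * c1"
      "8 / (P - 1) * c2 * (6 * P * (P - 1)) = 48 * P * c2"
      "4 / (P - 1) * (d1 + d2) * (6 * P * (P - 1)) = 24 * P * (d1 + d2)"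
      using P by (simp_all add: field_simps)
    show ?thesis unfolding distrib_right[of _ _ "6 * P * (P - 1)"] e
      by (simp add: algebra_simps add_divide_distrib power_numeral_reduce power2_eq_square)
  qed
  then have "real orbs = a ^ 4 / 4 / (3 * P * (P - 1)) * (a ^ 2 + 5) + a ^ 2 / P * (a + 1) + 8 / (3 * (P - 1)) * c1 + 8 / (P - 1) * c2 + 4 / (P - 1) * (d1 + d2)"
    using main P by (metis mult_cancel_right mult_eq_0_iff zero_neq_numeral)
  then show ?thesis unfolding pw a_def[symmetric] P_def c1_def c2_def d1_def d2_def .
qed

end

theorem theorem5p11:
  fixes p :: nat
  assumes "prime p" and "p > 3"
  defines "U \<equiv> {r::nat. 1 < r \<and> r < 3 * p \<and> coprime r (3 * p)}"
  shows "num_cay_digraphs (dihedral (3 * p)) = num_aut_orbits (dihedral (3 * p))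
    \<and> real (num_aut_orbits (dihedral (3 * p))) =
        2 ^ (4 * p - 2) / (3 * real p * (real p - 1)) * (2 ^ (2 * p) + 5)
      + 2 ^ (2 * p) / real p * (2 ^ p + 1)
      + 8 / (3 * (real p - 1)) *
          (\<Sum>r\<in>{r\<in>U. ord 3 r = 1 \<and> \<not> 3 dvd ord p r}.
             (2 ^ (4 * (p - 1) div ord p r) + 2 ^ (1 + 6 * (p - 1) div ord p r)))
      + 8 / (real p - 1) *
          (\<Sum>r\<in>{r\<in>U. ord 3 r = 1 \<and> 3 dvd ord p r}. 2 ^ (6 * (p - 1) div ord p r))
      + 4 / (real p - 1) *
          ((\<Sum>r\<in>{r\<in>U. ord 3 r = 2 \<and> \<not> 2 dvd ord p r \<and> ord p r > 1}. 2 ^ (4 * (p - 1) div ord p r))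
         + (\<Sum>r\<in>{r\<in>U. ord 3 r = 2 \<and> 2 dvd ord p r}. 2 ^ (6 * (p - 1) div ord p r)))"
proof -
  note Ud = U_def
  interpret dih6 p using assms by unfold_locales
  show ?thesis unfolding num_eq_orbs Ud by (rule conjI[OF refl orbs_formula])
qed

end
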